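(* Let $k$ be an infinite field, let $R=k[[Y_1,\ldots,Y_n]]$ be a formal power series ring with maximal ideal $m$, let $I$ be a non-licci $m$-primary $R$-ideal, and let $T=k[[X,Y_1,\ldots,Y_n]]$. Then there is a natural set-theoretic embedding $$k[[X]]^n\hookrightarrow \mathcal{L}_n$$ into the set $\mathcal{L}_n$ of linkage classes of $1$-dimensional $T$-ideals. Explicitly, for $a=(a_1,\dots,a_n)\in k[[X]]^n$ let $g_a$ be the $k$-algebra automorphism of $T$ with $g_a(X)=X$ and $g_a(Y_i)=Y_i+a_iX$ for $1\le i\le n$; then the map sending $a$ to the linkage class of $g_a(IT)$ is injective.
   Context: A $1$-dimensional $T$-ideal is an (unmixed, indeed Cohen-Macaulay) ideal $K$ of $T$ with $\dim T/K=1$. A complete intersection is a proper ideal generated by a regular sequence. Two proper ideals $I,J$ of a local Gorenstein ring are directly linked if there is a complete intersection $(\underline{\alpha})\subseteq I\cap J$ with $I=(\underline{\alpha}):J$ and $J=(\underline{\alpha}):I$. The equivalence relation on unmixed ideals generated by direct linkage is called linkage; its classes are linkage classes. An ideal is licci if it lies in the linkage class of a complete intersection. *)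

theory Defs
  imports
    "HOL-Computational_Algebra.Formal_Power_Series"
    "HOL-Library.Extended_Nat"
begin

section \<open>Formal power series in finitely many variables\<close>

text \<open>
  The power series ring over the coefficients \<open>'k\<close> whose variables are indexed by the finite
  type \<open>'v\<close>. A monomial is its exponent vector \<open>'v \<Rightarrow> nat\<close>, and exponent vectors are
  ordered pointwise.
\<close>

typedef (overloaded) ('v, 'k) mfps = "UNIV :: (('v \<Rightarrow> nat) \<Rightarrow> 'k) set"
  morphisms mfps_coeff Abs_mfps
  by simp

lemma mfps_coeff_Abs [simp]: "mfps_coeff (Abs_mfps f) = f"
  by (simp add: Abs_mfps_inverse)

lemma mfps_eq_iff: "f = g \<longleftrightarrow> (\<forall>\<mu>. mfps_coeff f \<mu> = mfps_coeff g \<mu>)"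
  by (metis ext mfps_coeff_inject)

lemma mfps_eqI: "(\<And>\<mu>. mfps_coeff f \<mu> = mfps_coeff g \<mu>) \<Longrightarrow> f = g"
  by (simp add: mfps_eq_iff)

lemma finite_exponents_le: "finite {\<nu>. \<nu> \<le> (\<mu> :: 'v::finite \<Rightarrow> nat)}"
proof -
  have "{\<nu>. \<nu> \<le> \<mu>} = PiE UNIV (\<lambda>i. {..\<mu> i})"
    by (auto simp: le_fun_def PiE_def)
  then show ?thesis
    by (simp add: finite_PiE)
qed

instantiation mfps :: (finite, comm_ring_1) comm_ring_1
begin

definition zero_mfps :: "('a, 'b) mfps"
  where "0 = Abs_mfps (\<lambda>_. 0)"

definition one_mfps :: "('a, 'b) mfps"
  where "1 = Abs_mfps (\<lambda>\<mu>. if \<mu> = (\<lambda>_. 0) then 1 else 0)"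

definition plus_mfps :: "('a, 'b) mfps \<Rightarrow> ('a, 'b) mfps \<Rightarrow> ('a, 'b) mfps"
  where "f + g = Abs_mfps (\<lambda>\<mu>. mfps_coeff f \<mu> + mfps_coeff g \<mu>)"

definition uminus_mfps :: "('a, 'b) mfps \<Rightarrow> ('a, 'b) mfps"
  where "- f = Abs_mfps (\<lambda>\<mu>. - mfps_coeff f \<mu>)"

definition minus_mfps :: "('a, 'b) mfps \<Rightarrow> ('a, 'b) mfps \<Rightarrow> ('a, 'b) mfps"
  where "f - g = Abs_mfps (\<lambda>\<mu>. mfps_coeff f \<mu> - mfps_coeff g \<mu>)"

definition times_mfps :: "('a, 'b) mfps \<Rightarrow> ('a, 'b) mfps \<Rightarrow> ('a, 'b) mfps"
  where "f * g =
    Abs_mfps (\<lambda>\<mu>. \<Sum>\<nu> | \<nu> \<le> \<mu>. mfps_coeff f \<nu> * mfps_coeff g (\<lambda>i. \<mu> i - \<nu> i))"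

instance
proof
  fix f g h :: "('a, 'b) mfps"
  show "f * g * h = f * (g * h)"
  proof (rule mfps_eqI)
    fix \<mu> :: "'a \<Rightarrow> nat"
    let ?f = "mfps_coeff f" and ?g = "mfps_coeff g" and ?h = "mfps_coeff h"
    have "mfps_coeff (f * g * h) \<mu> =
        (\<Sum>\<nu> | \<nu> \<le> \<mu>. \<Sum>\<kappa> | \<kappa> \<le> \<nu>. ?f \<kappa> * ?g (\<lambda>i. \<nu> i - \<kappa> i) * ?h (\<lambda>i. \<mu> i - \<nu> i))"
      by (simp add: times_mfps_def sum_distrib_right)
    also have "\<dots> = (\<Sum>(\<nu>, \<kappa>) \<in> Sigma {\<nu>. \<nu> \<le> \<mu>} (\<lambda>\<nu>. {\<kappa>. \<kappa> \<le> \<nu>}).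
        ?f \<kappa> * ?g (\<lambda>i. \<nu> i - \<kappa> i) * ?h (\<lambda>i. \<mu> i - \<nu> i))"
      by (subst sum.Sigma) (auto simp: finite_exponents_le)
    also have "\<dots> = (\<Sum>(\<kappa>, \<rho>) \<in> Sigma {\<kappa>. \<kappa> \<le> \<mu>} (\<lambda>\<kappa>. {\<rho>. \<rho> \<le> (\<lambda>i. \<mu> i - \<kappa> i)}).
        ?f \<kappa> * (?g \<rho> * ?h (\<lambda>i. \<mu> i - \<kappa> i - \<rho> i)))"
    proof (rule sum.reindex_bij_witness
        [where j = "\<lambda>(\<nu>, \<kappa>). (\<kappa>, \<lambda>i. \<nu> i - \<kappa> i)" and i = "\<lambda>(\<kappa>, \<rho>). (\<lambda>i. \<kappa> i + \<rho> i, \<kappa>)"],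
        goal_cases)
      case (1 p)
      then show ?case by (auto simp: le_fun_def)
    next
      case (2 p)
      then obtain \<nu> \<kappa> where p: "p = (\<nu>, \<kappa>)" "\<And>i. \<nu> i \<le> \<mu> i" "\<And>i. \<kappa> i \<le> \<nu> i"
        by (auto simp: le_fun_def)
      then have "\<kappa> i \<le> \<mu> i" "\<nu> i - \<kappa> i \<le> \<mu> i - \<kappa> i" for i
        by (meson le_trans diff_le_mono)+
      then show ?case by (simp add: p(1) le_fun_def)
    next
      case (3 q)
      then show ?case by (auto simp: le_fun_def)
    next
      case (4 q)
      then obtain \<kappa> \<rho> where q: "q = (\<kappa>, \<rho>)" "\<And>i. \<kappa> i \<le> \<mu> i" "\<And>i. \<rho> i \<le> \<mu> i - \<kappa> i"
        by (auto simp: le_fun_def)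
      then have "\<kappa> i + \<rho> i \<le> \<mu> i" for i
        by (metis add.commute le_diff_conv2)
      then show ?case by (simp add: q(1) le_fun_def)
    next
      case (5 p)
      then obtain \<nu> \<kappa> where p: "p = (\<nu>, \<kappa>)" "\<And>i. \<nu> i \<le> \<mu> i" "\<And>i. \<kappa> i \<le> \<nu> i"
        by (auto simp: le_fun_def)
      have "(\<lambda>i. \<mu> i - \<kappa> i - (\<nu> i - \<kappa> i)) = (\<lambda>i. \<mu> i - \<nu> i)"
        using p by auto
      then show ?case
        by (simp add: p mult.assoc)
    qed
    also have "\<dots> = (\<Sum>\<kappa> | \<kappa> \<le> \<mu>. \<Sum>\<rho> | \<rho> \<le> (\<lambda>i. \<mu> i - \<kappa> i).
        ?f \<kappa> * (?g \<rho> * ?h (\<lambda>i. \<mu> i - \<kappa> i - \<rho> i)))"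
      by (subst sum.Sigma) (auto simp: finite_exponents_le)
    also have "\<dots> = mfps_coeff (f * (g * h)) \<mu>"
      by (simp add: times_mfps_def sum_distrib_left)
    finally show "mfps_coeff (f * g * h) \<mu> = mfps_coeff (f * (g * h)) \<mu>" .
  qed
  show "f * g = g * f"
  proof (rule mfps_eqI)
    fix \<mu> :: "'a \<Rightarrow> nat"
    show "mfps_coeff (f * g) \<mu> = mfps_coeff (g * f) \<mu>"
      unfolding times_mfps_def mfps_coeff_Abs
      by (rule sum.reindex_bij_witness
          [where i = "\<lambda>\<nu> i. \<mu> i - \<nu> i" and j = "\<lambda>\<nu> i. \<mu> i - \<nu> i"])
        (auto simp: le_fun_def mult.commute)
  qed
  show "1 * f = f"
  proof (rule mfps_eqI)
    fix \<mu> :: "'a \<Rightarrow> nat"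
    have "mfps_coeff (1 * f) \<mu> =
        (\<Sum>\<nu> | \<nu> \<le> \<mu>. if \<nu> = (\<lambda>_. 0) then mfps_coeff f (\<lambda>i. \<mu> i - \<nu> i) else 0)"
      unfolding times_mfps_def one_mfps_def mfps_coeff_Abs by (intro sum.cong) auto
    also have "\<dots> = mfps_coeff f \<mu>"
      by (subst sum.delta[OF finite_exponents_le]) (simp add: le_fun_def)
    finally show "mfps_coeff (1 * f) \<mu> = mfps_coeff f \<mu>" .
  qed
  show "(f + g) * h = f * h + g * h"
    by (simp add: times_mfps_def plus_mfps_def mfps_eq_iff distrib_right sum.distrib)
  show "(0 :: ('a, 'b) mfps) \<noteq> 1"
    by (auto simp: zero_mfps_def one_mfps_def mfps_eq_iff intro!: exI[of _ "\<lambda>_. 0"])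
qed (simp_all add: mfps_eq_iff zero_mfps_def plus_mfps_def uminus_mfps_def minus_mfps_def
      add.assoc add.commute)

end

definition mfps_const :: "'k \<Rightarrow> ('v::finite, 'k::comm_ring_1) mfps"
  where "mfps_const c = Abs_mfps (\<lambda>\<mu>. if \<mu> = (\<lambda>_. 0) then c else 0)"

definition mfps_var :: "'v \<Rightarrow> ('v::finite, 'k::comm_ring_1) mfps"
  where "mfps_var v = Abs_mfps (\<lambda>\<mu>. if \<mu> = (\<lambda>w. if w = v then 1 else 0) then 1 else 0)"

text \<open>
  If the variables of \<open>R\<close> are indexed by \<open>'n\<close>, those of \<open>T = R[[X]]\<close> are indexed by
  \<open>'n option\<close>: the variable at \<open>None\<close> is \<open>X\<close> and the one at \<open>Some i\<close> is \<open>Y\<^sub>i\<close>.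
  The next two maps are the inclusions of \<open>R\<close> and of \<open>k[[X]]\<close> into \<open>T\<close>.
\<close>

definition mfps_of_base :: "('n::finite, 'k::comm_ring_1) mfps \<Rightarrow> ('n option, 'k) mfps"
  where "mfps_of_base f =
    Abs_mfps (\<lambda>\<mu>. if \<mu> None = 0 then mfps_coeff f (\<lambda>i. \<mu> (Some i)) else 0)"

definition mfps_of_fps :: "'k fps \<Rightarrow> ('n::finite option, 'k::comm_ring_1) mfps"
  where "mfps_of_fps a =
    Abs_mfps (\<lambda>\<mu>. if \<forall>i. \<mu> (Some i) = 0 then fps_nth a (\<mu> None) else 0)"


section \<open>Ideals\<close>

text \<open>Ideals of a commutative ring are its submodules as a module over itself.\<close>

lemma module_times: "module ((*) :: 'a::comm_ring_1 \<Rightarrow> 'a \<Rightarrow> 'a)"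
  by unfold_locales (simp_all add: algebra_simps)

abbreviation is_ideal :: "'a::comm_ring_1 set \<Rightarrow> bool"
  where "is_ideal \<equiv> module.subspace (*)"

abbreviation ideal_gen :: "'a::comm_ring_1 set \<Rightarrow> 'a set"
  where "ideal_gen \<equiv> module.span (*)"

definition proper_ideal :: "'a::comm_ring_1 set \<Rightarrow> bool"
  where "proper_ideal I \<longleftrightarrow> is_ideal I \<and> I \<noteq> UNIV"

definition maximal_ideal :: "'a::comm_ring_1 set \<Rightarrow> bool"
  where "maximal_ideal M \<longleftrightarrow>
    proper_ideal M \<and> (\<forall>J. proper_ideal J \<longrightarrow> M \<subseteq> J \<longrightarrow> J = M)"

definition prime_ideal :: "'a::comm_ring_1 set \<Rightarrow> bool"
  where "prime_ideal P \<longleftrightarrow>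
    proper_ideal P \<and> (\<forall>x y. x * y \<in> P \<longrightarrow> x \<in> P \<or> y \<in> P)"

definition primary_ideal :: "'a::comm_ring_1 set \<Rightarrow> bool"
  where "primary_ideal Q \<longleftrightarrow>
    proper_ideal Q \<and> (\<forall>x y. x * y \<in> Q \<longrightarrow> x \<in> Q \<or> (\<exists>e. y ^ e \<in> Q))"

definition radical_ideal :: "'a::comm_ring_1 set \<Rightarrow> 'a set"
  where "radical_ideal I = {x. \<exists>e. x ^ e \<in> I}"

definition primary_to :: "'a::comm_ring_1 set \<Rightarrow> 'a set \<Rightarrow> bool"
  where "primary_to P Q \<longleftrightarrow> primary_ideal Q \<and> radical_ideal Q = P"

definition ideal_quotient :: "'a::comm_ring_1 set \<Rightarrow> 'a set \<Rightarrow> 'a set"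
  where "ideal_quotient I J = {x. \<forall>y\<in>J. x * y \<in> I}"

definition associated_primes :: "'a::comm_ring_1 set \<Rightarrow> 'a set set"
  where "associated_primes I = {P. prime_ideal P \<and> (\<exists>x. P = ideal_quotient I {x})}"

text \<open>
  The Krull dimension of the quotient ring by \<open>I\<close>, through the primes containing \<open>I\<close>.
  For the unit ideal the supremum is over the empty set and gives 0; the notions below only
  use proper ideals.
\<close>

definition quotient_dim :: "'a::comm_ring_1 set \<Rightarrow> enat"
  where "quotient_dim I = Sup {enat r | r. \<exists>P :: nat \<Rightarrow> 'a set.
    (\<forall>i\<le>r. prime_ideal (P i) \<and> I \<subseteq> P i) \<and> (\<forall>i<r. P i \<subset> P (Suc i))}"

definition unmixed :: "'a::comm_ring_1 set \<Rightarrow> bool"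
  where "unmixed I \<longleftrightarrow>
    proper_ideal I \<and> (\<forall>P\<in>associated_primes I. quotient_dim P = quotient_dim I)"

text \<open>\<open>xs\<close> is a regular sequence on the quotient ring by \<open>I\<close>.\<close>

definition regular_sequence_mod :: "'a::comm_ring_1 set \<Rightarrow> 'a list \<Rightarrow> bool"
  where "regular_sequence_mod I xs \<longleftrightarrow>
    ideal_gen (I \<union> set xs) \<noteq> UNIV \<and>
    (\<forall>j<length xs. \<forall>y. xs ! j * y \<in> ideal_gen (I \<union> set (take j xs))
       \<longrightarrow> y \<in> ideal_gen (I \<union> set (take j xs)))"

text \<open>
  For ideals of a Noetherian local ring: the quotient has depth equal to its dimension. That the
  regular sequence lies in the maximal ideal is part of the properness condition in
  \<^const>\<open>regular_sequence_mod\<close>.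
\<close>

definition cohen_macaulay_ideal :: "'a::comm_ring_1 set \<Rightarrow> bool"
  where "cohen_macaulay_ideal I \<longleftrightarrow> proper_ideal I \<and>
    (\<exists>xs. regular_sequence_mod I xs \<and> enat (length xs) = quotient_dim I)"


section \<open>Linkage\<close>

definition complete_intersection :: "'a::comm_ring_1 set \<Rightarrow> bool"
  where "complete_intersection C \<longleftrightarrow>
    proper_ideal C \<and> (\<exists>xs. regular_sequence_mod {0} xs \<and> C = ideal_gen (set xs))"

definition directly_linked :: "'a::comm_ring_1 set \<Rightarrow> 'a set \<Rightarrow> bool"
  where "directly_linked I J \<longleftrightarrow> proper_ideal I \<and> proper_ideal J \<and>
    (\<exists>C. complete_intersection C \<and> C \<subseteq> I \<inter> J \<and>
         I = ideal_quotient C J \<and> J = ideal_quotient C I)"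

definition linkage :: "('a::comm_ring_1 set \<times> 'a set) set"
  where "linkage = {(I, J). unmixed I \<and> unmixed J \<and>
    equivclp (\<lambda>I J. unmixed I \<and> unmixed J \<and> directly_linked I J) I J}"

definition linkage_class :: "'a::comm_ring_1 set \<Rightarrow> 'a set set"
  where "linkage_class I = linkage `` {I}"

definition licci :: "'a::comm_ring_1 set \<Rightarrow> bool"
  where "licci I \<longleftrightarrow> (\<exists>C. complete_intersection C \<and> I \<in> linkage_class C)"

definition one_dimensional_ideal :: "'a::comm_ring_1 set \<Rightarrow> bool"
  where "one_dimensional_ideal K \<longleftrightarrow>
    unmixed K \<and> cohen_macaulay_ideal K \<and> quotient_dim K = 1"

definition one_dimensional_linkage_classes :: "'a::comm_ring_1 set set set"
  where "one_dimensional_linkage_classes = {K. one_dimensional_ideal K} // linkage"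


section \<open>The automorphisms of \<open>T\<close>\<close>

definition mfps_algebra_automorphism ::
    "(('v::finite, 'k::comm_ring_1) mfps \<Rightarrow> ('v, 'k) mfps) \<Rightarrow> bool"
  where "mfps_algebra_automorphism g \<longleftrightarrow> bij g \<and>
    (\<forall>x y. g (x + y) = g x + g y) \<and> (\<forall>x y. g (x * y) = g x * g y) \<and>
    (\<forall>c. g (mfps_const c) = mfps_const c)"

definition is_shift ::
    "('n::finite \<Rightarrow> 'k::field fps) \<Rightarrow> (('n option, 'k) mfps \<Rightarrow> ('n option, 'k) mfps) \<Rightarrow> bool"
  where "is_shift a g \<longleftrightarrow> mfps_algebra_automorphism g \<and>
    g (mfps_var None) = mfps_var None \<and>
    (\<forall>i. g (mfps_var (Some i)) = mfps_var (Some i) + mfps_of_fps (a i) * mfps_var None)"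

definition shift :: "('n::finite \<Rightarrow> 'k::field fps) \<Rightarrow> ('n option, 'k) mfps \<Rightarrow> ('n option, 'k) mfps"
  where "shift a = (THE g. is_shift a g)"

definition extended_ideal :: "('n::finite, 'k::comm_ring_1) mfps set \<Rightarrow> ('n option, 'k) mfps set"
  where "extended_ideal I = ideal_gen (mfps_of_base ` I)"

end

theory Submission
  imports
    Defs
    "HOL-Library.Cardinality"
    "HOL-Computational_Algebra.Formal_Laurent_Series"
    "HOL-Computational_Algebra.Polynomial_FPS"
    "HOL-Algebra.Algebraic_Closure_Type"
begin

text \<open>
  Put \<open>P = (Y\<^sub>1, \<dots>, Y\<^sub>n)\<close>. Localizing \<open>T\<close> at \<open>P\<close> and completing gives \<open>k((X))[[Y]]\<close>. A link in \<open>T\<close> of an ideal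
  that is \<open>P\<close>-primary at \<open>P\<close> becomes a link through a system of parameters there, and an ideal not contained in \<open>P\<close>
  becomes the unit ideal. If \<open>c \<noteq> 0\<close>, then \<open>g\<^sub>c(IT)\<close> contains a power of \<open>Y\<^sub>i + c\<^sub>i X \<notin> P\<close> for some \<open>i\<close>. So if \<open>IT\<close> and
  \<open>g\<^sub>c(IT)\<close> are linked, then finitely many links through systems of parameters lead from the extension of \<open>I\<close> to
  \<open>k((X))[[Y]]\<close> to the unit ideal.

  Such a chain of links descends to \<open>k\<close>. Over an algebraically closed field containing \<open>k((X))\<close>, the coefficients of
  the first system of parameters are changed one by one into elements of \<open>k\<close>. The rest of the chain follows for all
  but finitely many values of the coefficient: in a one-parameter family it lifts from the special member to the
  generic one, because the quotient by a system of parameters is self-injective, and it specializes from the generic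
  member to almost all members. Hence \<open>I\<close> would be licci. Injectivity results from \<open>c = b - a\<close>, as
  \<open>g\<^sub>b = g\<^sub>a g\<^sub>b\<^sub>-\<^sub>a\<close>.
\<close>

text \<open>The rings \<open>k[[Y]]\<close>, \<open>k((X))[[Y]]\<close> and \<open>k[[X, Y]]\<close>
  are instances of one type, so a single local theory serves the given ring, the completed
  localization and the families. In particular \<open>k[[X, Y]]\<close> has two roles: it is the
  ring \<open>T\<close> in which linkage is assumed, and it is a family over \<open>k[[X]]\<close>
  whose special member is the reduction at \<open>X = 0\<close> (\<open>rho\<close>) and whose
  generic member is the image in \<open>k((X))[[Y]]\<close> (\<open>eta\<close>). A complete
  intersection in \<open>T\<close> may have any length; that it has exactly \<open>n\<close>
  generators when it links ideals primary at \<open>P\<close> must be derived from the grade of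
  \<open>P\<close>. Both this and the duality modulo parameters rest on Koszul cohomology. The
  descent changes one coefficient at a time because only families with one parameter are at hand.
  Conditions on a specialization are recorded as a finite set of field elements on which it must be
  defined. An algebraically closed target lets evaluation at \<open>X = c\<close> extend to a
  subring containing such a set for all but finitely many \<open>c\<close>, and an infinite
  \<open>k\<close> leaves an admissible value.\<close>

section \<open>Ideals\<close>

interpretation idl: Modules.module "(*) :: 'a::comm_ring_1 \<Rightarrow> 'a \<Rightarrow> 'a"
  by (rule module_times)

text \<open>As a rewrite rule this would loop with associativity of multiplication.\<close>

declare idl.scale_scale [simp del]

lemma ideal_mult: "is_ideal I \<Longrightarrow> y \<in> I \<Longrightarrow> c * y \<in> I"
  by (rule idl.subspace_scale)

lemma ideal_mult': "is_ideal I \<Longrightarrow> y \<in> I \<Longrightarrow> y * c \<in> I"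
  by (metis ideal_mult mult.commute)

lemma ideal_UNIV_iff: "is_ideal I \<Longrightarrow> I = UNIV \<longleftrightarrow> 1 \<in> I"
  using ideal_mult[of I 1] by auto

lemma is_ideal_quotient:
  assumes I: "is_ideal I"
  shows "is_ideal (ideal_quotient I J)"
proof (rule idl.subspaceI)
  show "0 \<in> ideal_quotient I J"
    using idl.subspace_0[OF I] by (simp add: ideal_quotient_def)
  show "x + y \<in> ideal_quotient I J" if "x \<in> ideal_quotient I J" "y \<in> ideal_quotient I J" for x y
    using that idl.subspace_add[OF I] by (simp add: ideal_quotient_def distrib_right)
  show "c * x \<in> ideal_quotient I J" if "x \<in> ideal_quotient I J" for c x
    using that ideal_mult[OF I] by (simp add: ideal_quotient_def mult.assoc)
qed

lemma ideal_quotient_superset: "is_ideal I \<Longrightarrow> I \<subseteq> ideal_quotient I J"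
  unfolding ideal_quotient_def using ideal_mult'[of I] by blast

lemma ideal_quotient_UNIV_iff:
  "is_ideal I \<Longrightarrow> ideal_quotient I J = UNIV \<longleftrightarrow> J \<subseteq> I"
  unfolding ideal_UNIV_iff[OF is_ideal_quotient] by (auto simp: ideal_quotient_def)

text \<open>A sequence together with a length replaces a list, so that initial segments, the change
  of one entry and the image under a map keep the same form.\<close>

definition igen :: "(nat \<Rightarrow> 'a::comm_ring_1) \<Rightarrow> nat \<Rightarrow> 'a set"
  where "igen x n = ideal_gen (x ` {..<n})"

lemma is_ideal_igen [simp]: "is_ideal (igen x n)"
  by (simp add: igen_def idl.subspace_span)

lemma ideal_gen_image_iff:
  assumes "finite A"
  shows "y \<in> ideal_gen (x ` A) \<longleftrightarrow> (\<exists>c. y = (\<Sum>i\<in>A. c i * x i))"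
  using assms
proof (induction A arbitrary: y rule: finite_induct)
  case empty
  then show ?case by simp
next
  case (insert a A)
  show ?case
  proof
    assume "y \<in> ideal_gen (x ` insert a A)"
    then obtain k where "y - k * x a \<in> ideal_gen (x ` A)"
      by (auto simp: idl.span_insert)
    then obtain c where c: "y - k * x a = (\<Sum>i\<in>A. c i * x i)"
      using insert by auto
    have "(\<Sum>i\<in>A. (c(a := k)) i * x i) = (\<Sum>i\<in>A. c i * x i)"
      using insert by (intro sum.cong) auto
    then have "y = (\<Sum>i\<in>insert a A. (c(a := k)) i * x i)"
      using insert c by (simp add: algebra_simps)
    then show "\<exists>c. y = (\<Sum>i\<in>insert a A. c i * x i)" by blast
  next
    assume "\<exists>c. y = (\<Sum>i\<in>insert a A. c i * x i)"
    then obtain c where "y = (\<Sum>i\<in>insert a A. c i * x i)" ..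
    then show "y \<in> ideal_gen (x ` insert a A)"
      by (simp only:) (intro idl.span_sum idl.span_scale idl.span_base imageI)
  qed
qed

lemma igen_iff: "y \<in> igen x n \<longleftrightarrow> (\<exists>c. y = (\<Sum>i<n. c i * x i))"
  unfolding igen_def by (rule ideal_gen_image_iff) simp

lemma igen_base: "i < n \<Longrightarrow> x i \<in> igen x n"
  unfolding igen_def by (auto intro: idl.span_base)

lemma igen_subset_iff: "is_ideal I \<Longrightarrow> igen x n \<subseteq> I \<longleftrightarrow> (\<forall>i<n. x i \<in> I)"
  unfolding igen_def
  by (metis idl.span_minimal idl.span_superset image_subset_iff lessThan_iff subset_trans)

lemma igen_Suc_iff: "y \<in> igen x (Suc n) \<longleftrightarrow> (\<exists>c. y - c * x n \<in> igen x n)"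
  unfolding igen_def by (simp add: lessThan_Suc idl.span_insert)

lemma igen_0 [simp]: "igen x 0 = {0}"
  by (simp add: igen_def)

lemma igen_cong: "(\<And>i. i < n \<Longrightarrow> x i = y i) \<Longrightarrow> igen x n = igen y n"
  unfolding igen_def by (metis image_cong lessThan_iff)

lemma ideal_power_mono:
  assumes "is_ideal I" "x ^ a \<in> I" "a \<le> b"
  shows "x ^ b \<in> I"
  using ideal_mult[OF assms(1,2), of "x ^ (b - a)"] assms(3)
  by (simp flip: power_add)

section \<open>Coefficients, order and convergence of power series\<close>

lemma coeff_0 [simp]: "mfps_coeff 0 \<mu> = 0"
  by (simp add: zero_mfps_def)

lemma coeff_1: "mfps_coeff 1 \<mu> = (if \<mu> = (\<lambda>_. 0) then 1 else 0)"
  by (simp add: one_mfps_def)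

lemma coeff_add [simp]: "mfps_coeff (f + g) \<mu> = mfps_coeff f \<mu> + mfps_coeff g \<mu>"
  by (simp add: plus_mfps_def)

lemma coeff_minus [simp]: "mfps_coeff (- f) \<mu> = - mfps_coeff f \<mu>"
  by (simp add: uminus_mfps_def)

lemma coeff_diff [simp]: "mfps_coeff (f - g) \<mu> = mfps_coeff f \<mu> - mfps_coeff g \<mu>"
  by (simp add: minus_mfps_def)

lemma coeff_mult:
  "mfps_coeff (f * g) \<mu> = (\<Sum>\<nu> | \<nu> \<le> \<mu>. mfps_coeff f \<nu> * mfps_coeff g (\<lambda>i. \<mu> i - \<nu> i))"
  by (simp add: times_mfps_def)

lemma coeff_sum [simp]: "mfps_coeff (sum f A) \<mu> = (\<Sum>i\<in>A. mfps_coeff (f i) \<mu>)"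
  by (induction A rule: infinite_finite_induct) auto

section \<open>Total degree and the filtration by order\<close>

definition tdeg :: "('v::finite \<Rightarrow> nat) \<Rightarrow> nat"
  where "tdeg \<mu> = (\<Sum>i\<in>UNIV. \<mu> i)"

lemma tdeg_add [simp]: "tdeg (\<lambda>i. \<mu> i + \<nu> i) = tdeg \<mu> + tdeg \<nu>"
  by (simp add: tdeg_def sum.distrib)

lemma tdeg_zero [simp]: "tdeg (\<lambda>_. 0) = 0"
  by (simp add: tdeg_def)

lemma tdeg_eq_0_iff [simp]: "tdeg \<mu> = 0 \<longleftrightarrow> \<mu> = (\<lambda>_. 0)"
  by (auto simp: tdeg_def)

lemma tdeg_diff: "\<nu> \<le> \<mu> \<Longrightarrow> tdeg \<nu> + tdeg (\<lambda>i. \<mu> i - \<nu> i) = tdeg \<mu>"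
proof -
  assume "\<nu> \<le> \<mu>"
  then have "(\<lambda>i. \<nu> i + (\<mu> i - \<nu> i)) = \<mu>"
    by (auto simp: le_fun_def)
  then show ?thesis
    by (metis tdeg_add)
qed

lemma le_tdeg: "\<mu> i \<le> tdeg \<mu>"
  by (auto simp: tdeg_def intro: member_le_sum)

lemma finite_tdeg_le: "finite {\<mu> :: 'v::finite \<Rightarrow> nat. tdeg \<mu> \<le> d}"
proof (rule finite_subset)
  show "{\<mu> :: 'v \<Rightarrow> nat. tdeg \<mu> \<le> d} \<subseteq> {\<nu>. \<nu> \<le> (\<lambda>_. d)}"
    using le_tdeg by (auto simp: le_fun_def intro: le_trans)
qed (rule finite_exponents_le)

lemma finite_tdeg_less: "finite {\<mu> :: 'v::finite \<Rightarrow> nat. tdeg \<mu> < d}"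
  by (rule finite_subset[OF _ finite_tdeg_le[of d]]) auto

lemma finite_tdeg_eq: "finite {\<mu> :: 'v::finite \<Rightarrow> nat. tdeg \<mu> = d}"
  by (rule finite_subset[OF _ finite_tdeg_le[of d]]) auto

text \<open>The \<open>M\<close>-th power of the ideal generated by the variables, read off from
  coefficients.\<close>

definition ordge :: "nat \<Rightarrow> ('v::finite, 'k::comm_ring_1) mfps set"
  where "ordge M = {f. \<forall>\<mu>. tdeg \<mu> < M \<longrightarrow> mfps_coeff f \<mu> = 0}"

lemma ordge_0 [simp]: "f \<in> ordge 0"
  by (simp add: ordge_def)

lemma ordge_mono: "M \<le> N \<Longrightarrow> ordge N \<subseteq> ordge M"
  by (auto simp: ordge_def)

lemma ordge_add: "f \<in> ordge M \<Longrightarrow> g \<in> ordge M \<Longrightarrow> f + g \<in> ordge M"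
  by (simp add: ordge_def)

lemma ordge_diff: "f \<in> ordge M \<Longrightarrow> g \<in> ordge M \<Longrightarrow> f - g \<in> ordge M"
  by (simp add: ordge_def)

lemma zero_ordge [simp]: "0 \<in> ordge M"
  by (simp add: ordge_def)

lemma ordge_mult:
  fixes f g :: "('v::finite, 'k::comm_ring_1) mfps"
  assumes "f \<in> ordge M" "g \<in> ordge N"
  shows "f * g \<in> ordge (M + N)"
  unfolding ordge_def
proof (clarify)
  fix \<mu> :: "'v \<Rightarrow> nat" assume \<mu>: "tdeg \<mu> < M + N"
  have "mfps_coeff f \<nu> * mfps_coeff g (\<lambda>i. \<mu> i - \<nu> i) = 0" if "\<nu> \<le> \<mu>" for \<nu>
  proof -
    have "tdeg \<nu> < M \<or> tdeg (\<lambda>i. \<mu> i - \<nu> i) < N"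
      using tdeg_diff[OF that] \<mu> by linarith
    then show ?thesis
      using assms by (auto simp: ordge_def)
  qed
  then show "mfps_coeff (f * g) \<mu> = 0"
    by (simp add: coeff_mult)
qed

lemma is_ideal_ordge [simp]: "is_ideal (ordge M)"
  unfolding idl.subspace_def using ordge_mult[of _ 0 _ M] by (auto intro: ordge_add)

lemma ordge_power: "f \<in> ordge 1 \<Longrightarrow> f ^ n \<in> ordge n"
proof (induction n)
  case (Suc n)
  then show ?case using ordge_mult[of f 1 "f ^ n" n] by simp
qed simp

lemma ordge_separated: "(\<And>N. f \<in> ordge N) \<Longrightarrow> f = 0"
  unfolding ordge_def by (rule mfps_eqI) auto

text \<open>A convergent infinite sum: if \<open>g j\<close> has order at least \<open>j\<close>,
  the terms with \<open>j > tdeg \<mu>\<close> do not reach the coefficient at \<open>\<mu>\<close>,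
  so a finite sum defines it.\<close>

definition mfps_suminf :: "(nat \<Rightarrow> ('v::finite, 'k::comm_ring_1) mfps) \<Rightarrow> ('v, 'k) mfps"
  where "mfps_suminf g = Abs_mfps (\<lambda>\<mu>. \<Sum>j\<le>tdeg \<mu>. mfps_coeff (g j) \<mu>)"

lemma mfps_suminf_ordge:
  assumes "\<And>j. g j \<in> ordge j"
  shows "mfps_suminf g - (\<Sum>j<N. g j) \<in> ordge N"
  unfolding ordge_def
proof (clarify)
  fix \<mu> :: "'a \<Rightarrow> nat" assume \<mu>: "tdeg \<mu> < N"
  have "(\<Sum>j<N. mfps_coeff (g j) \<mu>) = (\<Sum>j\<le>tdeg \<mu>. mfps_coeff (g j) \<mu>)"
    using \<mu> assms by (intro sum.mono_neutral_right) (auto simp: ordge_def)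
  then show "mfps_coeff (mfps_suminf g - (\<Sum>j<N. g j)) \<mu> = 0"
    by (simp add: mfps_suminf_def)
qed

section \<open>Monomials, constants and division of terms by monomials\<close>

definition monom :: "('v \<Rightarrow> nat) \<Rightarrow> ('v::finite, 'k::comm_ring_1) mfps"
  where "monom \<nu> = Abs_mfps (\<lambda>\<mu>. if \<mu> = \<nu> then 1 else 0)"

lemma coeff_monom: "mfps_coeff (monom \<nu>) \<mu> = (if \<mu> = \<nu> then 1 else 0)"
  by (simp add: monom_def)

lemma coeff_monom_mult:
  "mfps_coeff (monom \<nu> * f) \<mu> = (if \<nu> \<le> \<mu> then mfps_coeff f (\<lambda>i. \<mu> i - \<nu> i) else 0)"
proof -
  have "mfps_coeff (monom \<nu> * f) \<mu>
      = (\<Sum>\<kappa> | \<kappa> \<le> \<mu>. if \<kappa> = \<nu> then mfps_coeff f (\<lambda>i. \<mu> i - \<kappa> i) else 0)"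
    unfolding coeff_mult by (intro sum.cong) (auto simp: coeff_monom)
  then show ?thesis
    by (simp add: sum.delta finite_exponents_le)
qed

lemma coeff_monom_mult_add [simp]:
  "mfps_coeff (monom \<nu> * f) (\<lambda>i. \<nu> i + \<mu> i) = mfps_coeff f \<mu>"
  by (simp add: coeff_monom_mult le_fun_def)

lemma coeff_const: "mfps_coeff (mfps_const c) \<mu> = (if \<mu> = (\<lambda>_. 0) then c else 0)"
  by (simp add: mfps_const_def)

lemma coeff_const_mult [simp]: "mfps_coeff (mfps_const c * f) \<mu> = c * mfps_coeff f \<mu>"
proof -
  have "mfps_coeff (mfps_const c * f) \<mu>
      = (\<Sum>\<kappa> | \<kappa> \<le> \<mu>. if \<kappa> = (\<lambda>_. 0) then c * mfps_coeff f (\<lambda>i. \<mu> i - \<kappa> i) else 0)"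
    unfolding coeff_mult by (intro sum.cong) (auto simp: coeff_const)
  also have "\<dots> = c * mfps_coeff f \<mu>"
    by (subst sum.delta[OF finite_exponents_le]) (simp add: le_fun_def)
  finally show ?thesis .
qed

lemma const_add: "mfps_const (a + b) = mfps_const a + mfps_const b"
  by (simp add: mfps_eq_iff coeff_const)

lemma const_mult: "mfps_const (a * b) = mfps_const a * mfps_const b"
  by (simp add: mfps_eq_iff) (simp add: coeff_const)

lemma const_0 [simp]: "mfps_const 0 = 0"
  by (simp add: mfps_eq_iff coeff_const)

lemma const_1 [simp]: "mfps_const 1 = 1"
  by (simp add: mfps_eq_iff coeff_const coeff_1)

lemma const_diff: "mfps_const (a - b) = mfps_const a - mfps_const b"
  by (simp add: mfps_eq_iff coeff_const)

lemma const_sum: "mfps_const (sum f A) = (\<Sum>i\<in>A. mfps_const (f i))"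
  by (induction A rule: infinite_finite_induct) (auto simp: const_add)

lemma coeff_mult_zero:
  fixes f g :: "('v::finite, 'k::comm_ring_1) mfps"
  shows "mfps_coeff (f * g) (\<lambda>_. 0) = mfps_coeff f (\<lambda>_. 0) * mfps_coeff g (\<lambda>_. 0)"
proof -
  have *: "{\<nu> :: 'v \<Rightarrow> nat. \<nu> \<le> (\<lambda>_. 0)} = {\<lambda>_. 0}"
    by (auto simp: le_fun_def)
  show ?thesis unfolding coeff_mult * by simp
qed

lemma monom_0: "monom (\<lambda>_. 0) = 1"
  by (simp add: mfps_eq_iff coeff_monom coeff_1)

lemma monom_mult: "monom \<mu> * monom \<nu> = monom (\<lambda>i. \<mu> i + \<nu> i)"
proof (rule mfps_eqI)
  fix \<kappa> :: "'a \<Rightarrow> nat"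
  have "(\<lambda>i. \<kappa> i - \<mu> i) = \<nu> \<longleftrightarrow> \<kappa> = (\<lambda>i. \<mu> i + \<nu> i)" if "\<mu> \<le> \<kappa>"
    using that by (auto simp: le_fun_def fun_eq_iff) (metis le_add_diff_inverse)
  then show "mfps_coeff (monom \<mu> * monom \<nu>) \<kappa> = mfps_coeff (monom (\<lambda>i. \<mu> i + \<nu> i)) \<kappa>"
    by (auto simp: coeff_monom_mult coeff_monom le_fun_def)
qed

lemma var_monom: "mfps_var v = monom (\<lambda>w. if w = v then 1 else 0)"
  by (simp add: mfps_var_def monom_def)

lemma var_power: "mfps_var v ^ n = monom (\<lambda>w. if w = v then n else 0)"
proof (induction n)
  case 0
  then show ?case by (simp add: monom_0)
next
  case (Suc n)
  have "(\<lambda>i. (if i = v then 1 else 0) + (if i = v then n else 0)) = (\<lambda>w. if w = v then Suc n else (0::nat))"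
    by auto
  then show ?case by (simp add: Suc) (simp add: var_monom monom_mult)
qed

lemma monom_ordge: "monom \<mu> \<in> ordge (tdeg \<mu>)"
  by (auto simp: ordge_def coeff_monom)

lemma var_ordge: "mfps_var v \<in> ordge 1"
  by (auto simp: ordge_def var_monom coeff_monom fun_eq_iff)

text \<open>Each term of \<open>f\<close> is assigned, by the choice function \<open>sel\<close>, to a monomial dividing it.\<close>

lemma monom_decomp:
  fixes f :: "('v::finite, 'k::comm_ring_1) mfps"
  assumes "finite A" and "\<And>\<mu>. mfps_coeff f \<mu> \<noteq> 0 \<Longrightarrow> \<exists>\<nu>\<in>A. \<nu> \<le> \<mu>"
  obtains h where "f = (\<Sum>\<nu>\<in>A. monom \<nu> * h \<nu>)"
    and "\<And>\<nu> \<kappa>. mfps_coeff (h \<nu>) \<kappa> = 0 \<or>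
      mfps_coeff (h \<nu>) \<kappa> = mfps_coeff f (\<lambda>i. \<nu> i + \<kappa> i)"
proof
  define sel where "sel \<mu> = (SOME \<nu>. \<nu> \<in> A \<and> \<nu> \<le> \<mu>)" for \<mu>
  have sel: "sel \<mu> \<in> A" "sel \<mu> \<le> \<mu>" if "mfps_coeff f \<mu> \<noteq> 0" for \<mu>
    using someI_ex[of "\<lambda>\<nu>. \<nu> \<in> A \<and> \<nu> \<le> \<mu>"] assms(2)[OF that] unfolding sel_def by blast+
  define h :: "('v \<Rightarrow> nat) \<Rightarrow> ('v, 'k) mfps" where
    "h \<nu> = Abs_mfps (\<lambda>\<kappa>. if sel (\<lambda>i. \<nu> i + \<kappa> i) = \<nu> then mfps_coeff f (\<lambda>i. \<nu> i + \<kappa> i) else 0)" for \<nu>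
  show "mfps_coeff (h \<nu>) \<kappa> = 0 \<or> mfps_coeff (h \<nu>) \<kappa> = mfps_coeff f (\<lambda>i. \<nu> i + \<kappa> i)" for \<nu> \<kappa>
    by (simp add: h_def)
  show "f = (\<Sum>\<nu>\<in>A. monom \<nu> * h \<nu>)"
  proof (rule mfps_eqI)
    fix \<mu>
    have "mfps_coeff (monom \<nu> * h \<nu>) \<mu> = (if \<nu> = sel \<mu> then mfps_coeff f \<mu> else 0)" for \<nu>
    proof (cases "\<nu> \<le> \<mu>")
      case True
      then have "(\<lambda>i. \<nu> i + (\<mu> i - \<nu> i)) = \<mu>"
        by (auto simp: le_fun_def)
      then show ?thesis
        using True by (auto simp: coeff_monom_mult h_def)
    next
      case False
      then show ?thesis
        using sel(2)[of \<mu>] by (auto simp: coeff_monom_mult)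
    qed
    then show "mfps_coeff f \<mu> = mfps_coeff (\<Sum>\<nu>\<in>A. monom \<nu> * h \<nu>) \<mu>"
      using sel(1)[of \<mu>] assms(1) by (auto simp: sum.delta)
  qed
qed

lemma exists_le_tdeg:
  fixes \<mu> :: "'v::finite \<Rightarrow> nat"
  assumes "j \<le> tdeg \<mu>"
  shows "\<exists>\<nu>\<le>\<mu>. tdeg \<nu> = j"
  using assms
proof (induction "tdeg \<mu> - j" arbitrary: \<mu>)
  case 0
  then show ?case by auto
next
  case (Suc d)
  then have "tdeg \<mu> \<noteq> 0" by linarith
  then obtain i where i: "\<mu> i \<noteq> 0"
    by (metis ext tdeg_eq_0_iff)
  define \<mu>' where "\<mu>' = \<mu>(i := \<mu> i - 1)"
  have "(\<lambda>k. \<mu>' k + (if k = i then 1 else 0)) = \<mu>"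
    using i by (auto simp: \<mu>'_def)
  then have t: "tdeg \<mu> = Suc (tdeg \<mu>')"
    using tdeg_add[of \<mu>' "\<lambda>k. if k = i then 1 else 0"] by (simp add: tdeg_def)
  then obtain \<nu> where "\<nu> \<le> \<mu>'" "tdeg \<nu> = j"
    using Suc by (metis Suc_diff_le diff_Suc_1 diff_is_0_eq' le_Suc_eq nat.distinct(1) nat_le_linear)
  moreover have "\<mu>' \<le> \<mu>"
    by (auto simp: \<mu>'_def le_fun_def)
  ultimately show ?case
    by (intro exI[of _ \<nu>]) (auto intro: order.trans)
qed

text \<open>The dichotomy in \<open>monom_decomp\<close> makes every coefficient of
  \<open>h \<nu>\<close> zero or a coefficient of \<open>f\<close> in degree higher by
  \<open>j\<close>; this bounds the order of \<open>h \<nu>\<close>.\<close>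

lemma ordge_decomp:
  fixes f :: "('v::finite, 'k::comm_ring_1) mfps"
  assumes "f \<in> ordge (j + M)"
  obtains h where "f = (\<Sum>\<nu> | tdeg \<nu> = j. monom \<nu> * h \<nu>)" "\<And>\<nu>. tdeg \<nu> = j \<Longrightarrow> h \<nu> \<in> ordge M"
proof -
  have "\<exists>\<nu>\<in>{\<nu>. tdeg \<nu> = j}. \<nu> \<le> \<mu>" if "mfps_coeff f \<mu> \<noteq> 0" for \<mu>
  proof -
    have "j + M \<le> tdeg \<mu>"
      using that assms by (auto simp: ordge_def not_less[symmetric])
    then show ?thesis using exists_le_tdeg[of j \<mu>] by auto
  qed
  then obtain h where h: "f = (\<Sum>\<nu> | tdeg \<nu> = j. monom \<nu> * h \<nu>)"
    "\<And>\<nu> \<kappa>. mfps_coeff (h \<nu>) \<kappa> = 0 \<or> mfps_coeff (h \<nu>) \<kappa> = mfps_coeff f (\<lambda>i. \<nu> i + \<kappa> i)"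
    using monom_decomp[OF finite_tdeg_eq[of j], of f] by blast
  have "h \<nu> \<in> ordge M" if "tdeg \<nu> = j" for \<nu>
  proof -
    have "mfps_coeff f (\<lambda>i. \<nu> i + \<kappa> i) = 0" if "tdeg \<kappa> < M" for \<kappa>
      using assms that \<open>tdeg \<nu> = j\<close> by (auto simp: ordge_def)
    then show ?thesis using h(2)[of \<nu>] unfolding ordge_def by (smt (verit) mem_Collect_eq)
  qed
  then show ?thesis using that h(1) by blast
qed

section \<open>Completeness and Nakayama's lemma\<close>

lemma igen_sum: "(\<Sum>i<n. c i * x i) \<in> igen x n"
  unfolding igen_iff by blast

text \<open>Successive approximation: the coefficients of the corrections have growing order, so
  their sums converge, and what remains lies in every \<open>ordge N\<close>. The sets
  \<open>D j\<close> let an application carry an invariant of the remainder beyond its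
  order.\<close>

lemma igen_iterate:
  fixes x :: "nat \<Rightarrow> ('v::finite, 'k::comm_ring_1) mfps"
  assumes D: "\<And>j. D j \<subseteq> ordge j" and f: "f \<in> D 0"
    and step: "\<And>j g. g \<in> D j \<Longrightarrow> \<exists>c. (\<forall>i<n. c i \<in> ordge j) \<and> g - (\<Sum>i<n. c i * x i) \<in> D (Suc j)"
  shows "f \<in> igen x n"
proof -
  define C where "C j g = (SOME c. (\<forall>i<n. c i \<in> ordge j) \<and> g - (\<Sum>i<n. c i * x i) \<in> D (Suc j))" for j g
  have C: "\<forall>i<n. C j g i \<in> ordge j" "g - (\<Sum>i<n. C j g i * x i) \<in> D (Suc j)" if "g \<in> D j" for j g
    using someI_ex[OF step[OF that]] unfolding C_def by blast+
  define r where "r = rec_nat f (\<lambda>j g. g - (\<Sum>i<n. C j g i * x i))"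
  have r_simps: "r 0 = f" "r (Suc j) = r j - (\<Sum>i<n. C j (r j) i * x i)" for j
    by (simp_all add: r_def)
  have r: "r j \<in> D j" for j
    by (induction j) (auto simp: r_simps f C)
  define c where "c i j = (if i < n then C j (r j) i else 0)" for i j
  have c: "c i j \<in> ordge j" for i j
    using C(1)[OF r] by (simp add: c_def)
  have part: "f = (\<Sum>i<n. (\<Sum>j<N. c i j) * x i) + r N" for N
  proof (induction N)
    case (Suc N)
    have "r N = (\<Sum>i<n. c i N * x i) + r (Suc N)"
      by (simp add: r_simps c_def)
    with Suc show ?case
      by (simp add: distrib_right sum.distrib)
  qed (simp add: r_simps)
  have "f - (\<Sum>i<n. mfps_suminf (c i) * x i) \<in> ordge N" for N
  proof -
    have "f - (\<Sum>i<n. mfps_suminf (c i) * x i)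
        = r N - (\<Sum>i<n. (mfps_suminf (c i) - (\<Sum>j<N. c i j)) * x i)"
      by (subst part[of N]) (simp add: left_diff_distrib sum_subtractf)
    also have "\<dots> \<in> ordge N"
    proof (intro ordge_diff idl.subspace_sum is_ideal_ordge)
      show "r N \<in> ordge N" using r[of N] D[of N] by blast
      show "(mfps_suminf (c i) - (\<Sum>j<N. c i j)) * x i \<in> ordge N" for i
        using mfps_suminf_ordge[of "c i" N] c by (intro ideal_mult' is_ideal_ordge) blast
    qed
    finally show ?thesis .
  qed
  then have "f = (\<Sum>i<n. mfps_suminf (c i) * x i)"
    using ordge_separated by (metis right_minus_eq)
  then show ?thesis
    by (auto simp: igen_iff)
qed

text \<open>Solving the step from order \<open>M\<close> to \<open>Suc M\<close> is enough: a
  remainder of order \<open>j + M\<close> is a combination of the monomials of degree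
  \<open>j\<close> with coefficients in \<open>ordge M\<close>, and the step is applied to these
  coefficients.\<close>

lemma igen_nakayama:
  fixes x :: "nat \<Rightarrow> ('v::finite, 'k::comm_ring_1) mfps"
  assumes "\<And>f. f \<in> ordge M \<Longrightarrow> \<exists>g\<in>igen x n. f - g \<in> ordge (Suc M)"
  shows "ordge M \<subseteq> igen x n"
proof
  fix f :: "('v, 'k) mfps" assume "f \<in> ordge M"
  show "f \<in> igen x n"
  proof (rule igen_iterate[where D = "\<lambda>j. ordge (j + M)"])
    show "ordge (j + M) \<subseteq> ordge j" for j
      by (simp add: ordge_mono)
    show "f \<in> ordge (0 + M)" by (simp add: \<open>f \<in> ordge M\<close>)
    fix j and g :: "('v, 'k) mfps" assume "g \<in> ordge (j + M)"
    then obtain h where h: "g = (\<Sum>\<nu> | tdeg \<nu> = j. monom \<nu> * h \<nu>)"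
      "\<And>\<nu>. tdeg \<nu> = j \<Longrightarrow> h \<nu> \<in> ordge M"
      using ordge_decomp by blast
    have "\<exists>c. h \<nu> - (\<Sum>i<n. c i * x i) \<in> ordge (Suc M)" if "tdeg \<nu> = j" for \<nu>
      using assms[OF h(2)[OF that]] by (auto simp: igen_iff)
    then obtain c where c: "\<And>\<nu>. tdeg \<nu> = j \<Longrightarrow> h \<nu> - (\<Sum>i<n. c \<nu> i * x i) \<in> ordge (Suc M)"
      by metis
    define d where "d i = (\<Sum>\<nu> | tdeg \<nu> = j. monom \<nu> * c \<nu> i)" for i
    have "d i \<in> ordge j" for i
      unfolding d_def
      by (rule idl.subspace_sum) (auto intro!: ideal_mult' simp: monom_ordge)
    moreover have "g - (\<Sum>i<n. d i * x i) \<in> ordge (Suc j + M)"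
    proof -
      have "(\<Sum>i<n. d i * x i) = (\<Sum>\<nu> | tdeg \<nu> = j. monom \<nu> * (\<Sum>i<n. c \<nu> i * x i))"
        unfolding d_def sum_distrib_right sum_distrib_left by (subst sum.swap) (simp add: mult.assoc)
      then have "g - (\<Sum>i<n. d i * x i) = (\<Sum>\<nu> | tdeg \<nu> = j. monom \<nu> * (h \<nu> - (\<Sum>i<n. c \<nu> i * x i)))"
        by (simp add: h(1) right_diff_distrib sum_subtractf)
      also have "\<dots> \<in> ordge (j + Suc M)"
        using c by (intro idl.subspace_sum ordge_mult) (auto simp: monom_ordge)
      finally show ?thesis by simp
    qed
    ultimately show "\<exists>c. (\<forall>i<n. c i \<in> ordge j) \<and> g - (\<Sum>i<n. c i * x i) \<in> ordge (Suc j + M)"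
      by blast
  qed
qed

text \<open>By Nakayama's lemma, errors of order \<open>Suc M\<close> in the generators are
  invisible to an ideal that contains \<open>ordge M\<close>. This allows generators to be replaced
  by polynomials.\<close>

lemma igen_perturb:
  fixes x x' :: "nat \<Rightarrow> ('v::finite, 'k::comm_ring_1) mfps"
  assumes M: "ordge M \<subseteq> igen x n" and x': "\<And>i. i < n \<Longrightarrow> x i - x' i \<in> ordge (Suc M)"
  shows "ordge M \<subseteq> igen x' n" "igen x' n = igen x n"
proof -
  show *: "ordge M \<subseteq> igen x' n"
  proof (rule igen_nakayama)
    fix f :: "('v, 'k) mfps" assume "f \<in> ordge M"
    then have "f \<in> igen x n" using M by blast
    then obtain c where c: "f = (\<Sum>i<n. c i * x i)"
      unfolding igen_iff ..
    have "f - (\<Sum>i<n. c i * x' i) = (\<Sum>i<n. c i * (x i - x' i))"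
      by (simp add: c right_diff_distrib sum_subtractf)
    also have "\<dots> \<in> ordge (Suc M)"
      using x' by (intro idl.subspace_sum ideal_mult) auto
    finally show "\<exists>g\<in>igen x' n. f - g \<in> ordge (Suc M)"
      using igen_sum by blast
  qed
  have o: "ordge (Suc M) \<subseteq> ordge M" by (simp add: ordge_mono)
  show "igen x' n = igen x n"
  proof
    show "igen x n \<subseteq> igen x' n"
      unfolding igen_subset_iff[OF is_ideal_igen]
    proof clarify
      fix i assume "i < n"
      then have "x i - x' i \<in> igen x' n" "x' i \<in> igen x' n"
        using x' o * by (blast, simp add: igen_base)
      then show "x i \<in> igen x' n"
        using idl.subspace_add[OF is_ideal_igen, of "x i - x' i" x' n "x' i"] by simp
    qed
    show "igen x' n \<subseteq> igen x n"
      unfolding igen_subset_iff[OF is_ideal_igen]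
    proof clarify
      fix i assume "i < n"
      then have "x i - x' i \<in> igen x n" "x i \<in> igen x n"
        using x' o M by (blast, simp add: igen_base)
      then show "x' i \<in> igen x n"
        using idl.subspace_diff[OF is_ideal_igen, of "x i" x n "x i - x' i"] by simp
    qed
  qed
qed

lemma mfps_unit:
  fixes f :: "('v::finite, 'k::field) mfps"
  assumes "mfps_coeff f (\<lambda>_. 0) \<noteq> 0"
  obtains g where "f * g = 1"
proof -
  \<comment> \<open>Nakayama's lemma for the single generator \<open>f\<close>: it suffices to match
    constant terms, and \<open>ordge 0\<close> contains \<open>1\<close>.\<close>
  have "ordge 0 \<subseteq> igen (\<lambda>_. f) 1"
  proof (rule igen_nakayama)
    fix h :: "('v, 'k) mfps"
    define c where "c = mfps_coeff h (\<lambda>_. 0) / mfps_coeff f (\<lambda>_. 0)"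
    have "h - mfps_const c * f \<in> ordge (Suc 0)"
      using assms by (auto simp: ordge_def c_def)
    moreover have "mfps_const c * f \<in> igen (\<lambda>_. f) 1"
      using igen_base[of 0 1 "\<lambda>_. f"] by (intro ideal_mult) auto
    ultimately show "\<exists>g\<in>igen (\<lambda>_. f) 1. h - g \<in> ordge (Suc 0)" by blast
  qed
  then have "1 \<in> igen (\<lambda>_. f) 1" by auto
  then show ?thesis
    using that by (auto simp: igen_iff mult.commute)
qed

lemma ordge_1_iff: "f \<in> ordge 1 \<longleftrightarrow> mfps_coeff f (\<lambda>_. 0) = 0"
  by (auto simp: ordge_def)

lemma ideal_le_ordge_1:
  fixes I :: "('v::finite, 'k::field) mfps set"
  assumes "is_ideal I" "I \<noteq> UNIV"
  shows "I \<subseteq> ordge 1"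
proof
  fix f assume "f \<in> I"
  show "f \<in> ordge 1"
  proof (rule ccontr)
    assume "f \<notin> ordge 1"
    then obtain g where "f * g = 1"
      using mfps_unit ordge_1_iff by metis
    then have "1 \<in> I"
      using ideal_mult'[OF assms(1) \<open>f \<in> I\<close>] by metis
    then show False using assms ideal_UNIV_iff by blast
  qed
qed

lemma one_notin_ordge [simp]: "1 \<notin> ordge (Suc M)"
  by (auto simp: ordge_def coeff_1)

lemma ordge_Suc_neq_UNIV: "ordge (Suc M) \<noteq> UNIV"
  using one_notin_ordge by blast

lemma power_ideal_iff:
  fixes f :: "('v::finite, 'k::comm_ring_1) mfps"
  shows "f \<in> ideal_gen ((\<lambda>v. mfps_var v ^ e) ` A) \<longleftrightarrow>
    (\<forall>\<mu>. (\<forall>v\<in>A. \<mu> v < e) \<longrightarrow> mfps_coeff f \<mu> = 0)"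
proof
  let ?m = "\<lambda>v w. if w = v then e else 0"
  assume "f \<in> ideal_gen ((\<lambda>v. mfps_var v ^ e) ` A)"
  then obtain c where f: "f = (\<Sum>v\<in>A. c v * mfps_var v ^ e)"
    by (auto simp: ideal_gen_image_iff)
  have "mfps_coeff (c v * mfps_var v ^ e) \<mu> = 0" if "\<mu> v < e" for \<mu> v
  proof -
    have "\<not> ?m v \<le> \<mu>"
      using that by (auto simp: le_fun_def not_le)
    then show ?thesis
      by (simp add: var_power coeff_monom_mult mult.commute[of "c v"])
  qed
  then show "\<forall>\<mu>. (\<forall>v\<in>A. \<mu> v < e) \<longrightarrow> mfps_coeff f \<mu> = 0"
    by (simp add: f)
next
  let ?m = "\<lambda>v w. if w = v then e else 0"
  assume f: "\<forall>\<mu>. (\<forall>v\<in>A. \<mu> v < e) \<longrightarrow> mfps_coeff f \<mu> = 0"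
  have "\<exists>\<nu>\<in>?m ` A. \<nu> \<le> \<mu>" if nz: "mfps_coeff f \<mu> \<noteq> 0" for \<mu>
  proof -
    obtain v where "v \<in> A" "e \<le> \<mu> v" using f nz not_less by blast
    then show ?thesis by (auto simp: le_fun_def)
  qed
  then obtain h where "f = (\<Sum>\<nu>\<in>?m ` A. monom \<nu> * h \<nu>)"
    using monom_decomp[of "?m ` A" f] by auto
  also have "\<dots> \<in> ideal_gen ((\<lambda>v. mfps_var v ^ e) ` A)"
    by (intro idl.subspace_sum ideal_mult' idl.subspace_span)
      (auto simp flip: var_power intro: idl.span_base)
  finally show "f \<in> ideal_gen ((\<lambda>v. mfps_var v ^ e) ` A)" .
qed

text \<open>Pigeonhole: a monomial of degree at least \<open>CARD('v) * e\<close> has some exponent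
  at least \<open>e\<close>.\<close>

lemma ordge_le_of_var_powers:
  assumes "is_ideal I" "\<And>v. mfps_var v ^ e \<in> I"
  shows "(ordge (CARD('v) * e) :: ('v::finite, 'k::comm_ring_1) mfps set) \<subseteq> I"
proof
  fix f :: "('v, 'k) mfps" assume f: "f \<in> ordge (CARD('v) * e)"
  have "f \<in> ideal_gen (range (\<lambda>v. mfps_var v ^ e))"
    unfolding power_ideal_iff
  proof (intro allI impI)
    fix \<mu> :: "'v \<Rightarrow> nat" assume \<mu>: "\<forall>v\<in>UNIV. \<mu> v < e"
    have "tdeg \<mu> < (\<Sum>v\<in>(UNIV :: 'v set). e)"
      unfolding tdeg_def using \<mu> by (intro sum_strict_mono) auto
    then show "mfps_coeff f \<mu> = 0"
      using f by (simp add: ordge_def)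
  qed
  then show "f \<in> I"
    using idl.span_minimal[of "range (\<lambda>v. mfps_var v ^ e)" I] assms by blast
qed

lemma var_power_ordge: "mfps_var v ^ e \<in> ordge e"
  by (rule ordge_power[OF var_ordge])

text \<open>The nonzerodivisor half of regularity; properness is stated separately, as
  \<open>igen x r \<noteq> UNIV\<close>.\<close>

definition reg :: "nat \<Rightarrow> (nat \<Rightarrow> 'a::comm_ring_1) \<Rightarrow> bool"
  where "reg r x \<longleftrightarrow> (\<forall>j<r. \<forall>y. x j * y \<in> igen x j \<longrightarrow> y \<in> igen x j)"

lemma regD: "reg r x \<Longrightarrow> j < r \<Longrightarrow> x j * y \<in> igen x j \<Longrightarrow> y \<in> igen x j"
  by (simp add: reg_def)

lemma reg_mono: "reg r x \<Longrightarrow> s \<le> r \<Longrightarrow> reg s x"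
  by (simp add: reg_def)

lemma reg_cong:
  assumes "\<And>i. i < r \<Longrightarrow> x i = y i"
  shows "reg r x \<longleftrightarrow> reg r y"
proof -
  have "igen x j = igen y j" if "j < r" for j
    using that assms by (intro igen_cong) auto
  then show ?thesis
    unfolding reg_def using assms by auto
qed

lemma reg_var_powers:
  fixes v :: "nat \<Rightarrow> 'v::finite"
  assumes "inj_on v {..<r}"
  shows "reg r (\<lambda>i. mfps_var (v i) ^ e :: ('v, 'k::comm_ring_1) mfps)"
  unfolding reg_def
proof (intro allI impI)
  fix j and y :: "('v, 'k) mfps"
  assume j: "j < r" and y: "mfps_var (v j) ^ e * y \<in> igen (\<lambda>i. mfps_var (v i) ^ e) j"
  have img: "igen (\<lambda>i. mfps_var (v i) ^ e) j = ideal_gen ((\<lambda>w. mfps_var w ^ e) ` (v ` {..<j}))"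
    by (simp add: igen_def image_image)
  show "y \<in> igen (\<lambda>i. mfps_var (v i) ^ e) j"
    unfolding img power_ideal_iff
  proof (intro allI impI)
    fix \<mu> assume \<mu>: "\<forall>w\<in>v ` {..<j}. \<mu> w < e"
    \<comment> \<open>Multiplication by the \<open>j\<close>-th power moves the coefficient at
      \<open>\<mu>\<close> to \<open>\<mu>'\<close>; as the variables are distinct, the exponents
      tested by the first \<open>j\<close> powers stay the same.\<close>
    define \<mu>' where "\<mu>' = (\<lambda>i. (if i = v j then e else 0) + \<mu> i)"
    have "v w \<noteq> v j" if "w < j" for w
      using inj_onD[OF assms, of w j] j that by fastforce
    then have "\<forall>w\<in>v ` {..<j}. \<mu>' w < e"
      using \<mu> by (auto simp: \<mu>'_def)
    then have "mfps_coeff (mfps_var (v j) ^ e * y) \<mu>' = 0"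
      using y unfolding img power_ideal_iff by blast
    then show "mfps_coeff y \<mu> = 0"
      by (simp add: var_power \<mu>'_def)
  qed
qed

section \<open>Linear algebra modulo primary ideals\<close>

text \<open>Independent rows have a right inverse, built by adding one row at a time. The result is
  an explicit matrix because its finitely many entries can later be carried along a
  homomorphism.\<close>

lemma right_inverse_of_independent:
  fixes a :: "'i \<Rightarrow> 'q \<Rightarrow> 'k::field"
  assumes "finite I" "finite Q"
    and "\<And>c. (\<And>q. q \<in> Q \<Longrightarrow> (\<Sum>i\<in>I. c i * a i q) = 0) \<Longrightarrow> \<forall>i\<in>I. c i = 0"
  shows "\<exists>\<sigma>. \<forall>i\<in>I. \<forall>j\<in>I. (\<Sum>q\<in>Q. a i q * \<sigma> q j) = (if i = j then 1 else 0)"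
  using assms(1,3)
proof (induction I rule: finite_induct)
  case (insert i0 I)
  have "\<forall>i\<in>I. c i = 0" if c: "\<And>q. q \<in> Q \<Longrightarrow> (\<Sum>i\<in>I. c i * a i q) = 0" for c
  proof -
    have "(\<Sum>i\<in>insert i0 I. (c(i0 := 0)) i * a i q) = 0" if "q \<in> Q" for q
    proof -
      have "(\<Sum>i\<in>I. (c(i0 := 0)) i * a i q) = (\<Sum>i\<in>I. c i * a i q)"
        using insert.hyps by (intro sum.cong) auto
      then show ?thesis using insert.hyps c[OF that] by simp
    qed
    then have "\<forall>i\<in>insert i0 I. (c(i0 := 0)) i = 0"
      by (rule insert.prems)
    then show ?thesis using insert.hyps by (auto split: if_splits)
  qed
  then obtain \<sigma> where \<sigma>: "\<forall>i\<in>I. \<forall>j\<in>I. (\<Sum>q\<in>Q. a i q * \<sigma> q j) = (if i = j then 1 else 0)"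
    using insert.IH by blast
  define b where "b j = (\<Sum>q\<in>Q. a i0 q * \<sigma> q j)" for j
  \<comment> \<open>The part of the new row that the old rows do not account for: \<open>b\<close>
    holds its coordinates under \<open>\<sigma>\<close>, so \<open>r = 0\<close> would be a linear
    relation.\<close>
  define r where "r q = a i0 q - (\<Sum>j\<in>I. b j * a j q)" for q
  have "\<exists>p\<in>Q. r p \<noteq> 0"
  proof (rule ccontr)
    assume "\<not> (\<exists>p\<in>Q. r p \<noteq> 0)"
    then have r0: "r q = 0" if "q \<in> Q" for q using that by blast
    define c where "c i = (if i = i0 then -1 else b i)" for i
    have "(\<Sum>i\<in>insert i0 I. c i * a i q) = 0" if "q \<in> Q" for q
    proof -
      have "(\<Sum>i\<in>I. c i * a i q) = (\<Sum>i\<in>I. b i * a i q)"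
        using insert.hyps by (intro sum.cong) (auto simp: c_def)
      then show ?thesis
        using insert.hyps r0[OF that] by (simp add: c_def r_def)
    qed
    then have "c i0 = 0"
      using insert.prems[of c] by blast
    then show False by (simp add: c_def)
  qed
  then obtain p where p: "p \<in> Q" "r p \<noteq> 0" by blast
  \<comment> \<open>The unit column at \<open>p\<close>, corrected by \<open>\<sigma>\<close> so as
    to pair to 0 with the old rows and scaled so as to pair to 1 with the new one.\<close>
  define s where "s q = ((if q = p then 1 else 0) - (\<Sum>j\<in>I. \<sigma> q j * a j p)) / r p" for q
  have s: "(\<Sum>q\<in>Q. a k q * s q) = (a k p - (\<Sum>j\<in>I. (\<Sum>q\<in>Q. a k q * \<sigma> q j) * a j p)) / r p" for k
  proof -
    have "(\<Sum>q\<in>Q. a k q * s q)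
        = ((\<Sum>q\<in>Q. a k q * (if q = p then 1 else 0)) - (\<Sum>q\<in>Q. \<Sum>j\<in>I. a k q * \<sigma> q j * a j p)) / r p"
      unfolding s_def
      by (simp add: right_diff_distrib diff_divide_distrib sum_subtractf sum_distrib_left
          mult.assoc flip: sum_divide_distrib)
    also have "(\<Sum>q\<in>Q. a k q * (if q = p then 1 else 0)) = a k p"
      using assms(2) p(1) by (simp add: if_distrib sum.delta cong: if_cong)
    finally show ?thesis
      by (subst (asm) sum.swap) (simp add: sum_distrib_right)
  qed
  have s_I: "(\<Sum>q\<in>Q. a k q * s q) = 0" if "k \<in> I" for k
  proof -
    have "(\<Sum>j\<in>I. (\<Sum>q\<in>Q. a k q * \<sigma> q j) * a j p) = (\<Sum>j\<in>I. if k = j then a j p else 0)"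
      using \<sigma> that by (intro sum.cong) auto
    then show ?thesis
      using insert.hyps that by (simp add: s sum.delta')
  qed
  have s_i0: "(\<Sum>q\<in>Q. a i0 q * s q) = 1"
    using p by (simp add: s r_def b_def)
  define \<sigma>' where "\<sigma>' q j = (if j = i0 then s q else \<sigma> q j - b j * s q)" for q j
  have "(\<Sum>q\<in>Q. a k q * \<sigma>' q j) = (if k = j then 1 else 0)"
    if "k \<in> insert i0 I" "j \<in> insert i0 I" for k j
  proof (cases "j = i0")
    case True
    then show ?thesis
      using that s_I s_i0 insert.hyps by (auto simp: \<sigma>'_def)
  next
    case False
    then have "(\<Sum>q\<in>Q. a k q * \<sigma>' q j) = (\<Sum>q\<in>Q. a k q * \<sigma> q j) - b j * (\<Sum>q\<in>Q. a k q * s q)"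
      by (simp add: \<sigma>'_def right_diff_distrib sum_subtractf sum_distrib_left mult.left_commute)
    then show ?thesis
      using that False s_I s_i0 \<sigma> insert.hyps by (auto simp: b_def)
  qed
  then show ?case by blast
qed simp

section \<open>Monomial bases of finite-dimensional quotients\<close>

definition lincomb :: "('v \<Rightarrow> nat) set \<Rightarrow> (('v \<Rightarrow> nat) \<Rightarrow> 'k) \<Rightarrow> ('v::finite, 'k::comm_ring_1) mfps"
  where "lincomb B c = (\<Sum>\<nu>\<in>B. mfps_const (c \<nu>) * monom \<nu>)"

lemma coeff_lincomb: "finite B \<Longrightarrow> mfps_coeff (lincomb B c) \<mu> = (if \<mu> \<in> B then c \<mu> else 0)"
  by (simp add: lincomb_def coeff_monom if_distrib sum.delta' cong: if_cong)

lemma lincomb_add: "lincomb B (\<lambda>\<nu>. c \<nu> + d \<nu>) = lincomb B c + lincomb B d"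
  by (simp add: lincomb_def const_add distrib_right sum.distrib)

lemma lincomb_diff: "lincomb B (\<lambda>\<nu>. c \<nu> - d \<nu>) = lincomb B c - lincomb B d"
  by (simp add: lincomb_def const_diff left_diff_distrib sum_subtractf)

lemma lincomb_scale: "lincomb B (\<lambda>\<nu>. a * c \<nu>) = mfps_const a * lincomb B c"
  by (simp add: lincomb_def const_mult sum_distrib_left mult.assoc)

lemma lincomb_sum: "lincomb B (\<lambda>\<nu>. \<Sum>i\<in>A. c i \<nu>) = (\<Sum>i\<in>A. lincomb B (c i))"
  unfolding lincomb_def const_sum sum_distrib_right by (rule sum.swap)

lemma minus_truncate:
  "f - lincomb {\<mu>. tdeg \<mu> < M} (mfps_coeff f) \<in> ordge M"
  by (simp add: ordge_def coeff_lincomb finite_tdeg_less)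

text \<open>The monomials with exponents in \<open>B\<close> represent a vector space basis of the
  quotient by \<open>I\<close>.\<close>

definition nf_basis :: "('v::finite, 'k::field) mfps set \<Rightarrow> ('v \<Rightarrow> nat) set \<Rightarrow> bool"
  where "nf_basis I B \<longleftrightarrow> finite B \<and>
    (\<forall>c. lincomb B c \<in> I \<longrightarrow> (\<forall>\<nu>\<in>B. c \<nu> = 0)) \<and> (\<forall>f. \<exists>c. f - lincomb B c \<in> I)"

text \<open>Among the finitely many sets of monomials of degree below \<open>M\<close> that are
  independent modulo \<open>I\<close> there is a maximal one, and maximality expresses every other
  such monomial through it.\<close>

lemma ex_nf_basis:
  fixes I :: "('v::finite, 'k::field) mfps set"
  assumes I: "is_ideal I" and M: "ordge M \<subseteq> I"
  obtains B where "nf_basis I B" "\<And>\<nu>. \<nu> \<in> B \<Longrightarrow> tdeg \<nu> < M"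
proof -
  let ?ind = "\<lambda>B. \<forall>c. lincomb B c \<in> I \<longrightarrow> (\<forall>\<nu>\<in>B. c \<nu> = 0)"
  let ?T = "{\<nu> :: 'v \<Rightarrow> nat. tdeg \<nu> < M}"
  define \<B> where "\<B> = {B. B \<subseteq> ?T \<and> ?ind B}"
  have fin: "finite ?T" by (rule finite_tdeg_less)
  have "finite \<B>" "\<B> \<noteq> {}"
    using fin by (auto simp: \<B>_def intro!: finite_subset[of _ "Pow ?T"])
  then obtain B where B: "B \<in> \<B>" "\<And>B'. B' \<in> \<B> \<Longrightarrow> B \<subseteq> B' \<Longrightarrow> B' = B"
    using finite_has_maximal[of \<B>] by metis
  then have BT: "B \<subseteq> ?T" and ind: "?ind B" by (auto simp: \<B>_def)
  have finB: "finite B" using BT fin finite_subset by blast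
  have mono: "\<exists>c. monom \<kappa> - lincomb B c \<in> I" if \<kappa>: "tdeg \<kappa> < M" for \<kappa>
  proof (cases "\<kappa> \<in> B")
    case True
    have "monom \<kappa> - lincomb B (\<lambda>\<nu>. if \<nu> = \<kappa> then 1 else 0) = (0 :: ('v, 'k) mfps)"
      using True finB by (auto simp: mfps_eq_iff coeff_lincomb coeff_monom)
    then show ?thesis using idl.subspace_0[OF I] by metis
  next
    case False
    then have "insert \<kappa> B \<notin> \<B>" using B(2)[of "insert \<kappa> B"] by blast
    then have "\<not> ?ind (insert \<kappa> B)"
      using BT \<kappa> by (simp add: \<B>_def)
    then obtain c where c: "lincomb (insert \<kappa> B) c \<in> I" "\<exists>\<nu>\<in>insert \<kappa> B. c \<nu> \<noteq> 0"
      by blast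
    have eq: "lincomb (insert \<kappa> B) c = mfps_const (c \<kappa>) * monom \<kappa> + lincomb B c"
      using False finB by (simp add: lincomb_def)
    have "c \<kappa> \<noteq> 0"
    proof
      assume "c \<kappa> = 0"
      then have "lincomb B c \<in> I" using c(1) eq by simp
      then show False using ind c(2) \<open>c \<kappa> = 0\<close> by blast
    qed
    then have "mfps_const (1 / c \<kappa>) * mfps_const (c \<kappa>) = (1 :: ('v, 'k) mfps)"
      by (simp flip: const_mult)
    then have "mfps_const (1 / c \<kappa>) * lincomb (insert \<kappa> B) c
        = monom \<kappa> - lincomb B (\<lambda>\<nu>. - (1 / c \<kappa>) * c \<nu>)"
      unfolding lincomb_scale eq by (simp add: distrib_left flip: mult.assoc)
         (simp add: mfps_eq_iff)
    then show ?thesis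
      using ideal_mult[OF I c(1)] by metis
  qed
  have span: "\<exists>c. f - lincomb B c \<in> I" for f
  proof -
    obtain c where c: "\<And>\<kappa>. tdeg \<kappa> < M \<Longrightarrow> monom \<kappa> - lincomb B (c \<kappa>) \<in> I"
      using mono by metis
    define d where "d \<nu> = (\<Sum>\<kappa>\<in>?T. mfps_coeff f \<kappa> * c \<kappa> \<nu>)" for \<nu>
    have "lincomb ?T (mfps_coeff f) - lincomb B d
        = (\<Sum>\<kappa>\<in>?T. mfps_const (mfps_coeff f \<kappa>) * (monom \<kappa> - lincomb B (c \<kappa>)))"
      unfolding d_def lincomb_sum lincomb_scale
      by (simp add: lincomb_def right_diff_distrib sum_subtractf)
    also have "\<dots> \<in> I"
      using c by (intro idl.subspace_sum[OF I] ideal_mult[OF I]) auto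
    finally have "(f - lincomb ?T (mfps_coeff f)) + (lincomb ?T (mfps_coeff f) - lincomb B d) \<in> I"
      using minus_truncate M by (intro idl.subspace_add[OF I]) blast+
    then show ?thesis by auto
  qed
  show ?thesis
    using that[of B] BT finB ind span unfolding nf_basis_def by blast
qed

text \<open>Coordinates in the monomial basis. Values outside \<open>B\<close> are arbitrary, so all
  facts about them are stated at exponents in \<open>B\<close>.\<close>

definition nf :: "('v::finite, 'k::field) mfps set \<Rightarrow> ('v \<Rightarrow> nat) set \<Rightarrow> ('v, 'k) mfps \<Rightarrow> ('v \<Rightarrow> nat) \<Rightarrow> 'k"
  where "nf I B f = (SOME c. f - lincomb B c \<in> I)"

lemma nf_mem: "nf_basis I B \<Longrightarrow> f - lincomb B (nf I B f) \<in> I"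
  unfolding nf_def nf_basis_def by (metis (mono_tags, lifting) someI_ex)

lemma nf_unique:
  assumes "is_ideal I" "nf_basis I B" "f - lincomb B c \<in> I" "\<nu> \<in> B"
  shows "nf I B f \<nu> = c \<nu>"
proof -
  have "(f - lincomb B c) - (f - lincomb B (nf I B f)) \<in> I"
    using assms nf_mem by (blast intro: idl.subspace_diff)
  then have "lincomb B (\<lambda>\<nu>. nf I B f \<nu> - c \<nu>) \<in> I"
    by (simp add: lincomb_diff)
  then have "nf I B f \<nu> - c \<nu> = 0"
    using assms unfolding nf_basis_def by blast
  then show ?thesis by simp
qed

lemma nf_lincomb:
  assumes "is_ideal I" "nf_basis I B" "\<nu> \<in> B"
  shows "nf I B (lincomb B c) \<nu> = c \<nu>"
  using assms by (intro nf_unique) (auto simp: idl.subspace_0)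

lemma nf_add:
  assumes "is_ideal I" "nf_basis I B" "\<nu> \<in> B"
  shows "nf I B (f + g) \<nu> = nf I B f \<nu> + nf I B g \<nu>"
  using assms idl.subspace_add[OF assms(1) nf_mem[OF assms(2), of f] nf_mem[OF assms(2), of g]]
  by (intro nf_unique[where c = "\<lambda>\<nu>. nf I B f \<nu> + nf I B g \<nu>"]) (auto simp: lincomb_add algebra_simps)

lemma nf_scale:
  assumes "is_ideal I" "nf_basis I B" "\<nu> \<in> B"
  shows "nf I B (mfps_const a * f) \<nu> = a * nf I B f \<nu>"
  using assms ideal_mult[OF assms(1) nf_mem[OF assms(2), of f], of "mfps_const a"]
  by (intro nf_unique[where c = "\<lambda>\<nu>. a * nf I B f \<nu>"]) (auto simp: lincomb_scale algebra_simps)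

lemma nf_sum:
  assumes "is_ideal I" "nf_basis I B" "\<nu> \<in> B"
  shows "nf I B (\<Sum>i\<in>A. f i) \<nu> = (\<Sum>i\<in>A. nf I B (f i) \<nu>)"
proof (induction A rule: infinite_finite_induct)
  case empty
  then show ?case
    using nf_scale[OF assms, of 0 0] by simp
next
  case (infinite A)
  then show ?case using nf_scale[OF assms, of 0 0] by simp
qed (simp add: nf_add[OF assms])

lemma nf_eq_0_iff:
  assumes "is_ideal I" "nf_basis I B"
  shows "f \<in> I \<longleftrightarrow> (\<forall>\<nu>\<in>B. nf I B f \<nu> = 0)"
proof
  assume "f \<in> I"
  then have "nf I B f \<nu> = (\<lambda>_. 0) \<nu>" if "\<nu> \<in> B" for \<nu>
    using that assms by (intro nf_unique) (auto simp: lincomb_def)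
  then show "\<forall>\<nu>\<in>B. nf I B f \<nu> = 0" by simp
next
  assume "\<forall>\<nu>\<in>B. nf I B f \<nu> = 0"
  then have "lincomb B (nf I B f) = 0"
    by (simp add: lincomb_def)
  then show "f \<in> I"
    using nf_mem[OF assms(2), of f] by simp
qed

text \<open>Coordinates factor through the truncation below degree \<open>M\<close>. This finite
  formula is the one that can be transported to another field.\<close>

lemma nf_expand:
  assumes "is_ideal I" "nf_basis I B" "ordge M \<subseteq> I" "\<nu> \<in> B"
  shows "nf I B f \<nu> = (\<Sum>\<kappa> | tdeg \<kappa> < M. mfps_coeff f \<kappa> * nf I B (monom \<kappa>) \<nu>)"
proof -
  let ?t = "lincomb {\<kappa>. tdeg \<kappa> < M} (mfps_coeff f)"
  have "nf I B (f - ?t) \<nu> = 0"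
    using nf_eq_0_iff[OF assms(1,2)] minus_truncate[of f M] assms(3,4) by blast
  then have "nf I B f \<nu> = nf I B ?t \<nu>"
    using nf_add[OF assms(1,2,4), of "f - ?t" ?t] by simp
  then show ?thesis
    by (simp add: lincomb_def nf_sum[OF assms(1,2,4)] nf_scale[OF assms(1,2,4)])
qed

section \<open>Koszul cohomology\<close>

text \<open>
  Cochains of the Koszul complex of \<open>y 0, \<dots>, y (n - 1)\<close> are functions on the subsets of
  \<open>{..<n}\<close>, graded by cardinality. The complex of \<open>n + 1\<close> elements is the cone of multiplication by
  \<open>y n\<close> on the complex of \<open>n\<close> elements, which gives the recursion for the differential.
\<close>

primrec kd :: "(nat \<Rightarrow> 'a::comm_ring_1) \<Rightarrow> nat \<Rightarrow> (nat set \<Rightarrow> 'a) \<Rightarrow> nat set \<Rightarrow> 'a" where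
  "kd y 0 = (\<lambda>w A. 0)"
| "kd y (Suc n) = (\<lambda>w A. if n \<in> A
     then y n * w (A - {n}) - kd y n (\<lambda>B. w (insert n B)) (A - {n}) else kd y n w A)"

lemma sub_Suc_cases:
  assumes "A \<subseteq> {..<Suc n}"
  obtains "A \<subseteq> {..<n}" | B where "A = insert n B" "B \<subseteq> {..<n}"
proof (cases "n \<in> A")
  case True
  then have "A = insert n (A - {n})" "A - {n} \<subseteq> {..<n}"
    using assms by (auto simp: lessThan_Suc)
  then show ?thesis using that by blast
next
  case False
  then show ?thesis using assms that by (auto simp: lessThan_Suc)
qed

lemma sub_notin: "B \<subseteq> {..<n::nat} \<Longrightarrow> n \<notin> B"
  by auto

lemma sub_finite: "B \<subseteq> {..<n::nat} \<Longrightarrow> finite B"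
  using finite_subset by blast

lemma insert_minus: "B \<subseteq> {..<n::nat} \<Longrightarrow> B - {n} = B"
  by auto

lemma kd_Suc_low [simp]: "B \<subseteq> {..<n} \<Longrightarrow> kd y (Suc n) w B = kd y n w B"
  by (simp add: sub_notin)

lemma kd_Suc_insert [simp]:
  "B \<subseteq> {..<n} \<Longrightarrow> kd y (Suc n) w (insert n B) = y n * w B - kd y n (\<lambda>B. w (insert n B)) B"
  by (simp add: insert_minus)

declare kd.simps(2) [simp del]

lemma kd_cong:
  assumes "\<And>B. B \<subseteq> {..<n} \<Longrightarrow> w B = w' B" "A \<subseteq> {..<n}"
  shows "kd y n w A = kd y n w' A"
  using assms
proof (induction n arbitrary: w w' A)
  case (Suc n)
  have sub: "B \<subseteq> {..<Suc n}" "insert n B \<subseteq> {..<Suc n}" if "B \<subseteq> {..<n}" for B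
    using that by auto
  from \<open>A \<subseteq> {..<Suc n}\<close> show ?case
  proof (cases rule: sub_Suc_cases)
    case 1
    then show ?thesis
      using Suc.IH[of w w' A] Suc.prems(1) sub by simp
  next
    case (2 B)
    then show ?thesis
      using Suc.IH[of "\<lambda>B. w (insert n B)" "\<lambda>B. w' (insert n B)" B] Suc.prems(1) sub by simp
  qed
qed simp

lemma kd_lin:
  "A \<subseteq> {..<n} \<Longrightarrow> kd y n (\<lambda>B. c * w B + d * w' B) A = c * kd y n w A + d * kd y n w' A"
proof (induction n arbitrary: w w' A)
  case (Suc n)
  from Suc.prems show ?case
    by (cases rule: sub_Suc_cases) (simp_all add: Suc.IH algebra_simps)
qed simp

lemma kd_scale: "A \<subseteq> {..<n} \<Longrightarrow> kd y n (\<lambda>B. c * w B) A = c * kd y n w A"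
  using kd_lin[of A n y c w 0 w] by simp

lemma kd_add: "A \<subseteq> {..<n} \<Longrightarrow> kd y n (\<lambda>B. w B + w' B) A = kd y n w A + kd y n w' A"
  using kd_lin[of A n y 1 w 1 w'] by simp

lemma kd_diff: "A \<subseteq> {..<n} \<Longrightarrow> kd y n (\<lambda>B. w B - w' B) A = kd y n w A - kd y n w' A"
  using kd_lin[of A n y 1 w "-1" w'] by simp

lemma kd_zero: "A \<subseteq> {..<n} \<Longrightarrow> (\<And>B. B \<subseteq> {..<n} \<Longrightarrow> w B = 0) \<Longrightarrow> kd y n w A = 0"
  using kd_scale[of A n y 0 w] kd_cong[of n w "\<lambda>B. 0 * w B" A y] by simp

lemma kd_sum: "A \<subseteq> {..<n} \<Longrightarrow> kd y n (\<lambda>B. \<Sum>i\<in>S. w i B) A = (\<Sum>i\<in>S. kd y n (w i) A)"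
  by (induction S rule: infinite_finite_induct) (simp_all add: kd_zero kd_add)

text \<open>The differential is a signed sum of terms \<open>y l * w B\<close>, so only these
  products have to lie in \<open>I\<close>.\<close>

lemma kd_mem:
  assumes I: "is_ideal I" and "A \<subseteq> {..<n}"
    and "\<And>B l. B \<subseteq> {..<n} \<Longrightarrow> l < n \<Longrightarrow> y l * w B \<in> I"
  shows "kd y n w A \<in> I"
  using assms(2,3)
proof (induction n arbitrary: w A)
  case 0
  then show ?case using idl.subspace_0[OF I] by simp
next
  case (Suc n)
  have sub: "B \<subseteq> {..<Suc n}" "insert n B \<subseteq> {..<Suc n}" if "B \<subseteq> {..<n}" for B
    using that by auto
  from Suc.prems(1) show ?case
  proof (cases rule: sub_Suc_cases)
    case 1
    then show ?thesis using Suc.IH[of A w] Suc.prems(2) sub by simp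
  next
    case (2 B)
    then show ?thesis
      using Suc.IH[of B "\<lambda>B. w (insert n B)"] Suc.prems(2) sub by (simp add: idl.subspace_diff[OF I])
  qed
qed

lemma kd_mem': "is_ideal I \<Longrightarrow> A \<subseteq> {..<n} \<Longrightarrow> (\<And>B. B \<subseteq> {..<n} \<Longrightarrow> w B \<in> I) \<Longrightarrow> kd y n w A \<in> I"
  by (rule kd_mem) (auto intro: ideal_mult)

lemma kd_mem_igen: "A \<subseteq> {..<n} \<Longrightarrow> kd y n w A \<in> igen y n"
  by (rule kd_mem) (auto intro: ideal_mult' igen_base)

lemma kd_kd: "A \<subseteq> {..<n} \<Longrightarrow> kd y n (kd y n w) A = 0"
proof (induction n arbitrary: w A)
  case (Suc n)
  have low: "kd y n (kd y (Suc n) w) B = 0" if "B \<subseteq> {..<n}" for B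
    using kd_cong[of n "kd y (Suc n) w" "kd y n w" B] that Suc.IH by simp
  from Suc.prems show ?case
  proof (cases rule: sub_Suc_cases)
    case (2 B)
    have "kd y n (\<lambda>C. kd y (Suc n) w (insert n C)) B
        = kd y n (\<lambda>C. y n * w C - kd y n (\<lambda>D. w (insert n D)) C) B"
      using 2 by (intro kd_cong) auto
    also have "\<dots> = y n * kd y n w B"
      using 2 Suc.IH[of B "\<lambda>D. w (insert n D)"] by (simp add: kd_diff kd_scale)
    finally show ?thesis
      using 2 by simp
  qed (simp add: low)
qed simp

text \<open>The degree of \<open>w\<close> is \<open>i - s\<close>; written as a sum, the condition
  also covers negative degrees, where \<open>w\<close> has to vanish. Passing to the component on
  sets containing \<open>n\<close> raises \<open>s\<close> by one.\<close>

definition khom :: "nat \<Rightarrow> nat \<Rightarrow> nat \<Rightarrow> (nat set \<Rightarrow> 'a::comm_ring_1) \<Rightarrow> bool"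
  where "khom n s i w \<longleftrightarrow> (\<forall>A\<subseteq>{..<n}. card A + s \<noteq> i \<longrightarrow> w A = 0)"

lemma khom_shift: "khom n (Suc s) (Suc i) w \<longleftrightarrow> khom n s i w"
  by (simp add: khom_def)

lemma khom_lin: "khom n s i w \<Longrightarrow> khom n s i w' \<Longrightarrow> khom n s i (\<lambda>B. c * w B + d * w' B)"
  by (simp add: khom_def)

lemma khom_scale: "khom n s i w \<Longrightarrow> khom n s i (\<lambda>B. c * w B)"
  by (simp add: khom_def)

lemma khom_diff: "khom n s i w \<Longrightarrow> khom n s i w' \<Longrightarrow> khom n s i (\<lambda>B. w B - w' B)"
  by (simp add: khom_def)

lemma card_insert_sub: "B \<subseteq> {..<n::nat} \<Longrightarrow> card (insert n B) = Suc (card B)"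
  by (simp add: sub_finite sub_notin)

lemma khom_low: "khom (Suc n) s i w \<Longrightarrow> khom n s i w"
  unfolding khom_def by (meson lessThan_subset_iff lessI less_imp_le subset_trans)

lemma khom_insert: "khom (Suc n) s i w \<Longrightarrow> khom n (Suc s) i (\<lambda>B. w (insert n B))"
  unfolding khom_def
proof (intro allI impI)
  fix A assume *: "\<forall>A\<subseteq>{..<Suc n}. card A + s \<noteq> i \<longrightarrow> w A = 0"
    and A: "A \<subseteq> {..<n}" "card A + Suc s \<noteq> i"
  have "insert n A \<subseteq> {..<Suc n}" "card (insert n A) + s \<noteq> i"
    using A by (auto simp: card_insert_sub)
  then show "w (insert n A) = 0" using * by blast
qed

lemma khom_SucI:
  assumes "khom n s i w" "khom n (Suc s) i (\<lambda>B. w (insert n B))"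
  shows "khom (Suc n) s i w"
  unfolding khom_def
proof (intro allI impI)
  fix A assume A: "A \<subseteq> {..<Suc n}" "card A + s \<noteq> i"
  from A(1) show "w A = 0"
  proof (cases rule: sub_Suc_cases)
    case 1
    then show ?thesis using assms(1) A by (simp add: khom_def)
  next
    case (2 B)
    then show ?thesis using assms(2) A by (simp add: khom_def card_insert_sub)
  qed
qed

lemma kd_khom: "khom n (Suc s) i w \<Longrightarrow> khom n s i (kd y n w)"
proof (induction n arbitrary: s w)
  case 0
  then show ?case by (simp add: khom_def)
next
  case (Suc n)
  have low: "khom n s i (kd y n w)"
    using Suc.IH[OF khom_low[OF Suc.prems]] .
  have ins: "khom n (Suc s) i (kd y n (\<lambda>B. w (insert n B)))"
    using Suc.IH[OF khom_insert[OF Suc.prems]] .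
  show ?case
  proof (rule khom_SucI)
    show "khom n s i (kd y (Suc n) w)"
      using low by (simp add: khom_def)
    show "khom n (Suc s) i (\<lambda>B. kd y (Suc n) w (insert n B))"
      using ins khom_low[OF Suc.prems] by (simp add: khom_def)
  qed
qed

text \<open>Contraction with the \<open>l\<close>-th basis element, with signs matching the
  recursion of \<open>kd\<close>. It is the homotopy that makes multiplication by \<open>y l\<close>
  trivial on cohomology.\<close>

primrec ki :: "nat \<Rightarrow> nat \<Rightarrow> (nat set \<Rightarrow> 'a::comm_ring_1) \<Rightarrow> nat set \<Rightarrow> 'a" where
  "ki l 0 = (\<lambda>w A. 0)"
| "ki l (Suc n) = (\<lambda>w A. if l = n then (if n \<in> A then 0 else w (insert n A))
     else if n \<in> A then - ki l n (\<lambda>B. w (insert n B)) (A - {n}) else ki l n w A)"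

lemma ki_Suc_low [simp]:
  "B \<subseteq> {..<n} \<Longrightarrow> ki l (Suc n) w B = (if l = n then w (insert n B) else ki l n w B)"
  by (simp add: sub_notin)

lemma ki_Suc_insert [simp]:
  "B \<subseteq> {..<n} \<Longrightarrow> ki l (Suc n) w (insert n B) = (if l = n then 0 else - ki l n (\<lambda>B. w (insert n B)) B)"
  by (simp add: insert_minus)

declare ki.simps(2) [simp del]

lemma ki_cong:
  assumes "\<And>B. B \<subseteq> {..<n} \<Longrightarrow> w B = w' B" "A \<subseteq> {..<n}"
  shows "ki l n w A = ki l n w' A"
  using assms
proof (induction n arbitrary: w w' A)
  case (Suc n)
  have sub: "B \<subseteq> {..<Suc n}" "insert n B \<subseteq> {..<Suc n}" if "B \<subseteq> {..<n}" for B
    using that by auto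
  from \<open>A \<subseteq> {..<Suc n}\<close> show ?case
  proof (cases rule: sub_Suc_cases)
    case 1
    then show ?thesis
      using Suc.IH[of w w' A] Suc.prems(1) sub by simp
  next
    case (2 B)
    then show ?thesis
      using Suc.IH[of "\<lambda>B. w (insert n B)" "\<lambda>B. w' (insert n B)" B] Suc.prems(1) sub by simp
  qed
qed simp

lemma ki_lin:
  "A \<subseteq> {..<n} \<Longrightarrow> ki l n (\<lambda>B. c * w B + d * w' B) A = c * ki l n w A + d * ki l n w' A"
proof (induction n arbitrary: w w' A)
  case (Suc n)
  from Suc.prems show ?case
    by (cases rule: sub_Suc_cases) (simp_all add: Suc.IH algebra_simps)
qed simp

lemma ki_mem:
  "is_ideal I \<Longrightarrow> A \<subseteq> {..<n} \<Longrightarrow> (\<And>B. B \<subseteq> {..<n} \<Longrightarrow> w B \<in> I) \<Longrightarrow> ki l n w A \<in> I"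
proof (induction n arbitrary: w A)
  case 0
  then show ?case using idl.subspace_0 by simp
next
  case (Suc n)
  have sub: "B \<subseteq> {..<Suc n}" "insert n B \<subseteq> {..<Suc n}" if "B \<subseteq> {..<n}" for B
    using that by auto
  from Suc.prems(2) show ?case
  proof (cases rule: sub_Suc_cases)
    case 1
    then show ?thesis using Suc.IH[of A w] Suc.prems sub by simp
  next
    case (2 B)
    then show ?thesis
      using Suc.IH[of B "\<lambda>B. w (insert n B)"] Suc.prems sub idl.subspace_0[OF Suc.prems(1)]
      by (simp add: idl.subspace_neg)
  qed
qed

lemma ki_khom: "khom n s i w \<Longrightarrow> khom n (Suc s) i (ki l n w)"
proof (induction n arbitrary: s w)
  case 0
  then show ?case by (simp add: khom_def)
next
  case (Suc n)
  note low = khom_low[OF Suc.prems] and ins = khom_insert[OF Suc.prems]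
  show ?case
  proof (rule khom_SucI)
    show "khom n (Suc s) i (ki l (Suc n) w)"
      using Suc.IH[OF low] ins by (simp add: khom_def)
    show "khom n (Suc (Suc s)) i (\<lambda>B. ki l (Suc n) w (insert n B))"
      using Suc.IH[OF ins] by (simp add: khom_def)
  qed
qed

text \<open>Cartan's formula. If \<open>l = n\<close>, the two terms recover the mixed differential
  of the cone; otherwise the recursion reduces to the smaller complex and the terms with
  \<open>y n\<close> cancel.\<close>

lemma koszul_homotopy:
  "l < n \<Longrightarrow> A \<subseteq> {..<n} \<Longrightarrow> kd y n (ki l n w) A + ki l n (kd y n w) A = y l * w A"
proof (induction n arbitrary: w A)
  case (Suc n)
  let ?i = "\<lambda>B. w (insert n B)"
  show ?case
  proof (cases "l = n")
    case True
    have a: "kd y n (ki n (Suc n) w) B = kd y n ?i B" if "B \<subseteq> {..<n}" for B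
      using that by (intro kd_cong) auto
    have b: "kd y n (\<lambda>B. ki n (Suc n) w (insert n B)) B = 0" if "B \<subseteq> {..<n}" for B
      using that by (intro kd_zero) auto
    from Suc.prems(2) show ?thesis
      by (cases rule: sub_Suc_cases) (use True in \<open>simp_all add: a b\<close>)
  next
    case False
    then have l: "l < n" using Suc.prems by simp
    have a: "kd y n (ki l (Suc n) w) B = kd y n (ki l n w) B"
      "ki l n (kd y (Suc n) w) B = ki l n (kd y n w) B" if "B \<subseteq> {..<n}" for B
      using that False by (auto intro!: kd_cong ki_cong)
    have b: "kd y n (\<lambda>B. ki l (Suc n) w (insert n B)) B = - kd y n (ki l n ?i) B" if "B \<subseteq> {..<n}" for B
    proof -
      have "kd y n (\<lambda>B. ki l (Suc n) w (insert n B)) B = kd y n (\<lambda>B. (-1) * ki l n ?i B) B"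
        using that False by (intro kd_cong) auto
      then show ?thesis using that by (simp only: kd_scale) simp
    qed
    have c: "ki l n (\<lambda>B. kd y (Suc n) w (insert n B)) B = y n * ki l n w B - ki l n (kd y n ?i) B"
      if "B \<subseteq> {..<n}" for B
    proof -
      have "ki l n (\<lambda>B. kd y (Suc n) w (insert n B)) B
          = ki l n (\<lambda>B. y n * w B + (-1) * kd y n ?i B) B"
        using that by (intro ki_cong) auto
      then show ?thesis using that by (simp only: ki_lin) simp
    qed
    from Suc.prems(2) show ?thesis
    proof (cases rule: sub_Suc_cases)
      case 1
      then show ?thesis using Suc.IH[OF l 1, of w] False by (simp add: a)
    next
      case (2 B)
      then show ?thesis
        using Suc.IH[OF l 2(2), of ?i] False by (simp add: a b c algebra_simps)
    qed
  qed
qed simp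

text \<open>Cochains with values in the quotient by \<open>I\<close> are represented by cochains
  with values in the ring. Homogeneity is imposed exactly, the cocycle condition only modulo
  \<open>I\<close>.\<close>

definition kcocycle :: "(nat \<Rightarrow> 'a::comm_ring_1) \<Rightarrow> nat \<Rightarrow> 'a set \<Rightarrow> nat \<Rightarrow> (nat set \<Rightarrow> 'a) \<Rightarrow> bool"
  where "kcocycle y n I i w \<longleftrightarrow> khom n 0 i w \<and> (\<forall>A\<subseteq>{..<n}. kd y n w A \<in> I)"

definition kexact :: "(nat \<Rightarrow> 'a::comm_ring_1) \<Rightarrow> nat \<Rightarrow> 'a set \<Rightarrow> nat \<Rightarrow> (nat set \<Rightarrow> 'a) \<Rightarrow> bool"
  where "kexact y n I i w \<longleftrightarrow> (\<exists>u. khom n 1 i u \<and> (\<forall>A\<subseteq>{..<n}. w A - kd y n u A \<in> I))"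

definition kvanish :: "(nat \<Rightarrow> 'a::comm_ring_1) \<Rightarrow> nat \<Rightarrow> 'a set \<Rightarrow> nat \<Rightarrow> bool"
  where "kvanish y n I i \<longleftrightarrow> (\<forall>w. kcocycle y n I i w \<longrightarrow> kexact y n I i w)"

text \<open>Koszul cohomology is annihilated by the ideal of \<open>y\<close>: the contractions of
  \<open>w\<close>, combined with the coefficients that express \<open>c\<close>, give the
  primitive.\<close>

lemma igen_kexact:
  assumes I: "is_ideal I" and c: "c \<in> igen y n" and w: "kcocycle y n I i w"
  shows "kexact y n I i (\<lambda>A. c * w A)"
proof -
  obtain b where b: "c = (\<Sum>l<n. b l * y l)"
    using c unfolding igen_iff ..
  define u where "u A = (\<Sum>l<n. b l * ki l n w A)" for A
  have "khom n 1 i (ki l n w)" for l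
    using ki_khom[of n 0 i w l] w by (simp add: kcocycle_def)
  then have "khom n 1 i u"
    by (simp add: u_def khom_def)
  moreover have "c * w A - kd y n u A \<in> I" if A: "A \<subseteq> {..<n}" for A
  proof -
    have "kd y n u A = (\<Sum>l<n. b l * kd y n (ki l n w) A)"
      unfolding u_def using A by (simp add: kd_sum kd_scale)
    then have "c * w A - kd y n u A = (\<Sum>l<n. b l * (y l * w A - kd y n (ki l n w) A))"
      by (simp add: b sum_distrib_right right_diff_distrib sum_subtractf mult.assoc)
    also have "\<dots> = (\<Sum>l<n. b l * ki l n (kd y n w) A)"
    proof (rule sum.cong)
      fix l assume "l \<in> {..<n}"
      then have "kd y n (ki l n w) A + ki l n (kd y n w) A = y l * w A"
        using koszul_homotopy A by blast
      then have "y l * w A - kd y n (ki l n w) A = ki l n (kd y n w) A"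
        by (metis add_diff_cancel_left')
      then show "b l * (y l * w A - kd y n (ki l n w) A) = b l * ki l n (kd y n w) A"
        by (simp only:)
    qed simp
    also have "\<dots> \<in> I"
      using w ki_mem[OF I A] by (intro idl.subspace_sum[OF I] ideal_mult[OF I]) (auto simp: kcocycle_def)
    finally show ?thesis .
  qed
  ultimately show ?thesis unfolding kexact_def by blast
qed

section \<open>Top degree and vanishing below it\<close>

lemma card_sub_lessThan: "A \<subseteq> {..<n} \<Longrightarrow> card A = n \<Longrightarrow> A = {..<n::nat}"
  by (metis card_lessThan card_subset_eq finite_lessThan)

lemma card_sub_le: "A \<subseteq> {..<n::nat} \<Longrightarrow> card A \<le> n"
  by (metis card_lessThan card_mono finite_lessThan)

lemma khom_above: "khom n s i w \<Longrightarrow> n + s < i \<Longrightarrow> A \<subseteq> {..<n} \<Longrightarrow> w A = 0"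
  using card_sub_le[of A n] by (auto simp: khom_def)

lemma top_cocycle:
  assumes "is_ideal I" "khom n 0 n w"
  shows "kcocycle y n I n w"
proof -
  have "khom n 0 (Suc n) (kd y n w)"
    using assms by (intro kd_khom) (simp add: khom_shift)
  then have "kd y n w A = 0" if "A \<subseteq> {..<n}" for A
    using khom_above[OF _ _ that, of 0 "Suc n"] by simp
  then show ?thesis
    using assms idl.subspace_0[OF assms(1)] by (simp add: kcocycle_def)
qed

text \<open>In top degree only the component at \<open>{..<n}\<close> survives, and the coboundaries
  there fill the ideal of \<open>y\<close>; so top cohomology is the quotient by this ideal.\<close>

lemma top_exact_iff:
  assumes I: "is_ideal I" "I \<subseteq> igen y n" and w: "khom n 0 n w"
  shows "kexact y n I n w \<longleftrightarrow> w {..<n} \<in> igen y n"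
proof
  assume "kexact y n I n w"
  then obtain u where "w {..<n} - kd y n u {..<n} \<in> I"
    unfolding kexact_def by blast
  then have "(w {..<n} - kd y n u {..<n}) + kd y n u {..<n} \<in> igen y n"
    using I(2) kd_mem_igen[of "{..<n}" n y u] by (intro idl.subspace_add) auto
  then show "w {..<n} \<in> igen y n" by simp
next
  assume "w {..<n} \<in> igen y n"
  moreover define e where "e A = (if A = {..<n} then 1 else 0 :: 'a)" for A
  have "khom n 0 n e"
    using card_sub_lessThan by (auto simp: khom_def e_def)
  ultimately have "kexact y n I n (\<lambda>A. w {..<n} * e A)"
    by (intro igen_kexact top_cocycle I)
  moreover have "w {..<n} * e A = w A" if "A \<subseteq> {..<n}" for A
  proof (cases "A = {..<n}")
    case False
    then have "card A \<noteq> n" using card_sub_lessThan that by blast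
    then show ?thesis using w that False by (simp add: khom_def e_def)
  qed (simp add: e_def)
  ultimately show "kexact y n I n w"
    by (simp add: kexact_def)
qed

text \<open>The long exact sequence of the cone. The restriction of \<open>w\<close> to sets without
  \<open>n\<close> is a cocycle of the smaller complex; subtracting \<open>y n\<close> times a
  primitive of it from the other component turns that component into a cocycle one degree
  lower.\<close>

lemma kvanish_regular:
  assumes "reg n y" "i < n"
  shows "kvanish y n {0} i"
  using assms
proof (induction n arbitrary: i)
  case (Suc n)
  have z: "is_ideal {0 :: 'a}" by simp
  show ?case unfolding kvanish_def
  proof (intro allI impI)
    fix w assume w: "kcocycle y (Suc n) {0} i w"
    have low: "kd y n w B = 0" and ins: "y n * w B = kd y n (\<lambda>B. w (insert n B)) B" if "B \<subseteq> {..<n}" for B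
    proof -
      have "B \<subseteq> {..<Suc n}" "insert n B \<subseteq> {..<Suc n}" using that by auto
      then have "kd y (Suc n) w B = 0" "kd y (Suc n) w (insert n B) = 0"
        using w unfolding kcocycle_def by blast+
      then show "kd y n w B = 0" "y n * w B = kd y n (\<lambda>B. w (insert n B)) B"
        using that by simp_all
    qed
    have hw: "khom (Suc n) 0 i w" using w by (simp add: kcocycle_def)
    have cw: "kcocycle y n {0} i w"
      using low khom_low[OF hw] by (simp add: kcocycle_def)
    have "kexact y n {0} i w"
    proof (cases "i = n")
      case False
      then show ?thesis
        using Suc.IH[of i] Suc.prems reg_mono[OF Suc.prems(1), of n] cw by (simp add: kvanish_def)
    next
      case True
      \<comment> \<open>In the top degree of the smaller complex, regularity of \<open>y n\<close>
        modulo the earlier elements takes the place of vanishing.\<close>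
      have "y n * w {..<n} \<in> igen y n"
        using kd_mem_igen[of "{..<n}" n y] by (simp add: ins)
      then have "w {..<n} \<in> igen y n"
        using regD[OF Suc.prems(1), of n] by simp
      moreover have "{0} \<subseteq> igen y n" using idl.subspace_0[OF is_ideal_igen] by simp
      ultimately show ?thesis
        using top_exact_iff[OF z] khom_low[OF hw] True by blast
    qed
    then obtain u where u: "khom n 1 i u" "\<And>B. B \<subseteq> {..<n} \<Longrightarrow> w B = kd y n u B"
      by (auto simp: kexact_def)
    let ?b = "\<lambda>B. w (insert n B) - y n * u B"
    have hb: "khom n 1 i ?b"
      using khom_insert[OF hw] u(1) by (intro khom_diff khom_scale) auto
    have cb: "kd y n ?b B = 0" if "B \<subseteq> {..<n}" for B
      using that ins[OF that] u(2)[OF that] by (simp add: kd_diff kd_scale)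
    have "\<exists>v. khom n 2 i v \<and> (\<forall>B\<subseteq>{..<n}. ?b B = kd y n v B)"
    proof (cases i)
      case 0
      then have "?b B = 0" if "B \<subseteq> {..<n}" for B
        using hb that by (simp add: khom_def)
      moreover have "kd y n (\<lambda>_. 0) B = 0" if "B \<subseteq> {..<n}" for B
        using that by (simp add: kd_zero)
      ultimately show ?thesis
        by (intro exI[of _ "\<lambda>_. 0"]) (simp add: khom_def)
    next
      case (Suc i')
      then have "khom n 0 i' ?b" using hb by (simp add: khom_shift)
      then have "kcocycle y n {0} i' ?b"
        using cb by (simp add: kcocycle_def)
      then have "kexact y n {0} i' ?b"
        using Suc.IH[of i'] Suc Suc.prems reg_mono[OF Suc.prems(1), of n] by (simp add: kvanish_def)
      then obtain v where "khom n 1 i' v" "\<And>B. B \<subseteq> {..<n} \<Longrightarrow> ?b B = kd y n v B"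
        by (auto simp: kexact_def)
      then show ?thesis
        using Suc khom_shift[of n 1 i' v] by (auto simp: numeral_2_eq_2)
    qed
    then obtain v where v: "khom n 2 i v" "\<And>B. B \<subseteq> {..<n} \<Longrightarrow> ?b B = kd y n v B"
      by blast
    define U where "U A = (if n \<in> A then - v (A - {n}) else u A)" for A
    have U: "U B = u B" "U (insert n B) = - v B" if "B \<subseteq> {..<n}" for B
      using that by (simp_all add: U_def sub_notin insert_minus)
    have kdU: "kd y n U B = kd y n u B" "kd y n (\<lambda>B. U (insert n B)) B = - kd y n v B" if "B \<subseteq> {..<n}" for B
    proof -
      show "kd y n U B = kd y n u B" using U that by (intro kd_cong) auto
      have "kd y n (\<lambda>B. U (insert n B)) B = kd y n (\<lambda>B. (-1) * v B) B"
        using U that by (intro kd_cong) auto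
      then show "kd y n (\<lambda>B. U (insert n B)) B = - kd y n v B"
        using that by (simp only: kd_scale) simp
    qed
    have "w A - kd y (Suc n) U A = 0" if "A \<subseteq> {..<Suc n}" for A
      using that
    proof (cases rule: sub_Suc_cases)
      case 1
      then show ?thesis by (simp add: kdU u(2))
    next
      case (2 B)
      then show ?thesis using v(2)[of B] by (simp add: kdU U algebra_simps)
    qed
    moreover have "khom (Suc n) 1 i U"
      using u(1) v(1) U by (intro khom_SucI) (auto simp: khom_def numeral_2_eq_2)
    ultimately show "kexact y (Suc n) {0} i w"
      unfolding kexact_def by blast
  qed
qed simp

section \<open>Cohomology modulo a second regular sequence\<close>

lemma igen_Suc_choose:
  assumes "khom n s i g" "\<And>A. A \<subseteq> {..<n} \<Longrightarrow> g A \<in> igen x (Suc j)"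
  obtains v where "khom n s i v" "\<And>A. A \<subseteq> {..<n} \<Longrightarrow> g A - v A * x j \<in> igen x j"
proof -
  \<comment> \<open>Letting the coefficient vanish together with \<open>g A\<close> keeps the chosen
    cochain homogeneous.\<close>
  have "\<exists>c. (g A = 0 \<longrightarrow> c = 0) \<and> g A - c * x j \<in> igen x j" if "A \<subseteq> {..<n}" for A
  proof (cases "g A = 0")
    case True
    then show ?thesis using idl.subspace_0[OF is_ideal_igen] by auto
  qed (use assms(2)[OF that] in \<open>auto simp: igen_Suc_iff\<close>)
  then obtain v where "\<And>A. A \<subseteq> {..<n} \<Longrightarrow> (g A = 0 \<longrightarrow> v A = 0) \<and> g A - v A * x j \<in> igen x j"
    by metis
  then show ?thesis
    using that[of v] assms(1) by (simp add: khom_def)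
qed

lemma mem_diff_swap: "is_ideal I \<Longrightarrow> a - b \<in> I \<Longrightarrow> a \<in> I \<longleftrightarrow> b \<in> I"
  using idl.subspace_diff[of I a "a - b"] idl.subspace_add[of I "a - b" b] by auto

text \<open>The long exact sequence of multiplication by \<open>x j\<close>: cohomology modulo one
  more element lies between the cohomologies of degrees \<open>i\<close> and \<open>Suc i\<close>
  modulo the earlier ones.\<close>

lemma kvanish_step:
  assumes v0: "kvanish y n (igen x j) i" and v1: "kvanish y n (igen x j) (Suc i)"
    and x: "\<And>z. x j * z \<in> igen x j \<Longrightarrow> z \<in> igen x j"
  shows "kvanish y n (igen x (Suc j)) i"
  unfolding kvanish_def
proof (intro allI impI)
  let ?I = "igen x j"
  have I: "is_ideal ?I" by simp
  fix w assume w: "kcocycle y n (igen x (Suc j)) i w"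
  have hkd: "khom n 0 (Suc i) (kd y n w)"
    using w by (intro kd_khom) (simp add: kcocycle_def khom_shift)
  obtain v where v: "khom n 0 (Suc i) v" "\<And>A. A \<subseteq> {..<n} \<Longrightarrow> kd y n w A - v A * x j \<in> ?I"
    using igen_Suc_choose[OF hkd, of x j] w by (auto simp: kcocycle_def)
  have "kd y n v A \<in> ?I" if A: "A \<subseteq> {..<n}" for A
  proof -
    have "kd y n (\<lambda>B. kd y n w B - x j * v B) A \<in> ?I"
      using A v(2) by (intro kd_mem') (auto simp: mult.commute)
    then have "- (x j * kd y n v A) \<in> ?I"
      using A by (simp add: kd_diff kd_scale kd_kd)
    then show ?thesis
      using x idl.subspace_neg[OF I] by fastforce
  qed
  then have "kcocycle y n ?I (Suc i) v"
    using v by (simp add: kcocycle_def)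
  then obtain t where t: "khom n 1 (Suc i) t" "\<And>A. A \<subseteq> {..<n} \<Longrightarrow> v A - kd y n t A \<in> ?I"
    using v1 unfolding kvanish_def kexact_def by blast
  let ?w = "\<lambda>A. w A - x j * t A"
  have "kcocycle y n ?I i ?w"
    unfolding kcocycle_def
  proof (intro conjI allI impI)
    show "khom n 0 i ?w"
      using w t(1) by (intro khom_diff khom_scale) (auto simp: kcocycle_def khom_shift)
    fix A assume A: "A \<subseteq> {..<n}"
    have "(kd y n w A - v A * x j) + x j * (v A - kd y n t A) \<in> ?I"
      using v(2)[OF A] t(2)[OF A] by (intro idl.subspace_add[OF I] ideal_mult[OF I])
    then show "kd y n ?w A \<in> ?I"
      using A by (simp add: kd_diff kd_scale) (simp add: algebra_simps)
  qed
  then obtain u where u: "khom n 1 i u" "\<And>A. A \<subseteq> {..<n} \<Longrightarrow> ?w A - kd y n u A \<in> ?I"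
    using v0 unfolding kvanish_def kexact_def by blast
  have "w A - kd y n u A \<in> igen x (Suc j)" if A: "A \<subseteq> {..<n}" for A
    unfolding igen_Suc_iff using u(2)[OF A] by (intro exI[of _ "t A"]) (simp add: algebra_simps)
  then show "kexact y n (igen x (Suc j)) i w"
    using u(1) unfolding kexact_def by blast
qed

text \<open>Each element of \<open>x\<close> costs one degree of vanishing, which leaves the range
  \<open>i + j < n\<close>.\<close>

lemma kvanish_mod_regular:
  assumes "reg n y" "reg r x"
  shows "j \<le> r \<Longrightarrow> i + j < n \<Longrightarrow> kvanish y n (igen x j) i"
proof (induction j arbitrary: i)
  case 0
  then show ?case using kvanish_regular[OF assms(1)] by simp
next
  case (Suc j)
  show ?case
    using Suc by (intro kvanish_step) (auto intro: regD[OF assms(2), of j])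
qed

text \<open>The elements annihilated by \<open>y\<close> modulo \<open>(x)\<close> form the
  cohomology of degree 0, which vanishes because \<open>x\<close> is shorter than
  \<open>y\<close>.\<close>

lemma grade_short_regular:
  assumes "reg n y" "reg r x" "r < n" and z: "\<And>l. l < n \<Longrightarrow> y l * z \<in> igen x r"
  shows "z \<in> igen x r"
proof -
  let ?w = "\<lambda>A. if A = {} then z else 0"
  have "kcocycle y n (igen x r) 0 ?w"
    unfolding kcocycle_def
  proof (intro conjI allI impI)
    show "khom n 0 0 ?w" using sub_finite by (auto simp: khom_def)
    show "kd y n ?w A \<in> igen x r" if "A \<subseteq> {..<n}" for A
      using that z idl.subspace_0[OF is_ideal_igen] by (intro kd_mem) auto
  qed
  moreover have "kvanish y n (igen x r) 0"
    using kvanish_mod_regular[OF assms(1,2)] assms(3) by simp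
  ultimately obtain u where u: "khom n 1 0 u" "z - kd y n u {} \<in> igen x r"
    unfolding kvanish_def kexact_def by force
  have "kd y n u {} = 0"
    using u(1) by (intro kd_zero) (auto simp: khom_def)
  then show ?thesis using u(2) by simp
qed

text \<open>
  For two regular sequences \<open>x\<close>, \<open>y\<close> of the same length \<open>n\<close>, the iterated connecting maps identify
  the quotients of \<open>(x) : (y)\<close> by \<open>(x)\<close> and of \<open>(y) : (x)\<close> by \<open>(y)\<close>. The relation \<open>krel n x y j w b\<close>
  says that the cocycle \<open>w\<close> of degree \<open>n - j\<close> modulo \<open>x 0, \<dots>, x (j - 1)\<close> is sent to the class of \<open>b\<close>
  in top degree.
\<close>

primrec krel :: "nat \<Rightarrow> (nat \<Rightarrow> 'a::comm_ring_1) \<Rightarrow> (nat \<Rightarrow> 'a) \<Rightarrow> nat \<Rightarrow> (nat set \<Rightarrow> 'a) \<Rightarrow> 'a \<Rightarrow> bool" where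
  "krel n x y 0 w b \<longleftrightarrow> khom n 0 n w \<and> w {..<n} = b"
| "krel n x y (Suc j) w b \<longleftrightarrow> khom n 0 (n - Suc j) w \<and>
    (\<exists>v. krel n x y j v b \<and> (\<forall>A\<subseteq>{..<n}. kd y n w A - x j * v A \<in> igen x j))"

lemma krel_khom: "krel n x y j w b \<Longrightarrow> khom n 0 (n - j) w"
  by (cases j) auto

lemma krel_lin:
  "krel n x y j w b \<Longrightarrow> krel n x y j w' b' \<Longrightarrow> krel n x y j (\<lambda>A. c * w A + d * w' A) (c * b + d * b')"
proof (induction j arbitrary: w w')
  case 0
  then show ?case by (simp add: khom_lin)
next
  case (Suc j)
  obtain v v' where v: "krel n x y j v b" "\<And>A. A \<subseteq> {..<n} \<Longrightarrow> kd y n w A - x j * v A \<in> igen x j"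
    and v': "krel n x y j v' b'" "\<And>A. A \<subseteq> {..<n} \<Longrightarrow> kd y n w' A - x j * v' A \<in> igen x j"
    using Suc.prems by auto
  have "kd y n (\<lambda>A. c * w A + d * w' A) A - x j * (c * v A + d * v' A) \<in> igen x j" if "A \<subseteq> {..<n}" for A
  proof -
    have "c * (kd y n w A - x j * v A) + d * (kd y n w' A - x j * v' A) \<in> igen x j"
      using v(2)[OF that] v'(2)[OF that] by (intro idl.subspace_add ideal_mult is_ideal_igen)
    then show ?thesis using that by (simp add: kd_lin algebra_simps)
  qed
  then show ?case
    using Suc.IH[OF v(1) v'(1)] Suc.prems by (auto simp: khom_lin)
qed

lemma krel_scale: "krel n x y j w b \<Longrightarrow> krel n x y j (\<lambda>A. c * w A) (c * b)"
  using krel_lin[of n x y j w b w b c 0] by simp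

text \<open>Each connecting map is well defined and injective on cohomology; injectivity comes from
  the vanishing in degree \<open>n - Suc j\<close> modulo
  \<open>x 0, ..., x (j - 1)\<close>.\<close>

lemma krel_exact_iff:
  assumes y: "reg n y" and x: "reg n x"
  shows "j \<le> n \<Longrightarrow> krel n x y j w b \<Longrightarrow> kexact y n (igen x j) (n - j) w \<longleftrightarrow> b \<in> igen y n"
proof (induction j arbitrary: w)
  case 0
  have "is_ideal {0 :: 'a}" "{0} \<subseteq> igen y n"
    using idl.subspace_0[OF is_ideal_igen] by auto
  then have "kexact y n {0} n w \<longleftrightarrow> w {..<n} \<in> igen y n"
    using 0 by (intro top_exact_iff) auto
  then show ?case using 0 by simp
next
  case (Suc j)
  let ?I = "igen x j"
  have I: "is_ideal ?I" by simp
  have xreg: "z \<in> ?I" if "x j * z \<in> ?I" for z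
    using regD[OF x, of j] that Suc.prems by simp
  obtain v where v: "krel n x y j v b" "\<And>A. A \<subseteq> {..<n} \<Longrightarrow> kd y n w A - x j * v A \<in> ?I"
    and hw: "khom n 0 (n - Suc j) w"
    using Suc.prems by auto
  have nj: "n - j = Suc (n - Suc j)" using Suc.prems by simp
  have "kexact y n (igen x (Suc j)) (n - Suc j) w \<longleftrightarrow> kexact y n ?I (n - j) v"
  proof
    assume "kexact y n (igen x (Suc j)) (n - Suc j) w"
    then obtain u where u: "khom n 1 (n - Suc j) u"
      "\<And>A. A \<subseteq> {..<n} \<Longrightarrow> w A - kd y n u A \<in> igen x (Suc j)"
      unfolding kexact_def by blast
    have "khom n 0 (n - Suc j) (\<lambda>A. w A - kd y n u A)"
      using hw u(1) by (intro khom_diff kd_khom) auto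
    then obtain \<theta> where \<theta>: "khom n 0 (n - Suc j) \<theta>"
      "\<And>A. A \<subseteq> {..<n} \<Longrightarrow> w A - kd y n u A - \<theta> A * x j \<in> ?I"
      using igen_Suc_choose u(2) by blast
    have "v A - kd y n \<theta> A \<in> ?I" if A: "A \<subseteq> {..<n}" for A
    proof -
      have "kd y n (\<lambda>A. (w A - kd y n u A) - x j * \<theta> A) A \<in> ?I"
        using A \<theta>(2) by (intro kd_mem'[OF I]) (auto simp: mult.commute)
      then have "kd y n w A - x j * kd y n \<theta> A \<in> ?I"
        using A by (simp add: kd_diff kd_scale kd_kd)
      then have "(kd y n w A - x j * kd y n \<theta> A) - (kd y n w A - x j * v A) \<in> ?I"
        using v(2)[OF A] by (rule idl.subspace_diff[OF I])
      then have "x j * (v A - kd y n \<theta> A) \<in> ?I" by (simp add: algebra_simps)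
      then show ?thesis by (rule xreg)
    qed
    then show "kexact y n ?I (n - j) v"
      using \<theta>(1) unfolding kexact_def nj by (auto simp: khom_shift)
  next
    assume "kexact y n ?I (n - j) v"
    then obtain \<theta> where \<theta>: "khom n 1 (n - j) \<theta>" "\<And>A. A \<subseteq> {..<n} \<Longrightarrow> v A - kd y n \<theta> A \<in> ?I"
      unfolding kexact_def by blast
    let ?w = "\<lambda>A. w A - x j * \<theta> A"
    have "kcocycle y n ?I (n - Suc j) ?w"
      unfolding kcocycle_def
    proof (intro conjI allI impI)
      show "khom n 0 (n - Suc j) ?w"
        using hw \<theta>(1) unfolding nj by (intro khom_diff khom_scale) (auto simp: khom_shift)
      fix A assume A: "A \<subseteq> {..<n}"
      have "(kd y n w A - x j * v A) + x j * (v A - kd y n \<theta> A) \<in> ?I"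
        using v(2)[OF A] \<theta>(2)[OF A] by (intro idl.subspace_add[OF I] ideal_mult[OF I])
      then show "kd y n ?w A \<in> ?I"
        using A by (simp add: kd_diff kd_scale) (simp add: algebra_simps)
    qed
    moreover have "kvanish y n ?I (n - Suc j)"
      using kvanish_mod_regular[OF y x, of j "n - Suc j"] Suc.prems by simp
    ultimately obtain u where u: "khom n 1 (n - Suc j) u" "\<And>A. A \<subseteq> {..<n} \<Longrightarrow> ?w A - kd y n u A \<in> ?I"
      unfolding kvanish_def kexact_def by blast
    have "w A - kd y n u A \<in> igen x (Suc j)" if A: "A \<subseteq> {..<n}" for A
      unfolding igen_Suc_iff using u(2)[OF A] by (intro exI[of _ "\<theta> A"]) (simp add: algebra_simps)
    then show "kexact y n (igen x (Suc j)) (n - Suc j) w"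
      using u(1) unfolding kexact_def by blast
  qed
  then show ?case using Suc.IH[OF _ v(1)] Suc.prems by simp
qed

text \<open>The differential of a cocycle modulo \<open>x 0, ..., x j\<close> is divisible by
  \<open>x j\<close> modulo the earlier elements, and since \<open>x j\<close> is regular there, the
  quotient is again a cocycle.\<close>

lemma ex_krel_of_cocycle:
  assumes x: "reg n x"
  shows "j \<le> n \<Longrightarrow> kcocycle y n (igen x j) (n - j) w \<Longrightarrow> \<exists>b. krel n x y j w b"
proof (induction j arbitrary: w)
  case 0
  then show ?case by (simp add: kcocycle_def)
next
  case (Suc j)
  let ?I = "igen x j"
  have I: "is_ideal ?I" by simp
  have nj: "n - j = Suc (n - Suc j)" using Suc.prems by simp
  have hw: "khom n 0 (n - Suc j) w" using Suc.prems by (simp add: kcocycle_def)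
  then have "khom n 0 (n - j) (kd y n w)"
    unfolding nj by (intro kd_khom) (simp add: khom_shift)
  then obtain v where v: "khom n 0 (n - j) v" "\<And>A. A \<subseteq> {..<n} \<Longrightarrow> kd y n w A - v A * x j \<in> ?I"
    using igen_Suc_choose Suc.prems(2) unfolding kcocycle_def by metis
  have "kd y n v A \<in> ?I" if A: "A \<subseteq> {..<n}" for A
  proof -
    have "kd y n (\<lambda>B. kd y n w B - x j * v B) A \<in> ?I"
      using A v(2) by (intro kd_mem') (auto simp: mult.commute)
    then have "- (x j * kd y n v A) \<in> ?I"
      using A by (simp add: kd_diff kd_scale kd_kd)
    then have "x j * kd y n v A \<in> ?I"
      using idl.subspace_neg[OF I] by fastforce
    then show ?thesis
      using regD[OF x, of j] Suc.prems by simp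
  qed
  then obtain b where "krel n x y j v b"
    using Suc.IH[of v] Suc.prems v(1) by (auto simp: kcocycle_def)
  then show ?case
    using hw v(2) by (auto simp: mult.commute)
qed

text \<open>The connecting maps reach every top class annihilated by \<open>x\<close>: by
  injectivity \<open>x j * v\<close> is exact, and a primitive of it is a preimage of
  \<open>v\<close>.\<close>

lemma ex_krel_of_top:
  assumes y: "reg n y" and x: "reg n x" and b: "\<And>l. l < n \<Longrightarrow> x l * b \<in> igen y n"
  shows "j \<le> n \<Longrightarrow> \<exists>w. krel n x y j w b"
proof (induction j)
  case 0
  have "khom n 0 n (\<lambda>A. if A = {..<n} then b else 0)"
    using card_sub_lessThan by (auto simp: khom_def)
  then show ?case by (intro exI[of _ "\<lambda>A. if A = {..<n} then b else 0"]) simp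
next
  case (Suc j)
  then obtain v where v: "krel n x y j v b" by auto
  have "kexact y n (igen x j) (n - j) (\<lambda>A. x j * v A)"
    using krel_exact_iff[OF y x _ krel_scale[OF v]] b Suc.prems by simp
  then obtain u where u: "khom n 1 (n - j) u" "\<And>A. A \<subseteq> {..<n} \<Longrightarrow> x j * v A - kd y n u A \<in> igen x j"
    unfolding kexact_def by blast
  have "kd y n u A - x j * v A \<in> igen x j" if "A \<subseteq> {..<n}" for A
    using idl.subspace_neg[OF is_ideal_igen u(2)[OF that]] by simp
  moreover have "n - j = Suc (n - Suc j)" using Suc.prems by simp
  ultimately show ?case
    using v u(1) by (auto simp: khom_shift)
qed

text \<open>The case \<open>j = n\<close>, in which a cocycle has degree 0 and is a single ring
  element.\<close>

definition regrel :: "nat \<Rightarrow> (nat \<Rightarrow> 'a::comm_ring_1) \<Rightarrow> (nat \<Rightarrow> 'a) \<Rightarrow> 'a \<Rightarrow> 'a \<Rightarrow> bool"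
  where "regrel n x y a b \<longleftrightarrow> krel n x y n (\<lambda>A. if A = {} then a else 0) b"

lemma regrel_lin:
  assumes "regrel n x y a b" "regrel n x y a' b'"
  shows "regrel n x y (c * a + d * a') (c * b + d * b')"
proof -
  have "(\<lambda>A :: nat set. c * (if A = {} then a else 0) + d * (if A = {} then a' else 0))
      = (\<lambda>A. if A = {} then c * a + d * a' else 0)" by auto
  then show ?thesis
    using krel_lin[OF assms[unfolded regrel_def], of c d] unfolding regrel_def by (simp only:)
qed

lemma regrel_scale: "regrel n x y a b \<Longrightarrow> regrel n x y (c * a) (c * b)"
  using regrel_lin[of n x y a b a b c 0] by simp

lemma kd_empty [simp]: "kd y n w {} = 0"
  by (induction n) (simp_all add: kd.simps)

lemma regrel_iff:
  assumes "reg n y" "reg n x" "regrel n x y a b"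
  shows "a \<in> igen x n \<longleftrightarrow> b \<in> igen y n"
proof -
  have "b \<in> igen y n \<longleftrightarrow> kexact y n (igen x n) 0 (\<lambda>A. if A = {} then a else 0)"
    using krel_exact_iff[OF assms(1,2) order_refl] assms(3) by (simp add: regrel_def)
  also have "\<dots> \<longleftrightarrow> a \<in> igen x n"
  proof
    assume "a \<in> igen x n"
    then show "kexact y n (igen x n) 0 (\<lambda>A. if A = {} then a else 0)"
      unfolding kexact_def using idl.subspace_0[OF is_ideal_igen]
      by (intro exI[of _ "\<lambda>_. 0"]) (auto simp: khom_def kd_zero)
  next
    assume "kexact y n (igen x n) 0 (\<lambda>A. if A = {} then a else 0)"
    then obtain u where "\<And>A. A \<subseteq> {..<n} \<Longrightarrow> (if A = {} then a else 0) - kd y n u A \<in> igen x n"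
      unfolding kexact_def by blast
    from this[of "{}"] show "a \<in> igen x n" by simp
  qed
  finally show ?thesis by simp
qed

lemma ex_regrel_right:
  assumes x: "reg n x" and a: "\<And>l. l < n \<Longrightarrow> y l * a \<in> igen x n"
  shows "\<exists>b. regrel n x y a b"
  unfolding regrel_def
proof (rule ex_krel_of_cocycle[OF x order_refl])
  show "kcocycle y n (igen x n) (n - n) (\<lambda>A. if A = {} then a else 0)"
    unfolding kcocycle_def
  proof (intro conjI allI impI)
    show "khom n 0 (n - n) (\<lambda>A. if A = {} then a else 0)"
      using sub_finite by (auto simp: khom_def)
    show "kd y n (\<lambda>A. if A = {} then a else 0) A \<in> igen x n" if "A \<subseteq> {..<n}" for A
      using that a idl.subspace_0[OF is_ideal_igen] by (intro kd_mem) auto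
  qed
qed

lemma khom_0_0: "khom n 0 0 w \<Longrightarrow> A \<subseteq> {..<n} \<Longrightarrow> w A = (if A = {} then w {} else 0)"
  using sub_finite[of A n] by (auto simp: khom_def)

lemma krel_cong:
  assumes "\<And>A. A \<subseteq> {..<n} \<Longrightarrow> w A = w' A" "krel n x y j w b"
  shows "krel n x y j w' b"
proof (cases j)
  case 0
  then show ?thesis using assms by (simp add: khom_def)
next
  case (Suc j')
  have "kd y n w A = kd y n w' A" if "A \<subseteq> {..<n}" for A
    using assms(1) that by (rule kd_cong)
  then show ?thesis using assms by (auto simp: khom_def Suc)
qed

text \<open>That \<open>y l * a\<close> lies in \<open>(x)\<close> follows from
  \<open>regrel_iff\<close> for the multiple by \<open>y l\<close>, because \<open>y l * b\<close>
  trivially lies in \<open>(y)\<close>.\<close>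

lemma ex_regrel_left:
  assumes y: "reg n y" and x: "reg n x" and b: "\<And>l. l < n \<Longrightarrow> x l * b \<in> igen y n"
  shows "\<exists>a. regrel n x y a b \<and> (\<forall>l<n. y l * a \<in> igen x n)"
proof -
  obtain w where w: "krel n x y n w b"
    using ex_krel_of_top[OF assms] by blast
  have hw: "khom n 0 0 w" using krel_khom[OF w] by simp
  have r: "regrel n x y (w {}) b"
    unfolding regrel_def using khom_0_0[OF hw] by (intro krel_cong[OF _ w]) auto
  have "y l * w {} \<in> igen x n" if "l < n" for l
    using regrel_iff[OF y x regrel_scale[OF r, of "y l"]] ideal_mult'[OF is_ideal_igen igen_base[OF that]]
    by blast
  then show ?thesis using r by blast
qed

text \<open>Depth sensitivity, by descending induction on \<open>j\<close>. Since \<open>z j\<close>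
  lies in \<open>(x)\<close>, the cochain \<open>z j * w\<close> has a primitive \<open>u\<close>;
  modulo one more element of \<open>z\<close> this \<open>u\<close> is a cocycle of lower degree,
  hence of the form \<open>kd x n s + z j * t\<close>, and then \<open>t\<close> is a primitive of
  \<open>w\<close>.\<close>

lemma kvanish_of_regular_in_ideal:
  assumes z: "reg n z" and zx: "\<And>j. j < n \<Longrightarrow> z j \<in> igen x n"
  shows "i + j < n \<Longrightarrow> kvanish x n (igen z j) i"
proof (induction "n - j" arbitrary: j i)
  case 0
  then show ?case by simp
next
  case (Suc d)
  let ?I = "igen z j"
  have I: "is_ideal ?I" by simp
  have j: "j < n" using Suc by simp
  have zreg: "a \<in> ?I" if "z j * a \<in> ?I" for a
    using regD[OF z j that] .
  show ?case unfolding kvanish_def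
  proof (intro allI impI)
    fix w assume w: "kcocycle x n ?I i w"
    obtain u where u: "khom n 1 i u" "\<And>A. A \<subseteq> {..<n} \<Longrightarrow> z j * w A - kd x n u A \<in> ?I"
      using igen_kexact[OF I zx[OF j] w] unfolding kexact_def by blast
    have "\<exists>s t. khom n 1 i t \<and> (\<forall>A\<subseteq>{..<n}. u A - kd x n s A - t A * z j \<in> ?I)"
    proof (cases i)
      case 0
      then have "u A = 0" if "A \<subseteq> {..<n}" for A
        using u(1) that by (simp add: khom_def)
      then show ?thesis
        by (intro exI[of _ "\<lambda>_. 0"]) (simp add: khom_def kd_zero idl.subspace_0[OF I])
    next
      case (Suc i')
      have hu: "khom n 0 i' u" using u(1) Suc by (simp add: khom_shift)
      have "kcocycle x n (igen z (Suc j)) i' u"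
        unfolding kcocycle_def
      proof (intro conjI allI impI hu)
        fix A assume A: "A \<subseteq> {..<n}"
        show "kd x n u A \<in> igen z (Suc j)"
          unfolding igen_Suc_iff
          using idl.subspace_neg[OF I u(2)[OF A]] by (intro exI[of _ "w A"]) (simp add: mult.commute)
      qed
      moreover have "kvanish x n (igen z (Suc j)) i'"
        using Suc.hyps(1)[of "Suc j" i'] Suc.hyps(2) Suc.prems Suc by simp
      ultimately obtain s where s: "khom n 1 i' s" "\<And>A. A \<subseteq> {..<n} \<Longrightarrow> u A - kd x n s A \<in> igen z (Suc j)"
        unfolding kvanish_def kexact_def by blast
      have "khom n 0 i' (\<lambda>A. u A - kd x n s A)"
        using hu s(1) by (intro khom_diff kd_khom) auto
      then obtain t where "khom n 0 i' t" "\<And>A. A \<subseteq> {..<n} \<Longrightarrow> u A - kd x n s A - t A * z j \<in> ?I"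
        using igen_Suc_choose s(2) by blast
      then show ?thesis
        using Suc by (intro exI[of _ s] exI[of _ t]) (simp add: khom_shift)
    qed
    then obtain s t where t: "khom n 1 i t" "\<And>A. A \<subseteq> {..<n} \<Longrightarrow> u A - kd x n s A - t A * z j \<in> ?I"
      by blast
    have "w A - kd x n t A \<in> ?I" if A: "A \<subseteq> {..<n}" for A
    proof -
      have "kd x n (\<lambda>A. (u A - kd x n s A) - z j * t A) A \<in> ?I"
        using A t(2) by (intro kd_mem'[OF I]) (auto simp: mult.commute)
      then have "kd x n u A - z j * kd x n t A \<in> ?I"
        using A by (simp add: kd_diff kd_scale kd_kd)
      then have "(z j * w A - kd x n u A) + (kd x n u A - z j * kd x n t A) \<in> ?I"
        using u(2)[OF A] by (intro idl.subspace_add[OF I])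
      then have "z j * (w A - kd x n t A) \<in> ?I"
        by (simp add: right_diff_distrib)
      then show ?thesis by (rule zreg)
    qed
    then show "kexact x n ?I i w"
      using t(1) unfolding kexact_def by blast
  qed
qed

text \<open>Placed on the sets containing \<open>n\<close>, a cocycle of the smaller complex becomes
  one of the cone. So vanishing for the cone makes multiplication by \<open>x n\<close> surjective
  on the cohomology of the smaller complex.\<close>

lemma kvanish_drop_split:
  assumes v: "kvanish x (Suc n) {0} (Suc i)" and w: "khom n 0 i w" "\<And>A. A \<subseteq> {..<n} \<Longrightarrow> kd x n w A = 0"
  obtains a b where "khom n 0 i a" "\<And>A. A \<subseteq> {..<n} \<Longrightarrow> kd x n a A = 0" "khom n 1 i b"
    "\<And>A. A \<subseteq> {..<n} \<Longrightarrow> w A = x n * a A - kd x n b A"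
proof -
  define W where "W A = (if n \<in> A then w (A - {n}) else 0)" for A
  have W: "W B = 0" "W (insert n B) = w B" if "B \<subseteq> {..<n}" for B
    using that by (simp_all add: W_def sub_notin insert_minus)
  have "kcocycle x (Suc n) {0} (Suc i) W"
    unfolding kcocycle_def
  proof (intro conjI allI impI)
    show "khom (Suc n) 0 (Suc i) W"
      using w(1) by (intro khom_SucI) (auto simp: khom_def W)
    fix A assume "A \<subseteq> {..<Suc n}"
    then show "kd x (Suc n) W A \<in> {0}"
    proof (cases rule: sub_Suc_cases)
      case 1
      then show ?thesis using W by (simp add: kd_zero)
    next
      case (2 B)
      have "kd x n (\<lambda>B. W (insert n B)) B = kd x n w B"
        using 2 W by (intro kd_cong) auto
      then show ?thesis using 2 W w(2) by simp
    qed
  qed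
  then obtain U where U: "khom (Suc n) 1 (Suc i) U"
    "\<And>A. A \<subseteq> {..<Suc n} \<Longrightarrow> W A - kd x (Suc n) U A \<in> {0}"
    using v unfolding kvanish_def kexact_def by blast
  have eq: "kd x n U B = 0" "w B = x n * U B - kd x n (\<lambda>B. U (insert n B)) B" if "B \<subseteq> {..<n}" for B
  proof -
    have "B \<subseteq> {..<Suc n}" "insert n B \<subseteq> {..<Suc n}" using that by auto
    then show "kd x n U B = 0" "w B = x n * U B - kd x n (\<lambda>B. U (insert n B)) B"
      using U(2)[of B] U(2)[of "insert n B"] that W by simp_all
  qed
  have "khom n 0 i U" "khom n 1 i (\<lambda>B. U (insert n B))"
    using khom_low[OF U(1)] khom_insert[OF U(1)] by (simp_all add: khom_shift)
  then show ?thesis using that eq by blast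
qed

text \<open>Nakayama's lemma for cohomology on which \<open>x n\<close> acts surjectively, carried
  out by a convergent series since cochains are explicit power series.\<close>

lemma kvanish_drop:
  fixes x :: "nat \<Rightarrow> ('v::finite, 'k::comm_ring_1) mfps"
  assumes v: "kvanish x (Suc n) {0} (Suc i)" and x: "x n \<in> ordge 1"
  shows "kvanish x n {0} i"
  unfolding kvanish_def
proof (intro allI impI)
  fix w assume w: "kcocycle x n {0} i w"
  define P where "P w \<longleftrightarrow> khom n 0 i w \<and> (\<forall>A\<subseteq>{..<n}. kd x n w A = 0)" for w
  have "\<exists>a b. P a \<and> khom n 1 i b \<and> (\<forall>A\<subseteq>{..<n}. w A = x n * a A - kd x n b A)" if "P w" for w
    using kvanish_drop_split[OF v] that unfolding P_def by metis
  then obtain a b where ab: "\<And>w. P w \<Longrightarrow> P (a w)" "\<And>w. P w \<Longrightarrow> khom n 1 i (b w)"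
    "\<And>w A. P w \<Longrightarrow> A \<subseteq> {..<n} \<Longrightarrow> w A = x n * a w A - kd x n (b w) A"
    by metis
  define r where "r = rec_nat w (\<lambda>_. a)"
  have r_simps: "r 0 = w" "r (Suc k) = a (r k)" for k by (simp_all add: r_def)
  have "P w" using w by (simp add: P_def kcocycle_def)
  then have P: "P (r k)" for k
    by (induction k) (simp_all add: r_simps ab(1))
  \<comment> \<open>Unrolling \<open>r k = x n * r (Suc k) - kd x n (b (r k))\<close> weights the
    \<open>k\<close>-th primitive by \<open>x n ^ k\<close>; the minus sign makes \<open>- u\<close>
    the primitive of \<open>w\<close>.\<close>
  define u where "u A = mfps_suminf (\<lambda>k. x n ^ k * b (r k) A)" for A
  have o: "x n ^ k * c \<in> ordge k" for k c
    using x by (intro ideal_mult' ordge_power) auto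
  have "khom n 1 i u"
    unfolding khom_def
  proof (intro allI impI)
    fix A assume "A \<subseteq> {..<n}" "card A + 1 \<noteq> i"
    then have "b (r k) A = 0" for k using ab(2)[OF P] by (simp add: khom_def)
    then have "u A = mfps_suminf (\<lambda>_. 0)" by (simp add: u_def)
    then show "u A = 0" by (simp add: mfps_suminf_def mfps_eq_iff)
  qed
  have part: "w A = x n ^ N * r N A - kd x n (\<lambda>A. \<Sum>k<N. x n ^ k * b (r k) A) A" if A: "A \<subseteq> {..<n}" for A N
  proof (induction N)
    case 0
    then show ?case using A by (simp add: r_simps kd_zero)
  next
    case (Suc N)
    have "r N A = x n * r (Suc N) A - kd x n (b (r N)) A"
      using ab(3)[OF P A] by (simp add: r_simps)
    then have "x n ^ N * r N A = x n ^ Suc N * r (Suc N) A - x n ^ N * kd x n (b (r N)) A"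
      by (simp only: power_Suc2 right_diff_distrib mult.assoc)
    then show ?case
      using Suc A by (simp add: kd_add kd_scale)
  qed
  have "w A + kd x n u A \<in> ordge N" if A: "A \<subseteq> {..<n}" for A N
  proof -
    have "kd x n (\<lambda>A. u A - (\<Sum>k<N. x n ^ k * b (r k) A)) A \<in> ordge N"
      using A mfps_suminf_ordge[OF o] by (intro kd_mem') (auto simp: u_def)
    then have "x n ^ N * r N A + kd x n (\<lambda>A. u A - (\<Sum>k<N. x n ^ k * b (r k) A)) A \<in> ordge N"
      using o by (intro ordge_add) auto
    moreover have "x n ^ N * r N A + kd x n (\<lambda>A. u A - (\<Sum>k<N. x n ^ k * b (r k) A)) A
        = w A + kd x n u A"
      by (subst part[OF A, of N]) (simp add: kd_diff[OF A])
    ultimately show ?thesis by (simp only:)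
  qed
  then have "w A + kd x n u A = 0" if "A \<subseteq> {..<n}" for A
    using ordge_separated that by blast
  then have "w A - kd x n (\<lambda>A. (-1) * u A) A \<in> {0}" if "A \<subseteq> {..<n}" for A
    using that by (simp only: kd_scale) simp
  then show "kexact x n {0} i w"
    unfolding kexact_def using khom_scale[OF \<open>khom n 1 i u\<close>, of "-1"] by blast
qed

text \<open>A relation that puts \<open>x n * c\<close> into the ideal of the earlier elements is a
  cocycle of the larger complex whose component at \<open>{..<n}\<close> is \<open>c\<close>;
  exactness returns \<open>c\<close> as an element of that ideal.\<close>

lemma kvanish_regular_last:
  assumes v: "kvanish x (Suc n) {0} n" and c: "x n * c \<in> igen x n"
  shows "c \<in> igen x n"
proof -
  define e where "e A = (if A = {..<n} then c else 0)" for A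
  have e: "khom n 0 n e"
    using card_sub_lessThan by (auto simp: khom_def e_def)
  have z: "is_ideal {0 :: 'a}" "{0} \<subseteq> igen x n"
    using idl.subspace_0[OF is_ideal_igen] by auto
  have e0: "kd x n e A = 0" if "A \<subseteq> {..<n}" for A
    using top_cocycle[OF z(1) e, of x] that by (simp add: kcocycle_def)
  have "kexact x n {0} n (\<lambda>A. x n * e A)"
    using c khom_scale[OF e] by (subst top_exact_iff[OF z]) (auto simp: e_def)
  then obtain b where b: "khom n 1 n b" "\<And>A. A \<subseteq> {..<n} \<Longrightarrow> x n * e A = kd x n b A"
    by (auto simp: kexact_def)
  define W where "W A = (if n \<in> A then b (A - {n}) else e A)" for A
  have W: "W B = e B" "W (insert n B) = b B" if "B \<subseteq> {..<n}" for B
    using that by (simp_all add: W_def sub_notin insert_minus)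
  have "kcocycle x (Suc n) {0} n W"
    unfolding kcocycle_def
  proof (intro conjI allI impI)
    show "khom (Suc n) 0 n W"
      using e b(1) by (intro khom_SucI) (auto simp: khom_def W)
    fix A assume "A \<subseteq> {..<Suc n}"
    then show "kd x (Suc n) W A \<in> {0}"
    proof (cases rule: sub_Suc_cases)
      case 1
      have "kd x n W A = kd x n e A" using 1 W by (intro kd_cong) auto
      then show ?thesis using 1 e0 by simp
    next
      case (2 B)
      have "kd x n (\<lambda>B. W (insert n B)) B = kd x n b B"
        using 2 W by (intro kd_cong) auto
      then show ?thesis using 2 W b(2) by simp
    qed
  qed
  then obtain U where "\<And>A. A \<subseteq> {..<Suc n} \<Longrightarrow> W A - kd x (Suc n) U A \<in> {0}"
    using v unfolding kvanish_def kexact_def by blast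
  from this[of "{..<n}"] have "c = kd x n U {..<n}"
    using W[of "{..<n}"] by (simp add: e_def)
  then show ?thesis
    using kd_mem_igen[of "{..<n}" n x U] by simp
qed

text \<open>Vanishing for \<open>Suc n\<close> elements yields regularity of the last one and
  vanishing for the first \<open>n\<close>, so the sequence is peeled off from its end.\<close>

lemma reg_of_kvanish:
  fixes x :: "nat \<Rightarrow> ('v::finite, 'k::comm_ring_1) mfps"
  assumes "\<And>i. i < n \<Longrightarrow> x i \<in> ordge 1"
  shows "(\<And>i. i < n \<Longrightarrow> kvanish x n {0} i) \<Longrightarrow> reg n x"
  using assms
proof (induction n)
  case 0
  then show ?case by (simp add: reg_def)
next
  case (Suc n)
  have "reg n x"
    using Suc kvanish_drop[of x n] by (metis Suc_less_eq less_Suc_eq)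
  moreover have "y \<in> igen x n" if "x n * y \<in> igen x n" for y
    using kvanish_regular_last[OF _ that] Suc.prems by simp
  ultimately show ?case
    unfolding reg_def by (auto simp: less_Suc_eq)
qed

section \<open>Systems of parameters\<close>

lemma ex_enum: obtains e :: "nat \<Rightarrow> 'v::finite" where "bij_betw e {..<CARD('v)} UNIV"
  using ex_bij_betw_nat_finite[of "UNIV :: 'v set"] by (auto simp: atLeast0LessThan)

definition param :: "(nat \<Rightarrow> ('v::finite, 'k::comm_ring_1) mfps) \<Rightarrow> bool"
  where "param x \<longleftrightarrow> (\<forall>i<CARD('v). x i \<in> ordge 1) \<and> (\<exists>M. ordge M \<subseteq> igen x CARD('v))"

definition pgen :: "(nat \<Rightarrow> ('v::finite, 'k::comm_ring_1) mfps) \<Rightarrow> ('v, 'k) mfps set"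
  where "pgen x = igen x CARD('v)"

lemma is_ideal_pgen [simp]: "is_ideal (pgen x)"
  by (simp add: pgen_def)

text \<open>High powers of the variables lie in \<open>(x)\<close> and form a regular sequence of
  the same length, so the Koszul cohomology of \<open>x\<close> vanishes below top degree.\<close>

theorem param_regular:
  fixes x :: "nat \<Rightarrow> ('v::finite, 'k::comm_ring_1) mfps"
  assumes "param x"
  shows "reg CARD('v) x"
proof -
  obtain M where M: "ordge M \<subseteq> igen x CARD('v)" and x: "\<And>i. i < CARD('v) \<Longrightarrow> x i \<in> ordge 1"
    using assms by (auto simp: param_def)
  obtain e :: "nat \<Rightarrow> 'v" where e: "bij_betw e {..<CARD('v)} UNIV" by (rule ex_enum)
  define z :: "nat \<Rightarrow> ('v, 'k) mfps" where "z i = mfps_var (e i) ^ M" for i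
  have "reg CARD('v) z"
    unfolding z_def using reg_var_powers e by (blast intro: bij_betw_imp_inj_on)
  moreover have "z j \<in> igen x CARD('v)" for j
    using M var_power_ordge by (auto simp: z_def)
  ultimately have "kvanish x CARD('v) (igen z 0) i" if "i < CARD('v)" for i
    using that by (intro kvanish_of_regular_in_ideal) auto
  then show ?thesis
    using x by (intro reg_of_kvanish) auto
qed

lemma param_proper:
  assumes "param x"
  shows "pgen x \<subseteq> ordge 1" "1 \<notin> pgen x"
proof -
  show "pgen x \<subseteq> ordge 1"
    using assms by (simp add: param_def pgen_def igen_subset_iff)
  then show "1 \<notin> pgen x" using one_notin_ordge[of 0] by auto
qed

lemma param_primary: "param x \<Longrightarrow> \<exists>M. ordge M \<subseteq> pgen x"
  by (simp add: param_def pgen_def)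

section \<open>Duality modulo a system of parameters\<close>

definition klinear :: "(('v::finite, 'k::field) mfps \<Rightarrow> 'k) \<Rightarrow> bool"
  where "klinear \<phi> \<longleftrightarrow> (\<forall>f g. \<phi> (f + g) = \<phi> f + \<phi> g) \<and> (\<forall>c f. \<phi> (mfps_const c * f) = c * \<phi> f)"

lemma klinear_add: "klinear \<phi> \<Longrightarrow> \<phi> (f + g) = \<phi> f + \<phi> g"
  and klinear_scale: "klinear \<phi> \<Longrightarrow> \<phi> (mfps_const c * f) = c * \<phi> f"
  by (simp_all add: klinear_def)

lemma klinear_0: "klinear \<phi> \<Longrightarrow> \<phi> 0 = 0"
  using klinear_scale[of \<phi> 0 0] by simp

lemma klinear_sum: "klinear \<phi> \<Longrightarrow> \<phi> (sum f A) = (\<Sum>i\<in>A. \<phi> (f i))"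
  by (induction A rule: infinite_finite_induct) (simp_all add: klinear_0 klinear_add)

lemma klinear_diff: "klinear \<phi> \<Longrightarrow> \<phi> (f - g) = \<phi> f - \<phi> g"
  using klinear_add[of \<phi> "f - g" g] by simp

lemma klinear_lincomb: "klinear \<phi> \<Longrightarrow> \<phi> (lincomb B c) = (\<Sum>\<nu>\<in>B. c \<nu> * \<phi> (monom \<nu>))"
  by (simp add: lincomb_def klinear_sum klinear_scale)

lemma klinear_nf: "is_ideal I \<Longrightarrow> nf_basis I B \<Longrightarrow> \<nu> \<in> B \<Longrightarrow> klinear (\<lambda>f. nf I B f \<nu>)"
  by (simp add: klinear_def nf_add nf_scale)

lemma klinear_mult: "klinear \<phi> \<Longrightarrow> klinear (\<lambda>f. \<phi> (g * f))"
  by (simp add: klinear_def distrib_left mult.left_commute[of g])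

lemma klinear_eq_on_basis:
  assumes "klinear \<phi>" "nf_basis I B" "\<And>f. f \<in> I \<Longrightarrow> \<phi> f = 0"
  shows "\<phi> f = (\<Sum>\<nu>\<in>B. nf I B f \<nu> * \<phi> (monom \<nu>))"
proof -
  have "\<phi> (f - lincomb B (nf I B f)) = 0"
    using assms nf_mem by blast
  then show ?thesis
    by (simp add: klinear_diff[OF assms(1)] klinear_lincomb[OF assms(1)])
qed

text \<open>The pairing that sends \<open>f\<close>, \<open>g\<close> to
  \<open>\<phi> (f * g)\<close> is perfect on the quotient by \<open>I\<close>; its existence
  expresses that this quotient is Gorenstein.\<close>

definition dualizing :: "('v::finite, 'k::field) mfps set \<Rightarrow> (('v, 'k) mfps \<Rightarrow> 'k) \<Rightarrow> bool"
  where "dualizing I \<phi> \<longleftrightarrow> klinear \<phi> \<and> (\<forall>f\<in>I. \<phi> f = 0) \<and> (\<forall>f. (\<forall>g. \<phi> (g * f) = 0) \<longrightarrow> f \<in> I)"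

text \<open>A monomial multiple of \<open>f\<close> of maximal degree outside \<open>I\<close>
  works; the degrees are bounded because \<open>I\<close> contains \<open>ordge M\<close>.\<close>

lemma ex_socle_multiple:
  fixes f :: "('v::finite, 'k::comm_ring_1) mfps"
  assumes I: "is_ideal I" "ordge M \<subseteq> I" and f: "f \<notin> I"
  obtains g where "g * f \<notin> I" "\<And>v. mfps_var v * (g * f) \<in> I"
proof -
  let ?P = "\<lambda>d. \<exists>\<kappa>. tdeg \<kappa> = d \<and> monom \<kappa> * f \<notin> I"
  have "?P 0" using f by (intro exI[of _ "\<lambda>_. 0"]) (simp add: monom_0)
  moreover have bound: "d \<le> M" if "?P d" for d
  proof (rule ccontr)
    assume "\<not> d \<le> M"
    then have "ordge d \<subseteq> I" using I(2) ordge_mono[of M d] by auto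
    then show False
      using that ideal_mult'[OF is_ideal_ordge monom_ordge] by blast
  qed
  ultimately obtain d where d: "?P d" "\<And>d'. ?P d' \<Longrightarrow> d' \<le> d"
    using GreatestI_nat[of ?P 0 M] Greatest_le_nat[of ?P _ M] by blast
  then obtain \<kappa> where \<kappa>: "tdeg \<kappa> = d" "monom \<kappa> * f \<notin> I" by blast
  have "mfps_var v * (monom \<kappa> * f) \<in> I" for v
  proof (rule ccontr)
    assume *: "mfps_var v * (monom \<kappa> * f) \<notin> I"
    let ?k = "\<lambda>i. (if i = v then 1 else 0) + \<kappa> i"
    have "tdeg ?k = Suc d"
      using \<kappa>(1) by (simp add: tdeg_def sum.distrib)
    moreover have "monom ?k * f \<notin> I"
      using * by (simp add: var_monom monom_mult flip: mult.assoc)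
    ultimately have "?P (Suc d)" by blast
    then show False using d(2) by fastforce
  qed
  then show ?thesis using that \<kappa>(2) by blast
qed

theorem ex_dualizing:
  fixes x :: "nat \<Rightarrow> ('v::finite, 'k::field) mfps"
  assumes x: "param x"
  obtains \<phi> where "dualizing (pgen x) \<phi>"
proof -
  let ?I = "pgen x" and ?N = "CARD('v)"
  have I: "is_ideal ?I" by simp
  obtain M where M: "ordge M \<subseteq> ?I" using param_primary[OF x] by blast
  obtain B where B: "nf_basis ?I B" using ex_nf_basis[OF I M] by blast
  obtain \<Delta>0 where "\<Delta>0 * 1 \<notin> ?I" "\<And>v. mfps_var v * (\<Delta>0 * 1) \<in> ?I"
    using ex_socle_multiple[OF I M param_proper(2)[OF x]] by blast
  then obtain \<Delta> where \<Delta>: "\<Delta> \<notin> ?I" "\<And>v. mfps_var v * \<Delta> \<in> ?I" by blast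
  obtain e :: "nat \<Rightarrow> 'v" where e: "bij_betw e {..<?N} UNIV" by (rule ex_enum)
  \<comment> \<open>The exponent 1 is kept so that the facts about powers of variables
    apply.\<close>
  define y :: "nat \<Rightarrow> ('v, 'k) mfps" where "y i = mfps_var (e i) ^ 1" for i
  have y: "reg ?N y"
    unfolding y_def using reg_var_powers e by (blast intro: bij_betw_imp_inj_on)
  have xr: "reg ?N x" using x by (rule param_regular)
  have "y ` {..<?N} = (\<lambda>v. mfps_var v ^ 1) ` e ` {..<?N}"
    by (auto simp: y_def image_image)
  also have "\<dots> = (\<lambda>v. mfps_var v ^ 1) ` UNIV"
    by (simp only: bij_betw_imp_surj_on[OF e])
  finally have img: "y ` {..<?N} = (\<lambda>v. mfps_var v ^ 1) ` UNIV" .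
  have "(\<forall>v\<in>UNIV. \<mu> v < 1) \<longleftrightarrow> \<mu> = (\<lambda>_. 0)" for \<mu> :: "'v \<Rightarrow> nat"
    by (auto simp: fun_eq_iff)
  then have ymem: "f \<in> igen y ?N \<longleftrightarrow> f \<in> ordge 1" for f
    by (simp only: igen_def img power_ideal_iff ordge_1_iff) simp
  \<comment> \<open>Elements annihilated by all variables correspond under \<open>regrel\<close> to
    classes modulo the variables, that is, to constants. So the socle is spanned by
    \<open>\<Delta>\<close>.\<close>
  have socle: "\<exists>c. a - mfps_const c * \<Delta> \<in> ?I" if a: "\<And>v. mfps_var v * a \<in> ?I" for a
  proof -
    obtain b where b: "regrel ?N x y a b"
      using ex_regrel_right[OF xr, of y a] a by (auto simp: y_def pgen_def)
    obtain d where d: "regrel ?N x y \<Delta> d"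
      using ex_regrel_right[OF xr, of y \<Delta>] \<Delta>(2) by (auto simp: y_def pgen_def)
    have d0: "mfps_coeff d (\<lambda>_. 0) \<noteq> 0"
      using regrel_iff[OF y xr d] \<Delta>(1) ymem[of d] unfolding ordge_1_iff pgen_def by blast
    define c where "c = mfps_coeff b (\<lambda>_. 0) / mfps_coeff d (\<lambda>_. 0)"
    have "regrel ?N x y (1 * a + mfps_const (- c) * \<Delta>) (1 * b + mfps_const (- c) * d)"
      by (rule regrel_lin[OF b d])
    moreover have "1 * b + mfps_const (- c) * d \<in> ordge 1"
      unfolding ordge_1_iff using d0 by (simp add: c_def)
    ultimately have "1 * a + mfps_const (- c) * \<Delta> \<in> ?I"
      using regrel_iff[OF y xr] ymem unfolding pgen_def by blast
    moreover have "mfps_const (- c) * \<Delta> = - (mfps_const c * \<Delta>)"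
      by (simp add: mfps_eq_iff)
    ultimately show ?thesis by (intro exI[of _ c]) simp
  qed
  \<comment> \<open>Any functional that does not vanish on the socle is dualizing, since every
    nonzero ideal of the quotient meets the socle.\<close>
  obtain \<nu> where \<nu>: "\<nu> \<in> B" "nf ?I B \<Delta> \<nu> \<noteq> 0"
    using nf_eq_0_iff[OF I B] \<Delta>(1) by blast
  define \<phi> where "\<phi> f = nf ?I B f \<nu>" for f
  have lin: "klinear \<phi>"
    unfolding \<phi>_def using klinear_nf[OF I B \<nu>(1)] .
  have zero: "\<phi> f = 0" if "f \<in> ?I" for f
    unfolding \<phi>_def using nf_eq_0_iff[OF I B] that \<nu>(1) by blast
  have "f \<in> ?I" if f: "\<forall>g. \<phi> (g * f) = 0" for f
  proof (rule ccontr)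
    assume "f \<notin> ?I"
    then obtain g where g: "g * f \<notin> ?I" "\<And>v. mfps_var v * (g * f) \<in> ?I"
      using ex_socle_multiple[OF I M] by blast
    obtain c where c: "g * f - mfps_const c * \<Delta> \<in> ?I"
      using socle[OF g(2)] by blast
    have "c \<noteq> 0" using c g(1) by auto
    have "\<phi> (g * f) = c * \<phi> \<Delta>"
      using zero[OF c] by (simp add: klinear_diff[OF lin] klinear_scale[OF lin])
    then show False
      using f \<open>c \<noteq> 0\<close> \<nu>(2) by (simp add: \<phi>_def)
  qed
  then show ?thesis
    using that[of \<phi>] lin zero unfolding dualizing_def by blast
qed

theorem dualizing_represents:
  fixes I :: "('v::finite, 'k::field) mfps set"
  assumes I: "is_ideal I" "ordge M \<subseteq> I" and \<phi>: "dualizing I \<phi>"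
    and \<theta>: "klinear \<theta>" "\<And>f. f \<in> I \<Longrightarrow> \<theta> f = 0"
  obtains g where "\<And>f. \<theta> f = \<phi> (g * f)"
proof -
  obtain B where B: "nf_basis I B" using ex_nf_basis[OF I] by blast
  have finB: "finite B" and indep: "\<And>c. lincomb B c \<in> I \<Longrightarrow> \<forall>\<nu>\<in>B. c \<nu> = 0"
    using B by (auto simp: nf_basis_def)
  have lin: "klinear \<phi>" and zero: "\<And>f. f \<in> I \<Longrightarrow> \<phi> f = 0"
    and nondeg: "\<And>f. (\<And>g. \<phi> (g * f) = 0) \<Longrightarrow> f \<in> I"
    using \<phi> by (auto simp: dualizing_def)
  \<comment> \<open>The Gram matrix of the pairing. Nondegeneracy makes its rows independent, and a
    right inverse of it solves for \<open>g\<close>.\<close>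
  define a where "a \<kappa> \<nu> = \<phi> (monom \<kappa> * monom \<nu>)" for \<kappa> \<nu>
  have a_sym: "a \<kappa> \<nu> = a \<nu> \<kappa>" for \<kappa> \<nu> by (simp add: a_def mult.commute)
  have expand: "\<phi> (lincomb B c * monom \<nu>) = (\<Sum>\<kappa>\<in>B. c \<kappa> * a \<kappa> \<nu>)" for c \<nu>
    by (simp add: lincomb_def sum_distrib_right klinear_sum[OF lin] klinear_scale[OF lin] a_def mult.assoc)
  have "\<forall>\<kappa>\<in>B. c \<kappa> = 0" if c: "\<And>\<nu>. \<nu> \<in> B \<Longrightarrow> (\<Sum>\<kappa>\<in>B. c \<kappa> * a \<kappa> \<nu>) = 0" for c
  proof -
    have "\<phi> (g * lincomb B c) = 0" for g
    proof -
      have "\<phi> (lincomb B c * g) = (\<Sum>\<nu>\<in>B. nf I B g \<nu> * \<phi> (lincomb B c * monom \<nu>))"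
        using klinear_mult[OF lin] B zero ideal_mult[OF I(1)]
        by (intro klinear_eq_on_basis[where \<phi> = "\<lambda>f. \<phi> (lincomb B c * f)"]) auto
      also have "\<dots> = 0" using c by (simp add: expand)
      finally show ?thesis by (simp only: mult.commute[of g])
    qed
    then show ?thesis using nondeg indep by blast
  qed
  then obtain \<sigma> where \<sigma>: "\<forall>i\<in>B. \<forall>j\<in>B. (\<Sum>q\<in>B. a i q * \<sigma> q j) = (if i = j then 1 else 0)"
    using right_inverse_of_independent[OF finB finB, of a] by blast
  define g where "g = lincomb B (\<lambda>\<kappa>. \<Sum>\<mu>\<in>B. \<theta> (monom \<mu>) * \<sigma> \<kappa> \<mu>)"
  have g: "\<phi> (g * monom \<nu>) = \<theta> (monom \<nu>)" if "\<nu> \<in> B" for \<nu>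
  proof -
    have "\<phi> (g * monom \<nu>) = (\<Sum>\<kappa>\<in>B. (\<Sum>\<mu>\<in>B. \<theta> (monom \<mu>) * \<sigma> \<kappa> \<mu>) * a \<nu> \<kappa>)"
      unfolding g_def expand by (simp add: a_sym[of _ \<nu>])
    also have "\<dots> = (\<Sum>\<mu>\<in>B. \<theta> (monom \<mu>) * (\<Sum>\<kappa>\<in>B. a \<nu> \<kappa> * \<sigma> \<kappa> \<mu>))"
      unfolding sum_distrib_left sum_distrib_right by (subst sum.swap) (simp add: mult_ac)
    also have "\<dots> = (\<Sum>\<mu>\<in>B. if \<nu> = \<mu> then \<theta> (monom \<mu>) else 0)"
      using \<sigma> that by (intro sum.cong) auto
    also have "\<dots> = \<theta> (monom \<nu>)"
      using finB that by (simp add: sum.delta)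
    finally show ?thesis .
  qed
  have "\<theta> f = \<phi> (g * f)" for f
  proof -
    have "\<phi> (g * f) = (\<Sum>\<nu>\<in>B. nf I B f \<nu> * \<phi> (g * monom \<nu>))"
      using klinear_mult[OF lin] B zero ideal_mult[OF I(1)]
      by (intro klinear_eq_on_basis[where \<phi> = "\<lambda>f. \<phi> (g * f)"]) auto
    then show ?thesis
      using klinear_eq_on_basis[OF \<theta>(1) B \<theta>(2), of f] g by simp
  qed
  then show ?thesis using that by blast
qed

text \<open>A functional that vanishes on \<open>I\<close> but not at \<open>f\<close> is
  multiplication by some \<open>g\<close> followed by \<open>\<phi>\<close>. Then \<open>g\<close>
  lies in \<open>(x) : I\<close> while \<open>f * g\<close> is not in \<open>(x)\<close>.\<close>

theorem param_double_quotient: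
  fixes x :: "nat \<Rightarrow> ('v::finite, 'k::field) mfps"
  assumes x: "param x" and I: "is_ideal I" "pgen x \<subseteq> I"
  shows "ideal_quotient (pgen x) (ideal_quotient (pgen x) I) = I"
proof
  show "I \<subseteq> ideal_quotient (pgen x) (ideal_quotient (pgen x) I)"
    by (auto simp: ideal_quotient_def mult.commute)
  show "ideal_quotient (pgen x) (ideal_quotient (pgen x) I) \<subseteq> I"
  proof (rule subsetI, rule ccontr)
    fix f assume f: "f \<in> ideal_quotient (pgen x) (ideal_quotient (pgen x) I)" "f \<notin> I"
    obtain M where M: "ordge M \<subseteq> pgen x" using param_primary[OF x] by blast
    obtain \<phi> where \<phi>: "dualizing (pgen x) \<phi>" using ex_dualizing[OF x] .
    have "ordge M \<subseteq> I" using M I(2) by blast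
    then obtain B where B: "nf_basis I B" using ex_nf_basis[OF I(1)] by blast
    obtain \<nu> where \<nu>: "\<nu> \<in> B" "nf I B f \<nu> \<noteq> 0" using nf_eq_0_iff[OF I(1) B] f(2) by blast
    have z: "nf I B h \<nu> = 0" if "h \<in> I" for h
      using nf_eq_0_iff[OF I(1) B] that \<nu>(1) by blast
    obtain g where g: "\<And>h. nf I B h \<nu> = \<phi> (g * h)"
      using dualizing_represents[OF is_ideal_pgen M \<phi> klinear_nf[OF I(1) B \<nu>(1)]] z I(2) by blast
    have "g * h \<in> pgen x" if "h \<in> I" for h
    proof -
      have "\<phi> (k * (g * h)) = 0" for k
        using g[of "k * h"] z[OF ideal_mult[OF I(1) that]] by (simp add: mult.left_commute)
      then show ?thesis using \<phi> by (auto simp: dualizing_def)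
    qed
    then have "f * g \<in> pgen x"
      using f(1) by (auto simp: ideal_quotient_def)
    then show False
      using \<phi> g[of f] \<nu>(2) by (simp add: dualizing_def mult.commute)
  qed
qed

section \<open>Power series rings over a field are Noetherian\<close>

lemma ex_mono_subseq_nat:
  fixes s :: "nat \<Rightarrow> nat"
  shows "\<exists>r. strict_mono r \<and> (\<forall>i. s (r i) \<le> s (r (Suc i)))"
proof -
  have "\<exists>m. m > N \<and> (\<forall>n>N. s m \<le> s n)" for N
    using ex_has_least_nat[of "\<lambda>m. m > N" "Suc N" s] by auto
  then obtain nx where nx: "\<And>N. nx N > N" "\<And>N n. n > N \<Longrightarrow> s (nx N) \<le> s n"
    by metis
  \<comment> \<open>Each \<open>nx N\<close> is the place of a least value beyond \<open>N\<close>,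
    so its iterates give nondecreasing values.\<close>
  define r where "r = rec_nat (nx 0) (\<lambda>_. nx)"
  have r: "r 0 = nx 0" "r (Suc i) = nx (r i)" for i by (simp_all add: r_def)
  have "strict_mono r"
    using nx(1) by (auto simp: strict_mono_Suc_iff r)
  moreover have "s (r i) \<le> s (r (Suc i))" for i
  proof (cases i)
    case 0
    have "r 1 > 0" using nx(1)[of "r 0"] by (simp add: r)
    then show ?thesis using nx(2)[of 0 "r 1"] 0 by (simp add: r)
  next
    case (Suc k)
    have "r (Suc i) > r k"
      using \<open>strict_mono r\<close> Suc by (simp add: strict_mono_def)
    then show ?thesis using nx(2)[of "r k" "r (Suc i)"] Suc by (simp add: r)
  qed
  ultimately show ?thesis by blast
qed

text \<open>The sequence is thinned out once for each coordinate; monotonicity in the coordinates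
  treated before survives passage to a subsequence.\<close>

lemma ex_le_pair_exponents:
  fixes f :: "nat \<Rightarrow> 'v::finite \<Rightarrow> nat"
  shows "\<exists>i j. i < j \<and> f i \<le> f j"
proof -
  have "\<exists>r. strict_mono r \<and> (\<forall>v\<in>V. \<forall>i. f (r i) v \<le> f (r (Suc i)) v)" for V :: "'v set"
    using finite[of V]
  proof (induction V rule: finite_induct)
    case empty
    show ?case by (intro exI[of _ "\<lambda>i. i"]) (simp add: strict_mono_def)
  next
    case (insert v V)
    then obtain r where r: "strict_mono r" "\<forall>w\<in>V. \<forall>i. f (r i) w \<le> f (r (Suc i)) w" by blast
    obtain q where q: "strict_mono q" "\<forall>i. f (r (q i)) v \<le> f (r (q (Suc i))) v"
      using ex_mono_subseq_nat[of "\<lambda>i. f (r i) v"] by blast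
    have "f (r (q i)) w \<le> f (r (q (Suc i))) w" if "w \<in> V" for w i
    proof -
      have "mono (\<lambda>i. f (r i) w)"
        using r(2) that by (simp add: mono_iff_le_Suc)
      moreover have "q i \<le> q (Suc i)"
        using q(1) by (simp add: strict_mono_def less_imp_le)
      ultimately show ?thesis by (rule monoD)
    qed
    then show ?case
      using q r(1) by (intro exI[of _ "r \<circ> q"]) (auto simp: strict_mono_def)
  qed
  then obtain r where "strict_mono r" "\<forall>v. \<forall>i. f (r i) v \<le> f (r (Suc i)) v"
    by (metis UNIV_I)
  then show ?thesis
    by (intro exI[of _ "r 0"] exI[of _ "r (Suc 0)"]) (auto simp: strict_mono_def le_fun_def)
qed

lemma dickson:
  fixes A :: "('v::finite \<Rightarrow> nat) set"
  shows "\<exists>F\<subseteq>A. finite F \<and> (\<forall>a\<in>A. \<exists>b\<in>F. b \<le> a)"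
proof (intro exI conjI)
  \<comment> \<open>The minimal elements. An infinite set of them would contain two comparable
    ones.\<close>
  define F where "F = {a \<in> A. \<forall>b\<in>A. b \<le> a \<longrightarrow> b = a}"
  show "F \<subseteq> A" by (auto simp: F_def)
  show "\<forall>a\<in>A. \<exists>b\<in>F. b \<le> a"
  proof
    fix a assume "a \<in> A"
    then obtain b where b: "b \<in> A" "b \<le> a" "\<And>c. c \<in> A \<Longrightarrow> c \<le> a \<Longrightarrow> tdeg b \<le> tdeg c"
      using ex_has_least_nat[of "\<lambda>c. c \<in> A \<and> c \<le> a" a tdeg] by auto
    have "c = b" if "c \<in> A" "c \<le> b" for c
    proof -
      have "tdeg c + tdeg (\<lambda>i. b i - c i) = tdeg b" using tdeg_diff[OF that(2)] .
      moreover have "tdeg b \<le> tdeg c" using b that by (meson order.trans)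
      ultimately have "tdeg (\<lambda>i. b i - c i) = 0" by linarith
      then have "(\<lambda>i. b i - c i) = (\<lambda>_. 0)" by (simp only: tdeg_eq_0_iff)
      then have "b i \<le> c i" for i by (metis diff_is_0_eq)
      then show ?thesis using that(2) by (auto simp: le_fun_def fun_eq_iff intro: antisym)
    qed
    then show "\<exists>b\<in>F. b \<le> a" using b by (auto simp: F_def)
  qed
  show "finite F"
  proof (rule ccontr)
    assume "infinite F"
    then obtain f :: "nat \<Rightarrow> 'v \<Rightarrow> nat" where f: "inj f" "range f \<subseteq> F"
      using infinite_countable_subset by blast
    obtain i j where "i < j" "f i \<le> f j" using ex_le_pair_exponents[of f] by blast
    moreover have "f i \<in> F" "f j \<in> F" using f(2) by auto
    ultimately have "f i = f j" by (auto simp: F_def)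
    then show False using f(1) \<open>i < j\<close> by (simp add: inj_eq)
  qed
qed

text \<open>
  Ties between monomials of equal degree are broken by the weight \<open>W\<close> below, which is
  multiplicative and, by unique factorization, injective.
\<close>

lemma ex_exponent_weight:
  obtains W :: "('v::finite \<Rightarrow> nat) \<Rightarrow> nat" where "inj W" "\<And>\<mu> \<nu>. W (\<lambda>i. \<mu> i + \<nu> i) = W \<mu> * W \<nu>" "\<And>\<mu>. W \<mu> > 0"
proof -
  obtain P where P: "P \<subseteq> {p :: nat. Factorial_Ring.prime p}" "card P = CARD('v)" "finite P"
    using infinite_arbitrarily_large[OF primes_infinite] by blast
  then obtain p :: "'v \<Rightarrow> nat" where p: "bij_betw p UNIV P"
    using finite_same_card_bij[of "UNIV :: 'v set" P] by auto
  have pr: "Factorial_Ring.prime (p v)" for v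
    using P(1) bij_betwE[OF p] by blast
  have injp: "inj p" using p by (rule bij_betw_imp_inj_on)
  define W where "W \<mu> = (\<Prod>v\<in>UNIV. p v ^ \<mu> v)" for \<mu> :: "'v \<Rightarrow> nat"
  have mult: "multiplicity (p v) (W \<mu>) = \<mu> v" for v \<mu>
  proof -
    have "W \<mu> = (\<Prod>q\<in>P. q ^ \<mu> (inv_into UNIV p q))"
      using prod.reindex_bij_betw[OF p, of "\<lambda>q. q ^ \<mu> (inv_into UNIV p q)"] injp by (simp add: W_def)
    moreover have "multiplicity (p v) (\<Prod>q\<in>P. q ^ \<mu> (inv_into UNIV p q)) = \<mu> (inv_into UNIV p (p v))"
      using P bij_betwE[OF p] by (subst multiplicity_prod_prime_powers) (auto simp: pr)
    ultimately show ?thesis using injp by simp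
  qed
  have "inj W"
    by (rule injI) (metis ext mult)
  moreover have "W (\<lambda>i. \<mu> i + \<nu> i) = W \<mu> * W \<nu>" for \<mu> \<nu>
    by (simp add: W_def power_add prod.distrib)
  moreover have "W \<mu> > 0" for \<mu>
    unfolding W_def using pr prime_gt_0_nat by (intro prod_pos) simp
  ultimately show ?thesis using that by blast
qed

text \<open>Standard bases for a local order: the initial exponent of a series has least degree and,
  among those, least weight. By Dickson's lemma finitely many elements of \<open>I\<close> have
  initial exponents dividing all others, and reduction by them raises the order without end.\<close>

theorem mfps_noetherian:
  fixes I :: "('v::finite, 'k::field) mfps set"
  assumes I: "is_ideal I"
  obtains x n where "I = igen x n"
proof -
  obtain W :: "('v \<Rightarrow> nat) \<Rightarrow> nat" where W: "inj W" "\<And>\<mu> \<nu>. W (\<lambda>i. \<mu> i + \<nu> i) = W \<mu> * W \<nu>" "\<And>\<mu>. W \<mu> > 0"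
    using ex_exponent_weight by blast
  define lead where "lead g \<mu> \<longleftrightarrow> g \<in> I \<and> g \<in> ordge (tdeg \<mu>) \<and> mfps_coeff g \<mu> = 1 \<and>
    (\<forall>\<nu>. tdeg \<nu> = tdeg \<mu> \<longrightarrow> W \<nu> < W \<mu> \<longrightarrow> mfps_coeff g \<nu> = 0)" for g \<mu>
  obtain F where F: "F \<subseteq> {\<mu>. \<exists>g. lead g \<mu>}" "finite F" "\<And>\<mu> g. lead g \<mu> \<Longrightarrow> \<exists>\<phi>\<in>F. \<phi> \<le> \<mu>"
    using dickson[of "{\<mu>. \<exists>g. lead g \<mu>}"] by blast
  obtain e and n :: nat where e: "F = e ` {..<n}"
    using finite_imp_nat_seg_image_inj_on[OF F(2)] by (auto simp: lessThan_def)
  have "\<forall>i<n. \<exists>g. lead g (e i)"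
    using F(1) e by auto
  then obtain x where x: "\<And>i. i < n \<Longrightarrow> lead (x i) (e i)" by metis
  have xI: "x i \<in> I" if "i < n" for i
    using x[OF that] by (simp add: lead_def)
  \<comment> \<open>A bound for the degrees of the initial exponents: reducing a series of order
    \<open>j\<close> uses coefficients of order at least \<open>j - d\<close>.\<close>
  define d where "d = (\<Sum>i<n. tdeg (e i))"
  have d: "tdeg (e i) \<le> d" if "i < n" for i
    unfolding d_def using that by (intro member_le_sum) auto
  have step: "\<exists>c. (\<forall>i<n. c i \<in> ordge (j - d)) \<and> g - (\<Sum>i<n. c i * x i) \<in> I \<inter> ordge (Suc j)"
    if "g \<in> I" "g \<in> ordge j" for j g
  proof -
    \<comment> \<open>The terms of degree \<open>j\<close> are removed in order of increasing
      weight; \<open>m\<close> bounds these weights, so the inner induction ends.\<close>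
    define m where "m = Max (W ` {\<mu>. tdeg \<mu> = j})"
    have m: "W \<mu> \<le> m" if "tdeg \<mu> = j" for \<mu>
      unfolding m_def using that by (intro Max_ge) (auto simp: finite_tdeg_eq)
    have "\<exists>c. (\<forall>i<n. c i \<in> ordge (j - d)) \<and> g - (\<Sum>i<n. c i * x i) \<in> I \<inter> ordge (Suc j)"
      if "g \<in> I" "g \<in> ordge j" "\<And>\<mu>. tdeg \<mu> = j \<Longrightarrow> W \<mu> < b \<Longrightarrow> mfps_coeff g \<mu> = 0" for b g
      using that
    proof (induction "Suc m - b" arbitrary: b g)
      case 0
      then have "mfps_coeff g \<mu> = 0" if "tdeg \<mu> < Suc j" for \<mu>
        using that m[of \<mu>] by (cases "tdeg \<mu> = j") (auto simp: ordge_def)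
      then have "g \<in> ordge (Suc j)" by (simp add: ordge_def)
      then show ?case
        using 0 by (intro exI[of _ "\<lambda>_. 0"]) simp
    next
      case (Suc k)
      show ?case
      proof (cases "\<exists>\<mu>. tdeg \<mu> = j \<and> W \<mu> = b \<and> mfps_coeff g \<mu> \<noteq> 0")
        case False
        then have "mfps_coeff g \<mu> = 0" if "tdeg \<mu> = j" "W \<mu> < Suc b" for \<mu>
          using that Suc.prems(3)[of \<mu>] by (auto simp: less_Suc_eq)
        then show ?thesis
          using Suc.hyps(1)[of "Suc b" g] Suc.hyps(2) Suc.prems by auto
      next
        case True
        then obtain \<mu> where \<mu>: "tdeg \<mu> = j" "W \<mu> = b" "mfps_coeff g \<mu> \<noteq> 0" by blast
        have "lead (mfps_const (1 / mfps_coeff g \<mu>) * g) \<mu>"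
          unfolding lead_def using Suc.prems \<mu> by (auto intro: ideal_mult I)
        then obtain i where i: "i < n" "e i \<le> \<mu>"
          using F(3) e by blast
        define \<delta> where "\<delta> = (\<lambda>v. \<mu> v - e i v)"
        have \<mu>_eq: "\<mu> = (\<lambda>v. \<delta> v + e i v)"
          using i(2) by (auto simp: \<delta>_def le_fun_def)
        have \<delta>j: "tdeg \<delta> + tdeg (e i) = j" using \<mu>(1) \<mu>_eq tdeg_add by metis
        define c where "c = mfps_const (mfps_coeff g \<mu>) * monom \<delta>"
        have c: "c \<in> ordge (tdeg \<delta>)"
          unfolding c_def by (intro ideal_mult monom_ordge) simp
        have cx: "mfps_coeff (c * x i) \<nu> = (if \<nu> = \<mu> then mfps_coeff g \<mu> else 0)"
          if \<nu>: "tdeg \<nu> = j" "W \<nu> \<le> b" for \<nu>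
        proof (cases "\<delta> \<le> \<nu>")
          case True
          define \<kappa> where "\<kappa> = (\<lambda>v. \<nu> v - \<delta> v)"
          have \<nu>_eq: "\<nu> = (\<lambda>v. \<delta> v + \<kappa> v)"
            using True by (auto simp: \<kappa>_def le_fun_def)
          have k: "tdeg \<kappa> = tdeg (e i)" "W \<kappa> \<le> W (e i)"
          proof -
            have "tdeg \<delta> + tdeg \<kappa> = j" using \<nu>(1) \<nu>_eq tdeg_add by metis
            then show "tdeg \<kappa> = tdeg (e i)" using \<delta>j by simp
            have "W \<delta> * W \<kappa> \<le> W \<delta> * W (e i)" using \<nu>(2) \<mu>(2) W(2) \<nu>_eq \<mu>_eq by metis
            then show "W \<kappa> \<le> W (e i)" using W(3)[of \<delta>] by simp
          qed
          have "mfps_coeff (x i) \<kappa> = (if \<kappa> = e i then 1 else 0)"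
          proof (cases "\<kappa> = e i")
            case True
            then show ?thesis using x[OF i(1)] by (simp add: lead_def)
          next
            case False
            then have "W \<kappa> < W (e i)" using k(2) W(1) by (metis inj_eq le_neq_implies_less)
            then show ?thesis using x[OF i(1)] k(1) False by (simp add: lead_def)
          qed
          moreover have "\<nu> = \<mu> \<longleftrightarrow> \<kappa> = e i"
            unfolding \<nu>_eq \<mu>_eq by (auto simp: fun_eq_iff)
          moreover have "mfps_coeff (c * x i) \<nu> = mfps_coeff g \<mu> * mfps_coeff (x i) \<kappa>"
            by (simp add: c_def \<nu>_eq mult.assoc)
          ultimately show ?thesis by simp
        next
          case False
          have "\<delta> \<le> \<mu>" by (auto simp: \<delta>_def le_fun_def)
          then have "\<nu> \<noteq> \<mu>" using False by blast
          then show ?thesis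
            using False by (simp add: c_def mult.assoc coeff_monom_mult)
        qed
        define g' where "g' = g - c * x i"
        have "x i \<in> ordge (tdeg (e i))" using x[OF i(1)] by (simp add: lead_def)
        then have "c * x i \<in> ordge j" using ordge_mult[OF c] \<delta>j by metis
        then have g': "g' \<in> I" "g' \<in> ordge j"
          unfolding g'_def using Suc.prems ideal_mult[OF I xI[OF i(1)]]
          by (auto intro: idl.subspace_diff[OF I] ordge_diff)
        have "mfps_coeff g' \<nu> = 0" if "tdeg \<nu> = j" "W \<nu> < Suc b" for \<nu>
        proof (cases "\<nu> = \<mu>")
          case False
          then have "W \<nu> < b" using that(2) \<mu>(2) W(1) by (metis inj_eq less_antisym)
          then show ?thesis
            using False cx[of \<nu>] Suc.prems(3)[of \<nu>] that by (simp add: g'_def)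
        qed (use cx[of \<nu>] that in \<open>simp add: g'_def\<close>)
        moreover have "k = Suc m - Suc b" using Suc.hyps(2) by simp
        ultimately obtain c' where c': "\<forall>i<n. c' i \<in> ordge (j - d)" "g' - (\<Sum>i<n. c' i * x i) \<in> I \<inter> ordge (Suc j)"
          using Suc.hyps(1)[of "Suc b" g'] g' by blast
        define c'' where "c'' k = c' k + (if k = i then c else 0)" for k
        have "j - d \<le> tdeg \<delta>" using \<delta>j d[OF i(1)] by simp
        then have "c \<in> ordge (j - d)" using c ordge_mono by blast
        then have "\<forall>k<n. c'' k \<in> ordge (j - d)"
          using c'(1) by (auto simp: c''_def intro: ordge_add)
        moreover have "(\<Sum>k<n. c'' k * x k) = (\<Sum>k<n. c' k * x k) + c * x i"
        proof -
          have "(\<Sum>k<n. (if k = i then c else 0) * x k) = (\<Sum>k<n. if k = i then c * x i else 0)"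
            by (intro sum.cong) auto
          also have "\<dots> = c * x i" using i(1) by (simp add: sum.delta)
          finally show ?thesis by (simp add: c''_def distrib_right sum.distrib)
        qed
        ultimately show ?thesis
          using c'(2) by (intro exI[of _ c'']) (simp add: g'_def algebra_simps)
      qed
    qed
    from this[of g 0] show ?thesis using that by simp
  qed
  \<comment> \<open>From order \<open>d\<close> on, the loss of \<open>d\<close> in the order of the
    coefficients is harmless and the reductions converge.\<close>
  have deep: "I \<inter> ordge d \<subseteq> igen x n"
  proof
    fix f assume f: "f \<in> I \<inter> ordge d"
    show "f \<in> igen x n"
    proof (rule igen_iterate[where D = "\<lambda>j. I \<inter> ordge (j + d)"])
      show "I \<inter> ordge (j + d) \<subseteq> ordge j" for j using ordge_mono[of j "j + d"] by auto
      show "f \<in> I \<inter> ordge (0 + d)" using f by simp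
      show "\<exists>c. (\<forall>i<n. c i \<in> ordge j) \<and> g - (\<Sum>i<n. c i * x i) \<in> I \<inter> ordge (Suc j + d)"
        if "g \<in> I \<inter> ordge (j + d)" for j g
        using step[of g "j + d"] that by simp
    qed
  qed
  have "f \<in> igen x n" if "f \<in> I" for f
  proof -
    \<comment> \<open>Finitely many reductions bring an arbitrary element of \<open>I\<close> to
      order \<open>d\<close>.\<close>
    have "\<exists>h\<in>igen x n. f - h \<in> I \<inter> ordge j" for j
    proof (induction j)
      case 0
      show ?case using that idl.subspace_0[OF is_ideal_igen, of x n] by (intro bexI[of _ 0]) auto
    next
      case (Suc j)
      then obtain h where h: "h \<in> igen x n" "f - h \<in> I" "f - h \<in> ordge j" by blast
      obtain c where c: "f - h - (\<Sum>i<n. c i * x i) \<in> I \<inter> ordge (Suc j)"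
        using step[OF h(2,3)] by blast
      have "h + (\<Sum>i<n. c i * x i) \<in> igen x n"
        using h(1) igen_sum by (intro idl.subspace_add) auto
      then show ?case using c by (intro bexI[of _ "h + (\<Sum>i<n. c i * x i)"]) (simp_all add: algebra_simps)
    qed
    then obtain h where h: "h \<in> igen x n" "f - h \<in> I \<inter> ordge d" by blast
    then have "h + (f - h) \<in> igen x n"
      using deep by (intro idl.subspace_add) auto
    then show ?thesis by simp
  qed
  moreover have "igen x n \<subseteq> I"
    using xI by (simp add: igen_subset_iff[OF I])
  ultimately show ?thesis using that by blast
qed

section \<open>Localization of \<open>k[[X, Y]]\<close> at the prime generated by the variables \<open>Y\<close>\<close>

lemma igenE:
  assumes "y \<in> igen x n"
  obtains c where "y = (\<Sum>i<n. c i * x i)"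
  using assms unfolding igen_iff by auto

abbreviation ocons :: "nat \<Rightarrow> ('n \<Rightarrow> nat) \<Rightarrow> 'n option \<Rightarrow> nat"
  where "ocons j \<mu> \<equiv> case_option j \<mu>"

abbreviation ypart :: "('n option \<Rightarrow> nat) \<Rightarrow> 'n \<Rightarrow> nat"
  where "ypart \<kappa> \<equiv> (\<lambda>i. \<kappa> (Some i))"

lemma ocons_ypart: "ocons (\<kappa> None) (ypart \<kappa>) = \<kappa>"
  by (auto simp: fun_eq_iff split: option.splits)

lemma ocons_eq_iff [simp]: "ocons j \<mu> = ocons j' \<mu>' \<longleftrightarrow> j = j' \<and> \<mu> = \<mu>'"
proof
  assume *: "ocons j \<mu> = ocons j' \<mu>'"
  show "j = j' \<and> \<mu> = \<mu>'"
    using fun_cong[OF *, of None] fun_cong[OF *, of "Some _"] by auto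
qed simp

lemma ocons_zero [simp]: "ocons 0 (\<lambda>_. 0) = (\<lambda>_. 0)"
  by (auto simp: fun_eq_iff split: option.splits)

lemma ocons_le_iff [simp]: "ocons j \<mu> \<le> ocons j' \<mu>' \<longleftrightarrow> j \<le> j' \<and> \<mu> \<le> \<mu>'"
  by (auto simp: le_fun_def split: option.splits)

lemma ocons_diff: "(\<lambda>v. ocons j \<mu> v - ocons j' \<mu>' v) = ocons (j - j') (\<lambda>i. \<mu> i - \<mu>' i)"
  by (auto simp: fun_eq_iff split: option.splits)

lemma exponents_le_ocons:
  "{\<kappa>. \<kappa> \<le> ocons j \<mu>} = (\<lambda>(i, \<nu>). ocons i \<nu>) ` ({..j} \<times> {\<nu>. \<nu> \<le> \<mu>})"
proof (intro equalityI subsetI)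
  fix \<kappa> assume "\<kappa> \<in> {\<kappa>. \<kappa> \<le> ocons j \<mu>}"
  then have "ocons (\<kappa> None) (ypart \<kappa>) \<le> ocons j \<mu>" by (simp add: ocons_ypart)
  then have "(\<kappa> None, ypart \<kappa>) \<in> {..j} \<times> {\<nu>. \<nu> \<le> \<mu>}" by simp
  then show "\<kappa> \<in> (\<lambda>(i, \<nu>). ocons i \<nu>) ` ({..j} \<times> {\<nu>. \<nu> \<le> \<mu>})"
    by (intro image_eqI[of _ _ "(\<kappa> None, ypart \<kappa>)"]) (simp_all add: ocons_ypart)
qed auto

lemma coeff_mult_ocons:
  "mfps_coeff (f * g) (ocons j \<mu>) = (\<Sum>\<nu> | \<nu> \<le> \<mu>. \<Sum>i\<le>j.
     mfps_coeff f (ocons i \<nu>) * mfps_coeff g (ocons (j - i) (\<lambda>k. \<mu> k - \<nu> k)))"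
proof -
  have inj: "inj_on (\<lambda>(i, \<nu>). ocons i \<nu>) ({..j} \<times> {\<nu>. \<nu> \<le> \<mu>})"
    by (auto simp: inj_on_def)
  have "mfps_coeff (f * g) (ocons j \<mu>) = (\<Sum>(i, \<nu>)\<in>{..j} \<times> {\<nu>. \<nu> \<le> \<mu>}.
      mfps_coeff f (ocons i \<nu>) * mfps_coeff g (ocons (j - i) (\<lambda>k. \<mu> k - \<nu> k)))"
    unfolding coeff_mult exponents_le_ocons sum.reindex[OF inj]
    by (auto simp: ocons_diff intro!: sum.cong)
  then show ?thesis
    by (subst sum.swap) (simp add: sum.cartesian_product)
qed

text \<open>The coefficient of a monomial in the variables \<open>Y\<close>, as a power series in
  \<open>X\<close>.\<close>

definition xslice :: "('n::finite option, 'k::comm_ring_1) mfps \<Rightarrow> ('n \<Rightarrow> nat) \<Rightarrow> 'k fps"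
  where "xslice f \<mu> = Abs_fps (\<lambda>j. mfps_coeff f (ocons j \<mu>))"

lemma xslice_mult: "xslice (f * g) \<mu> = (\<Sum>\<nu> | \<nu> \<le> \<mu>. xslice f \<nu> * xslice g (\<lambda>i. \<mu> i - \<nu> i))"
  by (rule fps_ext) (simp add: xslice_def coeff_mult_ocons fps_sum_nth fps_mult_nth atLeast0AtMost)

text \<open>The completion of the localization of \<open>k[[X, Y]]\<close> at \<open>(Y)\<close> is \<open>k((X))[[Y]]\<close>; \<open>eta\<close> is the canonical map.\<close>

definition eta :: "('n::finite option, 'k::field) mfps \<Rightarrow> ('n, 'k fls) mfps"
  where "eta f = Abs_mfps (\<lambda>\<mu>. fps_to_fls (xslice f \<mu>))"

lemma coeff_eta: "mfps_coeff (eta f) \<mu> = fps_to_fls (xslice f \<mu>)"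
  by (simp add: eta_def)

lemma fps_to_fls_sum: "fps_to_fls (\<Sum>i\<in>A. f i) = (\<Sum>i\<in>A. fps_to_fls (f i))"
  by (induction A rule: infinite_finite_induct) auto

lemma eta_add [simp]: "eta (f + g) = eta f + eta g"
  by (rule mfps_eqI) (simp add: coeff_eta xslice_def flip: fps_to_fls_plus, simp add: fps_eq_iff)

lemma eta_diff [simp]: "eta (f - g) = eta f - eta g"
  by (rule mfps_eqI) (simp add: coeff_eta xslice_def flip: fps_to_fls_minus, simp add: fps_eq_iff)

lemma eta_mult [simp]: "eta (f * g) = eta f * eta g"
  by (rule mfps_eqI) (simp add: coeff_eta coeff_mult xslice_mult fps_to_fls_sum fls_times_fps_to_fls)

lemma eta_0 [simp]: "eta 0 = 0"
  using eta_diff[of 0 0] by simp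

lemma eta_sum: "eta (\<Sum>i\<in>A. f i) = (\<Sum>i\<in>A. eta (f i))"
  by (induction A rule: infinite_finite_induct) auto

lemma eta_monom:
  fixes \<mu> :: "'n::finite \<Rightarrow> nat"
  shows "eta (monom (ocons j \<mu>)) = (mfps_const (fls_X ^ j) * monom \<mu> :: ('n, 'k::field fls) mfps)"
proof (rule mfps_eqI)
  fix \<nu> :: "'n \<Rightarrow> nat"
  have "xslice (monom (ocons j \<mu>)) \<nu> = (if \<nu> = \<mu> then fps_X ^ j else 0 :: 'k fps)"
    by (auto simp: xslice_def coeff_monom fps_eq_iff)
  then show "mfps_coeff (eta (monom (ocons j \<mu>))) \<nu> =
      mfps_coeff (mfps_const (fls_X ^ j) * monom \<mu> :: ('n, 'k fls) mfps) \<nu>"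
    by (simp add: coeff_eta coeff_monom fps_to_fls_power)
qed

lemma eta_1 [simp]: "eta 1 = 1"
  using eta_monom[of 0 "\<lambda>_. 0"] by (simp add: monom_0)

lemma monom_var_Some_power: "mfps_var (Some i) ^ e = monom (ocons 0 (\<lambda>w. if w = i then e else 0))"
proof -
  have "(\<lambda>w. if w = Some i then e else 0) = ocons 0 (\<lambda>w. if w = i then e else 0)"
    by (auto simp: fun_eq_iff split: option.splits)
  then show ?thesis by (simp add: var_power)
qed

lemma eta_var_Some_power: "eta (mfps_var (Some i) ^ e) = mfps_var i ^ e"
  by (simp only: monom_var_Some_power eta_monom) (simp add: var_power)

lemma eta_power: "eta (f ^ e) = eta f ^ e"
  by (induction e) auto

lemma monom_var_None_power:
  "mfps_var None ^ e = (monom (ocons e (\<lambda>_. 0)) :: ('n::finite option, 'k::comm_ring_1) mfps)"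
proof -
  have "(\<lambda>w :: 'n option. if w = None then e else 0) = ocons e (\<lambda>_. 0)"
    by (auto simp: fun_eq_iff split: option.splits)
  then show ?thesis by (simp add: var_power)
qed

lemma eta_var_None_power: "eta (mfps_var None ^ e) = mfps_const (fls_X ^ e)"
  by (simp only: monom_var_None_power eta_monom) (simp add: monom_0)

text \<open>The \<open>M\<close>-th power of the prime ideal generated by the variables
  \<open>Y\<close>.\<close>

definition ypow :: "nat \<Rightarrow> ('n::finite option, 'k::comm_ring_1) mfps set"
  where "ypow M = {f. \<forall>\<kappa>. tdeg (ypart \<kappa>) < M \<longrightarrow> mfps_coeff f \<kappa> = 0}"

lemma ypow_iff: "f \<in> ypow M \<longleftrightarrow> (\<forall>j \<mu>. tdeg \<mu> < M \<longrightarrow> mfps_coeff f (ocons j \<mu>) = 0)"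
proof
  assume *: "\<forall>j \<mu>. tdeg \<mu> < M \<longrightarrow> mfps_coeff f (ocons j \<mu>) = 0"
  then have "mfps_coeff f \<kappa> = 0" if "tdeg (ypart \<kappa>) < M" for \<kappa>
    using that by (metis ocons_ypart)
  then show "f \<in> ypow M" by (simp add: ypow_def)
qed (auto simp: ypow_def)

lemma zero_ypow [simp]: "0 \<in> ypow M"
  by (simp add: ypow_def)

text \<open>Powers of \<open>(Y)\<close> are contracted from powers of the maximal ideal of
  \<open>k((X))[[Y]]\<close>; through this, facts about \<open>ypow\<close> are inherited from
  \<open>ordge\<close>.\<close>

lemma eta_ordge_iff: "eta f \<in> ordge M \<longleftrightarrow> f \<in> ypow M"
  by (auto simp: ypow_iff ordge_def coeff_eta xslice_def fps_eq_iff)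

lemma is_ideal_ypow [simp]: "is_ideal (ypow M :: ('n::finite option, 'k::field) mfps set)"
  by (rule idl.subspaceI) (simp_all flip: eta_ordge_iff add: ordge_add ideal_mult)

lemma eta_unit:
  assumes "h \<notin> ypow 1"
  obtains u where "eta h * u = 1"
  using assms mfps_unit[of "eta h"] unfolding eta_ordge_iff[symmetric] ordge_1_iff by blast

lemma ypow_prime:
  fixes f g :: "('n::finite option, 'k::field) mfps"
  shows "f * g \<in> ypow 1 \<longleftrightarrow> f \<in> ypow 1 \<or> g \<in> ypow 1"
  unfolding eta_ordge_iff[symmetric] ordge_1_iff by (simp add: coeff_mult_zero)

lemma var_None_power_notin: "mfps_var None ^ e \<notin> (ypow 1 :: ('n::finite option, 'k::field) mfps set)"
  unfolding eta_ordge_iff[symmetric] ordge_1_iff eta_var_None_power by (simp add: coeff_const)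

lemma ypow_decomp:
  fixes f :: "('n::finite option, 'k::field) mfps"
  assumes "f \<in> ypow (M + N)"
  obtains h where "f = (\<Sum>\<mu> | tdeg \<mu> = M. monom (ocons 0 \<mu>) * h \<mu>)" "\<And>\<mu>. tdeg \<mu> = M \<Longrightarrow> h \<mu> \<in> ypow N"
proof -
  let ?A = "(\<lambda>\<mu>. ocons 0 \<mu>) ` {\<mu> :: 'n \<Rightarrow> nat. tdeg \<mu> = M}"
  have "\<exists>\<nu>\<in>?A. \<nu> \<le> \<kappa>" if "mfps_coeff f \<kappa> \<noteq> 0" for \<kappa>
  proof -
    have "M + N \<le> tdeg (ypart \<kappa>)"
      using that assms by (auto simp: ypow_def not_less[symmetric])
    then obtain \<nu> where "\<nu> \<le> ypart \<kappa>" "tdeg \<nu> = M"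
      using exists_le_tdeg[of M "ypart \<kappa>"] by auto
    then have "ocons 0 \<nu> \<le> ocons (\<kappa> None) (ypart \<kappa>)" by simp
    then show ?thesis using \<open>tdeg \<nu> = M\<close> by (auto simp: ocons_ypart)
  qed
  then obtain h where h: "f = (\<Sum>\<nu>\<in>?A. monom \<nu> * h \<nu>)"
    "\<And>\<nu> \<kappa>. mfps_coeff (h \<nu>) \<kappa> = 0 \<or> mfps_coeff (h \<nu>) \<kappa> = mfps_coeff f (\<lambda>i. \<nu> i + \<kappa> i)"
    using monom_decomp[of ?A f] finite_tdeg_eq by blast
  have "inj_on (\<lambda>\<mu>. ocons 0 \<mu>) {\<mu> :: 'n \<Rightarrow> nat. tdeg \<mu> = M}" by (auto simp: inj_on_def)
  then have "f = (\<Sum>\<mu> | tdeg \<mu> = M. monom (ocons 0 \<mu>) * h (ocons 0 \<mu>))"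
    unfolding h(1) by (simp add: sum.reindex)
  moreover have "h (ocons 0 \<mu>) \<in> ypow N" if "tdeg \<mu> = M" for \<mu>
    unfolding ypow_def
  proof clarify
    fix \<kappa> :: "'n option \<Rightarrow> nat" assume \<kappa>: "tdeg (ypart \<kappa>) < N"
    have "tdeg (\<lambda>i. \<mu> i + \<kappa> (Some i)) < M + N" using \<kappa> that by simp
    then have "mfps_coeff f (\<lambda>i. ocons 0 \<mu> i + \<kappa> i) = 0"
      using assms by (simp add: ypow_def)
    then show "mfps_coeff (h (ocons 0 \<mu>)) \<kappa> = 0" using h(2)[of "ocons 0 \<mu>" \<kappa>] by simp
  qed
  ultimately show ?thesis by (rule that[of "\<lambda>\<mu>. h (ocons 0 \<mu>)"])
qed

section \<open>Denominators in \<open>X\<close> and extended ideals\<close>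

lemma fls_clear:
  assumes "- fls_subdegree z \<le> int a"
  shows "fls_X ^ a * z = fps_to_fls (Abs_fps (\<lambda>j. fls_nth (fls_X ^ a * z) (int j)))"
proof (rule fls_eqI)
  fix n
  show "fls_nth (fls_X ^ a * z) n = fls_nth (fps_to_fls (Abs_fps (\<lambda>j. fls_nth (fls_X ^ a * z) (int j)))) n"
  proof (cases "n < 0")
    case True
    then have "n - int a < fls_subdegree z" using assms by simp
    then show ?thesis using True by (simp add: fls_X_power_times_conv_shift)
  qed simp
qed

text \<open>A common denominator exists only for finitely many coefficients, hence the approximation
  modulo \<open>ordge M\<close>.\<close>

lemma clear_denominators:
  fixes g :: "'i \<Rightarrow> ('n::finite, 'k::field fls) mfps"
  assumes "finite S"
  obtains a g' where "\<And>i. i \<in> S \<Longrightarrow> mfps_const (fls_X ^ a) * g i - eta (g' i) \<in> ordge M"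
proof -
  let ?T = "S \<times> {\<mu> :: 'n \<Rightarrow> nat. tdeg \<mu> < M}"
  define b where "b p = nat (- fls_subdegree (mfps_coeff (g (fst p)) (snd p)))" for p
  define a where "a = (\<Sum>p\<in>?T. b p)"
  have fin: "finite ?T" using assms finite_tdeg_less by auto
  have ba: "b p \<le> a" if "p \<in> ?T" for p
    unfolding a_def using that fin by (intro member_le_sum) auto
  define g' :: "'i \<Rightarrow> ('n option, 'k) mfps" where
    "g' i = Abs_mfps (\<lambda>\<kappa>. fls_nth (fls_X ^ a * mfps_coeff (g i) (ypart \<kappa>)) (int (\<kappa> None)))" for i
  have "mfps_const (fls_X ^ a) * g i - eta (g' i) \<in> ordge M" if "i \<in> S" for i
    unfolding ordge_def
  proof clarify
    fix \<mu> :: "'n \<Rightarrow> nat" assume "tdeg \<mu> < M"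
    then have "b (i, \<mu>) \<le> a" using ba that by simp
    then have "fls_X ^ a * mfps_coeff (g i) \<mu>
        = fps_to_fls (Abs_fps (\<lambda>j. fls_nth (fls_X ^ a * mfps_coeff (g i) \<mu>) (int j)))"
      by (intro fls_clear) (simp add: b_def)
    then show "mfps_coeff (mfps_const (fls_X ^ a) * g i - eta (g' i)) \<mu> = 0"
      by (simp add: coeff_eta xslice_def g'_def)
  qed
  then show ?thesis using that by blast
qed

lemma const_X_unit: "mfps_const (inverse (fls_X ^ a)) * mfps_const (fls_X ^ a) = (1 :: ('n::finite, 'k::field fls) mfps)"
  by (simp flip: const_mult)

lemma const_X_mem_iff:
  fixes I :: "('n::finite, 'k::field fls) mfps set"
  assumes "is_ideal I"
  shows "mfps_const (fls_X ^ a) * f \<in> I \<longleftrightarrow> f \<in> I"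
proof
  assume "mfps_const (fls_X ^ a) * f \<in> I"
  then have "mfps_const (inverse (fls_X ^ a)) * mfps_const (fls_X ^ a) * f \<in> I"
    using ideal_mult[OF assms] by (simp add: mult.assoc)
  then show "f \<in> I" by (simp only: const_X_unit mult_1_left)
qed (rule ideal_mult[OF assms])

definition etaI :: "('n::finite option, 'k::field) mfps set \<Rightarrow> ('n, 'k fls) mfps set"
  where "etaI I = ideal_gen (eta ` I)"

lemma is_ideal_etaI [simp]: "is_ideal (etaI I)"
  by (simp add: etaI_def idl.subspace_span)

lemma etaI_base: "f \<in> I \<Longrightarrow> eta f \<in> etaI I"
  by (auto simp: etaI_def intro: idl.span_base)

lemma etaI_subset_iff: "is_ideal J \<Longrightarrow> etaI I \<subseteq> J \<longleftrightarrow> (\<forall>f\<in>I. eta f \<in> J)"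
  using etaI_base[of _ I] idl.span_minimal[of "eta ` I" J] by (auto simp: etaI_def)

lemma etaI_mono: "I \<subseteq> J \<Longrightarrow> etaI I \<subseteq> etaI J"
  by (auto simp: etaI_subset_iff etaI_base)

lemma etaI_igen: "etaI (igen x n) = igen (\<lambda>i. eta (x i)) n"
proof
  show "etaI (igen x n) \<subseteq> igen (\<lambda>i. eta (x i)) n"
    by (auto simp: etaI_subset_iff eta_sum igen_sum elim!: igenE)
  show "igen (\<lambda>i. eta (x i)) n \<subseteq> etaI (igen x n)"
    by (auto simp: igen_subset_iff etaI_base igen_base)
qed

lemma etaI_UNIV_of_notin: 
  assumes "h \<in> I" "h \<notin> ypow 1"
  shows "etaI I = UNIV"
proof -
  obtain u where "eta h * u = 1" using eta_unit[OF assms(2)] by blast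
  then have "1 \<in> etaI I" using ideal_mult'[OF is_ideal_etaI etaI_base[OF assms(1)], of u] by simp
  then show ?thesis using ideal_UNIV_iff[OF is_ideal_etaI] by blast
qed

text \<open>Nakayama's lemma over the complement of a prime, by elimination of one generator at a time.\<close>

lemma nakayama_elimination:
  fixes p :: "'i \<Rightarrow> 'a::comm_ring_1"
  assumes "finite A" and C: "is_ideal C" and Q: "is_ideal Q" "1 \<notin> Q" "\<And>a b. a * b \<in> Q \<Longrightarrow> a \<in> Q \<or> b \<in> Q"
    and "\<And>i. i \<in> A \<Longrightarrow> \<exists>h c. h \<notin> Q \<and> (\<forall>j. c j \<in> Q) \<and> h * p i - (\<Sum>j\<in>A. c j * p j) \<in> C"
  shows "\<exists>h. h \<notin> Q \<and> (\<forall>i\<in>A. h * p i \<in> C)"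
  using assms(1,6)
proof (induction A rule: finite_induct)
  case empty
  then show ?case using Q(2) by auto
next
  case (insert k A)
  obtain h0 c0 where 0: "h0 \<notin> Q" "\<And>j. c0 j \<in> Q" "h0 * p k - (\<Sum>j\<in>insert k A. c0 j * p j) \<in> C"
    using insert.prems[of k] by blast
  define u where "u = h0 - c0 k"
  have u: "u \<notin> Q"
  proof
    assume "u \<in> Q"
    then have "u + c0 k \<in> Q" using 0(2) by (intro idl.subspace_add[OF Q(1)])
    then show False using 0(1) by (simp add: u_def)
  qed
  have uk: "u * p k - (\<Sum>j\<in>A. c0 j * p j) \<in> C"
    using 0(3) insert.hyps by (simp add: u_def algebra_simps)
  have "\<exists>h c. h \<notin> Q \<and> (\<forall>j. c j \<in> Q) \<and> h * p i - (\<Sum>j\<in>A. c j * p j) \<in> C" if "i \<in> A" for i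
  proof -
    have "i \<in> insert k A" using that by simp
    then obtain h c where hc: "h \<notin> Q" "\<And>j. c j \<in> Q" "h * p i - (\<Sum>j\<in>insert k A. c j * p j) \<in> C"
      using insert.prems by metis
    have "u * (h * p i - (\<Sum>j\<in>insert k A. c j * p j)) + c k * (u * p k - (\<Sum>j\<in>A. c0 j * p j)) \<in> C"
      by (intro idl.subspace_add[OF C] ideal_mult[OF C] hc(3) uk)
    also have "u * (h * p i - (\<Sum>j\<in>insert k A. c j * p j)) + c k * (u * p k - (\<Sum>j\<in>A. c0 j * p j))
        = (u * h) * p i - (\<Sum>j\<in>A. (u * c j + c k * c0 j) * p j)"
      using insert.hyps
      by (simp add: sum_distrib_left distrib_right sum.distrib algebra_simps)
    finally have "(u * h) * p i - (\<Sum>j\<in>A. (u * c j + c k * c0 j) * p j) \<in> C" .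
    moreover have "u * h \<notin> Q" using u hc(1) Q(3) by blast
    moreover have "\<forall>j. u * c j + c k * c0 j \<in> Q"
      using 0(2) hc(2) by (intro allI idl.subspace_add[OF Q(1)] ideal_mult[OF Q(1)])
    ultimately show ?thesis
      by (intro exI[of _ "u * h"] exI[of _ "\<lambda>j. u * c j + c k * c0 j"]) simp
  qed
  then obtain h where h: "h \<notin> Q" "\<And>i. i \<in> A \<Longrightarrow> h * p i \<in> C"
    using insert.IH by blast
  have "h * (u * p k - (\<Sum>j\<in>A. c0 j * p j)) + (\<Sum>j\<in>A. c0 j * (h * p j)) \<in> C"
    by (intro idl.subspace_add[OF C] idl.subspace_sum[OF C] ideal_mult[OF C uk] ideal_mult[OF C h(2)])
  then have "(u * h) * p k \<in> C"
    by (simp add: sum_distrib_left algebra_simps)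
  moreover have "(u * h) * p i \<in> C" if "i \<in> A" for i
    using ideal_mult[OF C h(2)[OF that], of u] by (simp add: mult.assoc)
  moreover have "u * h \<notin> Q" using u h(1) Q(3) by blast
  ultimately show ?case by blast
qed

text \<open>After localization at \<open>(Y)\<close>, the ideal contains a power of the maximal
  ideal. Becoming the unit ideal there is allowed.\<close>

definition ylocal :: "('n::finite option, 'k::field) mfps set \<Rightarrow> bool"
  where "ylocal C \<longleftrightarrow> (\<exists>h M. h \<notin> ypow 1 \<and> (\<forall>f\<in>ypow M. h * f \<in> C))"

lemma ylocal_mono: "ylocal C \<Longrightarrow> C \<subseteq> D \<Longrightarrow> ylocal D"
  unfolding ylocal_def by blast

lemma one_notin_ypow: "1 \<notin> (ypow 1 :: ('n::finite option, 'k::field) mfps set)"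
  using var_None_power_notin[of 0] by simp

text \<open>Descent from the completion to the localization: coefficients in
  \<open>k((X))[[Y]]\<close> are approximated by fractions with denominator a power of
  \<open>X\<close>, and Nakayama's lemma removes the error.\<close>

lemma ylocal_of_eta:
  fixes x :: "nat \<Rightarrow> ('n::finite option, 'k::field) mfps"
  assumes M: "ordge M \<subseteq> igen (\<lambda>i. eta (x i)) r"
  shows "ylocal (igen x r)"
proof -
  let ?C = "igen x r" and ?A = "{\<mu> :: 'n \<Rightarrow> nat. tdeg \<mu> = M}"
  let ?p = "\<lambda>\<mu> :: 'n \<Rightarrow> nat. monom (ocons 0 \<mu>) :: ('n option, 'k) mfps"
  have "\<exists>h c. h \<notin> ypow 1 \<and> (\<forall>j. c j \<in> ypow 1) \<and> h * ?p \<mu> - (\<Sum>\<nu>\<in>?A. c \<nu> * ?p \<nu>) \<in> ?C" if "\<mu> \<in> ?A" for \<mu>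
  proof -
    have "eta (?p \<mu>) \<in> ordge M"
      using that monom_ordge[of \<mu>] by (simp add: eta_monom)
    then have "eta (?p \<mu>) \<in> igen (\<lambda>i. eta (x i)) r" using M by blast
    then obtain \<xi> where \<xi>: "eta (?p \<mu>) = (\<Sum>i<r. \<xi> i * eta (x i))" by (rule igenE)
    \<comment> \<open>Precision \<open>M + 1\<close> puts the error into \<open>(Y)\<close> times
      the span of the monomials \<open>?p \<nu>\<close>, as the elimination requires.\<close>
    obtain a \<xi>' where a: "\<And>i. i \<in> {..<r} \<Longrightarrow> mfps_const (fls_X ^ a) * \<xi> i - eta (\<xi>' i) \<in> ordge (M + 1)"
      using clear_denominators[of "{..<r}" \<xi> "M + 1"] by blast
    define e where "e = mfps_var None ^ a * ?p \<mu> - (\<Sum>i<r. \<xi>' i * x i)"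
    have "eta e = (\<Sum>i<r. (mfps_const (fls_X ^ a) * \<xi> i - eta (\<xi>' i)) * eta (x i))"
      unfolding e_def eta_diff eta_mult eta_sum eta_var_None_power \<xi>
      by (simp add: sum_distrib_left left_diff_distrib sum_subtractf mult.assoc)
    also have "\<dots> \<in> ordge (M + 1)"
      using a by (intro idl.subspace_sum ideal_mult') auto
    finally have "e \<in> ypow (M + 1)" by (simp only: eta_ordge_iff)
    then obtain c where c: "e = (\<Sum>\<nu>\<in>?A. ?p \<nu> * c \<nu>)" "\<And>\<nu>. tdeg \<nu> = M \<Longrightarrow> c \<nu> \<in> ypow 1"
      using ypow_decomp by blast
    \<comment> \<open>Extended by 0, so that the coefficients lie in \<open>ypow 1\<close> at every
      index.\<close>
    define c' where "c' \<nu> = (if tdeg \<nu> = M then c \<nu> else 0)" for \<nu>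
    have eq: "mfps_var None ^ a * ?p \<mu> - (\<Sum>\<nu>\<in>?A. c' \<nu> * ?p \<nu>) = (\<Sum>i<r. \<xi>' i * x i)"
    proof -
      have "(\<Sum>\<nu>\<in>?A. c' \<nu> * ?p \<nu>) = e"
        unfolding c(1) by (intro sum.cong) (auto simp: c'_def mult.commute)
      then show ?thesis by (simp add: e_def)
    qed
    have c': "c' \<nu> \<in> ypow 1" for \<nu>
      using c(2) by (simp add: c'_def)
    show ?thesis
    proof (intro exI[of _ "mfps_var None ^ a"] exI[of _ c'] conjI allI)
      show "mfps_var None ^ a * ?p \<mu> - (\<Sum>\<nu>\<in>?A. c' \<nu> * ?p \<nu>) \<in> ?C"
        unfolding eq by (rule igen_sum)
    qed (rule var_None_power_notin c')+
  qed
  note ex = this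
  have prime: "a \<in> ypow 1 \<or> b \<in> ypow 1" if "a * b \<in> ypow 1" for a b :: "('n option, 'k) mfps"
    using that ypow_prime by blast
  have "\<exists>h. h \<notin> ypow 1 \<and> (\<forall>\<mu>\<in>?A. h * ?p \<mu> \<in> ?C)"
    by (rule nakayama_elimination[OF finite_tdeg_eq is_ideal_igen is_ideal_ypow one_notin_ypow prime ex])
  then obtain h where h: "h \<notin> ypow 1" "\<forall>\<mu>\<in>?A. h * ?p \<mu> \<in> ?C" by blast
  have "h * f \<in> ?C" if "f \<in> ypow M" for f
  proof -
    have "f \<in> ypow (M + 0)" using that by simp
    then obtain c where "f = (\<Sum>\<mu>\<in>?A. ?p \<mu> * c \<mu>)"
      using ypow_decomp by blast
    then have "h * f = (\<Sum>\<mu>\<in>?A. (h * ?p \<mu>) * c \<mu>)"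
      by (simp add: sum_distrib_left mult.assoc)
    also have "\<dots> \<in> ?C"
    proof (rule idl.subspace_sum[OF is_ideal_igen])
      fix \<mu> assume "\<mu> \<in> ?A"
      then have "h * ?p \<mu> \<in> ?C" using h(2) by blast
      then show "h * ?p \<mu> * c \<mu> \<in> ?C" by (rule ideal_mult'[OF is_ideal_igen])
    qed
    finally show ?thesis .
  qed
  then show ?thesis using h(1) unfolding ylocal_def by blast
qed

text \<open>The multiplier \<open>h\<close> becomes a unit in \<open>k((X))[[Y]]\<close>, so the
  monomials of degree \<open>M\<close> enter the extended ideal.\<close>

lemma ylocal_etaI_primary:
  fixes C :: "('n::finite option, 'k::field) mfps set"
  assumes "ylocal C"
  obtains M where "ordge M \<subseteq> etaI C"
proof -
  obtain h M where h: "h \<notin> ypow 1" "\<And>f. f \<in> ypow M \<Longrightarrow> h * f \<in> C"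
    using assms unfolding ylocal_def by blast
  obtain u where u: "eta h * u = 1" using eta_unit[OF h(1)] by blast
  have mono: "monom \<mu> \<in> etaI C" if "tdeg \<mu> = M" for \<mu>
  proof -
    have em: "eta (monom (ocons 0 \<mu>) :: ('n option, 'k) mfps) = monom \<mu>" by (simp add: eta_monom)
    have "(monom (ocons 0 \<mu>) :: ('n option, 'k) mfps) \<in> ypow M"
      unfolding eta_ordge_iff[symmetric] em using that monom_ordge by blast
    then have "eta (h * monom (ocons 0 \<mu>)) \<in> etaI C" by (intro etaI_base h(2))
    then have "eta h * monom \<mu> \<in> etaI C" by (simp add: em)
    then have "u * (eta h * monom \<mu>) \<in> etaI C" by (rule ideal_mult[OF is_ideal_etaI])
    moreover have "u * (eta h * monom \<mu>) = (eta h * u) * monom \<mu>" by (simp only: mult_ac)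
    ultimately show ?thesis by (simp add: u)
  qed
  have "ordge M \<subseteq> etaI C"
  proof
    fix f :: "('n, 'k fls) mfps" assume "f \<in> ordge M"
    then have "f \<in> ordge (M + 0)" by simp
    then obtain c where "f = (\<Sum>\<mu> | tdeg \<mu> = M. monom \<mu> * c \<mu>)"
      using ordge_decomp by blast
    also have "\<dots> \<in> etaI C"
      using mono by (intro idl.subspace_sum ideal_mult') auto
    finally show "f \<in> etaI C" .
  qed
  then show ?thesis using that by blast
qed

text \<open>An element of the contraction is brought back into \<open>C\<close> by some multiplier
  outside \<open>(Y)\<close>. The contraction is finitely generated, so a product of multipliers
  serves all its elements.\<close>

lemma ylocal_contraction:
  fixes C :: "('n::finite option, 'k::field) mfps set"
  assumes C: "is_ideal C" and yl: "ylocal C"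
  obtains h where "h \<notin> ypow 1" "\<And>f. eta f \<in> etaI C \<Longrightarrow> h * f \<in> C"
proof -
  obtain h0 M where h0: "h0 \<notin> ypow 1" "\<And>f. f \<in> ypow M \<Longrightarrow> h0 * f \<in> C"
    using yl unfolding ylocal_def by blast
  obtain x r where x: "C = igen x r" using mfps_noetherian[OF C] .
  let ?D = "{f. eta f \<in> etaI C}"
  have "is_ideal ?D"
    by (rule idl.subspaceI) (auto intro: idl.subspace_add ideal_mult idl.subspace_0)
  then obtain d s where d: "?D = igen d s" using mfps_noetherian by blast
  have each: "\<exists>h. h \<notin> ypow 1 \<and> h * f \<in> C" if "f \<in> ?D" for f
  proof -
    have "eta f \<in> igen (\<lambda>i. eta (x i)) r" using that by (simp add: x etaI_igen)
    then obtain \<xi> where \<xi>: "eta f = (\<Sum>i<r. \<xi> i * eta (x i))" by (rule igenE)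
    obtain a \<xi>' where a: "\<And>i. i \<in> {..<r} \<Longrightarrow> mfps_const (fls_X ^ a) * \<xi> i - eta (\<xi>' i) \<in> ordge M"
      using clear_denominators[of "{..<r}" \<xi> M] by blast
    define e where "e = mfps_var None ^ a * f - (\<Sum>i<r. \<xi>' i * x i)"
    have "eta e = (\<Sum>i<r. (mfps_const (fls_X ^ a) * \<xi> i - eta (\<xi>' i)) * eta (x i))"
      unfolding e_def eta_diff eta_mult eta_sum eta_var_None_power \<xi>
      by (simp add: sum_distrib_left left_diff_distrib sum_subtractf mult.assoc)
    also have "\<dots> \<in> ordge M"
      using a by (intro idl.subspace_sum ideal_mult') auto
    finally have "h0 * e \<in> C" by (intro h0(2)) (simp only: eta_ordge_iff)
    moreover have "h0 * (\<Sum>i<r. \<xi>' i * x i) \<in> C"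
      unfolding x by (intro ideal_mult igen_sum is_ideal_igen)
    ultimately have "h0 * e + h0 * (\<Sum>i<r. \<xi>' i * x i) \<in> C"
      by (rule idl.subspace_add[OF C])
    then have "(h0 * mfps_var None ^ a) * f \<in> C"
      by (simp add: e_def algebra_simps)
    then show ?thesis using h0(1) var_None_power_notin ypow_prime by blast
  qed
  have "\<exists>h. h \<notin> ypow 1 \<and> (\<forall>i<s'. h * d i \<in> C)" if "s' \<le> s" for s'
    using that
  proof (induction s')
    case 0
    then show ?case using one_notin_ypow by blast
  next
    case (Suc s')
    then obtain h where h: "h \<notin> ypow 1" "\<forall>i<s'. h * d i \<in> C" by auto
    obtain h' where h': "h' \<notin> ypow 1" "h' * d s' \<in> C"
      using each[of "d s'"] igen_base[of s' s d] Suc.prems d by auto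
    have "(h * h') * d i \<in> C" if "i < Suc s'" for i
    proof (cases "i = s'")
      case True
      then show ?thesis using ideal_mult[OF C h'(2), of h] by (simp add: mult.assoc)
    next
      case False
      then have "h * d i \<in> C" using h(2) that by simp
      then have "h' * (h * d i) \<in> C" by (rule ideal_mult[OF C])
      then show ?thesis by (simp add: mult_ac)
    qed
    then show ?case using h(1) h'(1) ypow_prime by blast
  qed
  then obtain h where h: "h \<notin> ypow 1" "\<forall>i<s. h * d i \<in> C" by blast
  have "h * f \<in> C" if "eta f \<in> etaI C" for f
  proof -
    have "f \<in> igen d s" using that d by blast
    then obtain c where "f = (\<Sum>i<s. c i * d i)" by (rule igenE)
    then have "h * f = (\<Sum>i<s. c i * (h * d i))" by (simp add: sum_distrib_left mult_ac)
    also have "\<dots> \<in> C"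
    proof (rule idl.subspace_sum[OF C])
      fix i assume "i \<in> {..<s}"
      then have "h * d i \<in> C" using h(2) by simp
      then show "c i * (h * d i) \<in> C" by (rule ideal_mult[OF C])
    qed
    finally show ?thesis .
  qed
  then show ?thesis using that h(1) by blast
qed

text \<open>An element of the quotient upstairs is a fraction of the form \<open>eta (g' ())\<close>
  over a power of \<open>X\<close>, up to an element of the extension of \<open>C\<close>; after
  multiplication by the common \<open>h\<close> its numerator lies in \<open>C : J\<close>.\<close>

theorem etaI_quotient:
  fixes C J :: "('n::finite option, 'k::field) mfps set"
  assumes C: "is_ideal C" and yl: "ylocal C"
  shows "etaI (ideal_quotient C J) = ideal_quotient (etaI C) (etaI J)"
proof
  show "etaI (ideal_quotient C J) \<subseteq> ideal_quotient (etaI C) (etaI J)"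
    unfolding etaI_subset_iff[OF is_ideal_quotient[OF is_ideal_etaI]]
  proof
    fix f assume f: "f \<in> ideal_quotient C J"
    have "is_ideal {g. eta f * g \<in> etaI C}"
      by (rule idl.subspaceI)
        (auto simp: distrib_left mult.left_commute intro: idl.subspace_add ideal_mult idl.subspace_0)
    moreover have "eta g \<in> {g. eta f * g \<in> etaI C}" if "g \<in> J" for g
      using f that etaI_base[of "f * g" C] by (simp add: ideal_quotient_def)
    ultimately have "etaI J \<subseteq> {g. eta f * g \<in> etaI C}"
      by (simp add: etaI_subset_iff)
    then show "eta f \<in> ideal_quotient (etaI C) (etaI J)"
      by (auto simp: ideal_quotient_def)
  qed
  show "ideal_quotient (etaI C) (etaI J) \<subseteq> etaI (ideal_quotient C J)"
  proof
    fix g assume g: "g \<in> ideal_quotient (etaI C) (etaI J)"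
    obtain M where M: "ordge M \<subseteq> etaI C" using ylocal_etaI_primary[OF yl] .
    obtain h where h: "h \<notin> ypow 1" "\<And>f. eta f \<in> etaI C \<Longrightarrow> h * f \<in> C"
      using ylocal_contraction[OF C yl] by blast
    obtain a g' where "\<And>i. i \<in> {()} \<Longrightarrow> mfps_const (fls_X ^ a) * g - eta (g' i) \<in> ordge M"
      using clear_denominators[of "{()}" "\<lambda>_. g" M] by blast
    then have a: "mfps_const (fls_X ^ a) * g - eta (g' ()) \<in> etaI C" using M by blast
    have "h * g' () \<in> ideal_quotient C J"
      unfolding ideal_quotient_def
    proof clarify
      fix f assume "f \<in> J"
      then have "g * eta f \<in> etaI C"
        using g etaI_base[of f J] by (simp add: ideal_quotient_def)
      then have "mfps_const (fls_X ^ a) * (g * eta f) \<in> etaI C" by (rule ideal_mult[OF is_ideal_etaI])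
      then have "eta f * (mfps_const (fls_X ^ a) * g) \<in> etaI C" by (simp only: mult_ac)
      moreover have "eta f * (mfps_const (fls_X ^ a) * g - eta (g' ())) \<in> etaI C"
        using a by (intro ideal_mult) auto
      ultimately have "eta f * (mfps_const (fls_X ^ a) * g) - eta f * (mfps_const (fls_X ^ a) * g - eta (g' ())) \<in> etaI C"
        by (intro idl.subspace_diff) auto
      then have "eta (g' () * f) \<in> etaI C" by (simp add: right_diff_distrib mult.commute)
      then show "h * g' () * f \<in> C" using h(2) by (simp add: mult.assoc)
    qed
    then have eh: "eta h * eta (g' ()) \<in> etaI (ideal_quotient C J)"
      unfolding eta_mult[symmetric] by (rule etaI_base)
    obtain u where u: "eta h * u = 1" using eta_unit[OF h(1)] by blast
    have "u * (eta h * eta (g' ())) \<in> etaI (ideal_quotient C J)"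
      by (rule ideal_mult[OF is_ideal_etaI eh])
    moreover have "u * (eta h * eta (g' ())) = (eta h * u) * eta (g' ())" by (simp only: mult_ac)
    ultimately have "eta (g' ()) \<in> etaI (ideal_quotient C J)" by (simp add: u)
    moreover have "mfps_const (fls_X ^ a) * g - eta (g' ()) \<in> etaI (ideal_quotient C J)"
      using a etaI_mono[OF ideal_quotient_superset[OF C]] by blast
    ultimately have "eta (g' ()) + (mfps_const (fls_X ^ a) * g - eta (g' ())) \<in> etaI (ideal_quotient C J)"
      by (intro idl.subspace_add) auto
    then show "g \<in> etaI (ideal_quotient C J)"
      by (simp add: const_X_mem_iff)
  qed
qed

section \<open>From regular sequences in \<open>(Y)\<close> to systems of parameters\<close>

lemma param_var_powers:
  fixes e :: "nat \<Rightarrow> 'v::finite"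
  assumes e: "bij_betw e {..<CARD('v)} UNIV" and M: "M > 0"
  shows "param (\<lambda>i. mfps_var (e i) ^ M :: ('v, 'k::comm_ring_1) mfps)"
    and "pgen (\<lambda>i. mfps_var (e i) ^ M :: ('v, 'k::comm_ring_1) mfps) = ideal_gen ((\<lambda>v. mfps_var v ^ M) ` UNIV)"
proof -
  let ?y = "\<lambda>i. mfps_var (e i) ^ M :: ('v, 'k) mfps"
  have "?y ` {..<CARD('v)} = (\<lambda>v. mfps_var v ^ M) ` e ` {..<CARD('v)}"
    by (simp only: image_image)
  also have "\<dots> = (\<lambda>v. mfps_var v ^ M) ` UNIV"
    by (simp only: bij_betw_imp_surj_on[OF e])
  finally show eq: "pgen ?y = ideal_gen ((\<lambda>v. mfps_var v ^ M) ` UNIV)"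
    by (simp only: pgen_def igen_def)
  have "mfps_var v ^ M \<in> pgen ?y" for v
    unfolding eq by (rule idl.span_base) simp
  then have "ordge (CARD('v) * M) \<subseteq> pgen ?y"
    by (intro ordge_le_of_var_powers) auto
  moreover have "?y i \<in> ordge 1" for i
    using var_power_ordge[of "e i" M] ordge_mono[of 1 M] M by auto
  ultimately show "param ?y"
    unfolding param_def pgen_def by blast
qed

text \<open>The sequence \<open>x\<close> is compared with high powers of the variables
  \<open>Y\<close>. Under \<open>regrel\<close>, what \<open>x\<close> annihilates modulo these
  powers corresponds to what the powers annihilate modulo \<open>x\<close>, and by the Noetherian
  property a fixed exponent \<open>M0\<close> already annihilates the latter.\<close>

theorem regular_localizes_to_param:
  fixes x :: "nat \<Rightarrow> ('n::finite option, 'k::field) mfps"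
  assumes x: "reg CARD('n) x" and xy: "\<And>i. i < CARD('n) \<Longrightarrow> x i \<in> ypow 1"
  shows "param (\<lambda>i. eta (x i))"
proof -
  let ?n = "CARD('n)"
  let ?C = "igen x ?n" and ?X = "\<lambda>i. eta (x i)"
  have C: "is_ideal ?C" by simp
  \<comment> \<open>The elements annihilated modulo \<open>(x)\<close> by the \<open>M\<close>-th
    powers of the variables \<open>Y\<close>. Their union over \<open>M\<close> is finitely
    generated, which gives the uniform exponent \<open>M0\<close>.\<close>
  let ?S = "\<lambda>M u. \<forall>i. mfps_var (Some i) ^ M * u \<in> ?C"
  have S_mono: "?S N u" if "?S M u" "M \<le> N" for M N u
  proof
    fix i
    have "mfps_var (Some i) ^ (N - M) * (mfps_var (Some i) ^ M * u) \<in> ?C"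
      by (rule ideal_mult[OF C]) (use that(1) in blast)
    moreover have "mfps_var (Some i) ^ (N - M) * (mfps_var (Some i) ^ M * u) = mfps_var (Some i) ^ N * u"
      using that(2) by (simp flip: power_add mult.assoc)
    ultimately show "mfps_var (Some i) ^ N * u \<in> ?C" by (simp only:)
  qed
  let ?U = "{u. \<exists>M. ?S M u}"
  have "is_ideal ?U"
  proof (rule idl.subspaceI)
    show "0 \<in> ?U" using idl.subspace_0[OF C] by simp
    show "c * u \<in> ?U" if u: "u \<in> ?U" for c u
    proof -
      obtain M where "?S M u" using u by blast
      then have "?S M (c * u)"
        using ideal_mult[OF C] by (simp add: mult.left_commute)
      then show ?thesis by blast
    qed
    show "u + v \<in> ?U" if uv: "u \<in> ?U" "v \<in> ?U" for u v
    proof -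
      obtain M N where MN: "?S M u" "?S N v" using uv by blast
      then have "?S (max M N) u" "?S (max M N) v"
        using S_mono by (meson max.cobounded1 max.cobounded2)+
      then have "?S (max M N) (u + v)"
        by (simp add: distrib_left idl.subspace_add[OF C])
      then show ?thesis by blast
    qed
  qed
  then obtain d s where d: "?U = igen d s" using mfps_noetherian by blast
  have "\<exists>M. \<forall>i<s. ?S M (d i)"
  proof -
    have "\<exists>M. ?S M (d i)" if "i < s" for i
      using igen_base[OF that, of d] d by blast
    then obtain f where f: "\<And>i. i < s \<Longrightarrow> ?S (f i) (d i)" by metis
    have "f i \<le> (\<Sum>i<s. f i)" if "i < s" for i
      using that by (intro member_le_sum) auto
    then show ?thesis using f S_mono by meson
  qed
  then obtain M0 where M0d: "\<And>i. i < s \<Longrightarrow> ?S M0 (d i)" by blast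
  have M0: "?S M0 u" if u: "?S M u" for M u
  proof
    fix i
    have "u \<in> igen d s" using u d by blast
    then obtain c where c: "u = (\<Sum>j<s. c j * d j)" by (rule igenE)
    have "mfps_var (Some i) ^ M0 * u = (\<Sum>j<s. c j * (mfps_var (Some i) ^ M0 * d j))"
      by (simp add: c sum_distrib_left mult.left_commute)
    also have "\<dots> \<in> ?C"
    proof (rule idl.subspace_sum[OF C])
      fix j assume "j \<in> {..<s}"
      then have "mfps_var (Some i) ^ M0 * d j \<in> ?C" using M0d by blast
      then show "c j * (mfps_var (Some i) ^ M0 * d j) \<in> ?C" by (rule ideal_mult[OF C])
    qed
    finally show "mfps_var (Some i) ^ M0 * u \<in> ?C" .
  qed
  \<comment> \<open>Beyond \<open>?n * M0\<close>, the degree from which every monomial has an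
    exponent at least \<open>M0\<close>; the added 1 provides the error term for Nakayama's
    lemma.\<close>
  define M where "M = ?n * M0 + 1"
  have "M > 0" by (simp add: M_def)
  obtain e :: "nat \<Rightarrow> 'n" where e: "bij_betw e {..<?n} UNIV" by (rule ex_enum)
  define y :: "nat \<Rightarrow> ('n option, 'k) mfps" where "y i = mfps_var (Some (e i)) ^ M" for i
  have y: "reg ?n y"
    unfolding y_def using bij_betw_imp_inj_on[OF e]
    by (intro reg_var_powers) (simp add: inj_on_def)
  define z :: "nat \<Rightarrow> ('n, 'k fls) mfps" where "z i = mfps_var (e i) ^ M" for i
  have z: "param z" "pgen z = ideal_gen ((\<lambda>v. mfps_var v ^ M) ` UNIV)"
    unfolding z_def by (rule param_var_powers[OF e \<open>M > 0\<close>])+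
  have "y ` {..<?n} = (\<lambda>w. mfps_var w ^ M) ` Some ` e ` {..<?n}"
    by (auto simp: image_image y_def)
  also have "\<dots> = (\<lambda>w. mfps_var w ^ M) ` range Some"
    by (simp only: bij_betw_imp_surj_on[OF e])
  finally have y_gen: "igen y ?n = ideal_gen ((\<lambda>w. mfps_var w ^ M) ` range Some)"
    by (simp only: igen_def)
  have contract: "f \<in> igen y ?n \<longleftrightarrow> eta f \<in> pgen z" for f
    unfolding y_gen z(2) power_ideal_iff
  proof safe
    fix \<mu> :: "'n \<Rightarrow> nat"
    assume *: "\<forall>\<kappa>. (\<forall>w\<in>range Some. \<kappa> w < M) \<longrightarrow> mfps_coeff f \<kappa> = 0" and "\<forall>v\<in>UNIV. \<mu> v < M"
    then have "mfps_coeff f (ocons j \<mu>) = 0" for j by simp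
    then show "mfps_coeff (eta f) \<mu> = 0"
      by (simp add: coeff_eta xslice_def fps_eq_iff)
  next
    fix \<kappa> :: "'n option \<Rightarrow> nat"
    assume *: "\<forall>\<mu>. (\<forall>v\<in>UNIV. \<mu> v < M) \<longrightarrow> mfps_coeff (eta f) \<mu> = 0" and "\<forall>w\<in>range Some. \<kappa> w < M"
    then have "mfps_coeff (eta f) (ypart \<kappa>) = 0" by simp
    then have "mfps_coeff f (ocons (\<kappa> None) (ypart \<kappa>)) = 0"
      by (simp add: coeff_eta xslice_def fps_eq_iff)
    then show "mfps_coeff f \<kappa> = 0" by (simp only: ocons_ypart)
  qed
  let ?b = "ideal_gen (?X ` {..<?n} \<union> (\<lambda>v. mfps_var v ^ M) ` UNIV)"
  have b: "is_ideal ?b" by (rule idl.subspace_span)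
  have xb: "?X i \<in> ?b" if "i < ?n" for i
    using that by (auto intro: idl.span_base)
  have zb: "pgen z \<subseteq> ?b"
    unfolding z(2) by (intro idl.span_mono) auto
  have var_b: "mfps_var i ^ M0 \<in> ?b" for i
  proof (rule ccontr)
    assume notin: "mfps_var i ^ M0 \<notin> ?b"
    obtain N where N: "ordge N \<subseteq> pgen z" using param_primary[OF z(1)] by blast
    have Nb: "ordge N \<subseteq> ?b" using N zb by blast
    obtain B where B: "nf_basis ?b B" using ex_nf_basis[OF b Nb] by blast
    \<comment> \<open>By duality modulo the powers \<open>z\<close>, a functional that separates the
      power from \<open>?b\<close> becomes an element \<open>g\<close> annihilated by
      \<open>x\<close> but not by \<open>mfps_var i ^ M0\<close>.\<close>
    obtain \<nu> where \<nu>: "\<nu> \<in> B" "nf ?b B (mfps_var i ^ M0) \<nu> \<noteq> 0"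
      using nf_eq_0_iff[OF b B] notin by blast
    have van: "nf ?b B f \<nu> = 0" if "f \<in> ?b" for f
      using nf_eq_0_iff[OF b B] that \<nu>(1) by blast
    obtain \<phi> where \<phi>: "dualizing (pgen z) \<phi>" using ex_dualizing[OF z(1)] .
    obtain g where g: "\<And>f. nf ?b B f \<nu> = \<phi> (g * f)"
      using dualizing_represents[OF is_ideal_pgen N \<phi> klinear_nf[OF b B \<nu>(1)]] van zb by blast
    have gx: "g * ?X j \<in> pgen z" if "j < ?n" for j
    proof -
      have "\<phi> (k * (g * ?X j)) = 0" for k
        using g[of "k * ?X j"] van[OF ideal_mult[OF b xb[OF that]]] by (simp add: mult.left_commute)
      then show ?thesis using \<phi> by (auto simp: dualizing_def)
    qed
    have gi: "g * mfps_var i ^ M0 \<notin> pgen z"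
      using \<phi> g[of "mfps_var i ^ M0"] \<nu>(2) by (auto simp: dualizing_def)
    obtain a g' where "\<And>k. k \<in> {()} \<Longrightarrow> mfps_const (fls_X ^ a) * g - eta (g' k) \<in> ordge N"
      using clear_denominators[of "{()}" "\<lambda>_. g" N] by blast
    then have a: "mfps_const (fls_X ^ a) * g - eta (g' ()) \<in> pgen z" using N by blast
    have swap: "g * q \<in> pgen z \<longleftrightarrow> eta (g' ()) * q \<in> pgen z" for q
    proof -
      have "(mfps_const (fls_X ^ a) * g) * q - eta (g' ()) * q \<in> pgen z"
        using ideal_mult'[OF is_ideal_pgen a, of q] by (simp add: left_diff_distrib)
      then have "(mfps_const (fls_X ^ a) * g) * q \<in> pgen z \<longleftrightarrow> eta (g' ()) * q \<in> pgen z"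
        by (rule mem_diff_swap[OF is_ideal_pgen])
      then show ?thesis by (simp only: mult.assoc const_X_mem_iff[OF is_ideal_pgen])
    qed
    have "x j * g' () \<in> igen y ?n" if "j < ?n" for j
      using gx[OF that] swap unfolding contract by (simp add: mult.commute)
    \<comment> \<open>The counterpart \<open>r\<close> of \<open>g' ()\<close> is annihilated by
      \<open>M\<close>-th powers modulo \<open>(x)\<close>, hence by \<open>M0\<close>-th powers;
      translated back, this contradicts the choice of \<open>g\<close>.\<close>
    then obtain r where r: "regrel ?n x y r (g' ())" "\<forall>l<?n. y l * r \<in> ?C"
      using ex_regrel_left[OF y x] by blast
    have "mfps_var (Some v) ^ M * r \<in> ?C" for v
    proof -
      have "v \<in> e ` {..<?n}" using bij_betw_imp_surj_on[OF e] by blast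
      then show ?thesis using r(2) by (auto simp: y_def)
    qed
    then have "mfps_var (Some i) ^ M0 * r \<in> ?C" using M0 by blast
    then have "mfps_var (Some i) ^ M0 * g' () \<in> igen y ?n"
      using regrel_iff[OF y x regrel_scale[OF r(1)]] by blast
    then have "eta (g' ()) * mfps_var i ^ M0 \<in> pgen z"
      unfolding contract by (simp only: eta_mult eta_var_Some_power mult.commute)
    then show False using gi swap by blast
  qed
  \<comment> \<open>The \<open>M\<close>-th powers in \<open>?b\<close> have order one more than
    \<open>?n * M0\<close>, so they count as errors.\<close>
  have "ordge (?n * M0) \<subseteq> igen ?X ?n"
  proof (rule igen_nakayama)
    fix f :: "('n, 'k fls) mfps" assume "f \<in> ordge (?n * M0)"
    then have "f \<in> ?b" using ordge_le_of_var_powers[OF b var_b] by blast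
    then obtain p q where pq: "f = p + q" "p \<in> igen ?X ?n" "q \<in> ideal_gen ((\<lambda>v. mfps_var v ^ M) ` UNIV)"
      unfolding idl.span_Un igen_def by auto
    have "(ideal_gen ((\<lambda>v. mfps_var v ^ M) ` UNIV) :: ('n, 'k fls) mfps set) \<subseteq> ordge M"
      by (rule idl.span_minimal) (auto simp: var_power_ordge)
    then have "f - p \<in> ordge (Suc (?n * M0))" using pq by (auto simp: M_def)
    then show "\<exists>g\<in>igen ?X ?n. f - g \<in> ordge (Suc (?n * M0))" using pq(2) by blast
  qed
  moreover have "?X i \<in> ordge 1" if "i < ?n" for i
    using xy[OF that] by (simp only: eta_ordge_iff)
  ultimately show ?thesis unfolding param_def by blast
qed

section \<open>One-parameter families\<close>

lemma coeff_of_base: "mfps_coeff (mfps_of_base f) (ocons j \<mu>) = (if j = 0 then mfps_coeff f \<mu> else 0)"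
  by (simp add: mfps_of_base_def)

lemma mfps_eq_ocons: "(\<And>j \<mu>. mfps_coeff f (ocons j \<mu>) = mfps_coeff g (ocons j \<mu>)) \<Longrightarrow> f = g"
  by (rule mfps_eqI) (metis ocons_ypart)

lemma of_base_add [simp]: "mfps_of_base (f + g) = mfps_of_base f + mfps_of_base g"
  by (rule mfps_eq_ocons) (simp add: coeff_of_base)

lemma of_base_0 [simp]: "mfps_of_base 0 = 0"
  by (rule mfps_eq_ocons) (simp add: coeff_of_base)

definition rho :: "('n::finite option, 'k::comm_ring_1) mfps \<Rightarrow> ('n, 'k) mfps"
  where "rho f = Abs_mfps (\<lambda>\<mu>. mfps_coeff f (ocons 0 \<mu>))"

lemma coeff_rho: "mfps_coeff (rho f) \<mu> = mfps_coeff f (ocons 0 \<mu>)"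
  by (simp add: rho_def)

lemma rho_add [simp]: "rho (f + g) = rho f + rho g"
  and rho_diff [simp]: "rho (f - g) = rho f - rho g"
  and rho_0 [simp]: "rho 0 = 0"
  by (simp_all add: mfps_eq_iff coeff_rho)

lemma rho_mult [simp]: "rho (f * g) = rho f * rho g"
  by (rule mfps_eqI, simp only: coeff_rho coeff_mult_ocons) (simp add: coeff_mult coeff_rho)

lemma rho_sum: "rho (\<Sum>i\<in>A. f i) = (\<Sum>i\<in>A. rho (f i))"
  by (induction A rule: infinite_finite_induct) auto

lemma rho_of_base [simp]: "rho (mfps_of_base f) = f"
  by (simp add: mfps_eq_iff coeff_rho coeff_of_base)

abbreviation xvar :: "('n::finite option, 'k::comm_ring_1) mfps"
  where "xvar \<equiv> mfps_var None"

lemma xvar_power_ordge: "xvar ^ j * f \<in> ordge j"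
  by (rule ideal_mult'[OF is_ideal_ordge var_power_ordge])

lemma ocons_ge_iff: "ocons N (\<lambda>_. 0) \<le> \<kappa> \<longleftrightarrow> N \<le> \<kappa> None"
  by (auto simp: le_fun_def split: option.splits)

lemma coeff_xvar_mult:
  "mfps_coeff (xvar ^ N * f) (ocons j \<mu>) = (if N \<le> j then mfps_coeff f (ocons (j - N) \<mu>) else 0)"
  by (simp add: monom_var_None_power coeff_monom_mult ocons_ge_iff ocons_diff)

lemma rho_xvar [simp]: "rho xvar = 0"
  by (simp add: mfps_eq_iff coeff_rho coeff_xvar_mult[of 1 1 0, simplified])

lemma xvar_divides:
  assumes "\<And>j \<mu>. j < N \<Longrightarrow> mfps_coeff f (ocons j \<mu>) = 0"
  obtains g where "f = xvar ^ N * g"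
proof
  show "f = xvar ^ N * Abs_mfps (\<lambda>\<kappa>. mfps_coeff f (ocons (\<kappa> None + N) (ypart \<kappa>)))"
    by (rule mfps_eq_ocons) (simp add: coeff_xvar_mult assms)
qed

lemma rho_eq_0:
  assumes "rho f = 0"
  obtains g where "f = xvar * g"
proof -
  have "mfps_coeff f (ocons j \<mu>) = 0" if "j < 1" for j \<mu>
    using assms that by (simp add: mfps_eq_iff coeff_rho)
  then show ?thesis using xvar_divides[of 1 f] that by auto
qed

definition xsum :: "(nat \<Rightarrow> ('n::finite, 'k::comm_ring_1) mfps) \<Rightarrow> ('n option, 'k) mfps"
  where "xsum G = Abs_mfps (\<lambda>\<kappa>. mfps_coeff (G (\<kappa> None)) (ypart \<kappa>))"

lemma xsum_partial: obtains r where "xsum G - (\<Sum>j<N. xvar ^ j * mfps_of_base (G j)) = xvar ^ N * r"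
proof (rule xvar_divides)
  fix k \<mu> assume k: "k < N"
  have "mfps_coeff (xvar ^ j * mfps_of_base (G j)) (ocons k \<mu>) = (if j = k then mfps_coeff (G k) \<mu> else 0)" for j
    by (auto simp: coeff_xvar_mult coeff_of_base)
  then show "mfps_coeff (xsum G - (\<Sum>j<N. xvar ^ j * mfps_of_base (G j))) (ocons k \<mu>) = 0"
    using k by (simp add: xsum_def)
qed (use that in blast)

text \<open>Flatness of the family over \<open>k[[X]]\<close>: multiplication by \<open>X\<close> is
  injective modulo \<open>I\<close>.\<close>

definition xsat :: "('n::finite option, 'k::comm_ring_1) mfps set \<Rightarrow> bool"
  where "xsat I \<longleftrightarrow> (\<forall>f. xvar * f \<in> I \<longrightarrow> f \<in> I)"

lemma xsat_power: "xsat I \<Longrightarrow> xvar ^ j * f \<in> I \<Longrightarrow> f \<in> I"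
  by (induction j) (auto simp: xsat_def mult.assoc)

section \<open>Lifting annihilators from the special member\<close>

lemma is_ideal_rho_image:
  assumes I: "is_ideal I"
  shows "is_ideal (rho ` I)"
proof (rule idl.subspaceI)
  show "0 \<in> rho ` I" using idl.subspace_0[OF I] by (intro image_eqI[of _ _ 0]) auto
  show "p + q \<in> rho ` I" if pq: "p \<in> rho ` I" "q \<in> rho ` I" for p q
  proof -
    obtain f g where "f \<in> I" "g \<in> I" "p = rho f" "q = rho g" using pq by blast
    then show ?thesis using idl.subspace_add[OF I] by (intro image_eqI[of _ _ "f + g"]) auto
  qed
  show "c * p \<in> rho ` I" if p: "p \<in> rho ` I" for c p
  proof -
    obtain f where "f \<in> I" "p = rho f" using p by blast
    then show ?thesis using ideal_mult[OF I] by (intro image_eqI[of _ _ "mfps_of_base c * f"]) auto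
  qed
qed

lemma rho_mem_imp:
  assumes "is_ideal C" "rho r \<in> rho ` C"
  obtains r' where "r - xvar * r' \<in> C"
proof -
  obtain c where c: "c \<in> C" "rho r = rho c" using assms(2) by blast
  then have "rho (r - c) = 0" by simp
  then obtain r' where "r - c = xvar * r'" by (rule rho_eq_0)
  then have "r - xvar * r' = c" by (simp add: algebra_simps)
  then have "r - xvar * r' \<in> C" using c(1) by (simp only:)
  then show ?thesis by (rule that)
qed

text \<open>Saturation lets the remainder be divided by \<open>X\<close> at each stage without
  leaving the set of elements approximable to every order, so the approximation can
  continue.\<close>

lemma xadic_closed:
  assumes C: "C = igen x n" and sat: "xsat C" and f: "\<And>N. \<exists>r. f - xvar ^ N * r \<in> C"
  shows "f \<in> C"
proof -
  have CI: "is_ideal C" by (simp add: C)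
  let ?cl = "\<lambda>r. \<forall>N. \<exists>s. r - xvar ^ N * s \<in> C"
  have "f \<in> igen x n"
  proof (rule igen_iterate[where D = "\<lambda>j. {xvar ^ j * r |r. ?cl r}"])
    show "{xvar ^ j * r |r. ?cl r} \<subseteq> ordge j" for j
      by (auto simp: xvar_power_ordge)
    show "f \<in> {xvar ^ 0 * r |r. ?cl r}" using f by auto
    fix j g assume "g \<in> {xvar ^ j * r |r. ?cl r}"
    then obtain r where r: "g = xvar ^ j * r" "?cl r" by blast
    obtain r' where r': "r - xvar * r' \<in> C" using r(2)[rule_format, of 1] by auto
    then obtain c where c: "r - xvar * r' = (\<Sum>i<n. c i * x i)" unfolding C by (rule igenE)
    have "?cl r'"
    proof
      fix N
      obtain s where s: "r - xvar ^ Suc N * s \<in> C" using r(2) by blast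
      have "(r - xvar ^ Suc N * s) - (r - xvar * r') \<in> C" using s r' by (rule idl.subspace_diff[OF CI])
      then have "xvar * (r' - xvar ^ N * s) \<in> C" by (simp add: algebra_simps)
      then show "\<exists>s. r' - xvar ^ N * s \<in> C" using sat unfolding xsat_def by blast
    qed
    moreover have "g - (\<Sum>i<n. (xvar ^ j * c i) * x i) = xvar ^ Suc j * r'"
    proof -
      have "(\<Sum>i<n. (xvar ^ j * c i) * x i) = xvar ^ j * (r - xvar * r')"
        by (simp add: c sum_distrib_left mult.assoc)
      then show ?thesis by (simp add: r(1) algebra_simps)
    qed
    ultimately show "\<exists>c. (\<forall>i<n. c i \<in> ordge j) \<and> g - (\<Sum>i<n. c i * x i) \<in> {xvar ^ Suc j * r |r. ?cl r}"
      by (intro exI[of _ "\<lambda>i. xvar ^ j * c i"]) (auto simp: xvar_power_ordge)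
  qed
  then show ?thesis by (simp add: C)
qed

text \<open>
  The obstruction to lifting \<open>h\<close> one step further is a linear functional on \<open>rho ` I\<close> vanishing
  on \<open>rho ` C\<close>; since the quotient by \<open>rho ` C\<close> is self-injective, it is multiplication by an element.
\<close>

lemma lift_annihilator_step:
  fixes C I :: "('n::finite option, 'k::field) mfps set"
  assumes C: "is_ideal C" "xsat C" and I: "is_ideal I" "xsat I" "C \<subseteq> I"
    and \<phi>: "dualizing (rho ` C) \<phi>" and M: "ordge M \<subseteq> rho ` C"
    and u: "\<And>f. f \<in> I \<Longrightarrow> \<exists>r. u * f - xvar ^ j * r \<in> C"
  shows "\<exists>g. \<forall>f\<in>I. \<exists>r. (u - xvar ^ j * mfps_of_base g) * f - xvar ^ Suc j * r \<in> C"
proof -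
  have lin: "klinear \<phi>" and van: "\<And>f. f \<in> rho ` C \<Longrightarrow> \<phi> f = 0"
    and nondeg: "\<And>f. (\<And>g. \<phi> (g * f) = 0) \<Longrightarrow> f \<in> rho ` C"
    using \<phi> unfolding dualizing_def by blast+
  have rC: "is_ideal (rho ` C)" and rI: "is_ideal (rho ` I)"
    using is_ideal_rho_image C I by blast+
  \<comment> \<open>By saturation \<open>R f\<close> is determined modulo \<open>C\<close>, so that
    \<open>\<psi>\<close> below is independent of the choice.\<close>
  define R where "R f = (SOME r. u * f - xvar ^ j * r \<in> C)" for f
  have R: "u * f - xvar ^ j * R f \<in> C" if "f \<in> I" for f
    unfolding R_def using someI_ex[OF u[OF that]] .
  define \<psi> where "\<psi> f = \<phi> (rho (R f))" for f
  have \<psi>: "\<psi> f = \<phi> (rho r)" if "f \<in> I" "u * f - xvar ^ j * r \<in> C" for f r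
  proof -
    have "(u * f - xvar ^ j * r) - (u * f - xvar ^ j * R f) \<in> C"
      using idl.subspace_diff[OF C(1) that(2) R[OF that(1)]] .
    then have "xvar ^ j * (R f - r) \<in> C" by (simp add: algebra_simps)
    then have "R f - r \<in> C" by (rule xsat_power[OF C(2)])
    then have "\<phi> (rho (R f - r)) = 0" using van by blast
    then show ?thesis by (simp add: \<psi>_def klinear_diff[OF lin])
  qed
  have \<psi>_add: "\<psi> (f + g) = \<psi> f + \<psi> g" if "f \<in> I" "g \<in> I" for f g
  proof -
    have "(u * f - xvar ^ j * R f) + (u * g - xvar ^ j * R g) \<in> C"
      using R that by (intro idl.subspace_add[OF C(1)])
    then have "u * (f + g) - xvar ^ j * (R f + R g) \<in> C" by (simp add: algebra_simps)
    then show ?thesis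
      using \<psi>[of "f + g"] idl.subspace_add[OF I(1) that] by (simp add: klinear_add[OF lin] \<psi>_def)
  qed
  have \<psi>_mult: "\<psi> (q * f) = \<phi> (rho q * rho (R f))" if "f \<in> I" for q f
  proof -
    have "q * (u * f - xvar ^ j * R f) \<in> C"
      using R that by (intro ideal_mult[OF C(1)])
    then have "u * (q * f) - xvar ^ j * (q * R f) \<in> C" by (simp add: algebra_simps)
    then show ?thesis
      using \<psi>[of "q * f"] ideal_mult[OF I(1) that] by simp
  qed
  have \<psi>_C: "\<psi> c = 0" if "c \<in> C" for c
    using \<psi>[of c 0] that I(3) ideal_mult[OF C(1) that] by (auto simp: klinear_0[OF lin])
  have \<psi>_eq: "\<psi> f = \<psi> g" if "f \<in> I" "g \<in> I" "rho f = rho g" for f g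
  proof -
    have "rho (f - g) = 0" using that by simp
    then obtain d where d: "f - g = xvar * d" by (rule rho_eq_0)
    have "d \<in> I" using I(2) idl.subspace_diff[OF I(1) that(1,2)] unfolding xsat_def d by blast
    then have "\<psi> (f - g) = 0" using \<psi>_mult[of d xvar] by (simp add: d klinear_0[OF lin])
    then show ?thesis
      using \<psi>_add[of "f - g" g] idl.subspace_diff[OF I(1) that(1,2)] that(2) by simp
  qed
  \<comment> \<open>Since \<open>\<psi>\<close> depends only on the reduction of \<open>f\<close>,
    it descends to the image of \<open>I\<close> under \<open>rho\<close>.\<close>
  define \<theta>0 where "\<theta>0 p = \<psi> (SOME f. f \<in> I \<and> rho f = p)" for p
  have \<theta>0: "\<theta>0 (rho f) = \<psi> f" if "f \<in> I" for f
  proof -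
    have "\<exists>g. g \<in> I \<and> rho g = rho f" using that by blast
    then have "(SOME g. g \<in> I \<and> rho g = rho f) \<in> I \<and> rho (SOME g. g \<in> I \<and> rho g = rho f) = rho f"
      by (rule someI_ex)
    then show ?thesis unfolding \<theta>0_def using \<psi>_eq that by blast
  qed
  have "ordge M \<subseteq> rho ` I" using M I(3) by blast
  then obtain B where B: "nf_basis (rho ` I) B" using ex_nf_basis[OF rI] by blast
  let ?nf = "nf (rho ` I) B"
  \<comment> \<open>The functional is extended to the whole ring by first projecting onto the image
    of \<open>I\<close> along the span of the monomials in \<open>B\<close>.\<close>
  define \<theta> where "\<theta> p = \<theta>0 (p - lincomb B (?nf p))" for p
  have \<theta>_rho: "\<theta> p = \<psi> f" if "f \<in> I" "rho f = p - lincomb B (?nf p)" for p f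
    unfolding \<theta>_def that(2)[symmetric] using \<theta>0 that(1) .
  have ex_rho: "\<exists>f. f \<in> I \<and> rho f = p - lincomb B (?nf p)" for p
    using nf_mem[OF B, of p] by force
  have lc: "lincomb B c = lincomb B d" if "\<And>\<nu>. \<nu> \<in> B \<Longrightarrow> c \<nu> = d \<nu>" for c d :: "('n \<Rightarrow> nat) \<Rightarrow> 'k"
    unfolding lincomb_def using that by (intro sum.cong) auto
  have "klinear \<theta>"
    unfolding klinear_def
  proof (intro conjI allI)
    fix p q
    obtain f g where f: "f \<in> I" "rho f = p - lincomb B (?nf p)" and g: "g \<in> I" "rho g = q - lincomb B (?nf q)"
      using ex_rho by metis
    have "lincomb B (?nf (p + q)) = lincomb B (?nf p) + lincomb B (?nf q)"
      using lc[of "?nf (p + q)" "\<lambda>\<nu>. ?nf p \<nu> + ?nf q \<nu>"] nf_add[OF rI B] by (simp add: lincomb_add)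
    then have "rho (f + g) = (p + q) - lincomb B (?nf (p + q))" by (simp add: f g)
    then show "\<theta> (p + q) = \<theta> p + \<theta> q"
      using \<theta>_rho[of "f + g" "p + q"] \<theta>_rho[OF f] \<theta>_rho[OF g] \<psi>_add f g idl.subspace_add[OF I(1)] by simp
  next
    fix c p
    obtain f where f: "f \<in> I" "rho f = p - lincomb B (?nf p)"
      using ex_rho by metis
    have "lincomb B (?nf (mfps_const c * p)) = mfps_const c * lincomb B (?nf p)"
      using lc[of "?nf (mfps_const c * p)" "\<lambda>\<nu>. c * ?nf p \<nu>"] nf_scale[OF rI B] by (simp add: lincomb_scale)
    then have "rho (mfps_of_base (mfps_const c) * f) = mfps_const c * p - lincomb B (?nf (mfps_const c * p))"
      by (simp add: f right_diff_distrib)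
    then have "\<theta> (mfps_const c * p) = \<psi> (mfps_of_base (mfps_const c) * f)"
      using ideal_mult[OF I(1) f(1)] by (intro \<theta>_rho) auto
    also have "\<dots> = c * \<psi> f"
      unfolding \<psi>_mult[OF f(1)] by (simp add: klinear_scale[OF lin] \<psi>_def)
    finally show "\<theta> (mfps_const c * p) = c * \<theta> p"
      using \<theta>_rho[OF f] by simp
  qed
  have \<theta>_I: "\<theta> (rho f) = \<psi> f" if "f \<in> I" for f
  proof -
    have "?nf (rho f) \<nu> = 0" if "\<nu> \<in> B" for \<nu>
      using nf_eq_0_iff[OF rI B, of "rho f"] \<open>f \<in> I\<close> that by blast
    then have "lincomb B (?nf (rho f)) = 0"
      using lc[of "?nf (rho f)" "\<lambda>_. 0"] by (simp add: lincomb_def)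
    then show ?thesis using \<theta>_rho[OF that, of "rho f"] by simp
  qed
  have "\<theta> p = 0" if p: "p \<in> rho ` C" for p
  proof -
    obtain c where c: "c \<in> C" "p = rho c" using p by blast
    then have "\<theta> p = \<psi> c" using \<theta>_I I(3) by blast
    then show ?thesis using \<psi>_C c(1) by simp
  qed
  then obtain g where g: "\<And>p. \<theta> p = \<phi> (g * p)"
    using dualizing_represents[OF rC M \<phi> \<open>klinear \<theta>\<close>] by blast
  show ?thesis
  proof (intro exI[of _ g] ballI)
    fix f assume f: "f \<in> I"
    have "\<phi> (q * rho (R f - mfps_of_base g * f)) = 0" for q
    proof -
      have "\<phi> (q * rho (R f)) = \<psi> (mfps_of_base q * f)" using \<psi>_mult[OF f, of "mfps_of_base q"] by simp
      also have "\<dots> = \<phi> (g * (q * rho f))"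
        using \<theta>_I[OF ideal_mult[OF I(1) f], of "mfps_of_base q"] g by simp
      also have "g * (q * rho f) = q * (g * rho f)" by (simp only: mult.left_commute)
      finally show ?thesis by (simp add: right_diff_distrib klinear_diff[OF lin])
    qed
    then have "rho (R f - mfps_of_base g * f) \<in> rho ` C" by (rule nondeg)
    then obtain r where r: "R f - mfps_of_base g * f - xvar * r \<in> C" by (rule rho_mem_imp[OF C(1)])
    have "(u * f - xvar ^ j * R f) + xvar ^ j * (R f - mfps_of_base g * f - xvar * r) \<in> C"
      using R[OF f] ideal_mult[OF C(1) r] by (rule idl.subspace_add[OF C(1)])
    then have "(u - xvar ^ j * mfps_of_base g) * f - xvar ^ Suc j * r \<in> C"
      by (simp add: algebra_simps)
    then show "\<exists>r. (u - xvar ^ j * mfps_of_base g) * f - xvar ^ Suc j * r \<in> C" by blast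
  qed
qed

text \<open>The corrections from the one-step lemma involve ever higher powers of \<open>X\<close>
  and add up to a series; \<open>xadic_closed\<close> turns the approximate annihilation into an
  exact one.\<close>

theorem lift_annihilator:
  fixes C I :: "('n::finite option, 'k::field) mfps set"
  assumes C: "C = igen x n" "xsat C" and I: "is_ideal I" "xsat I" "C \<subseteq> I"
    and \<phi>: "dualizing (rho ` C) \<phi>" and M: "ordge M \<subseteq> rho ` C"
    and h: "h \<in> ideal_quotient (rho ` C) (rho ` I)"
  obtains h' where "h' \<in> ideal_quotient C I" "rho h' = h"
proof -
  have CI: "is_ideal C" by (simp add: C)
  define P where "P j u \<longleftrightarrow> (\<forall>f\<in>I. \<exists>r. u * f - xvar ^ j * r \<in> C)" for j u
  have "\<exists>g. P (Suc j) (u - xvar ^ j * mfps_of_base g)" if "P j u" for j u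
    using lift_annihilator_step[OF CI C(2) I \<phi> M, of u j] that unfolding P_def by blast
  then obtain g where g: "\<And>j u. P j u \<Longrightarrow> P (Suc j) (u - xvar ^ j * mfps_of_base (g j u))" by metis
  \<comment> \<open>\<open>u j\<close> annihilates \<open>I\<close> modulo \<open>C\<close> up to
    \<open>X ^ Suc j\<close>; later corrections leave its terms below that power unchanged.\<close>
  define u where "u = rec_nat (mfps_of_base h) (\<lambda>j u. u - xvar ^ Suc j * mfps_of_base (g (Suc j) u))"
  have u: "u 0 = mfps_of_base h" "u (Suc j) = u j - xvar ^ Suc j * mfps_of_base (g (Suc j) (u j))" for j
    by (simp_all add: u_def)
  have Pu: "P (Suc j) (u j)" for j
  proof (induction j)
    case 0
    show ?case unfolding P_def
    proof
      fix f assume "f \<in> I"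
      then have "rho (u 0 * f) \<in> rho ` C" using h by (simp add: u ideal_quotient_def)
      then obtain r where "u 0 * f - xvar * r \<in> C" by (rule rho_mem_imp[OF CI])
      then show "\<exists>r. u 0 * f - xvar ^ Suc 0 * r \<in> C" by auto
    qed
  qed (simp only: u g)
  define G where "G j = (case j of 0 \<Rightarrow> h | Suc i \<Rightarrow> - g (Suc i) (u i))" for j
  have part: "(\<Sum>j<Suc N. xvar ^ j * mfps_of_base (G j)) = u N" for N
  proof (induction N)
    case (Suc N)
    have "mfps_of_base (- g (Suc N) (u N)) = - mfps_of_base (g (Suc N) (u N))"
      using of_base_add[of "- g (Suc N) (u N)" "g (Suc N) (u N)"] by (simp add: eq_neg_iff_add_eq_0)
    then show ?case using Suc by (simp add: u G_def)
  qed (simp add: G_def u)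
  have "xsum G * f \<in> C" if f: "f \<in> I" for f
  proof (rule xadic_closed[OF C])
    fix N
    obtain r where r: "xsum G - u N = xvar ^ Suc N * r"
      using xsum_partial[of G "Suc N"] unfolding part by blast
    obtain s where s: "u N * f - xvar ^ Suc N * s \<in> C" using Pu f unfolding P_def by blast
    have "xsum G * f - xvar ^ N * (xvar * (r * f + s)) = u N * f - xvar ^ Suc N * s"
    proof -
      have "xsum G = u N + xvar ^ Suc N * r" using r by (simp add: algebra_simps)
      then show ?thesis by (simp add: algebra_simps)
    qed
    then show "\<exists>r. xsum G * f - xvar ^ N * r \<in> C" using s by metis
  qed
  then have "xsum G \<in> ideal_quotient C I" by (simp add: ideal_quotient_def)
  moreover have "rho (xsum G) = h"
    by (simp add: mfps_eq_iff coeff_rho xsum_def G_def)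
  ultimately show ?thesis using that by blast
qed

lemma card_option: "CARD('n::finite option) = Suc CARD('n)"
  by (simp add: UNIV_option_conv card_image)

text \<open>With \<open>X\<close> appended, the sequence is a system of parameters of
  \<open>k[[X, Y]]\<close>, hence regular. Its initial part is then regular, and regularity of the
  last element is saturation.\<close>

lemma regular_of_rho_param:
  fixes x :: "nat \<Rightarrow> ('n::finite option, 'k::field) mfps"
  assumes x: "param (\<lambda>i. rho (x i))"
  shows "reg CARD('n) x" "xsat (igen x CARD('n))"
proof -
  let ?n = "CARD('n)"
  define z where "z i = (if i < ?n then x i else xvar)" for i
  have z_x: "igen z ?n = igen x ?n" by (rule igen_cong) (simp add: z_def)
  have zz: "igen z (Suc ?n) = pgen z" by (simp only: pgen_def card_option)
  obtain M where M: "ordge M \<subseteq> igen (\<lambda>i. rho (x i)) ?n" and x1: "\<And>i. i < ?n \<Longrightarrow> rho (x i) \<in> ordge 1"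
    using x unfolding param_def by blast
  have Xs: "xvar \<in> pgen z"
    using igen_base[of ?n "Suc ?n" z] unfolding zz by (simp add: z_def)
  have xz: "x i \<in> pgen z" if "i < ?n" for i
    using igen_base[of i "Suc ?n" z] that unfolding zz by (simp add: z_def)
  have var: "mfps_var v ^ Suc M \<in> pgen z" for v
  proof (cases v)
    case None
    then show ?thesis using ideal_mult'[OF is_ideal_pgen Xs, of "xvar ^ M"] by simp
  next
    case (Some i)
    have r: "rho (mfps_var (Some i) ^ Suc M) = mfps_var i ^ Suc M"
    proof (rule mfps_eqI)
      fix \<mu> :: "'n \<Rightarrow> nat"
      show "mfps_coeff (rho (mfps_var (Some i) ^ Suc M)) \<mu> = mfps_coeff (mfps_var i ^ Suc M) \<mu>"
        unfolding monom_var_Some_power unfolding var_power coeff_rho coeff_monom by simp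
    qed
    have "(mfps_var i ^ Suc M :: ('n, 'k) mfps) \<in> ordge M"
      using var_power_ordge[of i "Suc M"] ordge_mono[of M "Suc M"] by auto
    then have "mfps_var i ^ Suc M \<in> igen (\<lambda>i. rho (x i)) ?n" using M by blast
    then obtain c where c: "mfps_var i ^ Suc M = (\<Sum>i<?n. c i * rho (x i))" by (rule igenE)
    have "rho (mfps_var v ^ Suc M - (\<Sum>i<?n. mfps_of_base (c i) * x i)) = 0"
      unfolding Some rho_diff r c by (simp add: rho_sum)
    then obtain g where "mfps_var v ^ Suc M - (\<Sum>i<?n. mfps_of_base (c i) * x i) = xvar * g"
      by (rule rho_eq_0)
    then have "mfps_var v ^ Suc M = xvar * g + (\<Sum>i<?n. mfps_of_base (c i) * x i)"
      by (simp add: algebra_simps)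
    also have "\<dots> \<in> pgen z"
      using Xs xz by (intro idl.subspace_add idl.subspace_sum is_ideal_pgen)
        (auto intro: ideal_mult ideal_mult')
    finally show ?thesis .
  qed
  have "ordge (CARD('n option) * Suc M) \<subseteq> pgen z"
    by (rule ordge_le_of_var_powers[OF is_ideal_pgen var])
  moreover have "z i \<in> ordge 1" for i
  proof (cases "i < ?n")
    case True
    then have "mfps_coeff (rho (x i)) (\<lambda>_. 0) = 0" using x1 unfolding ordge_1_iff by blast
    then have "mfps_coeff (x i) (\<lambda>_. 0) = 0" by (simp add: coeff_rho)
    then show ?thesis unfolding ordge_1_iff using True by (simp add: z_def)
  next
    case False
    then show ?thesis using var_ordge[of None] by (simp add: z_def)
  qed
  ultimately have "param z" unfolding param_def pgen_def by blast
  then have z: "reg (Suc ?n) z" unfolding card_option[symmetric] by (rule param_regular)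
  have "reg ?n z" using z by (rule reg_mono) simp
  then show "reg ?n x"
    using reg_cong[of ?n z x] by (simp add: z_def)
  show "xsat (igen x ?n)"
    unfolding xsat_def
  proof (intro allI impI)
    fix f assume "xvar * f \<in> igen x ?n"
    then have "z ?n * f \<in> igen z ?n" by (simp add: z_x) (simp add: z_def)
    then have "f \<in> igen z ?n" using regD[OF z, of ?n] by simp
    then show "f \<in> igen x ?n" by (simp add: z_x)
  qed
qed

lemma rho_image_igen: "rho ` igen x n = igen (\<lambda>i. rho (x i)) n"
proof (intro equalityI subsetI)
  fix p assume "p \<in> igen (\<lambda>i. rho (x i)) n"
  then obtain c where "p = (\<Sum>i<n. c i * rho (x i))" by (rule igenE)
  then have "p = rho (\<Sum>i<n. mfps_of_base (c i) * x i)" by (simp add: rho_sum)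
  then show "p \<in> rho ` igen x n" by (rule image_eqI) (rule igen_sum)
next
  fix p assume "p \<in> rho ` igen x n"
  then obtain f where f: "f \<in> igen x n" "p = rho f" by blast
  obtain c where "f = (\<Sum>i<n. c i * x i)" using f(1) by (rule igenE)
  then have "p = (\<Sum>i<n. rho (c i) * rho (x i))" by (simp add: f(2) rho_sum)
  then show "p \<in> igen (\<lambda>i. rho (x i)) n" by (simp add: igen_sum)
qed

text \<open>One link in the family restricts to a link in both members: in the generic one by
  compatibility of quotients with localization, in the special one because annihilators
  lift.\<close>

theorem link_in_family:
  fixes x :: "nat \<Rightarrow> ('n::finite option, 'k::field) mfps"
  assumes I: "is_ideal I" "xsat I" and xI: "\<And>i. i < CARD('n) \<Longrightarrow> x i \<in> I"
    and x: "param (\<lambda>i. rho (x i))" and xy: "\<And>i. i < CARD('n) \<Longrightarrow> x i \<in> ypow 1"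
  defines "J \<equiv> ideal_quotient (igen x CARD('n)) I"
  shows "is_ideal J" "xsat J" "param (\<lambda>i. eta (x i))"
    "rho ` J = ideal_quotient (pgen (\<lambda>i. rho (x i))) (rho ` I)"
    "etaI J = ideal_quotient (pgen (\<lambda>i. eta (x i))) (etaI I)"
proof -
  let ?n = "CARD('n)"
  let ?C = "igen x ?n"
  have C: "is_ideal ?C" by simp
  have reg: "reg ?n x" and sat: "xsat ?C" using regular_of_rho_param[OF x] by blast+
  have rC: "rho ` ?C = pgen (\<lambda>i. rho (x i))" unfolding pgen_def by (rule rho_image_igen)
  have CI: "?C \<subseteq> I" using xI by (simp add: igen_subset_iff[OF I(1)])
  show "is_ideal J" unfolding J_def by (rule is_ideal_quotient[OF C])
  show "xsat J"
    unfolding xsat_def J_def ideal_quotient_def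
    using sat by (auto simp: xsat_def mult.assoc)
  show pe: "param (\<lambda>i. eta (x i))" by (rule regular_localizes_to_param[OF reg xy])
  obtain N where "ordge N \<subseteq> igen (\<lambda>i. eta (x i)) ?n" using pe unfolding param_def by blast
  then have yl: "ylocal ?C" by (rule ylocal_of_eta)
  show "etaI J = ideal_quotient (pgen (\<lambda>i. eta (x i))) (etaI I)"
    unfolding J_def etaI_quotient[OF C yl] etaI_igen pgen_def ..
  obtain \<phi> where \<phi>: "dualizing (rho ` ?C) \<phi>" using ex_dualizing[OF x] unfolding rC .
  obtain M where M: "ordge M \<subseteq> rho ` ?C" using param_primary[OF x] unfolding rC by blast
  have "rho ` J = ideal_quotient (rho ` ?C) (rho ` I)"
  proof (intro equalityI subsetI)
    fix p assume "p \<in> rho ` J"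
    then obtain f where f: "f \<in> J" "p = rho f" by blast
    show "p \<in> ideal_quotient (rho ` ?C) (rho ` I)"
      unfolding ideal_quotient_def
    proof clarify
      fix g assume "g \<in> I"
      then have "f * g \<in> ?C" using f(1) by (simp add: J_def ideal_quotient_def)
      then show "p * rho g \<in> rho ` ?C" unfolding f(2) rho_mult[symmetric] by (rule imageI)
    qed
  next
    fix h assume "h \<in> ideal_quotient (rho ` ?C) (rho ` I)"
    then obtain h' where "h' \<in> J" "rho h' = h"
      unfolding J_def by (rule lift_annihilator[OF refl sat I CI \<phi> M])
    then show "h \<in> rho ` J" by blast
  qed
  then show "rho ` J = ideal_quotient (pgen (\<lambda>i. rho (x i))) (rho ` I)" by (simp only: rC)
qed

text \<open>
  \<open>plicci s I\<close>: the ideal \<open>I\<close> reaches the unit ideal by at most \<open>s\<close> links through systems of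
  parameters. Admitting the unit ideal makes the notion stable under localization, where a link
  may become trivial.
\<close>

primrec plicci :: "nat \<Rightarrow> ('v::finite, 'k::comm_ring_1) mfps set \<Rightarrow> bool" where
  "plicci 0 I \<longleftrightarrow> I = UNIV"
| "plicci (Suc s) I \<longleftrightarrow> I = UNIV \<or> (\<exists>x. param x \<and> pgen x \<subseteq> I \<and> plicci s (ideal_quotient (pgen x) I))"

lemma plicci_UNIV: "plicci s UNIV"
  by (cases s) auto

text \<open>Each system of parameters in the special member is lifted into the family, and the
  linked family again has the properties required for the next link.\<close>

theorem plicci_generic_of_special:
  fixes I :: "('n::finite option, 'k::field) mfps set"
  assumes "is_ideal I" "xsat I" "plicci s (rho ` I)"
  shows "plicci s (etaI I)"
  using assms
proof (induction s arbitrary: I)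
  have unit: "etaI I = UNIV" if "is_ideal I" "rho ` I = UNIV" for I :: "('n option, 'k) mfps set"
  proof -
    have "1 \<in> rho ` I" using that(2) by blast
    then obtain f where f: "f \<in> I" "rho f = 1" by auto
    then have "mfps_coeff f (ocons 0 (\<lambda>_. 0)) = 1"
      using coeff_rho[of f "\<lambda>_. 0"] by (simp only: f coeff_1) simp
    then have "f \<notin> ypow 1"
      unfolding ypow_iff by (metis ocons_zero tdeg_zero zero_less_one zero_neq_one)
    then show ?thesis using etaI_UNIV_of_notin f(1) by blast
  qed
  {
    case 0
    then show ?case using unit by simp
  next
    case (Suc s)
    show ?case
    proof (cases "rho ` I = UNIV")
      case True
      then show ?thesis using unit Suc.prems plicci_UNIV by simp
    next
      case False
      then obtain x where x: "param x" "pgen x \<subseteq> rho ` I" "plicci s (ideal_quotient (pgen x) (rho ` I))"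
        using Suc.prems(3) by auto
      have "\<exists>f. f \<in> I \<and> rho f = x i" if "i < CARD('n)" for i
        using x(2) igen_base[OF that, of x] by (force simp: pgen_def)
      then obtain z where z: "\<And>i. i < CARD('n) \<Longrightarrow> z i \<in> I \<and> rho (z i) = x i" by metis
      have pz: "pgen (\<lambda>i. rho (z i)) = pgen x"
        unfolding pgen_def by (rule igen_cong) (simp add: z)
      have parz: "param (\<lambda>i. rho (z i))"
        using x(1) pz z unfolding param_def pgen_def by auto
      \<comment> \<open>A lift outside \<open>ypow 1\<close> becomes a unit in the generic member,
        where the ideal is then already the unit ideal.\<close>
      show ?thesis
      proof (cases "\<forall>i<CARD('n). z i \<in> ypow 1")
        case False
        then obtain i where "z i \<in> I" "z i \<notin> ypow 1" using z by blast
        then show ?thesis using etaI_UNIV_of_notin plicci_UNIV by metis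
      next
        case True
        let ?J = "ideal_quotient (igen z CARD('n)) I"
        have J: "is_ideal ?J" "xsat ?J" "param (\<lambda>i. eta (z i))"
          "rho ` ?J = ideal_quotient (pgen x) (rho ` I)"
          "etaI ?J = ideal_quotient (pgen (\<lambda>i. eta (z i))) (etaI I)"
          using link_in_family[OF Suc.prems(1,2) _ parz, of] z True pz by auto
        have "plicci s (etaI ?J)"
          by (rule Suc.IH[OF J(1,2)]) (simp only: J(4) x(3))
        then have "plicci s (ideal_quotient (pgen (\<lambda>i. eta (z i))) (etaI I))" by (simp only: J(5))
        moreover have "pgen (\<lambda>i. eta (z i)) \<subseteq> etaI I"
          unfolding pgen_def using z by (simp add: igen_subset_iff etaI_base)
        ultimately show ?thesis using J(3) by auto
      qed
    qed
  }
qed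

section \<open>Specialization of coefficients\<close>

text \<open>A ring homomorphism on a subring \<open>B\<close>, given as a total function with
  arbitrary values elsewhere. Specializations of a field are only defined on such subrings.\<close>

definition subhom :: "'a::comm_ring_1 set \<Rightarrow> ('a \<Rightarrow> 'b::comm_ring_1) \<Rightarrow> bool"
  where "subhom B g \<longleftrightarrow> 0 \<in> B \<and> 1 \<in> B \<and>
    (\<forall>x\<in>B. \<forall>y\<in>B. x + y \<in> B \<and> x * y \<in> B \<and> g (x + y) = g x + g y \<and> g (x * y) = g x * g y) \<and>
    (\<forall>x\<in>B. - x \<in> B) \<and> g 1 = 1"

lemma subhom_add: "subhom B g \<Longrightarrow> x \<in> B \<Longrightarrow> y \<in> B \<Longrightarrow> x + y \<in> B \<and> g (x + y) = g x + g y"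
  and subhom_mult: "subhom B g \<Longrightarrow> x \<in> B \<Longrightarrow> y \<in> B \<Longrightarrow> x * y \<in> B \<and> g (x * y) = g x * g y"
  and subhom_1: "subhom B g \<Longrightarrow> 1 \<in> B \<and> g 1 = 1"
  by (simp_all add: subhom_def)

lemma subhom_0: "subhom B g \<Longrightarrow> 0 \<in> B \<and> g 0 = 0"
  unfolding subhom_def by (metis add.right_neutral add_left_cancel)

lemma subhom_uminus:
  assumes "subhom B g" "x \<in> B"
  shows "- x \<in> B \<and> g (- x) = - g x"
proof -
  have "- x \<in> B" using assms by (simp add: subhom_def)
  moreover have "g (- x) + g x = 0"
    using subhom_add[OF assms(1) calculation assms(2)] subhom_0[OF assms(1)] by simp
  ultimately show ?thesis by (simp add: eq_neg_iff_add_eq_0)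
qed

lemma subhom_sum:
  assumes "subhom B g" "\<And>i. i \<in> A \<Longrightarrow> f i \<in> B"
  shows "sum f A \<in> B \<and> g (sum f A) = (\<Sum>i\<in>A. g (f i))"
  using assms(2)
proof (induction A rule: infinite_finite_induct)
  case (insert a A)
  then have "f a \<in> B" "sum f A \<in> B" "g (sum f A) = (\<Sum>i\<in>A. g (f i))" by auto
  then show ?case using insert.hyps subhom_add[OF assms(1), of "f a" "sum f A"] by simp
qed (use subhom_0[OF assms(1)] in auto)

definition coeffs_in :: "'a set \<Rightarrow> ('v::finite, 'a::comm_ring_1) mfps \<Rightarrow> bool"
  where "coeffs_in B f \<longleftrightarrow> (\<forall>\<mu>. mfps_coeff f \<mu> \<in> B)"

definition map_coeffs :: "('a \<Rightarrow> 'b) \<Rightarrow> ('v::finite, 'a::comm_ring_1) mfps \<Rightarrow> ('v, 'b::comm_ring_1) mfps"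
  where "map_coeffs g f = Abs_mfps (\<lambda>\<mu>. g (mfps_coeff f \<mu>))"

lemma coeff_map_coeffs [simp]: "mfps_coeff (map_coeffs g f) \<mu> = g (mfps_coeff f \<mu>)"
  by (simp add: map_coeffs_def)

lemma map_coeffs_add: "subhom B g \<Longrightarrow> coeffs_in B f \<Longrightarrow> coeffs_in B h \<Longrightarrow> coeffs_in B (f + h) \<and> map_coeffs g (f + h) = map_coeffs g f + map_coeffs g h"
  using subhom_add[of B g] by (simp add: coeffs_in_def mfps_eq_iff)

lemma map_coeffs_diff:
  assumes "subhom B g" "coeffs_in B f" "coeffs_in B h"
  shows "coeffs_in B (f - h) \<and> map_coeffs g (f - h) = map_coeffs g f - map_coeffs g h"
proof -
  have "x - y \<in> B \<and> g (x - y) = g x - g y" if "x \<in> B" "y \<in> B" for x y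
    using subhom_add[OF assms(1), of x "- y"] subhom_uminus[OF assms(1), of y] that by simp
  then show ?thesis using assms by (simp add: coeffs_in_def mfps_eq_iff)
qed

lemma map_coeffs_mult:
  assumes "subhom B g" "coeffs_in B f" "coeffs_in B h"
  shows "coeffs_in B (f * h) \<and> map_coeffs g (f * h) = map_coeffs g f * map_coeffs g h"
proof -
  have "mfps_coeff (f * h) \<mu> \<in> B \<and> g (mfps_coeff (f * h) \<mu>) = mfps_coeff (map_coeffs g f * map_coeffs g h) \<mu>" for \<mu>
  proof -
    have "mfps_coeff f \<nu> * mfps_coeff h \<kappa> \<in> B \<and>
      g (mfps_coeff f \<nu> * mfps_coeff h \<kappa>) = g (mfps_coeff f \<nu>) * g (mfps_coeff h \<kappa>)" for \<nu> \<kappa>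
      using assms(2,3) subhom_mult[OF assms(1)] by (simp add: coeffs_in_def)
    then show ?thesis
      unfolding coeff_mult coeff_map_coeffs
      using subhom_sum[OF assms(1), of "{\<nu>. \<nu> \<le> \<mu>}" "\<lambda>\<nu>. mfps_coeff f \<nu> * mfps_coeff h (\<lambda>i. \<mu> i - \<nu> i)"]
      by simp
  qed
  then show ?thesis by (simp add: coeffs_in_def mfps_eq_iff)
qed

lemma map_coeffs_monom: "subhom B g \<Longrightarrow> coeffs_in B (monom \<mu>) \<and> map_coeffs g (monom \<mu>) = monom \<mu>"
  using subhom_0[of B g] subhom_1[of B g] by (auto simp: coeffs_in_def mfps_eq_iff coeff_monom)

lemma map_coeffs_lincomb:
  assumes "subhom B g" "finite A" "\<And>\<nu>. \<nu> \<in> A \<Longrightarrow> c \<nu> \<in> B"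
  shows "coeffs_in B (lincomb A c) \<and> map_coeffs g (lincomb A c) = lincomb A (\<lambda>\<nu>. g (c \<nu>))"
  using assms subhom_0[of B g] by (simp add: coeffs_in_def mfps_eq_iff coeff_lincomb)

lemma map_coeffs_sum:
  assumes "subhom B g" "\<And>i. i \<in> A \<Longrightarrow> coeffs_in B (f i)"
  shows "coeffs_in B (sum f A) \<and> map_coeffs g (sum f A) = (\<Sum>i\<in>A. map_coeffs g (f i))"
  using assms(2)
proof (induction A rule: infinite_finite_induct)
  case (insert a A)
  then show ?case using map_coeffs_add[OF assms(1), of "f a" "sum f A"] by simp
qed (use subhom_0[OF assms(1)] in \<open>auto simp: coeffs_in_def mfps_eq_iff\<close>)

lemma map_coeffs_ordge: "subhom B g \<Longrightarrow> f \<in> ordge M \<Longrightarrow> map_coeffs g f \<in> ordge M"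
  using subhom_0[of B g] by (simp add: ordge_def)

section \<open>Ideals under specialization\<close>

lemma nf_basisI:
  fixes I :: "('v::finite, 'k::field) mfps set"
  assumes I: "is_ideal I" "ordge M \<subseteq> I" and B: "finite B"
    and indep: "\<And>c. lincomb B c \<in> I \<Longrightarrow> \<forall>\<nu>\<in>B. c \<nu> = 0"
    and c: "\<And>\<kappa>. tdeg \<kappa> < M \<Longrightarrow> monom \<kappa> - lincomb B (c \<kappa>) \<in> I"
  shows "nf_basis I B"
proof -
  have "\<exists>d. f - lincomb B d \<in> I" for f
  proof -
    let ?T = "{\<nu> :: 'v \<Rightarrow> nat. tdeg \<nu> < M}"
    define d where "d \<nu> = (\<Sum>\<kappa>\<in>?T. mfps_coeff f \<kappa> * c \<kappa> \<nu>)" for \<nu>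
    have "lincomb ?T (mfps_coeff f) - lincomb B d
        = (\<Sum>\<kappa>\<in>?T. mfps_const (mfps_coeff f \<kappa>) * (monom \<kappa> - lincomb B (c \<kappa>)))"
      unfolding d_def lincomb_sum lincomb_scale
      by (simp add: lincomb_def right_diff_distrib sum_subtractf)
    also have "\<dots> \<in> I"
      using c by (intro idl.subspace_sum[OF I(1)] ideal_mult[OF I(1)]) auto
    finally have "(f - lincomb ?T (mfps_coeff f)) + (lincomb ?T (mfps_coeff f) - lincomb B d) \<in> I"
      using minus_truncate I(2) by (intro idl.subspace_add[OF I(1)]) blast+
    then show ?thesis by auto
  qed
  then show ?thesis using B indep unfolding nf_basis_def by blast
qed

lemma nf_basis_UNIV_iff:
  fixes I :: "('v::finite, 'k::field) mfps set"
  assumes "nf_basis I A"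
  shows "I = UNIV \<longleftrightarrow> A = {}"
proof
  assume "I = UNIV"
  then have "\<forall>\<nu>\<in>A. (1 :: 'k) = 0"
    using assms unfolding nf_basis_def by (elim conjE allE[of _ "\<lambda>_. 1"]) simp
  then show "A = {}" by auto
next
  assume A: "A = {}"
  have "f \<in> I" for f using nf_mem[OF assms, of f] by (simp add: A lincomb_def)
  then show "I = UNIV" by blast
qed

lemma ordge_generated:
  fixes I :: "('v::finite, 'k::comm_ring_1) mfps set"
  assumes I: "is_ideal I" and m: "\<And>\<kappa>. tdeg \<kappa> = M \<Longrightarrow> monom \<kappa> \<in> I"
  shows "ordge M \<subseteq> I"
proof
  fix f :: "('v, 'k) mfps" assume "f \<in> ordge M"
  then have "f \<in> ordge (M + 0)" by simp
  then obtain h where "f = (\<Sum>\<nu> | tdeg \<nu> = M. monom \<nu> * h \<nu>)" using ordge_decomp by blast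
  also have "\<dots> \<in> I" using m by (intro idl.subspace_sum[OF I] ideal_mult'[OF I]) auto
  finally show "f \<in> I" .
qed

text \<open>Members of \<open>I\<close> with coefficients outside \<open>B\<close> have no image and
  are left out; the definition is used when \<open>I\<close> has enough generators over
  \<open>B\<close>.\<close>

definition map_ideal :: "'a set \<Rightarrow> ('a \<Rightarrow> 'b) \<Rightarrow> ('v::finite, 'a::comm_ring_1) mfps set \<Rightarrow> ('v, 'b::comm_ring_1) mfps set"
  where "map_ideal B g I = ideal_gen (map_coeffs g ` {f \<in> I. coeffs_in B f})"

lemma is_ideal_map_ideal [simp]: "is_ideal (map_ideal B g I)"
  by (simp add: map_ideal_def idl.subspace_span)

lemma map_ideal_base: "f \<in> I \<Longrightarrow> coeffs_in B f \<Longrightarrow> map_coeffs g f \<in> map_ideal B g I"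
  unfolding map_ideal_def by (intro idl.span_base) blast

lemma map_ideal_subset: "is_ideal K \<Longrightarrow> (\<And>f. f \<in> I \<Longrightarrow> coeffs_in B f \<Longrightarrow> map_coeffs g f \<in> K) \<Longrightarrow> map_ideal B g I \<subseteq> K"
  unfolding map_ideal_def by (rule idl.span_minimal) auto

text \<open>A monomial basis of the quotient whose structure constants lie in \<open>B\<close>; such
  a basis survives every homomorphism on \<open>B\<close>.\<close>

definition nf_defined_over :: "'k set \<Rightarrow> ('v::finite, 'k::field) mfps set \<Rightarrow> nat \<Rightarrow> ('v \<Rightarrow> nat) set \<Rightarrow> bool"
  where "nf_defined_over B I M A \<longleftrightarrow> is_ideal I \<and> ordge M \<subseteq> I \<and> nf_basis I A \<and> (\<forall>\<nu>\<in>A. tdeg \<nu> < M) \<and>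
    (\<forall>\<kappa>. \<forall>\<nu>\<in>A. nf I A (monom \<kappa>) \<nu> \<in> B)"

text \<open>Monomials of degree at least \<open>M\<close> lie in \<open>I\<close> and have normal
  form 0, so only finitely many structure constants have to be put into \<open>B\<close>.\<close>

lemma ex_nf_defined_over:
  fixes I :: "('v::finite, 'k::field) mfps set"
  assumes I: "is_ideal I" "ordge M \<subseteq> I"
  obtains Xs A where "finite Xs" "\<And>B. Xs \<subseteq> B \<Longrightarrow> 0 \<in> B \<Longrightarrow> nf_defined_over B I M A"
proof -
  obtain A where A: "nf_basis I A" "\<And>\<nu>. \<nu> \<in> A \<Longrightarrow> tdeg \<nu> < M"
    using ex_nf_basis[OF I] by blast
  let ?T = "{\<kappa> :: 'v \<Rightarrow> nat. tdeg \<kappa> < M}"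
  let ?X = "(\<lambda>(\<kappa>, \<nu>). nf I A (monom \<kappa>) \<nu>) ` (?T \<times> A)"
  have "finite A" using A(1) by (simp add: nf_basis_def)
  then have "finite ?X" using finite_tdeg_less by blast
  moreover have "nf_defined_over B I M A" if "?X \<subseteq> B" "0 \<in> B" for B
  proof -
    have "nf I A (monom \<kappa>) \<nu> \<in> B" if "\<nu> \<in> A" for \<kappa> \<nu>
    proof (cases "tdeg \<kappa> < M")
      case True
      then show ?thesis using \<open>?X \<subseteq> B\<close> that by auto
    next
      case False
      then have "(monom \<kappa> :: ('v, 'k) mfps) \<in> ordge M"
        using monom_ordge[of \<kappa>] ordge_mono[of M "tdeg \<kappa>"] by auto
      then have "monom \<kappa> \<in> I" using I(2) by blast
      then have "nf I A (monom \<kappa>) \<nu> = 0" using nf_eq_0_iff[OF I(1) A(1)] that by blast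
      then show ?thesis using \<open>0 \<in> B\<close> by simp
    qed
    then show ?thesis using A I by (simp add: nf_defined_over_def)
  qed
  ultimately show ?thesis using that[of ?X A] by blast
qed

lemma ex_nf_defined_over_UNIV:
  assumes "is_ideal I" "ordge M \<subseteq> I"
  shows "\<exists>A. nf_defined_over UNIV I M A"
proof -
  obtain Xs A where "\<And>B. Xs \<subseteq> B \<Longrightarrow> 0 \<in> B \<Longrightarrow> nf_defined_over B I M A" using ex_nf_defined_over[OF assms] by blast
  then show ?thesis by blast
qed

context
  fixes B :: "'k::field set" and g :: "'k \<Rightarrow> 'l::field"
    and I :: "('v::finite, 'k) mfps set" and M :: nat and A :: "('v \<Rightarrow> nat) set"
  assumes g: "subhom B g" and d: "nf_defined_over B I M A"
begin

lemma nf_defined_overD: "is_ideal I" "ordge M \<subseteq> I" "nf_basis I A" "finite A"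
  and nf_defined_over_tdeg: "\<And>\<nu>. \<nu> \<in> A \<Longrightarrow> tdeg \<nu> < M" and nf_defined_over_coeff: "\<And>\<kappa> \<nu>. \<nu> \<in> A \<Longrightarrow> nf I A (monom \<kappa>) \<nu> \<in> B"
  using d by (auto simp: nf_defined_over_def nf_basis_def)

text \<open>The formula of \<open>nf_expand\<close> with its structure constants mapped by
  \<open>g\<close>: the candidate for the coordinates modulo the specialized ideal.\<close>

definition "nfL f \<nu> = (\<Sum>\<kappa> | tdeg \<kappa> < M. mfps_coeff f \<kappa> * g (nf I A (monom \<kappa>) \<nu>))"

lemma nf_defined_over_generator:
  "monom \<kappa> - lincomb A (nf I A (monom \<kappa>)) \<in> I"
  "coeffs_in B (monom \<kappa> - lincomb A (nf I A (monom \<kappa>)))"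
  "map_coeffs g (monom \<kappa> - lincomb A (nf I A (monom \<kappa>))) = monom \<kappa> - lincomb A (\<lambda>\<nu>. g (nf I A (monom \<kappa>) \<nu>))"
proof -
  have lc: "coeffs_in B (lincomb A (nf I A (monom \<kappa>)))"
    "map_coeffs g (lincomb A (nf I A (monom \<kappa>))) = lincomb A (\<lambda>\<nu>. g (nf I A (monom \<kappa>) \<nu>))"
    using map_coeffs_lincomb[OF g nf_defined_overD(4), of "nf I A (monom \<kappa>)"] nf_defined_over_coeff by blast+
  show "monom \<kappa> - lincomb A (nf I A (monom \<kappa>)) \<in> I" by (rule nf_mem[OF nf_defined_overD(3)])
  show "coeffs_in B (monom \<kappa> - lincomb A (nf I A (monom \<kappa>)))"
    "map_coeffs g (monom \<kappa> - lincomb A (nf I A (monom \<kappa>))) = monom \<kappa> - lincomb A (\<lambda>\<nu>. g (nf I A (monom \<kappa>) \<nu>))"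
    using map_coeffs_diff[OF g _ lc(1), of "monom \<kappa>"] map_coeffs_monom[OF g, of \<kappa>] lc(2) by auto
qed

lemma nfL_map_coeffs: "coeffs_in B f \<Longrightarrow> \<nu> \<in> A \<Longrightarrow> nfL (map_coeffs g f) \<nu> = g (nf I A f \<nu>) \<and> nf I A f \<nu> \<in> B"
proof -
  assume f: "coeffs_in B f" "\<nu> \<in> A"
  have "mfps_coeff f \<kappa> * nf I A (monom \<kappa>) \<nu> \<in> B \<and>
    g (mfps_coeff f \<kappa> * nf I A (monom \<kappa>) \<nu>) = g (mfps_coeff f \<kappa>) * g (nf I A (monom \<kappa>) \<nu>)" for \<kappa>
    using f nf_defined_over_coeff by (intro subhom_mult[OF g]) (auto simp: coeffs_in_def)
  then show ?thesis
    unfolding nfL_def coeff_map_coeffs nf_expand[OF nf_defined_overD(1,3,2) f(2), of f]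
    using subhom_sum[OF g, of "{\<kappa>. tdeg \<kappa> < M}" "\<lambda>\<kappa>. mfps_coeff f \<kappa> * nf I A (monom \<kappa>) \<nu>"] by simp
qed

lemma nfL_add: "nfL (f + h) \<nu> = nfL f \<nu> + nfL h \<nu>"
  by (simp add: nfL_def distrib_right sum.distrib)

lemma nfL_scale: "nfL (mfps_const c * f) \<nu> = c * nfL f \<nu>"
  by (simp add: nfL_def sum_distrib_left mult.assoc)

lemma nfL_sum: "nfL (\<Sum>i\<in>S. f i) \<nu> = (\<Sum>i\<in>S. nfL (f i) \<nu>)"
proof (induction S rule: infinite_finite_induct)
  case empty
  then show ?case by (simp add: nfL_def)
next
  case (infinite S)
  then show ?case by (simp add: nfL_def)
qed (simp add: nfL_add)

lemma nfL_ordge: "f \<in> ordge M \<Longrightarrow> nfL f \<nu> = 0"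
  by (simp add: nfL_def ordge_def)

text \<open>The candidate coordinates vanish on the specialized ideal, which is why no new relation
  between the basis monomials appears there.\<close>

lemma nfL_map_ideal: "f \<in> map_ideal B g I \<Longrightarrow> \<nu> \<in> A \<Longrightarrow> nfL f \<nu> = 0"
proof -
  assume f: "f \<in> map_ideal B g I" and \<nu>: "\<nu> \<in> A"
  \<comment> \<open>The largest ideal in the kernel of \<open>nfL\<close> at \<open>\<nu>\<close>;
    by truncation, multiples by monomials decide membership of the generators.\<close>
  let ?K = "{f. \<forall>h. nfL (h * f) \<nu> = 0}"
  have "is_ideal ?K"
  proof (rule idl.subspaceI)
    show "0 \<in> ?K" by (simp add: nfL_def)
    show "p + q \<in> ?K" if "p \<in> ?K" "q \<in> ?K" for p q
      using that by (simp add: distrib_left nfL_add)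
    show "c * p \<in> ?K" if "p \<in> ?K" for c p
    proof -
      have "nfL ((h * c) * p) \<nu> = 0" for h using that by blast
      then show ?thesis by (simp add: mult.assoc)
    qed
  qed
  moreover have "map_coeffs g p \<in> ?K" if p: "p \<in> I" "coeffs_in B p" for p
  proof clarify
    fix h :: "('v, 'l) mfps"
    let ?t = "lincomb {\<kappa>. tdeg \<kappa> < M} (mfps_coeff h)"
    have "nfL (monom \<tau> * map_coeffs g p) \<nu> = 0" for \<tau>
    proof -
      have m: "coeffs_in B (monom \<tau> * p)" "map_coeffs g (monom \<tau> * p) = monom \<tau> * map_coeffs g p"
        using map_coeffs_mult[OF g _ p(2), of "monom \<tau>"] map_coeffs_monom[OF g, of \<tau>] by auto
      have "monom \<tau> * p \<in> I" by (rule ideal_mult[OF nf_defined_overD(1) p(1)])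
      then have "nf I A (monom \<tau> * p) \<nu> = 0" using nf_eq_0_iff[OF nf_defined_overD(1,3)] \<nu> by blast
      then show ?thesis using nfL_map_coeffs[OF m(1) \<nu>] subhom_0[OF g] by (simp add: m(2))
    qed
    then have "nfL (?t * map_coeffs g p) \<nu> = 0"
      by (simp add: lincomb_def sum_distrib_right nfL_sum mult.assoc nfL_scale)
    moreover have "nfL ((h - ?t) * map_coeffs g p) \<nu> = 0"
      by (intro nfL_ordge ideal_mult'[OF is_ideal_ordge] minus_truncate)
    moreover have "h * map_coeffs g p = (h - ?t) * map_coeffs g p + ?t * map_coeffs g p" by (simp add: algebra_simps)
    ultimately show "nfL (h * map_coeffs g p) \<nu> = 0" using nfL_add by simp
  qed
  ultimately have "map_ideal B g I \<subseteq> ?K" by (rule map_ideal_subset)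
  then have "nfL (1 * f) \<nu> = 0" using f by blast
  then show ?thesis by simp
qed

lemma ordge_map_ideal: "ordge M \<subseteq> map_ideal B g I"
proof (rule ordge_generated[OF is_ideal_map_ideal])
  fix \<kappa> :: "'v \<Rightarrow> nat" assume "tdeg \<kappa> = M"
  then have "(monom \<kappa> :: ('v, 'k) mfps) \<in> I" using monom_ordge[of \<kappa>] nf_defined_overD(2) by auto
  then have "map_coeffs g (monom \<kappa>) \<in> map_ideal B g I" using map_coeffs_monom[OF g, of \<kappa>] by (intro map_ideal_base) auto
  then show "monom \<kappa> \<in> map_ideal B g I" using map_coeffs_monom[OF g, of \<kappa>] by simp
qed

text \<open>Independence comes from the functionals \<open>nfL\<close>, and spanning from the images
  of the relations that reduce each monomial.\<close>

lemma nf_basis_map_ideal: "nf_basis (map_ideal B g I) A"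
proof (rule nf_basisI[OF is_ideal_map_ideal ordge_map_ideal nf_defined_overD(4)])
  fix c assume c: "lincomb A c \<in> map_ideal B g I"
  show "\<forall>\<nu>\<in>A. c \<nu> = 0"
  proof
    fix \<nu> assume \<nu>: "\<nu> \<in> A"
    have "nfL (monom \<kappa>) \<nu> = (if \<kappa> = \<nu> then 1 else 0)" if "\<kappa> \<in> A" for \<kappa>
    proof -
      have eq: "monom \<kappa> = lincomb A (\<lambda>\<nu>. if \<nu> = \<kappa> then 1 else 0 :: 'k)"
        using nf_defined_overD(4) that by (auto simp: mfps_eq_iff coeff_lincomb coeff_monom)
      have "nf I A (monom \<kappa>) \<nu> = (if \<nu> = \<kappa> then 1 else 0)"
        unfolding eq by (rule nf_lincomb[OF nf_defined_overD(1,3) \<nu>])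
      then show ?thesis
        using nfL_map_coeffs[of "monom \<kappa>" \<nu>] map_coeffs_monom[OF g, of \<kappa>] \<nu> subhom_0[OF g] subhom_1[OF g] by auto
    qed
    then have "(\<Sum>\<kappa>\<in>A. c \<kappa> * nfL (monom \<kappa>) \<nu>) = (\<Sum>\<kappa>\<in>A. if \<kappa> = \<nu> then c \<kappa> else 0)"
      by (intro sum.cong) auto
    then have "nfL (lincomb A c) \<nu> = c \<nu>"
      using nf_defined_overD(4) \<nu> by (simp add: lincomb_def nfL_sum nfL_scale)
    then show "c \<nu> = 0" using nfL_map_ideal[OF c \<nu>] by simp
  qed
next
  fix \<kappa> :: "'v \<Rightarrow> nat"
  show "monom \<kappa> - lincomb A (\<lambda>\<nu>. g (nf I A (monom \<kappa>) \<nu>)) \<in> map_ideal B g I"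
    using map_ideal_base[OF nf_defined_over_generator(1)[of \<kappa>] nf_defined_over_generator(2)[of \<kappa>], of g]
    unfolding nf_defined_over_generator(3) .
qed

lemma nf_map_ideal:
  assumes "coeffs_in B f" "\<nu> \<in> A"
  shows "nf (map_ideal B g I) A (map_coeffs g f) \<nu> = g (nf I A f \<nu>)" "nf I A f \<nu> \<in> B"
proof -
  show "nf I A f \<nu> \<in> B" using nfL_map_coeffs assms by blast
  have b: "nf I A f \<nu> \<in> B" if "\<nu> \<in> A" for \<nu> using nfL_map_coeffs assms(1) that by blast
  have lc: "coeffs_in B (lincomb A (nf I A f))" "map_coeffs g (lincomb A (nf I A f)) = lincomb A (\<lambda>\<nu>. g (nf I A f \<nu>))"
    using map_coeffs_lincomb[OF g nf_defined_overD(4), of "nf I A f"] b by blast+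
  have "map_coeffs g (f - lincomb A (nf I A f)) \<in> map_ideal B g I"
    using map_coeffs_diff[OF g assms(1) lc(1)] nf_mem[OF nf_defined_overD(3)] by (intro map_ideal_base) auto
  then have "map_coeffs g f - lincomb A (\<lambda>\<nu>. g (nf I A f \<nu>)) \<in> map_ideal B g I"
    using map_coeffs_diff[OF g assms(1) lc(1)] lc(2) by simp
  then show "nf (map_ideal B g I) A (map_coeffs g f) \<nu> = g (nf I A f \<nu>)"
    by (rule nf_unique[OF is_ideal_map_ideal nf_basis_map_ideal _ assms(2)])
qed

lemma map_ideal_subset_generators:
  assumes K: "is_ideal K" "ordge M \<subseteq> K"
    and p: "\<And>\<kappa>. tdeg \<kappa> < M \<Longrightarrow> monom \<kappa> - lincomb A (\<lambda>\<nu>. g (nf I A (monom \<kappa>) \<nu>)) \<in> K"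
  shows "map_ideal B g I \<subseteq> K"
proof
  fix f assume f: "f \<in> map_ideal B g I"
  let ?T = "{\<kappa> :: 'v \<Rightarrow> nat. tdeg \<kappa> < M}"
  let ?p = "\<lambda>\<kappa>. monom \<kappa> - lincomb A (\<lambda>\<nu>. g (nf I A (monom \<kappa>) \<nu>))"
  have "(\<Sum>\<kappa>\<in>?T. mfps_const (mfps_coeff f \<kappa>) * ?p \<kappa>) = lincomb ?T (mfps_coeff f) - lincomb A (nfL f)"
    unfolding nfL_def lincomb_sum lincomb_scale
    by (simp add: lincomb_def right_diff_distrib sum_subtractf)
  also have "lincomb A (nfL f) = 0" using nfL_map_ideal[OF f] by (simp add: lincomb_def)
  finally have "f = (f - lincomb ?T (mfps_coeff f)) + (\<Sum>\<kappa>\<in>?T. mfps_const (mfps_coeff f \<kappa>) * ?p \<kappa>)"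
    by simp
  also have "\<dots> \<in> K"
  proof (rule idl.subspace_add[OF K(1)])
    show "f - lincomb ?T (mfps_coeff f) \<in> K" using minus_truncate K(2) by blast
    show "(\<Sum>\<kappa>\<in>?T. mfps_const (mfps_coeff f \<kappa>) * ?p \<kappa>) \<in> K"
      using p by (intro idl.subspace_sum[OF K(1)] ideal_mult[OF K(1)]) auto
  qed
  finally show "f \<in> K" .
qed

lemma map_ideal_UNIV_iff: "map_ideal B g I = UNIV \<longleftrightarrow> I = UNIV"
  using nf_basis_UNIV_iff[OF nf_defined_overD(3)] nf_basis_UNIV_iff[OF nf_basis_map_ideal] by simp

text \<open>Normal forms commute with \<open>g\<close>, so for injective \<open>g\<close> a
  vanishing normal form downstairs already vanishes upstairs.\<close>

lemma map_ideal_reflects: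
  assumes "inj_on g B" "coeffs_in B f"
  shows "map_coeffs g f \<in> map_ideal B g I \<longleftrightarrow> f \<in> I"
proof
  assume "map_coeffs g f \<in> map_ideal B g I"
  then have "g (nf I A f \<nu>) = g 0 \<and> nf I A f \<nu> \<in> B" if "\<nu> \<in> A" for \<nu>
    using that nf_eq_0_iff[OF is_ideal_map_ideal nf_basis_map_ideal] nf_map_ideal[OF assms(2) that] subhom_0[OF g] by metis
  then have "nf I A f \<nu> = 0" if "\<nu> \<in> A" for \<nu>
    using that inj_onD[OF assms(1)] subhom_0[OF g] by blast
  then show "f \<in> I" using nf_eq_0_iff[OF nf_defined_overD(1,3)] by blast
qed (intro map_ideal_base assms)

end

text \<open>The containment is witnessed by the coefficients expressing the monomials of degree
  \<open>M\<close> through \<open>x\<close>. Nakayama's lemma tolerates errors of order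
  \<open>Suc M\<close>, so only finitely many field elements enter, and these form
  \<open>Xs\<close>.\<close>

lemma map_coeffs_param_primary:
  fixes x :: "nat \<Rightarrow> ('v::finite, 'k::field) mfps"
  assumes M: "ordge M \<subseteq> igen x n"
  obtains Xs where "finite Xs"
    "\<And>B (g :: 'k \<Rightarrow> 'l::field). subhom B g \<Longrightarrow> Xs \<subseteq> B \<Longrightarrow> (\<And>i. i < n \<Longrightarrow> coeffs_in B (x i)) \<Longrightarrow>
      ordge M \<subseteq> igen (\<lambda>i. map_coeffs g (x i)) n"
proof -
  let ?S = "{\<kappa> :: 'v \<Rightarrow> nat. tdeg \<kappa> = M}" and ?T = "{\<kappa> :: 'v \<Rightarrow> nat. tdeg \<kappa> < Suc M}"
  have "\<exists>c. monom \<kappa> = (\<Sum>i<n. c i * x i)" if "\<kappa> \<in> ?S" for \<kappa>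
    using M monom_ordge[of \<kappa>] that igen_iff[of "monom \<kappa>" x n] by auto
  then obtain \<xi> where \<xi>: "\<And>\<kappa>. \<kappa> \<in> ?S \<Longrightarrow> monom \<kappa> = (\<Sum>i<n. \<xi> \<kappa> i * x i)" by metis
  define Xs where "Xs = (\<lambda>(\<kappa>, i, \<tau>). mfps_coeff (\<xi> \<kappa> i) \<tau>) ` (?S \<times> {..<n} \<times> ?T)"
  have "finite Xs" unfolding Xs_def using finite_tdeg_eq finite_tdeg_less by blast
  moreover have "ordge M \<subseteq> igen (\<lambda>i. map_coeffs g (x i)) n"
    if g: "subhom B g" and XB: "Xs \<subseteq> B" and x: "\<And>i. i < n \<Longrightarrow> coeffs_in B (x i)" for B and g :: "'k \<Rightarrow> 'l"
  proof (rule igen_nakayama)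
    let ?x = "\<lambda>i. map_coeffs g (x i)"
    let ?t = "\<lambda>\<kappa> i. lincomb ?T (mfps_coeff (\<xi> \<kappa> i))"
    have key: "monom \<kappa> - (\<Sum>i<n. map_coeffs g (?t \<kappa> i) * ?x i) \<in> ordge (Suc M)" if \<kappa>: "\<kappa> \<in> ?S" for \<kappa>
    proof -
      have bt: "coeffs_in B (?t \<kappa> i)" if "i < n" for i
      proof -
        have "mfps_coeff (\<xi> \<kappa> i) \<tau> \<in> B" if \<tau>: "\<tau> \<in> ?T" for \<tau>
        proof -
          have "mfps_coeff (\<xi> \<kappa> i) \<tau> \<in> Xs"
            unfolding Xs_def using \<kappa> \<tau> \<open>i < n\<close> by (intro image_eqI[of _ _ "(\<kappa>, i, \<tau>)"]) auto
          then show ?thesis using XB by blast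
        qed
        then show ?thesis using map_coeffs_lincomb[OF g finite_tdeg_less] by blast
      qed
      have btx: "coeffs_in B (?t \<kappa> i * x i)" "map_coeffs g (?t \<kappa> i * x i) = map_coeffs g (?t \<kappa> i) * ?x i" if "i < n" for i
        using map_coeffs_mult[OF g bt[OF that] x[OF that]] by auto
      have bs: "coeffs_in B (\<Sum>i<n. ?t \<kappa> i * x i)" "map_coeffs g (\<Sum>i<n. ?t \<kappa> i * x i) = (\<Sum>i<n. map_coeffs g (?t \<kappa> i) * ?x i)"
        using map_coeffs_sum[OF g, of "{..<n}" "\<lambda>i. ?t \<kappa> i * x i"] btx by auto
      have "monom \<kappa> - (\<Sum>i<n. ?t \<kappa> i * x i) = (\<Sum>i<n. (\<xi> \<kappa> i - ?t \<kappa> i) * x i)"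
        using \<xi>[OF \<kappa>] by (simp add: left_diff_distrib sum_subtractf)
      also have "\<dots> \<in> ordge (Suc M)"
        by (intro idl.subspace_sum[OF is_ideal_ordge] ideal_mult'[OF is_ideal_ordge] minus_truncate)
      finally have "map_coeffs g (monom \<kappa> - (\<Sum>i<n. ?t \<kappa> i * x i)) \<in> ordge (Suc M)" by (rule map_coeffs_ordge[OF g])
      then show ?thesis
        using map_coeffs_diff[OF g _ bs(1), of "monom \<kappa>"] map_coeffs_monom[OF g, of \<kappa>] bs(2) by simp
    qed
    fix f :: "('v, 'l) mfps" assume "f \<in> ordge M"
    then have "f \<in> ordge (M + 0)" by simp
    then obtain h where h: "f = (\<Sum>\<kappa>\<in>?S. monom \<kappa> * h \<kappa>)" using ordge_decomp by blast
    have "f - (\<Sum>\<kappa>\<in>?S. (\<Sum>i<n. map_coeffs g (?t \<kappa> i) * ?x i) * h \<kappa>)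
        = (\<Sum>\<kappa>\<in>?S. (monom \<kappa> - (\<Sum>i<n. map_coeffs g (?t \<kappa> i) * ?x i)) * h \<kappa>)"
      by (simp add: h left_diff_distrib sum_subtractf)
    also have "\<dots> \<in> ordge (Suc M)"
      by (intro idl.subspace_sum[OF is_ideal_ordge] ideal_mult'[OF is_ideal_ordge] key)
    finally have "f - (\<Sum>\<kappa>\<in>?S. (\<Sum>i<n. map_coeffs g (?t \<kappa> i) * ?x i) * h \<kappa>) \<in> ordge (Suc M)" .
    moreover have "(\<Sum>\<kappa>\<in>?S. (\<Sum>i<n. map_coeffs g (?t \<kappa> i) * ?x i) * h \<kappa>) \<in> igen ?x n"
      by (intro idl.subspace_sum[OF is_ideal_igen] ideal_mult'[OF is_ideal_igen] igen_sum)
    ultimately show "\<exists>p\<in>igen ?x n. f - p \<in> ordge (Suc M)" by blast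
  qed
  ultimately show ?thesis by (rule that)
qed

lemma map_coeffs_param:
  fixes x :: "nat \<Rightarrow> ('v::finite, 'k::field) mfps"
  assumes x: "param x"
  obtains Xs where "finite Xs"
    "\<And>B (g :: 'k \<Rightarrow> 'l::field). subhom B g \<Longrightarrow> Xs \<subseteq> B \<Longrightarrow> (\<And>i. i < CARD('v) \<Longrightarrow> coeffs_in B (x i)) \<Longrightarrow>
      param (\<lambda>i. map_coeffs g (x i)) \<and> map_ideal B g (pgen x) = pgen (\<lambda>i. map_coeffs g (x i))"
proof -
  let ?n = "CARD('v)"
  obtain M where M: "ordge M \<subseteq> igen x ?n" using x unfolding param_def by blast
  have Mp: "ordge M \<subseteq> pgen x" using M by (simp add: pgen_def)
  obtain X1 where X1: "finite X1"
    "\<And>B (g :: 'k \<Rightarrow> 'l). subhom B g \<Longrightarrow> X1 \<subseteq> B \<Longrightarrow> (\<And>i. i < ?n \<Longrightarrow> coeffs_in B (x i)) \<Longrightarrow>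
      ordge M \<subseteq> igen (\<lambda>i. map_coeffs g (x i)) ?n"
    using map_coeffs_param_primary[OF M] by blast
  obtain X2 A where X2: "finite X2" "\<And>B. X2 \<subseteq> B \<Longrightarrow> 0 \<in> B \<Longrightarrow> nf_defined_over B (pgen x) M A"
    using ex_nf_defined_over[OF is_ideal_pgen Mp] by blast
  let ?T = "{\<kappa> :: 'v \<Rightarrow> nat. tdeg \<kappa> < M}"
  let ?p = "\<lambda>\<kappa>. monom \<kappa> - lincomb A (nf (pgen x) A (monom \<kappa>))"
  have nfb: "nf_basis (pgen x) A" using X2(2)[of UNIV] by (simp add: nf_defined_over_def)
  have "\<exists>c. ?p \<kappa> = (\<Sum>i<?n. c i * x i)" for \<kappa>
    using nf_mem[OF nfb, of "monom \<kappa>"] igen_iff[of "?p \<kappa>" x ?n] by (simp add: pgen_def)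
  then obtain \<zeta> where \<zeta>: "\<And>\<kappa>. ?p \<kappa> = (\<Sum>i<?n. \<zeta> \<kappa> i * x i)" by metis
  \<comment> \<open>Field elements that express the standard generators of \<open>(x)\<close>
    through \<open>x\<close> modulo \<open>ordge M\<close>; they bound the specialized ideal from
    above.\<close>
  define X3 where "X3 = (\<lambda>(\<kappa>, i, \<tau>). mfps_coeff (\<zeta> \<kappa> i) \<tau>) ` (?T \<times> {..<?n} \<times> ?T)"
  have "finite (X1 \<union> X2 \<union> X3)"
    unfolding X3_def using X1(1) X2(1) finite_tdeg_less by blast
  moreover have "param (\<lambda>i. map_coeffs g (x i)) \<and> map_ideal B g (pgen x) = pgen (\<lambda>i. map_coeffs g (x i))"
    if g: "subhom B g" and XB: "X1 \<union> X2 \<union> X3 \<subseteq> B" and xB: "\<And>i. i < ?n \<Longrightarrow> coeffs_in B (x i)"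
    for B and g :: "'k \<Rightarrow> 'l"
  proof
    let ?x = "\<lambda>i. map_coeffs g (x i)"
    have M': "ordge M \<subseteq> igen ?x ?n" using X1(2)[OF g] XB xB by blast
    have "?x i \<in> ordge 1" if "i < ?n" for i
      using x that by (intro map_coeffs_ordge[OF g]) (auto simp: param_def)
    then show "param ?x" using M' unfolding param_def by blast
    have d: "nf_defined_over B (pgen x) M A" using X2(2)[of B] XB subhom_0[OF g] by blast
    show "map_ideal B g (pgen x) = pgen ?x"
    proof
      show "pgen ?x \<subseteq> map_ideal B g (pgen x)"
        unfolding pgen_def igen_subset_iff[OF is_ideal_map_ideal] using xB
        by (auto intro!: map_ideal_base igen_base)
      show "map_ideal B g (pgen x) \<subseteq> pgen ?x"
      proof (rule map_ideal_subset_generators[OF g d is_ideal_pgen])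
        show "ordge M \<subseteq> pgen ?x" using M' by (simp add: pgen_def)
        fix \<kappa> :: "'v \<Rightarrow> nat" assume \<kappa>: "tdeg \<kappa> < M"
        let ?t = "\<lambda>i. lincomb ?T (mfps_coeff (\<zeta> \<kappa> i))"
        have bt: "coeffs_in B (?t i)" if "i < ?n" for i
        proof -
          have "mfps_coeff (\<zeta> \<kappa> i) \<tau> \<in> B" if \<tau>: "\<tau> \<in> ?T" for \<tau>
          proof -
            have "mfps_coeff (\<zeta> \<kappa> i) \<tau> \<in> X3"
              unfolding X3_def using \<kappa> \<tau> \<open>i < ?n\<close> by (intro image_eqI[of _ _ "(\<kappa>, i, \<tau>)"]) auto
            then show ?thesis using XB by blast
          qed
          then show ?thesis using map_coeffs_lincomb[OF g finite_tdeg_less] by blast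
        qed
        have btx: "coeffs_in B (?t i * x i)" "map_coeffs g (?t i * x i) = map_coeffs g (?t i) * ?x i" if "i < ?n" for i
          using map_coeffs_mult[OF g bt[OF that] xB[OF that]] by auto
        have bs: "coeffs_in B (\<Sum>i<?n. ?t i * x i)" "map_coeffs g (\<Sum>i<?n. ?t i * x i) = (\<Sum>i<?n. map_coeffs g (?t i) * ?x i)"
          using map_coeffs_sum[OF g, of "{..<?n}" "\<lambda>i. ?t i * x i"] btx by auto
        have "?p \<kappa> - (\<Sum>i<?n. ?t i * x i) = (\<Sum>i<?n. (\<zeta> \<kappa> i - ?t i) * x i)"
          unfolding \<zeta>[of \<kappa>] by (simp add: left_diff_distrib sum_subtractf)
        also have "\<dots> \<in> ordge M"
          by (intro idl.subspace_sum[OF is_ideal_ordge] ideal_mult'[OF is_ideal_ordge] minus_truncate)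
        finally have "map_coeffs g (?p \<kappa> - (\<Sum>i<?n. ?t i * x i)) \<in> ordge M" by (rule map_coeffs_ordge[OF g])
        then have "map_coeffs g (?p \<kappa>) - (\<Sum>i<?n. map_coeffs g (?t i) * ?x i) \<in> ordge M"
          using map_coeffs_diff[OF g nf_defined_over_generator(2)[OF g d] bs(1)] bs(2) by simp
        then have "map_coeffs g (?p \<kappa>) - (\<Sum>i<?n. map_coeffs g (?t i) * ?x i) \<in> pgen ?x"
          using M' by (auto simp: pgen_def)
        then have "map_coeffs g (?p \<kappa>) - (\<Sum>i<?n. map_coeffs g (?t i) * ?x i) + (\<Sum>i<?n. map_coeffs g (?t i) * ?x i) \<in> pgen ?x"
          unfolding pgen_def by (intro idl.subspace_add[OF is_ideal_igen] igen_sum)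
        then show "monom \<kappa> - lincomb A (\<lambda>\<nu>. g (nf (pgen x) A (monom \<kappa>) \<nu>)) \<in> pgen ?x"
          using nf_defined_over_generator(3)[OF g d] by simp
      qed
    qed
  qed
  ultimately show ?thesis by (rule that)
qed

text \<open>The relations that reduce the monomials of degree below \<open>M\<close> generate
  \<open>I\<close> modulo \<open>ordge M\<close>, since the normal form of \<open>f\<close>
  vanishes.\<close>

lemma generators_expand:
  assumes I: "is_ideal I" "ordge M \<subseteq> I" and A: "nf_basis I A" and f: "f \<in> I"
  shows "f - (\<Sum>\<kappa> | tdeg \<kappa> < M. mfps_const (mfps_coeff f \<kappa>) * (monom \<kappa> - lincomb A (nf I A (monom \<kappa>)))) \<in> ordge M"
proof -
  let ?T = "{\<kappa> :: 'a \<Rightarrow> nat. tdeg \<kappa> < M}"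
  have "(\<Sum>\<kappa>\<in>?T. mfps_const (mfps_coeff f \<kappa>) * (monom \<kappa> - lincomb A (nf I A (monom \<kappa>))))
      = lincomb ?T (mfps_coeff f) - lincomb A (\<lambda>\<nu>. \<Sum>\<kappa>\<in>?T. mfps_coeff f \<kappa> * nf I A (monom \<kappa>) \<nu>)"
    unfolding lincomb_sum lincomb_scale by (simp add: lincomb_def right_diff_distrib sum_subtractf)
  also have "lincomb A (\<lambda>\<nu>. \<Sum>\<kappa>\<in>?T. mfps_coeff f \<kappa> * nf I A (monom \<kappa>) \<nu>) = 0"
  proof -
    have "(\<Sum>\<kappa>\<in>?T. mfps_coeff f \<kappa> * nf I A (monom \<kappa>) \<nu>) = 0" if "\<nu> \<in> A" for \<nu>
      using nf_expand[OF I(1) A I(2) that, of f] nf_eq_0_iff[OF I(1) A] f that by simp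
    then show ?thesis by (simp add: lincomb_def)
  qed
  finally show ?thesis using minus_truncate[of f M] by simp
qed

text \<open>
  The quotient of \<open>(x)\<close> by \<open>I\<close> is the kernel of a linear map \<open>a\<close> between finite-dimensional spaces.
  A right inverse of \<open>a\<close> on a complement of the kernel certifies that the kernel does not grow
  under specialization, so it suffices that \<open>g\<close> is defined on the entries of that inverse.
\<close>

lemma map_ideal_quotient:
  fixes x :: "nat \<Rightarrow> ('v::finite, 'k::field) mfps"
  assumes x: "param x" and I: "is_ideal I" "ordge M0 \<subseteq> I"
  obtains Xs where "finite Xs"
    "\<And>B (g :: 'k \<Rightarrow> 'l::field). subhom B g \<Longrightarrow> Xs \<subseteq> B \<Longrightarrow> (\<And>i. i < CARD('v) \<Longrightarrow> coeffs_in B (x i)) \<Longrightarrow>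
      map_ideal B g (ideal_quotient (pgen x) I) = ideal_quotient (pgen (\<lambda>i. map_coeffs g (x i))) (map_ideal B g I)"
proof -
  let ?n = "CARD('v)" and ?J = "ideal_quotient (pgen x) I"
  obtain M1 where M1: "ordge M1 \<subseteq> pgen x" using param_primary[OF x] by blast
  define M where "M = max M0 M1"
  have Mx: "ordge M \<subseteq> pgen x" and MI: "ordge M \<subseteq> I"
    using M1 I(2) ordge_mono[of M1 M] ordge_mono[of M0 M] by (auto simp: M_def)
  have J: "is_ideal ?J" by (rule is_ideal_quotient[OF is_ideal_pgen])
  have MJ: "ordge M \<subseteq> ?J" using Mx ideal_quotient_superset[OF is_ideal_pgen] by blast
  obtain X1 where X1: "finite X1"
    "\<And>B (g :: 'k \<Rightarrow> 'l). subhom B g \<Longrightarrow> X1 \<subseteq> B \<Longrightarrow> (\<And>i. i < ?n \<Longrightarrow> coeffs_in B (x i)) \<Longrightarrow>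
      param (\<lambda>i. map_coeffs g (x i)) \<and> map_ideal B g (pgen x) = pgen (\<lambda>i. map_coeffs g (x i))"
    using map_coeffs_param[OF x] by metis
  obtain X2 Ax where X2: "finite X2" "\<And>B. X2 \<subseteq> B \<Longrightarrow> 0 \<in> B \<Longrightarrow> nf_defined_over B (pgen x) M Ax"
    using ex_nf_defined_over[OF is_ideal_pgen Mx] by blast
  obtain X3 AI where X3: "finite X3" "\<And>B. X3 \<subseteq> B \<Longrightarrow> 0 \<in> B \<Longrightarrow> nf_defined_over B I M AI"
    using ex_nf_defined_over[OF I(1) MI] by blast
  obtain X4 AJ where X4: "finite X4" "\<And>B. X4 \<subseteq> B \<Longrightarrow> 0 \<in> B \<Longrightarrow> nf_defined_over B ?J M AJ"
    using ex_nf_defined_over[OF J MJ] by blast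
  have nx: "nf_basis (pgen x) Ax" and nI: "nf_basis I AI" and nJ: "nf_basis ?J AJ"
    using X2(2)[of UNIV] X3(2)[of UNIV] X4(2)[of UNIV] by (simp_all add: nf_defined_over_def)
  have finA: "finite Ax" "finite AJ" using nx nJ by (simp_all add: nf_basis_def)
  let ?T = "{\<kappa> :: 'v \<Rightarrow> nat. tdeg \<kappa> < M}"
  define p where "p \<tau> = monom \<tau> - lincomb AI (nf I AI (monom \<tau>))" for \<tau>
  \<comment> \<open>Products of the monomials complementary to \<open>(x) : I\<close> with the
    generators \<open>p\<close> of \<open>I\<close>, in coordinates modulo \<open>(x)\<close>. A
    combination annihilating all \<open>p\<close> lies in \<open>(x) : I\<close>, so the rows are
    independent.\<close>
  define a where "a \<kappa> q = nf (pgen x) Ax (monom \<kappa> * p (fst q)) (snd q)" for \<kappa> q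
  let ?Q = "?T \<times> Ax"
  have finQ: "finite ?Q" using finA finite_tdeg_less by blast
  have "\<forall>\<kappa>\<in>AJ. c \<kappa> = 0" if c: "\<And>q. q \<in> ?Q \<Longrightarrow> (\<Sum>\<kappa>\<in>AJ. c \<kappa> * a \<kappa> q) = 0" for c
  proof -
    have lp: "lincomb AJ c * p \<tau> \<in> pgen x" if \<tau>: "tdeg \<tau> < M" for \<tau>
    proof -
      have "nf (pgen x) Ax (lincomb AJ c * p \<tau>) \<nu> = 0" if "\<nu> \<in> Ax" for \<nu>
        using c[of "(\<tau>, \<nu>)"] that \<tau>
        by (simp add: lincomb_def sum_distrib_right mult.assoc nf_sum[OF is_ideal_pgen nx that]
            nf_scale[OF is_ideal_pgen nx that] a_def)
      then show ?thesis using nf_eq_0_iff[OF is_ideal_pgen nx] by blast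
    qed
    have "lincomb AJ c * f \<in> pgen x" if f: "f \<in> I" for f
    proof -
      let ?s = "\<Sum>\<kappa>\<in>?T. mfps_const (mfps_coeff f \<kappa>) * p \<kappa>"
      have "f - ?s \<in> ordge M"
        using generators_expand[OF I(1) MI nI f] by (simp add: p_def)
      then have "lincomb AJ c * (f - ?s) \<in> pgen x"
        using Mx by (intro ideal_mult[OF is_ideal_pgen]) blast
      moreover have "lincomb AJ c * ?s = (\<Sum>\<kappa>\<in>?T. mfps_const (mfps_coeff f \<kappa>) * (lincomb AJ c * p \<kappa>))"
        by (simp add: sum_distrib_left mult.left_commute)
      moreover have "(\<Sum>\<kappa>\<in>?T. mfps_const (mfps_coeff f \<kappa>) * (lincomb AJ c * p \<kappa>)) \<in> pgen x"
        by (rule idl.subspace_sum[OF is_ideal_pgen], rule ideal_mult[OF is_ideal_pgen], rule lp) simp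
      ultimately have "lincomb AJ c * (f - ?s) + lincomb AJ c * ?s \<in> pgen x"
        by (simp only: idl.subspace_add[OF is_ideal_pgen])
      then show ?thesis by (simp flip: distrib_left)
    qed
    then have "lincomb AJ c \<in> ?J" by (simp add: ideal_quotient_def)
    then show ?thesis using nJ unfolding nf_basis_def by blast
  qed
  then obtain \<sigma> where \<sigma>: "\<forall>i\<in>AJ. \<forall>j\<in>AJ. (\<Sum>q\<in>?Q. a i q * \<sigma> q j) = (if i = j then 1 else 0)"
    using right_inverse_of_independent[OF finA(2) finQ, of a] by blast
  define X5 where "X5 = (\<lambda>(q, j). \<sigma> q j) ` (?Q \<times> AJ)"
  define Xs where "Xs = X1 \<union> X2 \<union> X3 \<union> X4 \<union> X5"
  have "finite Xs" unfolding Xs_def X5_def using X1(1) X2(1) X3(1) X4(1) finA finQ by blast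
  moreover have "map_ideal B g ?J = ideal_quotient (pgen (\<lambda>i. map_coeffs g (x i))) (map_ideal B g I)"
    if g: "subhom B g" and XB: "Xs \<subseteq> B" and xB: "\<And>i. i < ?n \<Longrightarrow> coeffs_in B (x i)" for B and g :: "'k \<Rightarrow> 'l"
  proof -
    let ?x = "\<lambda>i. map_coeffs g (x i)"
    have B0: "0 \<in> B" using subhom_0[OF g] by simp
    have "X1 \<subseteq> B" using XB by (simp add: Xs_def)
    then have x': "param ?x" "map_ideal B g (pgen x) = pgen ?x" using X1(2)[OF g _ xB] by blast+
    have dx: "nf_defined_over B (pgen x) M Ax" by (rule X2(2)[OF _ B0]) (use XB in \<open>simp add: Xs_def\<close>)
    have dI: "nf_defined_over B I M AI" by (rule X3(2)[OF _ B0]) (use XB in \<open>simp add: Xs_def\<close>)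
    have dJ: "nf_defined_over B ?J M AJ" by (rule X4(2)[OF _ B0]) (use XB in \<open>simp add: Xs_def\<close>)
    have quot: "is_ideal (ideal_quotient (pgen ?x) (map_ideal B g I))" by (rule is_ideal_quotient[OF is_ideal_pgen])
    have sub: "map_ideal B g ?J \<subseteq> ideal_quotient (pgen ?x) (map_ideal B g I)"
    proof (rule map_ideal_subset[OF quot])
      fix f assume f: "f \<in> ?J" "coeffs_in B f"
      have "is_ideal {h. map_coeffs g f * h \<in> pgen ?x}"
      proof (rule idl.subspaceI)
        show "0 \<in> {h. map_coeffs g f * h \<in> pgen ?x}" using idl.subspace_0[OF is_ideal_pgen] by simp
        show "h + k \<in> {h. map_coeffs g f * h \<in> pgen ?x}"
          if "h \<in> {h. map_coeffs g f * h \<in> pgen ?x}" "k \<in> {h. map_coeffs g f * h \<in> pgen ?x}" for h k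
          using that idl.subspace_add[OF is_ideal_pgen] by (simp add: distrib_left)
        show "c * h \<in> {h. map_coeffs g f * h \<in> pgen ?x}" if "h \<in> {h. map_coeffs g f * h \<in> pgen ?x}" for c h
          using that ideal_mult[OF is_ideal_pgen, of "map_coeffs g f * h" ?x c] by (simp add: mult.left_commute)
      qed
      moreover have "map_coeffs g h \<in> {h. map_coeffs g f * h \<in> pgen ?x}" if h: "h \<in> I" "coeffs_in B h" for h
      proof -
        have "f * h \<in> pgen x" using f(1) h(1) by (simp add: ideal_quotient_def)
        then have "map_coeffs g (f * h) \<in> pgen ?x"
          using map_ideal_base[of "f * h" "pgen x" B g] map_coeffs_mult[OF g f(2) h(2)] x'(2) by simp
        then show ?thesis using map_coeffs_mult[OF g f(2) h(2)] by simp
      qed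
      ultimately have "map_ideal B g I \<subseteq> {h. map_coeffs g f * h \<in> pgen ?x}" by (rule map_ideal_subset)
      then show "map_coeffs g f \<in> ideal_quotient (pgen ?x) (map_ideal B g I)"
        by (auto simp: ideal_quotient_def)
    qed
    moreover have "ideal_quotient (pgen ?x) (map_ideal B g I) \<subseteq> map_ideal B g ?J"
    proof
      fix f assume f: "f \<in> ideal_quotient (pgen ?x) (map_ideal B g I)"
      note n'J = nf_basis_map_ideal[OF g dJ]
      \<comment> \<open>Modulo the specialized quotient \<open>f\<close> is a combination of
        complementary monomials; the image of the right inverse under \<open>g\<close> forces its
        coefficients to vanish.\<close>
      define c where "c = nf (map_ideal B g ?J) AJ f"
      have fc: "f - lincomb AJ c \<in> map_ideal B g ?J" unfolding c_def by (rule nf_mem[OF n'J])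
      have "f - (f - lincomb AJ c) \<in> ideal_quotient (pgen ?x) (map_ideal B g I)"
        using f subsetD[OF sub fc] by (rule idl.subspace_diff[OF quot])
      then have lc: "lincomb AJ c \<in> ideal_quotient (pgen ?x) (map_ideal B g I)" by simp
      note n'x = nf_basis_map_ideal[OF g dx]
      have bp: "coeffs_in B (p \<tau>)" "map_coeffs g (p \<tau>) \<in> map_ideal B g I" for \<tau>
        unfolding p_def using nf_defined_over_generator(1,2)[OF g dI] by (auto intro: map_ideal_base)
      have bmp: "coeffs_in B (monom \<kappa> * p \<tau>)" "map_coeffs g (monom \<kappa> * p \<tau>) = monom \<kappa> * map_coeffs g (p \<tau>)" for \<kappa> \<tau>
        using map_coeffs_mult[OF g _ bp(1), of "monom \<kappa>" \<tau>] map_coeffs_monom[OF g, of \<kappa>] by auto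
      have aB: "a \<kappa> q \<in> B" and an: "nf (map_ideal B g (pgen x)) Ax (monom \<kappa> * map_coeffs g (p (fst q))) (snd q) = g (a \<kappa> q)"
        if "q \<in> ?Q" for \<kappa> q
        using nf_map_ideal[OF g dx bmp(1), of "snd q" \<kappa> "fst q"] that by (auto simp: a_def bmp(2))
      have zero: "(\<Sum>\<kappa>\<in>AJ. c \<kappa> * g (a \<kappa> q)) = 0" if q: "q \<in> ?Q" for q
      proof -
        have sq: "snd q \<in> Ax" using q by auto
        have "lincomb AJ c * map_coeffs g (p (fst q)) \<in> map_ideal B g (pgen x)"
          using lc bp(2) by (simp add: ideal_quotient_def x'(2))
        then have "nf (map_ideal B g (pgen x)) Ax (lincomb AJ c * map_coeffs g (p (fst q))) (snd q) = 0"
          using nf_eq_0_iff[OF is_ideal_map_ideal n'x] sq by blast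
        then show ?thesis
          using an[OF q]
          by (simp add: lincomb_def sum_distrib_right mult.assoc nf_sum[OF is_ideal_map_ideal n'x sq]
              nf_scale[OF is_ideal_map_ideal n'x sq])
      qed
      have "c \<mu> = 0" if \<mu>: "\<mu> \<in> AJ" for \<mu>
      proof -
        have \<sigma>B: "\<sigma> q \<mu> \<in> B" if "q \<in> ?Q" for q
        proof -
          have "\<sigma> q \<mu> \<in> X5" unfolding X5_def using that \<mu> by (intro image_eqI[of _ _ "(q, \<mu>)"]) auto
          then show ?thesis using XB by (auto simp: Xs_def)
        qed
        have delta: "(\<Sum>q\<in>?Q. g (a \<kappa> q) * g (\<sigma> q \<mu>)) = (if \<kappa> = \<mu> then 1 else 0)" if \<kappa>: "\<kappa> \<in> AJ" for \<kappa>
        proof -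
          have m: "a \<kappa> q * \<sigma> q \<mu> \<in> B" "g (a \<kappa> q * \<sigma> q \<mu>) = g (a \<kappa> q) * g (\<sigma> q \<mu>)" if "q \<in> ?Q" for q
            using subhom_mult[OF g aB[OF that] \<sigma>B[OF that]] by auto
          have "(\<Sum>q\<in>?Q. g (a \<kappa> q) * g (\<sigma> q \<mu>)) = (\<Sum>q\<in>?Q. g (a \<kappa> q * \<sigma> q \<mu>))"
            using m(2) by (intro sum.cong) simp_all
          also have "\<dots> = g (\<Sum>q\<in>?Q. a \<kappa> q * \<sigma> q \<mu>)"
            using subhom_sum[OF g, of ?Q "\<lambda>q. a \<kappa> q * \<sigma> q \<mu>"] m(1) by simp
          also have "\<dots> = (if \<kappa> = \<mu> then 1 else 0)"
            using \<sigma> \<kappa> \<mu> subhom_0[OF g] subhom_1[OF g] by simp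
          finally show ?thesis .
        qed
        have "0 = (\<Sum>q\<in>?Q. (\<Sum>\<kappa>\<in>AJ. c \<kappa> * g (a \<kappa> q)) * g (\<sigma> q \<mu>))"
          using zero by simp
        also have "\<dots> = (\<Sum>\<kappa>\<in>AJ. c \<kappa> * (\<Sum>q\<in>?Q. g (a \<kappa> q) * g (\<sigma> q \<mu>)))"
          unfolding sum_distrib_left sum_distrib_right mult.assoc by (rule sum.swap)
        also have "\<dots> = (\<Sum>\<kappa>\<in>AJ. if \<kappa> = \<mu> then c \<kappa> else 0)"
          using delta by (intro sum.cong) auto
        also have "\<dots> = c \<mu>" using finA(2) \<mu> by simp
        finally show ?thesis by simp
      qed
      then have "lincomb AJ c = 0" by (simp add: lincomb_def)
      then show "f \<in> map_ideal B g ?J" using fc by simp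
    qed
    ultimately show ?thesis by (rule antisym)
  qed
  ultimately show ?thesis by (rule that)
qed

lemma map_ideal_UNIV:
  fixes g :: "'k::comm_ring_1 \<Rightarrow> 'l::comm_ring_1"
  assumes "subhom B g"
  shows "map_ideal B g (UNIV :: ('v::finite, 'k) mfps set) = UNIV"
proof -
  have 1: "coeffs_in B (1 :: ('v, 'k) mfps)" "map_coeffs g (1 :: ('v, 'k) mfps) = 1"
    using map_coeffs_monom[OF assms, of "\<lambda>_ :: 'v. 0"] by (simp_all add: monom_0)
  have "map_coeffs g 1 \<in> map_ideal B g (UNIV :: ('v, 'k) mfps set)" by (rule map_ideal_base[OF _ 1(1)]) simp
  then show ?thesis unfolding ideal_UNIV_iff[OF is_ideal_map_ideal] by (simp only: 1)
qed

lemma param_truncate: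
  fixes x :: "nat \<Rightarrow> ('v::finite, 'k::field) mfps"
  assumes "param x"
  obtains N where "param (\<lambda>i. lincomb {\<kappa>. tdeg \<kappa> < Suc N} (mfps_coeff (x i)))"
    "pgen (\<lambda>i. lincomb {\<kappa>. tdeg \<kappa> < Suc N} (mfps_coeff (x i))) = pgen x"
proof -
  obtain N where N: "ordge N \<subseteq> igen x CARD('v)" and x1: "\<And>i. i < CARD('v) \<Longrightarrow> x i \<in> ordge 1"
    using assms unfolding param_def by blast
  let ?y = "\<lambda>i. lincomb {\<kappa>. tdeg \<kappa> < Suc N} (mfps_coeff (x i))"
  have d: "x i - ?y i \<in> ordge (Suc N)" for i by (rule minus_truncate)
  have "?y i \<in> ordge 1" if "i < CARD('v)" for i
    using x1[OF that] unfolding ordge_1_iff by (simp add: coeff_lincomb finite_tdeg_less)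
  then show ?thesis
    using that[of N] igen_perturb[OF N d] unfolding param_def pgen_def by blast
qed

text \<open>The parameters of each link are first truncated to polynomials, so that a chain of links
  involves only finitely many field elements altogether.\<close>

theorem plicci_specialize:
  fixes I :: "('v::finite, 'k::field) mfps set"
  assumes "is_ideal I" "ordge M \<subseteq> I" "plicci s I"
  shows "\<exists>Xs. finite Xs \<and> (\<forall>B (g :: 'k \<Rightarrow> 'l::field). subhom B g \<longrightarrow> Xs \<subseteq> B \<longrightarrow> plicci s (map_ideal B g I))"
  using assms
proof (induction s arbitrary: I M)
  case 0
  then show ?case by (intro exI[of _ "{}"]) (simp add: map_ideal_UNIV)
next
  case (Suc s)
  show ?case
  proof (cases "I = UNIV")
    case True
    then show ?thesis by (intro exI[of _ "{}"]) (simp add: map_ideal_UNIV)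
  next
    case False
    then obtain x0 where x0: "param x0" "pgen x0 \<subseteq> I" "plicci s (ideal_quotient (pgen x0) I)"
      using Suc.prems(3) by auto
    obtain N where "param (\<lambda>i. lincomb {\<kappa>. tdeg \<kappa> < Suc N} (mfps_coeff (x0 i)))"
      "pgen (\<lambda>i. lincomb {\<kappa>. tdeg \<kappa> < Suc N} (mfps_coeff (x0 i))) = pgen x0"
      using param_truncate[OF x0(1)] by blast
    moreover define x where "x = (\<lambda>i. lincomb {\<kappa>. tdeg \<kappa> < Suc N} (mfps_coeff (x0 i)))"
    ultimately have x: "param x" "pgen x = pgen x0" by (simp_all only:)
    let ?J = "ideal_quotient (pgen x) I"
    define X1 where "X1 = (\<lambda>(i, \<kappa>). mfps_coeff (x0 i) \<kappa>) ` ({..<CARD('v)} \<times> {\<kappa>. tdeg \<kappa> < Suc N})"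
    obtain X2 where X2: "finite X2"
      "\<And>B (g :: 'k \<Rightarrow> 'l). subhom B g \<Longrightarrow> X2 \<subseteq> B \<Longrightarrow> (\<And>i. i < CARD('v) \<Longrightarrow> coeffs_in B (x i)) \<Longrightarrow>
        param (\<lambda>i. map_coeffs g (x i)) \<and> map_ideal B g (pgen x) = pgen (\<lambda>i. map_coeffs g (x i))"
      using map_coeffs_param[OF x(1)] by metis
    obtain X3 where X3: "finite X3"
      "\<And>B (g :: 'k \<Rightarrow> 'l). subhom B g \<Longrightarrow> X3 \<subseteq> B \<Longrightarrow> (\<And>i. i < CARD('v) \<Longrightarrow> coeffs_in B (x i)) \<Longrightarrow>
        map_ideal B g ?J = ideal_quotient (pgen (\<lambda>i. map_coeffs g (x i))) (map_ideal B g I)"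
      using map_ideal_quotient[OF x(1) Suc.prems(1,2)] by metis
    obtain M' where "ordge M' \<subseteq> pgen x" using param_primary[OF x(1)] by blast
    then have "ordge M' \<subseteq> ?J" using ideal_quotient_superset[OF is_ideal_pgen] by blast
    moreover have "plicci s ?J" using x0(3) x(2) by simp
    ultimately obtain X4 where X4: "finite X4"
      "\<And>B (g :: 'k \<Rightarrow> 'l). subhom B g \<Longrightarrow> X4 \<subseteq> B \<Longrightarrow> plicci s (map_ideal B g ?J)"
      using Suc.IH[OF is_ideal_quotient[OF is_ideal_pgen]] by meson
    have "plicci (Suc s) (map_ideal B g I)"
      if g: "subhom B g" and XB: "X1 \<union> X2 \<union> X3 \<union> X4 \<subseteq> B" for B and g :: "'k \<Rightarrow> 'l"
    proof -
      have xB: "coeffs_in B (x i)" if "i < CARD('v)" for i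
      proof -
        have "mfps_coeff (x0 i) \<kappa> \<in> B" if "\<kappa> \<in> {\<kappa>. tdeg \<kappa> < Suc N}" for \<kappa>
        proof -
          have "mfps_coeff (x0 i) \<kappa> \<in> X1"
            unfolding X1_def using that \<open>i < CARD('v)\<close> by (intro image_eqI[of _ _ "(i, \<kappa>)"]) auto
          then show ?thesis using XB by blast
        qed
        then show ?thesis unfolding x_def using map_coeffs_lincomb[OF g finite_tdeg_less] by blast
      qed
      have "param (\<lambda>i. map_coeffs g (x i))" using X2(2)[OF g _ xB] XB by blast
      moreover have "pgen (\<lambda>i. map_coeffs g (x i)) \<subseteq> map_ideal B g I"
        unfolding pgen_def igen_subset_iff[OF is_ideal_map_ideal]
      proof (intro allI impI)
        fix i assume i: "i < CARD('v)"
        have "x i \<in> I" using x(2) x0(2) igen_base[OF i, of x] by (auto simp: pgen_def)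
        then show "map_coeffs g (x i) \<in> map_ideal B g I" using xB[OF i] by (rule map_ideal_base)
      qed
      moreover have "plicci s (ideal_quotient (pgen (\<lambda>i. map_coeffs g (x i))) (map_ideal B g I))"
        using X3(2)[OF g _ xB] X4(2)[OF g] XB by simp
      ultimately show ?thesis by auto
    qed
    moreover have "finite (X1 \<union> X2 \<union> X3 \<union> X4)"
      unfolding X1_def
      by (intro finite_UnI finite_imageI finite_cartesian_product finite_lessThan X2(1) X3(1) X4(1) finite_tdeg_less)
    ultimately show ?thesis by (intro exI[of _ "X1 \<union> X2 \<union> X3 \<union> X4"]) simp
  qed
qed

section \<open>Extending homomorphisms into an algebraically closed field\<close>

definition poly_over :: "'a::comm_ring_1 set \<Rightarrow> 'a poly \<Rightarrow> bool"
  where "poly_over A p \<longleftrightarrow> (\<forall>i. Polynomial.coeff p i \<in> A)"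

definition subring :: "'a::comm_ring_1 set \<Rightarrow> bool"
  where "subring A \<longleftrightarrow> subhom A (\<lambda>x. x)"

lemma subringD:
  assumes "subring A"
  shows "0 \<in> A" "1 \<in> A" "x \<in> A \<Longrightarrow> y \<in> A \<Longrightarrow> x + y \<in> A" "x \<in> A \<Longrightarrow> y \<in> A \<Longrightarrow> x * y \<in> A" "x \<in> A \<Longrightarrow> - x \<in> A"
  using assms by (simp_all add: subring_def subhom_def)

lemma subring_sum: "subring A \<Longrightarrow> (\<And>i. i \<in> S \<Longrightarrow> f i \<in> A) \<Longrightarrow> sum f S \<in> A"
  unfolding subring_def using subhom_sum[of A "\<lambda>x. x" S f] by simp

lemma subring_power: "subring A \<Longrightarrow> x \<in> A \<Longrightarrow> x ^ n \<in> A"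
  by (induction n) (simp_all add: subringD)

context
  fixes A :: "'a::comm_ring_1 set"
  assumes A: "subring A"
begin

lemma poly_over_0: "poly_over A 0"
  by (simp add: poly_over_def subringD(1)[OF A])

lemma poly_over_1: "poly_over A 1"
  by (simp add: poly_over_def subringD(1,2)[OF A] Polynomial.coeff_1)

lemma poly_over_pCons: "a \<in> A \<Longrightarrow> poly_over A p \<Longrightarrow> poly_over A (pCons a p)"
  by (simp add: poly_over_def coeff_pCons split: nat.splits)

lemma poly_over_add: "poly_over A p \<Longrightarrow> poly_over A q \<Longrightarrow> poly_over A (p + q)"
  by (simp add: poly_over_def subringD(3)[OF A])

lemma poly_over_uminus: "poly_over A p \<Longrightarrow> poly_over A (- p)"
  by (simp add: poly_over_def subringD(5)[OF A])

lemma poly_over_diff: "poly_over A p \<Longrightarrow> poly_over A q \<Longrightarrow> poly_over A (p - q)"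
  using poly_over_add[of p "- q"] poly_over_uminus[of q] by simp

lemma poly_over_mult: "poly_over A p \<Longrightarrow> poly_over A q \<Longrightarrow> poly_over A (p * q)"
  unfolding poly_over_def by (simp add: Polynomial.coeff_mult subring_sum[OF A] subringD(4)[OF A])

lemma poly_over_smult: "a \<in> A \<Longrightarrow> poly_over A p \<Longrightarrow> poly_over A (smult a p)"
  by (simp add: poly_over_def subringD(4)[OF A])

lemma poly_over_monom: "a \<in> A \<Longrightarrow> poly_over A (Polynomial.monom a n)"
  by (simp add: poly_over_def Polynomial.coeff_monom subringD(1)[OF A])

end

text \<open>Division with remainder inside a subring, at the price of a power of the leading
  coefficient, which need not be invertible there.\<close>

lemma pseudo_division:
  fixes p q :: "'a::idom poly"
  assumes A: "subring A" and p: "poly_over A p" "p \<noteq> 0"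
  shows "poly_over A q \<Longrightarrow> \<exists>N s r. poly_over A s \<and> poly_over A r \<and>
    smult (lead_coeff p ^ N) q = p * s + r \<and> (r = 0 \<or> degree r < degree p)"
\<comment> \<open>The measure puts the zero polynomial below the nonzero constants, whose degree is
  also 0.\<close>
proof (induction "if q = 0 then 0 else Suc (degree q)" arbitrary: q rule: less_induct)
  case less
  let ?a = "lead_coeff p"
  have aA: "?a \<in> A" using p(1) by (simp add: poly_over_def)
  show ?case
  proof (cases "q = 0 \<or> degree q < degree p")
    case True
    then show ?thesis
      using less.prems poly_over_0[OF A] by (intro exI[of _ 0] exI[of _ 0] exI[of _ q]) auto
  next
    case False
    define m where "m = Polynomial.monom (lead_coeff q) (degree q - degree p)"
    define q' where "q' = smult ?a q - p * m"
    have mA: "poly_over A m"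
      unfolding m_def using less.prems by (intro poly_over_monom[OF A]) (simp add: poly_over_def)
    have q'A: "poly_over A q'"
      unfolding q'_def using less.prems p aA mA
      by (intro poly_over_diff[OF A] poly_over_smult[OF A] poly_over_mult[OF A])
    have m0: "m \<noteq> 0" using False by (simp add: m_def)
    have deg_pm: "degree (p * m) = degree q"
      using p(2) m0 False by (simp add: degree_mult_eq m_def degree_monom_eq)
    have "Polynomial.coeff (p * m) (degree q) = ?a * lead_coeff q"
    proof -
      have "Polynomial.coeff (p * m) (degree q) = lead_coeff (p * m)" by (simp only: deg_pm)
      also have "\<dots> = ?a * lead_coeff m" by (simp only: lead_coeff_mult)
      also have "lead_coeff m = lead_coeff q"
        using False by (simp add: m_def degree_monom_eq)
      finally show ?thesis .
    qed
    then have "Polynomial.coeff q' (degree q) = 0" by (simp add: q'_def)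
    moreover have "degree q' \<le> degree q"
      unfolding q'_def using deg_pm by (intro degree_diff_le) auto
    ultimately have "q' = 0 \<or> degree q' < degree q"
      by (metis le_neq_implies_less leading_coeff_0_iff)
    then have "(if q' = 0 then 0 else Suc (degree q')) < (if q = 0 then 0 else Suc (degree q))"
      using False by auto
    then obtain N s r where r: "poly_over A s" "poly_over A r" "smult (?a ^ N) q' = p * s + r"
      "r = 0 \<or> degree r < degree p"
      using less.hyps q'A by blast
    have "smult (?a ^ Suc N) q = smult (?a ^ N) (q' + p * m)"
      by (simp add: q'_def mult.commute)
    also have "\<dots> = p * (s + smult (?a ^ N) m) + r"
      using r(3) by (simp add: smult_add_right distrib_left)
    finally show ?thesis
      using r mA aA by (intro exI[of _ "Suc N"] exI[of _ "s + smult (?a ^ N) m"] exI[of _ r])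
        (auto intro!: poly_over_add[OF A] poly_over_smult[OF A] subring_power[OF A])
  qed
qed

definition adjoin :: "'a::comm_ring_1 set \<Rightarrow> 'a \<Rightarrow> 'a set"
  where "adjoin A x = {poly p x |p. poly_over A p}"

lemma adjoin_base: "subring A \<Longrightarrow> a \<in> A \<Longrightarrow> a \<in> adjoin A x"
  unfolding adjoin_def by (intro CollectI exI[of _ "[:a:]"]) (simp add: poly_over_pCons poly_over_0)

lemma adjoin_gen: "subring A \<Longrightarrow> x \<in> adjoin A x"
  unfolding adjoin_def
  by (intro CollectI exI[of _ "[:0, 1:]"]) (simp add: poly_over_pCons poly_over_0 subringD)

lemma subring_adjoin:
  assumes A: "subring A"
  shows "subring (adjoin A x)"
  unfolding subring_def subhom_def
proof (intro conjI ballI)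
  show "0 \<in> adjoin A x" "1 \<in> adjoin A x" using adjoin_base[OF A] subringD[OF A] by blast+
  fix y assume "y \<in> adjoin A x"
  then obtain p where p: "poly_over A p" "y = poly p x" unfolding adjoin_def by blast
  show "- y \<in> adjoin A x"
    unfolding adjoin_def using poly_over_uminus[OF A p(1)] p(2) by (intro CollectI exI[of _ "- p"]) simp
  fix z assume "z \<in> adjoin A x"
  then obtain q where q: "poly_over A q" "z = poly q x" unfolding adjoin_def by blast
  show "y + z \<in> adjoin A x"
    unfolding adjoin_def using poly_over_add[OF A p(1) q(1)] p(2) q(2)
    by (intro CollectI exI[of _ "p + q"]) simp
  show "y * z \<in> adjoin A x"
    unfolding adjoin_def using poly_over_mult[OF A p(1) q(1)] p(2) q(2)
    by (intro CollectI exI[of _ "p * q"]) simp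
qed simp_all

lemma subhom_subring: "subhom A g \<Longrightarrow> subring A"
  by (simp add: subring_def subhom_def)

lemma map_poly_subhom:
  assumes g: "subhom A g" and p: "poly_over A p" "poly_over A q"
  shows "map_poly g (p + q) = map_poly g p + map_poly g q"
    and "map_poly g (p * q) = map_poly g p * map_poly g q"
proof -
  have g0: "g 0 = 0" using subhom_0[OF g] by simp
  show "map_poly g (p + q) = map_poly g p + map_poly g q"
    using p subhom_add[OF g] by (intro poly_eqI) (simp add: coeff_map_poly g0 poly_over_def)
  have m: "Polynomial.coeff p i * Polynomial.coeff q j \<in> A"
    "g (Polynomial.coeff p i * Polynomial.coeff q j) = g (Polynomial.coeff p i) * g (Polynomial.coeff q j)" for i j
    using p subhom_mult[OF g] by (simp_all add: poly_over_def)
  show "map_poly g (p * q) = map_poly g p * map_poly g q"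
  proof (rule poly_eqI)
    fix n
    show "Polynomial.coeff (map_poly g (p * q)) n = Polynomial.coeff (map_poly g p * map_poly g q) n"
      using subhom_sum[OF g, of "{..n}" "\<lambda>i. Polynomial.coeff p i * Polynomial.coeff q (n - i)"] m
      by (simp add: coeff_map_poly g0 Polynomial.coeff_mult)
  qed
qed

text \<open>Two polynomials over \<open>A\<close> with the same value at \<open>x\<close> differ by
  a relation of \<open>x\<close>, so the choice of a representing polynomial does not affect the
  value at \<open>\<xi>\<close>.\<close>

lemma extend_subhom:
  fixes g :: "'a::idom \<Rightarrow> 'b::idom"
  assumes g: "subhom A g"
    and rel: "\<And>q. poly_over A q \<Longrightarrow> poly q x = 0 \<Longrightarrow> poly (map_poly g q) \<xi> = 0"
  obtains g' where "subhom (adjoin A x) g'" "\<And>a. a \<in> A \<Longrightarrow> g' a = g a"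
    "\<And>q. poly_over A q \<Longrightarrow> g' (poly q x) = poly (map_poly g q) \<xi>"
proof -
  have A: "subring A" by (rule subhom_subring[OF g])
  have g0: "g 0 = 0" using subhom_0[OF g] by simp
  define g' where "g' z = poly (map_poly g (SOME q. poly_over A q \<and> poly q x = z)) \<xi>" for z
  have ev: "g' (poly q x) = poly (map_poly g q) \<xi>" if q: "poly_over A q" for q
  proof -
    define r where "r = (SOME r. poly_over A r \<and> poly r x = poly q x)"
    have r: "poly_over A r" "poly r x = poly q x"
      using someI[of "\<lambda>r. poly_over A r \<and> poly r x = poly q x" q] q by (simp_all add: r_def)
    have "poly (map_poly g (r + (- q))) \<xi> = 0"
      using r q by (intro rel poly_over_add[OF A] poly_over_uminus[OF A]) simp_all
    moreover have "poly (map_poly g (q + (- q))) \<xi> = 0" by simp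
    ultimately have "poly (map_poly g r) \<xi> = poly (map_poly g q) \<xi>"
      using map_poly_subhom(1)[OF g r(1) poly_over_uminus[OF A q]]
        map_poly_subhom(1)[OF g q poly_over_uminus[OF A q]] by (metis add_right_cancel poly_add)
    then show ?thesis by (simp add: g'_def r_def)
  qed
  have base: "g' a = g a" if "a \<in> A" for a
    using ev[of "[:a:]"] that poly_over_pCons[OF A that poly_over_0[OF A]] g0 by (simp add: map_poly_pCons)
  have "subhom (adjoin A x) g'"
    unfolding subhom_def
  proof (intro conjI ballI)
    note sr = subringD[OF subring_adjoin[OF A]]
    show "0 \<in> adjoin A x" "1 \<in> adjoin A x" by (rule sr)+
    show "g' 1 = 1" using base[of 1] subhom_1[OF g] by simp
    fix y assume y: "y \<in> adjoin A x"
    then show "- y \<in> adjoin A x" by (rule sr)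
    obtain p where p: "poly_over A p" "y = poly p x" using y unfolding adjoin_def by blast
    fix z assume z: "z \<in> adjoin A x"
    then obtain q where q: "poly_over A q" "z = poly q x" unfolding adjoin_def by blast
    show "y + z \<in> adjoin A x" "y * z \<in> adjoin A x" using y z by (auto intro: sr)
    show "g' (y + z) = g' y + g' z"
      using ev[OF poly_over_add[OF A p(1) q(1)]] ev[OF p(1)] ev[OF q(1)] p q map_poly_subhom(1)[OF g p(1) q(1)]
      by simp
    show "g' (y * z) = g' y * g' z"
      using ev[OF poly_over_mult[OF A p(1) q(1)]] ev[OF p(1)] ev[OF q(1)] p q map_poly_subhom(2)[OF g p(1) q(1)]
      by simp
  qed
  then show ?thesis using base ev by (rule that)
qed

text \<open>The element \<open>u\<close> is the open condition on a homomorphism of \<open>A\<close>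
  under which it extends to \<open>A[x]\<close> without killing \<open>v\<close>. Prescribing
  \<open>v\<close> is what makes the statement iterable over further elements.\<close>

lemma extend_subhom_adjoin:
  fixes A :: "'a::idom set"
  assumes A: "subring A" and v: "v \<in> adjoin A x" "v \<noteq> 0" and inf: "infinite (UNIV :: 'k::alg_closed_field set)"
  shows "\<exists>u\<in>A. u \<noteq> 0 \<and> (\<forall>g :: 'a \<Rightarrow> 'k. subhom A g \<longrightarrow> g u \<noteq> 0 \<longrightarrow>
    (\<exists>g'. subhom (adjoin A x) g' \<and> (\<forall>a\<in>A. g' a = g a) \<and> g' v \<noteq> 0))"
proof -
  obtain q where q: "poly_over A q" "v = poly q x" using v(1) unfolding adjoin_def by blast
  have q0: "q \<noteq> 0" using q(2) v(2) by auto
  show ?thesis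
  proof (cases "\<exists>p. poly_over A p \<and> p \<noteq> 0 \<and> poly p x = 0")
    \<comment> \<open>Here \<open>x\<close> is transcendental over \<open>A\<close>, so any
      \<open>\<xi>\<close> is allowed; a nonzero leading coefficient leaves a \<open>\<xi>\<close>
      that is not a root of the image of \<open>q\<close>.\<close>
    case False
    show ?thesis
    proof (intro bexI conjI allI impI)
      show "lead_coeff q \<in> A" using q(1) by (simp add: poly_over_def)
      show "lead_coeff q \<noteq> 0" using q0 by simp
      fix g :: "'a \<Rightarrow> 'k" assume g: "subhom A g" and u: "g (lead_coeff q) \<noteq> 0"
      have g0: "g 0 = 0" using subhom_0[OF g] by simp
      have "Polynomial.coeff (map_poly g q) (degree q) \<noteq> 0" using u by (simp add: coeff_map_poly g0)
      then have "map_poly g q \<noteq> 0" by auto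
      then have "finite {\<xi>. poly (map_poly g q) \<xi> = 0}" by (rule poly_roots_finite)
      then have "{\<xi>. poly (map_poly g q) \<xi> = 0} \<noteq> UNIV" using inf by auto
      then obtain \<xi> where \<xi>: "poly (map_poly g q) \<xi> \<noteq> 0" by blast
      have "poly (map_poly g r) \<xi> = 0" if "poly_over A r" "poly r x = 0" for r
        using False that by fastforce
      then obtain g' where g': "subhom (adjoin A x) g'" "\<And>a. a \<in> A \<Longrightarrow> g' a = g a"
        "\<And>q. poly_over A q \<Longrightarrow> g' (poly q x) = poly (map_poly g q) \<xi>"
        using extend_subhom[OF g, of x \<xi>] by blast
      then show "\<exists>g'. subhom (adjoin A x) g' \<and> (\<forall>a\<in>A. g' a = g a) \<and> g' v \<noteq> 0"
        using \<xi> q by auto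
    qed
  next
    case True
    then obtain p where p: "poly_over A p" "p \<noteq> 0" "poly p x = 0"
      and pmin: "\<And>r. poly_over A r \<Longrightarrow> r \<noteq> 0 \<Longrightarrow> poly r x = 0 \<Longrightarrow> degree p \<le> degree r"
      using ex_has_least_nat[of "\<lambda>p. poly_over A p \<and> p \<noteq> 0 \<and> poly p x = 0" _ degree] by blast
    have pmin0: "r = 0" if "poly_over A r" "poly r x = 0" "r = 0 \<or> degree r < degree p" for r
      using pmin[OF that(1) _ that(2)] that(3) by fastforce
    let ?a = "lead_coeff p"
    have a: "?a \<in> A" "?a \<noteq> 0" using p by (simp_all add: poly_over_def)
    have degp: "degree p > 0"
    proof (rule ccontr)
      assume "\<not> degree p > 0"
      then obtain c where "p = [:c:]" using degree_eq_zeroE by blast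
      then show False using p by simp
    qed
    \<comment> \<open>Euclid's algorithm by pseudo-division: below the minimal degree, every nonzero
      value at \<open>x\<close> has a multiple that is a nonzero element of
      \<open>A\<close>.\<close>
    have inv_small: "\<exists>r b. poly_over A r \<and> b \<in> A \<and> b \<noteq> 0 \<and> poly r x * poly s x = b"
      if "poly_over A s" "poly s x \<noteq> 0" "degree s < degree p" for s
      using that
    proof (induction "degree s" arbitrary: s rule: less_induct)
      case less
      show ?case
      proof (cases "degree s = 0")
        case True
        then obtain c where c: "s = [:c:]" using degree_eq_zeroE by blast
        then have "c \<in> A" "c \<noteq> 0" using less.prems by (auto simp: poly_over_def dest: spec[of _ 0])
        then show ?thesis using c poly_over_1[OF A] by (intro exI[of _ 1] exI[of _ c]) simp
      next
        case False
        have s0: "s \<noteq> 0" using less.prems(2) by auto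
        obtain N w r where w: "poly_over A w" "poly_over A r" "smult (lead_coeff s ^ N) p = s * w + r"
          "r = 0 \<or> degree r < degree s"
          using pseudo_division[OF A less.prems(1) s0 p(1)] by blast
        have ev: "poly s x * poly w x + poly r x = 0"
          using arg_cong[OF w(3), of "\<lambda>p. poly p x"] p(3) by simp
        have "poly r x \<noteq> 0"
        proof
          assume r0: "poly r x = 0"
          then have "r = 0" using pmin0[of r] w(2,4) less.prems(3) by auto
          then have eq: "smult (lead_coeff s ^ N) p = s * w" using w(3) by simp
          have "poly w x = 0" using ev r0 less.prems(2) by simp
          moreover have "w \<noteq> 0" using eq p(2) s0 by auto
          moreover have "degree s + degree w = degree p"
            using arg_cong[OF eq, of degree] s0 \<open>w \<noteq> 0\<close> by (simp add: degree_mult_eq)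
          ultimately show False using pmin[OF w(1)] False by simp
        qed
        moreover from this have "degree r < degree s" using w(4) by auto
        ultimately obtain r' b where r': "poly_over A r'" "b \<in> A" "b \<noteq> 0" "poly r' x * poly r x = b"
          using less.hyps[of r] w(2) less.prems(3) by auto
        have "poly r x = - (poly s x * poly w x)" using ev by (simp add: add_eq_0_iff)
        then have "poly (- (r' * w)) x * poly s x = b"
          using r'(4) by (simp add: mult_ac)
        then show ?thesis
          using r' w(1) by (intro exI[of _ "- (r' * w)"] exI[of _ b])
            (simp add: poly_over_uminus[OF A] poly_over_mult[OF A])
      qed
    qed
    obtain N w r where w: "poly_over A w" "poly_over A r" "smult (?a ^ N) q = p * w + r"
      "r = 0 \<or> degree r < degree p"
      using pseudo_division[OF A p(1,2) q(1)] by blast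
    have rv: "poly r x = ?a ^ N * v"
      using arg_cong[OF w(3), of "\<lambda>p. poly p x"] p(3) q(2) by simp
    then have "poly r x \<noteq> 0" using a(2) v(2) by simp
    moreover from this have "degree r < degree p" using w(4) by auto
    ultimately obtain r' b where r': "poly_over A r'" "b \<in> A" "b \<noteq> 0" "poly r' x * poly r x = b"
      using inv_small[OF w(2)] by blast
    show ?thesis
    proof (intro bexI conjI allI impI)
      \<comment> \<open>A nonzero image of \<open>?a\<close> leaves \<open>p\<close> a root and lets
        relations be divided by \<open>p\<close>; a nonzero image of \<open>b\<close>, a multiple of
        \<open>v\<close> in \<open>A[x]\<close>, keeps the image of \<open>v\<close>
        nonzero.\<close>
      show "?a * b \<in> A" using a(1) r'(2) by (rule subringD(4)[OF A])
      show "?a * b \<noteq> 0" using a(2) r'(3) by simp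
      fix g :: "'a \<Rightarrow> 'k" assume g: "subhom A g" and u: "g (?a * b) \<noteq> 0"
      have g0: "g 0 = 0" using subhom_0[OF g] by simp
      have gab: "g ?a \<noteq> 0" "g b \<noteq> 0" using u subhom_mult[OF g a(1) r'(2)] by auto
      have "Polynomial.coeff (map_poly g p) (degree p) \<noteq> 0" using gab by (simp add: coeff_map_poly g0)
      then have "degree (map_poly g p) > 0" using degp le_degree by fastforce
      then obtain \<xi> where \<xi>: "poly (map_poly g p) \<xi> = 0" using alg_closed_imp_poly_has_root by blast
      have "poly (map_poly g s) \<xi> = 0" if s: "poly_over A s" "poly s x = 0" for s
      proof -
        obtain N w r where w: "poly_over A w" "poly_over A r" "smult (?a ^ N) s = p * w + r"
          "r = 0 \<or> degree r < degree p"
          using pseudo_division[OF A p(1,2) s(1)] by blast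
        have "poly r x = 0" using arg_cong[OF w(3), of "\<lambda>p. poly p x"] p(3) s(2) by simp
        then have "r = 0" using pmin0[OF w(2) _ w(4)] by blast
        then have eq: "[:?a ^ N:] * s = p * w" using w(3) by simp
        have aN: "poly_over A [:?a ^ N:]"
          by (intro poly_over_pCons[OF A] subring_power[OF A] a(1) poly_over_0[OF A])
        have "map_poly g [:?a ^ N:] * map_poly g s = map_poly g p * map_poly g w"
          using arg_cong[OF eq, of "map_poly g"] map_poly_subhom(2)[OF g aN s(1)] map_poly_subhom(2)[OF g p(1) w(1)]
          by simp
        then have "poly (map_poly g [:?a ^ N:] * map_poly g s) \<xi> = poly (map_poly g p * map_poly g w) \<xi>"
          by (simp only:)
        then have "g (?a ^ N) * poly (map_poly g s) \<xi> = 0"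
          using \<xi> by (simp add: map_poly_pCons g0)
        moreover have "g (?a ^ N) = g ?a ^ N"
        proof (induction N)
          case (Suc N)
          then show ?case using subhom_mult[OF g a(1) subring_power[OF A a(1), of N]] by simp
        qed (simp add: subhom_1[OF g])
        ultimately show ?thesis using gab(1) by simp
      qed
      then obtain g' where g': "subhom (adjoin A x) g'" "\<And>a. a \<in> A \<Longrightarrow> g' a = g a"
        using extend_subhom[OF g, of x \<xi>] by blast
      have mem: "poly r' x \<in> adjoin A x" "?a ^ N \<in> adjoin A x"
        using r'(1) adjoin_base[OF A subring_power[OF A a(1)]] unfolding adjoin_def by blast+
      have "poly r' x * (?a ^ N * v) = b" using r'(4) rv by simp
      then have "g' (poly r' x) * (g' (?a ^ N) * g' v) = g' b"
        using subhom_mult[OF g'(1) mem(1), of "?a ^ N * v"] subhom_mult[OF g'(1) mem(2) v(1)] by simp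
      then have "g' v \<noteq> 0" using g'(2)[OF r'(2)] gab(2) by auto
      then show "\<exists>g'. subhom (adjoin A x) g' \<and> (\<forall>a\<in>A. g' a = g a) \<and> g' v \<noteq> 0"
        using g' by blast
    qed
  qed
qed

text \<open>Otherwise the product of all monic linear factors, increased by 1, would be a
  nonconstant polynomial without a root.\<close>

lemma alg_closed_infinite: "infinite (UNIV :: 'k::alg_closed_field set)"
proof
  assume fin: "finite (UNIV :: 'k set)"
  let ?p = "(\<Prod>a\<in>(UNIV :: 'k set). [:- a, 1:]) + 1"
  have pos: "0 < CARD('k)" using fin by (simp add: card_gt_0_iff)
  have "degree (\<Prod>a\<in>(UNIV :: 'k set). [:- a, 1:]) = CARD('k)"
    by (subst degree_prod_eq_sum_degree) auto
  then have "degree ?p = CARD('k)"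
    using pos by (subst degree_add_eq_left) auto
  then obtain \<xi> where "poly ?p \<xi> = 0" using pos alg_closed_imp_poly_has_root[of ?p] by auto
  moreover have "poly ?p \<xi> = 1" using fin by (auto simp: poly_prod prod_zero_iff)
  ultimately show False by simp
qed

text \<open>Elements are adjoined one at a time, and the nonvanishing condition is pulled back
  through the stages down to \<open>A0\<close>.\<close>

lemma extend_subhom_finite:
  fixes A0 :: "'a::idom set"
  assumes A0: "subring A0" and Xs: "finite Xs"
  shows "\<exists>A. subring A \<and> A0 \<subseteq> A \<and> Xs \<subseteq> A \<and> (\<forall>v\<in>A. v \<noteq> 0 \<longrightarrow> (\<exists>u\<in>A0. u \<noteq> 0 \<and>
    (\<forall>g0 :: 'a \<Rightarrow> 'k::alg_closed_field. subhom A0 g0 \<longrightarrow> g0 u \<noteq> 0 \<longrightarrow>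
      (\<exists>g. subhom A g \<and> (\<forall>a\<in>A0. g a = g0 a) \<and> g v \<noteq> 0))))"
  using Xs
proof (induction Xs)
  case empty
  show ?case by (intro exI[of _ A0]) (use A0 in auto)
next
  case (insert x Xs)
  then obtain A where A: "subring A" "A0 \<subseteq> A" "Xs \<subseteq> A" and ext: "\<And>v. v \<in> A \<Longrightarrow> v \<noteq> 0 \<Longrightarrow> \<exists>u\<in>A0. u \<noteq> 0 \<and>
    (\<forall>g0 :: 'a \<Rightarrow> 'k. subhom A0 g0 \<longrightarrow> g0 u \<noteq> 0 \<longrightarrow>
      (\<exists>g. subhom A g \<and> (\<forall>a\<in>A0. g a = g0 a) \<and> g v \<noteq> 0))"
    by (elim exE conjE) (rule that, auto)
  show ?case
  proof (intro exI[of _ "adjoin A x"] conjI ballI impI)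
    show "subring (adjoin A x)" by (rule subring_adjoin[OF A(1)])
    show "A0 \<subseteq> adjoin A x" "insert x Xs \<subseteq> adjoin A x"
      using A adjoin_base[OF A(1)] adjoin_gen[OF A(1)] by auto
    fix v assume v: "v \<in> adjoin A x" "v \<noteq> 0"
    obtain w where w: "w \<in> A" "w \<noteq> 0" and wext: "\<And>g :: 'a \<Rightarrow> 'k. subhom A g \<Longrightarrow> g w \<noteq> 0 \<Longrightarrow>
        \<exists>g'. subhom (adjoin A x) g' \<and> (\<forall>a\<in>A. g' a = g a) \<and> g' v \<noteq> 0"
      using extend_subhom_adjoin[OF A(1) v alg_closed_infinite] by blast
    obtain u where u: "u \<in> A0" "u \<noteq> 0" and uext: "\<And>g0 :: 'a \<Rightarrow> 'k. subhom A0 g0 \<Longrightarrow> g0 u \<noteq> 0 \<Longrightarrow>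
        \<exists>g. subhom A g \<and> (\<forall>a\<in>A0. g a = g0 a) \<and> g w \<noteq> 0"
      using ext[OF w] by blast
    show "\<exists>u\<in>A0. u \<noteq> 0 \<and> (\<forall>g0 :: 'a \<Rightarrow> 'k. subhom A0 g0 \<longrightarrow> g0 u \<noteq> 0 \<longrightarrow>
      (\<exists>g. subhom (adjoin A x) g \<and> (\<forall>a\<in>A0. g a = g0 a) \<and> g v \<noteq> 0))"
    proof (intro bexI conjI allI impI)
      fix g0 :: "'a \<Rightarrow> 'k" assume "subhom A0 g0" "g0 u \<noteq> 0"
      then obtain g where g: "subhom A g" "\<And>a. a \<in> A0 \<Longrightarrow> g a = g0 a" "g w \<noteq> 0" using uext by blast
      obtain g' where "subhom (adjoin A x) g'" "\<And>a. a \<in> A \<Longrightarrow> g' a = g a" "g' v \<noteq> 0"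
        using wext[OF g(1,3)] by blast
      then show "\<exists>g. subhom (adjoin A x) g \<and> (\<forall>a\<in>A0. g a = g0 a) \<and> g v \<noteq> 0"
        using g(2) A(2) by (intro exI[of _ g']) auto
    qed (use u in auto)
  qed
qed

text \<open>Evaluation at \<open>c\<close> is defined on the polynomials in \<open>X\<close>. It
  extends to a subring containing \<open>Xs\<close> unless \<open>c\<close> is a root of the
  polynomial that the extension lemma provides.\<close>

lemma fls_specialization:
  fixes Xs :: "'k::alg_closed_field fls set"
  assumes Xs: "finite Xs"
  shows "finite {c. \<not> (\<exists>B g. subhom B g \<and> Xs \<subseteq> B \<and> (\<forall>a. fls_const a \<in> B \<and> g (fls_const a) = a) \<and>
    fls_X \<in> B \<and> g fls_X = c)}"
proof -
  define \<iota> where "\<iota> p = fps_to_fls (fps_of_poly p)" for p :: "'k poly"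
  have \<iota>: "\<iota> (p + q) = \<iota> p + \<iota> q" "\<iota> (p * q) = \<iota> p * \<iota> q" "\<iota> (- p) = - \<iota> p" "\<iota> 0 = 0" "\<iota> 1 = 1" for p q
    by (simp_all add: \<iota>_def fps_of_poly_add fps_of_poly_mult fps_of_poly_uminus fps_to_fls_plus fls_times_fps_to_fls
        fps_to_fls_uminus)
  have \<iota>inj: "\<iota> p = \<iota> q \<longleftrightarrow> p = q" for p q by (simp add: \<iota>_def)
  have \<iota>g: "\<iota> [:a:] = fls_const a" "\<iota> [:0, 1:] = fls_X" for a
    by (simp_all add: \<iota>_def fps_of_poly_const fps_of_poly_linear fps_of_poly_fps_X)
  let ?A = "range \<iota>"
  have A: "subring ?A"
    unfolding subring_def subhom_def
    using \<iota> by (auto simp: image_iff) metis+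
  obtain A where A': "subring A" "?A \<subseteq> A" "Xs \<subseteq> A" and ext: "\<forall>v\<in>A. v \<noteq> 0 \<longrightarrow> (\<exists>u\<in>?A. u \<noteq> 0 \<and>
    (\<forall>g0 :: 'k fls \<Rightarrow> 'k. subhom ?A g0 \<longrightarrow> g0 u \<noteq> 0 \<longrightarrow>
      (\<exists>g. subhom A g \<and> (\<forall>a\<in>?A. g a = g0 a) \<and> g v \<noteq> 0)))"
    using extend_subhom_finite[OF A Xs] by (elim exE conjE) (rule that)
  \<comment> \<open>Taking the prescribed element to be 1 leaves just the existence of an
    extension.\<close>
  have "\<exists>u\<in>?A. u \<noteq> 0 \<and> (\<forall>g0 :: 'k fls \<Rightarrow> 'k. subhom ?A g0 \<longrightarrow> g0 u \<noteq> 0 \<longrightarrow>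
      (\<exists>g. subhom A g \<and> (\<forall>a\<in>?A. g a = g0 a) \<and> g 1 \<noteq> 0))"
    by (rule ext[rule_format]) (use subringD(2)[OF A'(1)] in auto)
  then obtain p where p: "\<iota> p \<noteq> 0" and pext: "\<And>g0 :: 'k fls \<Rightarrow> 'k. subhom ?A g0 \<Longrightarrow> g0 (\<iota> p) \<noteq> 0 \<Longrightarrow>
      \<exists>g. subhom A g \<and> (\<forall>a\<in>?A. g a = g0 a)"
    by (elim bexE conjE rangeE) (rule that, blast+)
  have "p \<noteq> 0" using p \<iota>(4) by auto
  then have "finite {c. poly p c = 0}" by (rule poly_roots_finite)
  moreover have "\<exists>B g. subhom B g \<and> Xs \<subseteq> B \<and> (\<forall>a. fls_const a \<in> B \<and> g (fls_const a) = a) \<and>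
    fls_X \<in> B \<and> g fls_X = c" if c: "poly p c \<noteq> 0" for c
  proof -
    define g0 where "g0 z = poly (inv_into UNIV \<iota> z) c" for z
    have g0: "g0 (\<iota> q) = poly q c" for q
    proof -
      have "inj \<iota>" using \<iota>inj by (simp add: inj_def)
      then show ?thesis by (simp add: g0_def inv_f_f)
    qed
    have "subhom ?A g0"
      unfolding subhom_def
    proof (intro conjI ballI)
      show "0 \<in> ?A" "1 \<in> ?A" using subringD(1,2)[OF A] .
      show "g0 1 = 1" using g0[of 1] by (simp add: \<iota>)
      fix x assume x: "x \<in> ?A"
      then show "- x \<in> ?A" by (rule subringD(5)[OF A])
      obtain p where p: "x = \<iota> p" using x by blast
      fix y assume y: "y \<in> ?A"
      then obtain q where q: "y = \<iota> q" by blast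
      show "x + y \<in> ?A" "x * y \<in> ?A" using subringD(3,4)[OF A x y] .
      show "g0 (x + y) = g0 x + g0 y" "g0 (x * y) = g0 x * g0 y"
        using g0[of "p + q"] g0[of "p * q"] by (simp_all add: p q \<iota> g0)
    qed
    moreover have "g0 (\<iota> p) \<noteq> 0" using g0 c by simp
    ultimately obtain g where g: "subhom A g" "\<And>a. a \<in> ?A \<Longrightarrow> g a = g0 a" using pext by meson
    have "g (\<iota> q) = poly q c" "\<iota> q \<in> A" for q using g(2) g0 A'(2) by auto
    from this[of "[:_:]"] this[of "[:0,1:]"] show ?thesis
      using g(1) A'(3) unfolding \<iota>g by (intro exI[of _ A] exI[of _ g]) simp
  qed
  ultimately show ?thesis by (elim finite_subset[rotated]) blast
qed

section \<open>Composition of specializations and extension to \<open>k[[X, Y]]\<close>\<close>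

lemma subhom_comp:
  assumes "subhom UNIV e" "subhom B g" "range e \<subseteq> B"
  shows "subhom UNIV (g \<circ> e)"
proof -
  have "e x \<in> B" for x using assms(3) by blast
  then show ?thesis using assms(1,2) unfolding subhom_def by simp
qed

text \<open>The second map sees only series with coefficients in \<open>B\<close>; as
  \<open>e\<close> carries normal forms to normal forms, the generators they give have coefficients
  in \<open>range e\<close> and suffice.\<close>

lemma map_ideal_comp:
  fixes I :: "('v::finite, 'k::field) mfps set" and e :: "'k \<Rightarrow> 'l::field" and g :: "'l \<Rightarrow> 'm::field"
  assumes e: "subhom UNIV e" and g: "subhom B g" and eB: "range e \<subseteq> B" and I: "is_ideal I" "ordge M \<subseteq> I"
  shows "map_ideal B g (map_ideal UNIV e I) = map_ideal UNIV (g \<circ> e) I"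
proof -
  note ge = subhom_comp[OF e g eB]
  obtain A where d: "nf_defined_over UNIV I M A" using ex_nf_defined_over_UNIV[OF I] by blast
  have bU: "coeffs_in UNIV f" for f :: "('v, 'k) mfps" by (simp add: coeffs_in_def)
  have nf': "nf (map_ideal UNIV e I) A (monom \<kappa>) \<nu> = e (nf I A (monom \<kappa>) \<nu>)" if "\<nu> \<in> A" for \<kappa> \<nu>
    using nf_map_ideal(1)[OF e d bU that, of "monom \<kappa>"] map_coeffs_monom[OF e, of \<kappa>] by simp
  have d': "nf_defined_over B (map_ideal UNIV e I) M A"
    unfolding nf_defined_over_def
  proof (intro conjI ballI allI)
    show "ordge M \<subseteq> map_ideal UNIV e I" by (rule ordge_map_ideal[OF e d])
    show "nf_basis (map_ideal UNIV e I) A" by (rule nf_basis_map_ideal[OF e d])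
    show "tdeg \<nu> < M" if "\<nu> \<in> A" for \<nu> using nf_defined_over_tdeg[OF e d] that by blast
    show "nf (map_ideal UNIV e I) A (monom \<kappa>) \<nu> \<in> B" if "\<nu> \<in> A" for \<kappa> \<nu> using nf'[OF that] eB by auto
  qed simp
  show ?thesis
  proof (rule antisym)
    show "map_ideal UNIV (g \<circ> e) I \<subseteq> map_ideal B g (map_ideal UNIV e I)"
    proof (rule map_ideal_subset[OF is_ideal_map_ideal])
      fix f assume "f \<in> I"
      then have "map_coeffs g (map_coeffs e f) \<in> map_ideal B g (map_ideal UNIV e I)"
        using eB by (intro map_ideal_base bU) (auto simp: coeffs_in_def)
      moreover have "map_coeffs g (map_coeffs e f) = map_coeffs (g \<circ> e) f" by (rule mfps_eqI) simp
      ultimately show "map_coeffs (g \<circ> e) f \<in> map_ideal B g (map_ideal UNIV e I)" by simp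
    qed
    show "map_ideal B g (map_ideal UNIV e I) \<subseteq> map_ideal UNIV (g \<circ> e) I"
    proof (rule map_ideal_subset_generators[OF g d' is_ideal_map_ideal ordge_map_ideal[OF ge d]])
      fix \<kappa> :: "'v \<Rightarrow> nat"
      have "map_coeffs (g \<circ> e) (monom \<kappa> - lincomb A (nf I A (monom \<kappa>))) \<in> map_ideal UNIV (g \<circ> e) I"
        by (intro map_ideal_base bU nf_defined_over_generator(1)[OF ge d])
      moreover have "lincomb A (\<lambda>\<nu>. (g \<circ> e) (nf I A (monom \<kappa>) \<nu>)) = lincomb A (\<lambda>\<nu>. g (nf (map_ideal UNIV e I) A (monom \<kappa>) \<nu>))"
        unfolding lincomb_def using nf' by (intro sum.cong) simp_all
      ultimately show "monom \<kappa> - lincomb A (\<lambda>\<nu>. g (nf (map_ideal UNIV e I) A (monom \<kappa>) \<nu>)) \<in> map_ideal UNIV (g \<circ> e) I"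
        using nf_defined_over_generator(3)[OF ge d, of \<kappa>] by simp
    qed
  qed
qed

lemma map_ideal_id:
  fixes I :: "('v::finite, 'k::comm_ring_1) mfps set"
  assumes "is_ideal I" "\<And>a. e a = a"
  shows "map_ideal UNIV e I = I"
proof -
  have "map_coeffs e f = f" for f :: "('v, 'k) mfps" by (rule mfps_eqI) (simp add: assms(2))
  then have "map_coeffs e ` {f \<in> I. coeffs_in UNIV f} = I" by (simp add: coeffs_in_def)
  then show ?thesis using idl.span_eq_iff assms(1) by (simp add: map_ideal_def)
qed

definition slice :: "nat \<Rightarrow> ('n::finite option, 'k::comm_ring_1) mfps \<Rightarrow> ('n, 'k) mfps"
  where "slice j f = Abs_mfps (\<lambda>\<mu>. mfps_coeff f (ocons j \<mu>))"

lemma coeff_slice: "mfps_coeff (slice j f) \<mu> = mfps_coeff f (ocons j \<mu>)"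
  by (simp add: slice_def)

lemma slice_add: "slice j (f + g) = slice j f + slice j g"
  by (simp add: mfps_eq_iff coeff_slice)

lemma slice_sum: "slice j (sum f A) = (\<Sum>i\<in>A. slice j (f i))"
  by (simp add: mfps_eq_iff coeff_slice)

lemma slice_of_base: "slice j (mfps_of_base f) = (if j = 0 then f else 0)"
  by (simp add: mfps_eq_iff coeff_slice coeff_of_base)

lemma slice_mult: "slice j (f * g) = (\<Sum>i\<le>j. slice i f * slice (j - i) g)"
proof (rule mfps_eqI)
  fix \<mu> :: "'a \<Rightarrow> nat"
  show "mfps_coeff (slice j (f * g)) \<mu> = mfps_coeff (\<Sum>i\<le>j. slice i f * slice (j - i) g) \<mu>"
    unfolding coeff_slice coeff_mult_ocons coeff_sum coeff_mult[of "slice _ _"] by (rule sum.swap)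
qed

lemma slice_mult_of_base: "slice j (f * mfps_of_base g) = slice j f * g"
proof -
  have "slice i f * slice (j - i) (mfps_of_base g) = (if i = j then slice j f * g else 0)" if "i \<le> j" for i
    using that by (simp add: slice_of_base)
  then have "slice j (f * mfps_of_base g) = (\<Sum>i\<le>j. if i = j then slice j f * g else 0)"
    unfolding slice_mult by (intro sum.cong) auto
  then show ?thesis by simp
qed

lemma is_ideal_extended_ideal [simp]: "is_ideal (extended_ideal I)"
  by (simp add: extended_ideal_def)

text \<open>For the converse, finitely many generators of \<open>I\<close> serve all slices at once,
  so the coefficients of the slices can be assembled into power series in \<open>X\<close>.\<close>

lemma extended_ideal_iff:
  fixes I :: "('n::finite, 'k::field) mfps set"
  assumes I: "is_ideal I"
  shows "f \<in> extended_ideal I \<longleftrightarrow> (\<forall>j. slice j f \<in> I)"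
proof
  assume "f \<in> extended_ideal I"
  moreover have "extended_ideal I \<subseteq> {f. \<forall>j. slice j f \<in> I}"
    unfolding extended_ideal_def
  proof (rule idl.span_minimal)
    show "mfps_of_base ` I \<subseteq> {f. \<forall>j. slice j f \<in> I}"
      using idl.subspace_0[OF I] by (auto simp: slice_of_base)
    show "is_ideal {f. \<forall>j. slice j f \<in> I}"
    proof (rule idl.subspaceI)
      show "0 \<in> {f. \<forall>j. slice j f \<in> I}"
        using idl.subspace_0[OF I] by (simp add: slice_def flip: zero_mfps_def)
      show "p + q \<in> {f. \<forall>j. slice j f \<in> I}" if "p \<in> {f. \<forall>j. slice j f \<in> I}" "q \<in> {f. \<forall>j. slice j f \<in> I}" for p q
        using that idl.subspace_add[OF I] by (simp add: slice_add)
      show "c * p \<in> {f. \<forall>j. slice j f \<in> I}" if "p \<in> {f. \<forall>j. slice j f \<in> I}" for c p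
        using that by (auto simp: slice_mult intro!: idl.subspace_sum[OF I] ideal_mult[OF I])
    qed
  qed
  ultimately show "\<forall>j. slice j f \<in> I" by blast
next
  assume f: "\<forall>j. slice j f \<in> I"
  obtain x n where x: "I = igen x n" using mfps_noetherian[OF I] .
  have "\<forall>j. \<exists>c. slice j f = (\<Sum>i<n. c i * x i)" using f unfolding x igen_iff .
  then obtain c where c: "\<And>j. slice j f = (\<Sum>i<n. c j i * x i)" by metis
  let ?f = "\<Sum>i<n. xsum (\<lambda>j. c j i) * mfps_of_base (x i)"
  have sx: "slice j (xsum G) = G j" for j and G :: "nat \<Rightarrow> ('n, 'k) mfps"
    by (simp add: mfps_eq_iff coeff_slice xsum_def)
  have sf: "slice j f = slice j ?f" for j by (simp add: slice_sum slice_mult_of_base sx c)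
  have "f = ?f"
  proof (rule mfps_eq_ocons)
    fix j \<mu>
    show "mfps_coeff f (ocons j \<mu>) = mfps_coeff ?f (ocons j \<mu>)"
      using arg_cong[OF sf[of j], of "\<lambda>h. mfps_coeff h \<mu>"] by (simp only: coeff_slice)
  qed
  also have "?f \<in> extended_ideal I"
  proof (intro idl.subspace_sum[OF is_ideal_extended_ideal] ideal_mult[OF is_ideal_extended_ideal])
    fix i assume "i \<in> {..<n}"
    then have "x i \<in> I" by (simp add: x igen_base)
    then show "mfps_of_base (x i) \<in> extended_ideal I" unfolding extended_ideal_def by (intro idl.span_base imageI)
  qed
  finally show "f \<in> extended_ideal I" .
qed

lemma xsat_extended_ideal:
  fixes I :: "('n::finite, 'k::field) mfps set"
  assumes I: "is_ideal I"
  shows "xsat (extended_ideal I)"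
  unfolding xsat_def extended_ideal_iff[OF I]
proof (intro allI impI)
  fix f :: "('n option, 'k) mfps" and j assume f: "\<forall>j. slice j (xvar * f) \<in> I"
  have "slice (Suc j) (xvar * f) = slice j f"
    using coeff_xvar_mult[of 1 f "Suc j"] by (simp add: mfps_eq_iff coeff_slice)
  then show "slice j f \<in> I" using f by metis
qed

lemma of_base_mem_extended_ideal: "f \<in> I \<Longrightarrow> mfps_of_base f \<in> extended_ideal I"
  unfolding extended_ideal_def by (intro idl.span_base imageI)

lemma rho_extended_ideal:
  fixes I :: "('n::finite, 'k::field) mfps set"
  assumes I: "is_ideal I"
  shows "rho ` extended_ideal I = I"
proof
  have "rho f = slice 0 f" for f :: "('n option, 'k) mfps" by (simp add: mfps_eq_iff coeff_slice coeff_rho)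
  then show "rho ` extended_ideal I \<subseteq> I" by (auto simp: extended_ideal_iff[OF I])
  show "I \<subseteq> rho ` extended_ideal I"
    using of_base_mem_extended_ideal by (force simp: image_iff intro: rho_of_base[symmetric])
qed

lemma eta_of_base: "eta (mfps_of_base f) = map_coeffs fls_const f"
proof (rule mfps_eqI)
  fix \<mu>
  have "xslice (mfps_of_base f) \<mu> = fps_const (mfps_coeff f \<mu>)"
    by (rule fps_ext) (simp add: xslice_def coeff_of_base)
  then show "mfps_coeff (eta (mfps_of_base f)) \<mu> = mfps_coeff (map_coeffs fls_const f) \<mu>"
    by (simp add: coeff_eta fps_const_to_fls)
qed

lemma subhom_fls_const: "subhom UNIV (fls_const :: 'k::field \<Rightarrow> 'k fls)"
  unfolding subhom_def by (simp add: fls_plus_const fls_const_mult_const)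

lemma etaI_extended_ideal:
  fixes I :: "('n::finite, 'k::field) mfps set"
  shows "etaI (extended_ideal I) = map_ideal UNIV fls_const I"
proof
  have e: "map_coeffs fls_const f = eta (mfps_of_base f)" for f :: "('n, 'k) mfps" by (simp add: eta_of_base)
  show "map_ideal UNIV fls_const I \<subseteq> etaI (extended_ideal I)"
    by (rule map_ideal_subset) (simp_all add: e etaI_base of_base_mem_extended_ideal)
  have "extended_ideal I \<subseteq> {f. eta f \<in> map_ideal UNIV fls_const I}"
    unfolding extended_ideal_def
  proof (rule idl.span_minimal)
    show "mfps_of_base ` I \<subseteq> {f. eta f \<in> map_ideal UNIV fls_const I}"
      by (auto simp: eta_of_base intro!: map_ideal_base) (simp add: coeffs_in_def)
    show "is_ideal {f. eta f \<in> map_ideal UNIV fls_const I}"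
      by (rule idl.subspaceI)
        (auto simp: idl.subspace_0[OF is_ideal_map_ideal] idl.subspace_add[OF is_ideal_map_ideal] ideal_mult[OF is_ideal_map_ideal])
  qed
  then show "etaI (extended_ideal I) \<subseteq> map_ideal UNIV fls_const I"
    by (subst etaI_subset_iff) auto
qed

section \<open>Moving a link to the smaller field\<close>

lemma ordge_subset_quotient_pgen:
  assumes "param x"
  obtains M where "ordge M \<subseteq> ideal_quotient (pgen x) I"
proof -
  obtain M where "ordge M \<subseteq> pgen x" using param_primary[OF assms] by blast
  then show ?thesis using that ideal_quotient_superset[OF is_ideal_pgen] by blast
qed

text \<open>
  Since \<open>x + X \<beta> e\<^sub>i\<close> specializes to \<open>x\<close> at \<open>X = 0\<close>, its link of \<open>I\<close> over \<open>k((X))\<close> stays in the class, and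
  so do all but finitely many of its other specializations \<open>X = c\<close>.
\<close>

lemma move_coordinate:
  fixes I :: "('n::finite, 'k::alg_closed_field) mfps set"
  assumes I: "is_ideal I" "ordge M \<subseteq> I" "I \<noteq> UNIV" and x: "param x" "pgen x \<subseteq> I" and \<beta>: "\<beta> \<in> I"
    and s: "plicci s (ideal_quotient (pgen x) I)"
  shows "\<exists>S. finite S \<and> (\<forall>c. c \<notin> S \<longrightarrow> param (x(i := x i + mfps_const c * \<beta>)) \<and>
    plicci s (ideal_quotient (pgen (x(i := x i + mfps_const c * \<beta>))) I))"
proof -
  let ?n = "CARD('n)"
  let ?T = "extended_ideal I" and ?E = "map_ideal UNIV fls_const I"
  define y where "y j = mfps_of_base (x j) + (if j = i then xvar * mfps_of_base \<beta> else 0)" for j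
  have bU: "coeffs_in UNIV f" for f :: "('n, 'k) mfps" by (simp add: coeffs_in_def)
  have xI: "x j \<in> I" if "j < ?n" for j using x(2) igen_base[OF that, of x] by (auto simp: pgen_def)
  have rx: "rho (y j) = x j" for j by (simp add: y_def)
  have yT: "y j \<in> ?T" if "j < ?n" for j
    unfolding y_def using xI[OF that] \<beta> idl.subspace_0[OF is_ideal_extended_ideal[of I]]
    by (auto intro!: idl.subspace_add[OF is_ideal_extended_ideal] ideal_mult[OF is_ideal_extended_ideal]
        of_base_mem_extended_ideal)
  have TY: "?T \<subseteq> ypow 1"
  proof -
    have "?E \<subseteq> ordge 1"
      using ideal_le_ordge_1[OF I(1,3)] map_coeffs_ordge[OF subhom_fls_const]
      by (intro map_ideal_subset is_ideal_ordge) blast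
    then show ?thesis unfolding etaI_extended_ideal[symmetric] using etaI_base[of _ ?T] eta_ordge_iff by blast
  qed
  note link = link_in_family[OF is_ideal_extended_ideal xsat_extended_ideal[OF I(1)] yT]
  have px: "param (\<lambda>j. rho (y j))" using x(1) by (simp add: rx)
  have yY: "y j \<in> ypow 1" if "j < ?n" for j using yT[OF that] TY by blast
  let ?J = "ideal_quotient (igen y ?n) ?T" and ?J' = "ideal_quotient (pgen (\<lambda>j. eta (y j))) ?E"
  have pe: "param (\<lambda>j. eta (y j))" using link(3)[OF _ px yY] by blast
  have "plicci s (rho ` ?J)"
    using link(4)[OF _ px yY] s by (simp add: rx rho_extended_ideal[OF I(1)])
  then have "plicci s (etaI ?J)"
    using link(1,2)[OF _ px yY] by (intro plicci_generic_of_special) blast+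
  then have sJ: "plicci s ?J'"
    using link(5)[OF _ px yY] by (simp add: etaI_extended_ideal)
  have E: "is_ideal ?E" "ordge M \<subseteq> ?E"
  proof -
    obtain A where "nf_defined_over UNIV I M A" using ex_nf_defined_over_UNIV[OF I(1,2)] by blast
    then show "ordge M \<subseteq> ?E" by (rule ordge_map_ideal[OF subhom_fls_const])
  qed simp
  obtain M' where M': "ordge M' \<subseteq> ?J'" using ordge_subset_quotient_pgen[OF pe] .
  obtain X1 where X1: "finite X1" "\<forall>B (g :: 'k fls \<Rightarrow> 'k). subhom B g \<longrightarrow> X1 \<subseteq> B \<longrightarrow> plicci s (map_ideal B g ?J')"
    using plicci_specialize[OF is_ideal_quotient[OF is_ideal_pgen] M' sJ, where 'l = 'k] by (elim exE conjE) (rule that)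
  obtain X2 where X2: "finite X2"
      "\<And>B (g :: 'k fls \<Rightarrow> 'k). subhom B g \<Longrightarrow> X2 \<subseteq> B \<Longrightarrow> (\<And>j. j < ?n \<Longrightarrow> coeffs_in B (eta (y j))) \<Longrightarrow>
        param (\<lambda>j. map_coeffs g (eta (y j))) \<and> map_ideal B g (pgen (\<lambda>j. eta (y j))) = pgen (\<lambda>j. map_coeffs g (eta (y j)))"
    using map_coeffs_param[OF pe, where 'l = 'k] by metis
  obtain X3 where X3: "finite X3"
      "\<And>B (g :: 'k fls \<Rightarrow> 'k). subhom B g \<Longrightarrow> X3 \<subseteq> B \<Longrightarrow> (\<And>j. j < ?n \<Longrightarrow> coeffs_in B (eta (y j))) \<Longrightarrow>
        map_ideal B g ?J' = ideal_quotient (pgen (\<lambda>j. map_coeffs g (eta (y j)))) (map_ideal B g ?E)"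
    using map_ideal_quotient[OF pe E, where 'l = 'k] by metis
  let ?X = "X1 \<union> X2 \<union> X3"
  \<comment> \<open>Evaluation at \<open>X = c\<close> on a subring containing the finite data. It
    restores constants, so it takes the extension of \<open>I\<close> back to
    \<open>I\<close>.\<close>
  let ?P = "\<lambda>c. \<exists>B g. subhom B g \<and> ?X \<subseteq> B \<and> (\<forall>a. fls_const a \<in> B \<and> g (fls_const a) = a) \<and> fls_X \<in> B \<and> g fls_X = c"
  have "finite {c. \<not> ?P c}" using X1(1) X2(1) X3(1) by (intro fls_specialization) simp
  moreover have "param (x(i := x i + mfps_const c * \<beta>)) \<and>
    plicci s (ideal_quotient (pgen (x(i := x i + mfps_const c * \<beta>))) I)" if Pc: "?P c" for c
  proof -
    obtain B g where Bg: "subhom B g \<and> ?X \<subseteq> B \<and> (\<forall>a. fls_const a \<in> B \<and> g (fls_const a) = a) \<and> fls_X \<in> B \<and> g fls_X = c"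
      using Pc by (elim exE) (rule that)
    then have g: "subhom B g" and XB: "X1 \<subseteq> B" "X2 \<subseteq> B" "X3 \<subseteq> B"
      and gc: "\<And>a. fls_const a \<in> B" "\<And>a. g (fls_const a) = a" and gX: "fls_X \<in> B" "g fls_X = c"
      by simp_all
    have ev: "eta (y j) = map_coeffs fls_const (x j) + (if j = i then mfps_const fls_X * map_coeffs fls_const \<beta> else 0)" for j
    proof -
      have "eta (xvar :: ('n option, 'k) mfps) = mfps_const fls_X" using eta_var_None_power[of 1] by simp
      then show ?thesis by (simp add: y_def eta_of_base)
    qed
    have bB: "coeffs_in B (eta (y j))" for j
      using gc(1) gX(1) subhom_add[OF g] subhom_mult[OF g] subhom_0[OF g] unfolding ev coeffs_in_def by auto
    have gy: "map_coeffs g (eta (y j)) = (x(i := x i + mfps_const c * \<beta>)) j" for j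
      unfolding ev using gc gX subhom_add[OF g] subhom_mult[OF g] subhom_0[OF g]
      by (auto intro!: mfps_eqI)
    have "map_ideal B g ?E = I"
      using map_ideal_comp[OF subhom_fls_const g _ I(1,2)] map_ideal_id[OF I(1), of "g \<circ> fls_const"] gc by auto
    then show ?thesis
      using X1(2)[rule_format, OF g XB(1)] X2(2)[OF g XB(2) bB] X3(2)[OF g XB(3) bB] unfolding gy by (simp del: fun_upd_apply)
  qed
  ultimately show ?thesis by (intro exI[of _ "{c. \<not> ?P c}"]) blast
qed

lemma is_ideal_sums:
  assumes I: "is_ideal I" and J: "is_ideal J"
  shows "is_ideal {g + h |g h. g \<in> I \<and> h \<in> J}"
proof (rule idl.subspaceI)
  show "0 \<in> {g + h |g h. g \<in> I \<and> h \<in> J}" using idl.subspace_0[OF I] idl.subspace_0[OF J] by force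
  fix p assume "p \<in> {g + h |g h. g \<in> I \<and> h \<in> J}"
  then obtain g h where gh: "p = g + h" "g \<in> I" "h \<in> J" by blast
  show "c * p \<in> {g + h |g h. g \<in> I \<and> h \<in> J}" for c
    using ideal_mult[OF I gh(2)] ideal_mult[OF J gh(3)] gh(1) by (auto simp: distrib_left)
  fix q assume "q \<in> {g + h |g h. g \<in> I \<and> h \<in> J}"
  then obtain g' h' where gh': "q = g' + h'" "g' \<in> I" "h' \<in> J" by blast
  have "p + q = (g + g') + (h + h')" using gh(1) gh'(1) by (simp add: algebra_simps)
  then show "p + q \<in> {g + h |g h. g \<in> I \<and> h \<in> J}"
    using idl.subspace_add[OF I gh(2) gh'(2)] idl.subspace_add[OF J gh(3) gh'(3)] by blast
qed

text \<open>By Nakayama's lemma it suffices that \<open>ordge N\<close> lies in the sum of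
  \<open>(x)\<close> and \<open>ordge (Suc N)\<close>. This sum has a finite monomial basis, so
  membership in it is reflected by injective field maps.\<close>

lemma param_descend:
  fixes x :: "nat \<Rightarrow> ('v::finite, 'k::field) mfps" and e :: "'k \<Rightarrow> 'l::field"
  assumes e: "subhom UNIV e" "inj e" and x: "param (\<lambda>i. map_coeffs e (x i))"
  shows "param x"
proof -
  let ?n = "CARD('v)"
  have bU: "coeffs_in UNIV f" for f :: "('v, 'k) mfps" by (simp add: coeffs_in_def)
  have e0: "e a = 0 \<longleftrightarrow> a = 0" for a using e subhom_0[OF e(1)] by (metis injD)
  obtain N where N: "ordge N \<subseteq> igen (\<lambda>i. map_coeffs e (x i)) ?n" and x1: "\<And>i. i < ?n \<Longrightarrow> map_coeffs e (x i) \<in> ordge 1"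
    using x unfolding param_def by blast
  have "x i \<in> ordge 1" if "i < ?n" for i using x1[OF that] e0 unfolding ordge_1_iff by simp
  moreover have "ordge N \<subseteq> igen x ?n"
  proof (rule igen_nakayama)
    fix f :: "('v, 'k) mfps" assume f: "f \<in> ordge N"
    define K where "K = {g + h |g h. g \<in> igen x ?n \<and> h \<in> ordge (Suc N)}"
    have K: "is_ideal K" unfolding K_def by (rule is_ideal_sums) simp_all
    have KN: "ordge (Suc N) \<subseteq> K"
      unfolding K_def using idl.subspace_0[OF is_ideal_igen, of x ?n] by force
    have Kx: "igen x ?n \<subseteq> K"
      unfolding K_def using zero_ordge[of "Suc N", where 'a = 'v and 'b = 'k] by force
    obtain A where d: "nf_defined_over UNIV K (Suc N) A" using ex_nf_defined_over_UNIV[OF K KN] by blast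
    have sub: "igen (\<lambda>i. map_coeffs e (x i)) ?n \<subseteq> map_ideal UNIV e K"
      unfolding igen_subset_iff[OF is_ideal_map_ideal]
    proof (intro allI impI map_ideal_base bU)
      fix i assume "i < ?n"
      then show "x i \<in> K" using Kx igen_base by blast
    qed
    have "ordge N \<subseteq> K"
    proof (rule ordge_generated[OF K])
      fix \<kappa> :: "'v \<Rightarrow> nat" assume \<kappa>: "tdeg \<kappa> = N"
      have "monom \<kappa> \<in> map_ideal UNIV e K" using monom_ordge[of \<kappa>, where 'b = 'l] N sub unfolding \<kappa> by blast
      then have "map_coeffs e (monom \<kappa>) \<in> map_ideal UNIV e K" by (simp only: conjunct2[OF map_coeffs_monom[OF e(1)]])
      then show "monom \<kappa> \<in> K" unfolding map_ideal_reflects[OF e(1) d e(2) bU] .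
    qed
    then have "f \<in> K" using f by blast
    then obtain g h where gh: "f = g + h" "g \<in> igen x ?n" "h \<in> ordge (Suc N)" unfolding K_def by blast
    then show "\<exists>g\<in>igen x ?n. f - g \<in> ordge (Suc N)" by (intro bexI[of _ g]) simp_all
  qed
  ultimately show ?thesis unfolding param_def by blast
qed

text \<open>
  A link over \<open>'l\<close> is moved to one defined over \<open>'k\<close> by changing one coefficient at a time: at each step all but
  finitely many new values are admissible, and the image of \<open>'k\<close> is infinite.
\<close>

theorem plicci_descend:
  fixes I :: "('v::finite, 'k::field) mfps set" and e :: "'k \<Rightarrow> 'l::alg_closed_field"
  assumes e: "subhom UNIV e" "inj e" and k: "infinite (UNIV :: 'k set)"
    and "is_ideal I" "ordge M \<subseteq> I" "plicci s (map_ideal UNIV e I)"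
  shows "plicci s I"
  using assms(4-)
proof (induction s arbitrary: I M)
  case (0 I M)
  obtain A where d: "nf_defined_over UNIV I M A" using ex_nf_defined_over_UNIV[OF 0(1,2)] by blast
  show ?case using 0(3) map_ideal_UNIV_iff[OF e(1) d] by simp
next
  case (Suc s I M)
  let ?n = "CARD('v)" and ?F = "map_ideal UNIV e I"
  note I = Suc.prems(1)
  have bU: "coeffs_in UNIV f" for f :: "('v, 'k) mfps" by (simp add: coeffs_in_def)
  show ?case
  proof (cases "I = UNIV")
    case True
    then show ?thesis by simp
  next
    case False
    obtain A0 where "nf_defined_over UNIV I M A0" using ex_nf_defined_over_UNIV[OF Suc.prems(1,2)] by blast
    then have FU: "?F \<noteq> UNIV" using False map_ideal_UNIV_iff[OF e(1)] by blast
    then obtain x where x: "param x" "pgen x \<subseteq> ?F" "plicci s (ideal_quotient (pgen x) ?F)"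
      using Suc.prems(3) by auto
    obtain N where N: "ordge N \<subseteq> pgen x" using param_primary[OF x(1)] by blast
    \<comment> \<open>Large enough for \<open>I\<close> to contain \<open>ordge L\<close> and for
      errors of order \<open>L\<close> to leave the ideal of the parameters unchanged.\<close>
    define L where "L = max M (Suc N)"
    have MI: "ordge L \<subseteq> I" using Suc.prems(2) ordge_mono[of M L] by (auto simp: L_def)
    obtain A where d: "nf_defined_over UNIV I L A" using ex_nf_defined_over_UNIV[OF I MI] by blast
    define p where "p \<kappa> = monom \<kappa> - lincomb A (nf I A (monom \<kappa>))" for \<kappa>
    have pI: "p \<kappa> \<in> I" for \<kappa> unfolding p_def by (rule nf_defined_over_generator(1)[OF e(1) d])
    have gp: "map_coeffs e (p \<kappa>) = monom \<kappa> - lincomb A (nf ?F A (monom \<kappa>))" for \<kappa>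
    proof -
      have "nf ?F A (monom \<kappa>) \<nu> = e (nf I A (monom \<kappa>) \<nu>)" if "\<nu> \<in> A" for \<nu>
        using nf_map_ideal(1)[OF e(1) d bU that, of "monom \<kappa>"] map_coeffs_monom[OF e(1), of \<kappa>] by simp
      then have "lincomb A (nf ?F A (monom \<kappa>)) = lincomb A (\<lambda>\<nu>. e (nf I A (monom \<kappa>) \<nu>))"
        unfolding lincomb_def by (intro sum.cong) simp_all
      then show ?thesis using nf_defined_over_generator(3)[OF e(1) d, of \<kappa>] by (simp add: p_def)
    qed
    let ?T = "{\<kappa> :: 'v \<Rightarrow> nat. tdeg \<kappa> < L}"
    \<comment> \<open>Written in the generators of \<open>I\<close>, the parameters stay in the
      extended ideal whatever the coefficients \<open>u\<close> are.\<close>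
    define y where "y u i = (\<Sum>\<kappa>\<in>?T. mfps_const (u i \<kappa>) * map_coeffs e (p \<kappa>))" for u :: "nat \<Rightarrow> ('v \<Rightarrow> nat) \<Rightarrow> 'l" and i
    have pF: "map_coeffs e (p \<kappa>) \<in> ?F" for \<kappa> by (intro map_ideal_base pI bU)
    have yF: "y u i \<in> ?F" for u i
      unfolding y_def by (intro idl.subspace_sum[OF is_ideal_map_ideal] ideal_mult[OF is_ideal_map_ideal] pF)
    then have yF': "pgen (y u) \<subseteq> ?F" for u unfolding pgen_def igen_subset_iff[OF is_ideal_map_ideal] by blast
    let ?good = "\<lambda>u. param (y u) \<and> plicci s (ideal_quotient (pgen (y u)) ?F)"
    have start: "?good (\<lambda>i. mfps_coeff (x i))"
    proof -
      let ?y = "y (\<lambda>i. mfps_coeff (x i))"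
      have "x i - ?y i \<in> ordge (Suc N)" if i: "i < ?n" for i
      proof -
        have "x i \<in> ?F" using x(2) igen_base[OF i, of x] by (auto simp: pgen_def)
        then have "x i - ?y i \<in> ordge L"
          using generators_expand[OF is_ideal_map_ideal ordge_map_ideal[OF e(1) d] nf_basis_map_ideal[OF e(1) d]] by (simp add: y_def gp)
        then show ?thesis using ordge_mono[of "Suc N" L] by (auto simp: L_def)
      qed
      then have eq: "ordge N \<subseteq> pgen ?y" "pgen ?y = pgen x"
        using igen_perturb[of N x ?n ?y] N unfolding pgen_def by blast+
      have "?y i \<in> ordge 1" for i using ideal_le_ordge_1[OF is_ideal_map_ideal FU] yF by blast
      then have "param ?y" using eq(1) unfolding param_def pgen_def by blast
      then show ?thesis using x(3) eq(2) by simp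
    qed
    have re: "infinite (range e)" using k e(2) finite_imageD by blast
    have "\<exists>u. (\<forall>(i, \<kappa>)\<in>S. u i \<kappa> \<in> range e) \<and> ?good u" if "finite S" "S \<subseteq> {..<?n} \<times> ?T" for S
      using that
    proof (induction S)
      case empty
      then show ?case using start by blast
    next
      case (insert q S)
      obtain i \<kappa> where q: "q = (i, \<kappa>)" by (cases q)
      then have \<kappa>: "\<kappa> \<in> ?T" using insert.prems by auto
      obtain u where u: "\<forall>(i, \<kappa>)\<in>S. u i \<kappa> \<in> range e" "?good u" using insert by auto
      obtain Z where Z: "finite Z" "\<And>c. c \<notin> Z \<Longrightarrow> param ((y u)(i := y u i + mfps_const c * map_coeffs e (p \<kappa>))) \<and>
          plicci s (ideal_quotient (pgen ((y u)(i := y u i + mfps_const c * map_coeffs e (p \<kappa>)))) ?F)"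
        using move_coordinate[OF is_ideal_map_ideal ordge_map_ideal[OF e(1) d] FU _ yF' pF, of u s i \<kappa>] u(2)
        by (elim conjE) blast
      have "infinite (range e - (\<lambda>c. u i \<kappa> + c) ` Z)" using re Z(1) by simp
      then obtain a where a: "a \<in> range e" "a \<notin> (\<lambda>c. u i \<kappa> + c) ` Z"
        using infinite_imp_nonempty by blast
      \<comment> \<open>\<open>a\<close> is the new value of the coefficient in the image of
        \<open>e\<close>, and \<open>c\<close> is the change that \<open>move_coordinate\<close>
        controls.\<close>
      define c where "c = a - u i \<kappa>"
      have cZ: "c \<notin> Z" using a(2) by (auto simp: c_def image_iff)
      let ?u = "u(i := (u i)(\<kappa> := a))"
      have "y ?u = (y u)(i := y u i + mfps_const c * map_coeffs e (p \<kappa>))"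
      proof
        fix j
        have "y ?u i = (\<Sum>\<kappa>'\<in>?T. mfps_const (u i \<kappa>') * map_coeffs e (p \<kappa>') +
            (if \<kappa>' = \<kappa> then mfps_const c * map_coeffs e (p \<kappa>) else 0))"
          unfolding y_def by (intro sum.cong) (auto simp: c_def const_diff algebra_simps)
        also have "\<dots> = y u i + mfps_const c * map_coeffs e (p \<kappa>)"
          using \<kappa> finite_tdeg_less[of L, where 'v = 'v] by (simp add: sum.distrib y_def)
        finally show "y ?u j = ((y u)(i := y u i + mfps_const c * map_coeffs e (p \<kappa>))) j"
          by (simp add: y_def)
      qed
      then have "?good ?u" using Z(2)[OF cZ] by simp
      moreover have "\<forall>(i, \<kappa>)\<in>insert q S. ?u i \<kappa> \<in> range e" using u(1) a(1) q by auto
      ultimately show ?case by blast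
    qed
    then obtain u where u: "\<And>i \<kappa>. i < ?n \<Longrightarrow> \<kappa> \<in> ?T \<Longrightarrow> u i \<kappa> \<in> range e" "?good u"
      using finite_tdeg_less[of L, where 'v = 'v] by (metis (no_types, lifting) SigmaI case_prodD finite_SigmaI
          finite_lessThan lessThan_iff order_refl)
    define w where "w i \<kappa> = inv_into UNIV e (u i \<kappa>)" for i \<kappa>
    define z where "z i = (\<Sum>\<kappa>\<in>?T. mfps_const (w i \<kappa>) * p \<kappa>)" for i
    have zI: "z i \<in> I" for i unfolding z_def by (intro idl.subspace_sum[OF I] ideal_mult[OF I] pI)
    have gz: "map_coeffs e (z i) = y u i" if i: "i < ?n" for i
    proof -
      have "map_coeffs e (mfps_const (w i \<kappa>) * p \<kappa>) = mfps_const (u i \<kappa>) * map_coeffs e (p \<kappa>)" if "\<kappa> \<in> ?T" for \<kappa>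
        using u(1)[OF i that] subhom_mult[OF e(1)] by (intro mfps_eqI) (simp add: w_def f_inv_into_f)
      then have "(\<Sum>\<kappa>\<in>?T. map_coeffs e (mfps_const (w i \<kappa>) * p \<kappa>)) = y u i"
        unfolding y_def by (rule sum.cong[OF refl])
      moreover have "map_coeffs e (z i) = (\<Sum>\<kappa>\<in>?T. map_coeffs e (mfps_const (w i \<kappa>) * p \<kappa>))"
        unfolding z_def using map_coeffs_sum[OF e(1) bU] by blast
      ultimately show ?thesis by simp
    qed
    have pg: "pgen (\<lambda>i. map_coeffs e (z i)) = pgen (y u)" unfolding pgen_def by (rule igen_cong) (rule gz)
    have "param (\<lambda>i. map_coeffs e (z i))" using u(2) pg gz unfolding param_def pgen_def by simp
    then have pz: "param z" by (rule param_descend[OF e])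
    obtain X1 where X1: "\<And>B (g :: 'k \<Rightarrow> 'l). subhom B g \<Longrightarrow> X1 \<subseteq> B \<Longrightarrow> (\<And>i. i < ?n \<Longrightarrow> coeffs_in B (z i)) \<Longrightarrow>
      map_ideal B g (ideal_quotient (pgen z) I) = ideal_quotient (pgen (\<lambda>i. map_coeffs g (z i))) (map_ideal B g I)"
      using map_ideal_quotient[OF pz I MI, where 'l = 'l] by metis
    have "plicci s (map_ideal UNIV e (ideal_quotient (pgen z) I))"
      using X1[OF e(1) subset_UNIV bU] u(2) pg by simp
    moreover obtain M' where "ordge M' \<subseteq> ideal_quotient (pgen z) I" using ordge_subset_quotient_pgen[OF pz] .
    ultimately have "plicci s (ideal_quotient (pgen z) I)"
      using Suc.IH[OF is_ideal_quotient[OF is_ideal_pgen]] by blast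
    moreover have "pgen z \<subseteq> I" unfolding pgen_def igen_subset_iff[OF I] using zI by blast
    ultimately show ?thesis using pz by auto
  qed
qed

section \<open>Linkage\<close>

lemma quotient_dim_eqI:
  assumes P: "\<And>i. i \<le> d \<Longrightarrow> prime_ideal (P i) \<and> I \<subseteq> P i" "\<And>i. i < d \<Longrightarrow> P i \<subset> P (Suc i)"
    and le: "\<And>r P. (\<And>i. i \<le> r \<Longrightarrow> prime_ideal (P i) \<and> I \<subseteq> P i) \<Longrightarrow> (\<And>i. i < r \<Longrightarrow> P i \<subset> P (Suc i)) \<Longrightarrow> r \<le> d"
  shows "quotient_dim I = enat d"
  unfolding quotient_dim_def
proof (rule antisym)
  show "Sup {enat r |r. \<exists>P. (\<forall>i\<le>r. prime_ideal (P i) \<and> I \<subseteq> P i) \<and> (\<forall>i<r. P i \<subset> P (Suc i))} \<le> enat d"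
  proof (rule Sup_least)
    fix x assume "x \<in> {enat r |r. \<exists>P. (\<forall>i\<le>r. prime_ideal (P i) \<and> I \<subseteq> P i) \<and> (\<forall>i<r. P i \<subset> P (Suc i))}"
    then obtain r P where "x = enat r" "\<And>i. i \<le> r \<Longrightarrow> prime_ideal (P i) \<and> I \<subseteq> P i" "\<And>i. i < r \<Longrightarrow> P i \<subset> P (Suc i)"
      by blast
    then show "x \<le> enat d" using le[of r P] by simp
  qed
  show "enat d \<le> Sup {enat r |r. \<exists>P. (\<forall>i\<le>r. prime_ideal (P i) \<and> I \<subseteq> P i) \<and> (\<forall>i<r. P i \<subset> P (Suc i))}"
    using P by (intro Sup_upper) blast
qed

lemma associated_prime_superset:
  assumes "is_ideal I" "P \<in> associated_primes I"
  shows "prime_ideal P" "I \<subseteq> P"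
  using assms ideal_quotient_superset[OF assms(1)] unfolding associated_primes_def by auto

lemma prime_ideal_power: "prime_ideal P \<Longrightarrow> x ^ e \<in> P \<Longrightarrow> x \<in> P"
proof (induction e)
  case 0
  then have "is_ideal P" "P \<noteq> UNIV" "1 \<in> P" by (auto simp: prime_ideal_def proper_ideal_def)
  then show ?case using ideal_UNIV_iff by blast
qed (auto simp: prime_ideal_def)

lemma ordge_1_generated:
  fixes I :: "('v::finite, 'k::comm_ring_1) mfps set"
  assumes "is_ideal I" "\<And>v. mfps_var v \<in> I"
  shows "ordge 1 \<subseteq> I"
proof -
  have "monom \<kappa> \<in> I" if \<kappa>: "tdeg \<kappa> = 1" for \<kappa>
  proof -
    have "\<kappa> \<noteq> (\<lambda>_. 0)" using \<kappa> by auto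
    then obtain v where v: "\<kappa> v \<noteq> 0" by (auto simp: fun_eq_iff)
    have "\<kappa> = (\<lambda>w. if w = v then 1 else 0)"
    proof
      fix w
      have "sum \<kappa> {v, w} \<le> 1" using sum_mono2[of UNIV "{v, w}" \<kappa>] \<kappa> by (simp add: tdeg_def)
      then show "\<kappa> w = (if w = v then 1 else 0)" using v by (cases "w = v") auto
    qed
    then show ?thesis using assms(2)[of v] by (simp add: var_monom)
  qed
  then show ?thesis by (rule ordge_generated[OF assms(1)])
qed

lemma prime_ordge_1: "prime_ideal (ordge 1 :: ('v::finite, 'k::field) mfps set)"
  unfolding prime_ideal_def proper_ideal_def
proof (intro conjI allI impI)
  show "ordge 1 \<noteq> (UNIV :: ('v, 'k) mfps set)" using ordge_Suc_neq_UNIV[of 0] by simp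
  fix x y :: "('v, 'k) mfps" assume "x * y \<in> ordge 1"
  then show "x \<in> ordge 1 \<or> y \<in> ordge 1" unfolding ordge_1_iff by (simp add: coeff_mult_zero)
qed simp

lemma prime_superset_ordge:
  fixes P :: "('v::finite, 'k::field) mfps set"
  assumes P: "prime_ideal P" and M: "ordge M \<subseteq> P"
  shows "P = ordge 1"
proof
  have Pi: "is_ideal P" "P \<noteq> UNIV" using P by (auto simp: prime_ideal_def proper_ideal_def)
  then show "P \<subseteq> ordge 1" by (rule ideal_le_ordge_1)
  have "mfps_var v ^ M \<in> P" for v using M var_power_ordge by blast
  then have "mfps_var v \<in> P" for v by (rule prime_ideal_power[OF P])
  then show "ordge 1 \<subseteq> P" by (rule ordge_1_generated[OF Pi(1)])
qed

lemma quotient_dim_artinian: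
  fixes I :: "('v::finite, 'k::field) mfps set"
  assumes I: "is_ideal I" "I \<noteq> UNIV" "ordge M \<subseteq> I"
  shows "quotient_dim I = enat 0"
proof (rule quotient_dim_eqI[where P = "\<lambda>_. ordge 1"])
  show "prime_ideal (ordge 1 :: ('v, 'k) mfps set) \<and> I \<subseteq> ordge 1" by (intro conjI prime_ordge_1 ideal_le_ordge_1[OF I(1,2)])
  fix r and P :: "nat \<Rightarrow> ('v, 'k) mfps set"
  assume P: "\<And>i. i \<le> r \<Longrightarrow> prime_ideal (P i) \<and> I \<subseteq> P i" "\<And>i. i < r \<Longrightarrow> P i \<subset> P (Suc i)"
  have eq: "P i = ordge 1" if "i \<le> r" for i
    using P(1)[OF that] I(3) by (intro prime_superset_ordge[of _ M]) auto
  show "r \<le> 0"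
  proof (rule ccontr)
    assume "\<not> r \<le> 0"
    then show False using P(2)[of 0] eq[of 0] eq[of 1] by simp
  qed
qed simp

lemma unmixed_artinian:
  fixes I :: "('v::finite, 'k::field) mfps set"
  assumes I: "is_ideal I" "I \<noteq> UNIV" "ordge M \<subseteq> I"
  shows "unmixed I"
  unfolding unmixed_def proper_ideal_def
proof (intro conjI ballI I(1,2))
  fix P assume "P \<in> associated_primes I"
  then have P: "prime_ideal P" "I \<subseteq> P" using associated_prime_superset[OF I(1)] by auto
  then have "is_ideal P" "P \<noteq> UNIV" by (auto simp: prime_ideal_def proper_ideal_def)
  then have "quotient_dim P = enat 0" using P(2) I(3) by (intro quotient_dim_artinian) auto
  then show "quotient_dim P = quotient_dim I" using quotient_dim_artinian[OF I] by simp
qed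

section \<open>Complete intersections and chains of links\<close>

lemma ideal_gen_insert_0: "ideal_gen (insert 0 S) = ideal_gen S"
proof (rule antisym)
  show "ideal_gen (insert 0 S) \<subseteq> ideal_gen S"
    by (rule idl.span_minimal) (auto intro: idl.span_base idl.span_zero)
  show "ideal_gen S \<subseteq> ideal_gen (insert 0 S)" by (rule idl.span_mono) auto
qed

lemma ideal_gen_take:
  assumes "j \<le> length xs"
  shows "ideal_gen ({0} \<union> set (take j xs)) = igen ((!) xs) j"
proof -
  have "set (take j xs) = (!) xs ` {..<j}" using nth_image[OF assms] by (simp add: atLeast0LessThan)
  then show ?thesis using ideal_gen_insert_0[of "(!) xs ` {..<j}"] by (simp add: igen_def)
qed

lemma regular_sequence_iff:
  "regular_sequence_mod {0} xs \<longleftrightarrow> igen ((!) xs) (length xs) \<noteq> UNIV \<and> reg (length xs) ((!) xs)"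
  unfolding regular_sequence_mod_def reg_def using ideal_gen_take[of _ xs] ideal_gen_take[of "length xs" xs] by auto

lemma complete_intersectionE:
  assumes "complete_intersection C"
  obtains x r where "C = igen x r" "reg r x" "C \<noteq> UNIV"
proof -
  obtain xs where "regular_sequence_mod {0} xs" "C = ideal_gen (set xs)"
    using assms unfolding complete_intersection_def by blast
  then have "C = igen ((!) xs) (length xs)" "reg (length xs) ((!) xs)" "C \<noteq> UNIV"
    using ideal_gen_take[of "length xs" xs] ideal_gen_insert_0[of "set xs"] by (auto simp: regular_sequence_iff)
  then show ?thesis by (rule that)
qed

lemma complete_intersection_pgen:
  fixes x :: "nat \<Rightarrow> ('v::finite, 'k::field) mfps"
  assumes x: "param x"
  shows "complete_intersection (pgen x)"
proof -
  let ?xs = "map x [0..<CARD('v)]"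
  have g: "igen ((!) ?xs) (length ?xs) = pgen x" unfolding pgen_def by (simp, rule igen_cong) simp
  have "reg (length ?xs) ((!) ?xs) \<longleftrightarrow> reg CARD('v) x" by (simp, rule reg_cong) simp
  then have "regular_sequence_mod {0} ?xs"
    using param_regular[OF x] param_proper(2)[OF x] g unfolding regular_sequence_iff by auto
  moreover have "pgen x = ideal_gen (set ?xs)"
    using g ideal_gen_take[of "length ?xs" ?xs] ideal_gen_insert_0[of "set ?xs"] by simp
  moreover have "proper_ideal (pgen x)" using param_proper(2)[OF x] by (auto simp: proper_ideal_def)
  ultimately show ?thesis unfolding complete_intersection_def by blast
qed

text \<open>Links through parameters are direct links by the double quotient property, and all
  proper ideals in the chain are primary to the maximal ideal, hence unmixed.\<close>

theorem licci_of_plicci: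
  fixes I :: "('v::finite, 'k::field) mfps set"
  assumes "is_ideal I" "I \<noteq> UNIV" "ordge M \<subseteq> I" "plicci s I"
  shows "licci I"
  using assms
proof (induction s arbitrary: I M)
  case 0
  then show ?case by simp
next
  case (Suc s I M)
  note I = Suc.prems(1-3)
  obtain x where x: "param x" "pgen x \<subseteq> I" "plicci s (ideal_quotient (pgen x) I)"
    using Suc.prems by auto
  let ?J = "ideal_quotient (pgen x) I"
  have uI: "unmixed I" by (rule unmixed_artinian[OF I])
  have ci: "complete_intersection (pgen x)" by (rule complete_intersection_pgen[OF x(1)])
  show ?case
  proof (cases "?J = UNIV")
    \<comment> \<open>A chain that arrives at the unit ideal has \<open>I\<close> itself equal to
      the complete intersection of its last link.\<close>
    case True
    then have "I = pgen x" using x(2) ideal_quotient_UNIV_iff[OF is_ideal_pgen] by blast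
    then show ?thesis
      using ci uI unfolding licci_def linkage_class_def linkage_def by auto
  next
    case False
    have J: "is_ideal ?J" by (rule is_ideal_quotient[OF is_ideal_pgen])
    obtain M' where M': "ordge M' \<subseteq> ?J" using ordge_subset_quotient_pgen[OF x(1)] .
    have uJ: "unmixed ?J" by (rule unmixed_artinian[OF J False M'])
    have "directly_linked ?J I"
      unfolding directly_linked_def proper_ideal_def
      using I(1,2) J False ci x(2) ideal_quotient_superset[OF is_ideal_pgen] param_double_quotient[OF x(1) I(1) x(2)]
      by (intro conjI exI[of _ "pgen x"]) auto
    then have link: "equivclp (\<lambda>I J. unmixed I \<and> unmixed J \<and> directly_linked I J) ?J I"
      using uI uJ by (intro r_into_equivclp) simp
    obtain C where C: "complete_intersection C" "?J \<in> linkage_class C"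
      using Suc.IH[OF J False M' x(3)] unfolding licci_def by blast
    have "I \<in> linkage_class C"
      using C(2) uI equivclp_trans[OF _ link] unfolding linkage_class_def linkage_def by auto
    then show ?thesis using C(1) unfolding licci_def by blast
  qed
qed

lemma maximal_ideal_mfps:
  fixes m :: "('v::finite, 'k::field) mfps set"
  assumes "maximal_ideal m"
  shows "m = ordge 1"
proof -
  have m: "is_ideal m" "m \<noteq> UNIV" and max: "\<And>J. proper_ideal J \<Longrightarrow> m \<subseteq> J \<Longrightarrow> J = m"
    using assms unfolding maximal_ideal_def proper_ideal_def by blast+
  have "proper_ideal (ordge 1 :: ('v, 'k) mfps set)" using prime_ordge_1 unfolding prime_ideal_def by blast
  then show ?thesis using max ideal_le_ordge_1[OF m] by blast
qed

lemma primary_to_maximal: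
  fixes I :: "('v::finite, 'k::field) mfps set"
  assumes "maximal_ideal m" "primary_to m I"
  obtains M where "is_ideal I" "I \<noteq> UNIV" "ordge M \<subseteq> I"
proof -
  have I: "is_ideal I" "I \<noteq> UNIV" and rad: "radical_ideal I = ordge 1"
    using assms(2) maximal_ideal_mfps[OF assms(1)] by (auto simp: primary_to_def primary_ideal_def proper_ideal_def)
  have "\<exists>e. mfps_var v ^ e \<in> I" for v
    using var_ordge[of v, where 'b = 'k] rad unfolding radical_ideal_def by blast
  then obtain e where e: "\<And>v. mfps_var v ^ e v \<in> I" by metis
  have "mfps_var v ^ Max (range e) \<in> I" for v
    using ideal_power_mono[OF I(1) e[of v]] Max_ge[of "range e" "e v"] by simp
  then have "ordge (CARD('v) * Max (range e)) \<subseteq> I" by (rule ordge_le_of_var_powers[OF I(1)])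
  then show ?thesis using that I by blast
qed

text \<open>The length of the linking sequence is forced by the height \<open>n\<close> of
  \<open>(Y)\<close>: a shorter sequence contradicts grade, a longer one contradicts regularity
  after localization.\<close>

lemma linked_localizes:
  fixes K K' :: "('n::finite option, 'k::field) mfps set"
  assumes K: "is_ideal K" "K \<subseteq> ypow 1" "ylocal K" and C: "C = igen x r" "reg r x" "C \<subseteq> K"
    and link: "K = ideal_quotient C K'" "K' = ideal_quotient C K"
  shows "r = CARD('n)" "param (\<lambda>i. eta (x i))" "ylocal C"
proof -
  let ?n = "CARD('n)"
  have xP: "x i \<in> ypow 1" if "i < r" for i using that K(2) C(1,3) igen_base by blast
  \<comment> \<open>If \<open>r\<close> were smaller, then for \<open>z\<close> in \<open>K'\<close>
    the product \<open>h * z\<close>, annihilated modulo \<open>C\<close> by \<open>n\<close> powers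
    of variables, would lie in \<open>C\<close>; this would put \<open>h\<close> into
    \<open>K\<close>.\<close>
  have ge: "\<not> r < ?n"
  proof
    assume r: "r < ?n"
    obtain h M where h: "h \<notin> ypow 1" "\<And>f. f \<in> ypow M \<Longrightarrow> h * f \<in> K" using K(3) unfolding ylocal_def by blast
    obtain e :: "nat \<Rightarrow> 'n" where e: "bij_betw e {..<?n} UNIV" using ex_enum .
    let ?y = "\<lambda>l. mfps_var (Some (e l)) ^ M :: ('n option, 'k) mfps"
    have y: "reg ?n ?y"
      using reg_var_powers[of "\<lambda>l. Some (e l)" ?n M] e by (simp add: bij_betw_def inj_on_def)
    have yM: "?y l \<in> ypow M" for l
      unfolding eta_ordge_iff[symmetric] eta_var_Some_power by (rule var_power_ordge)
    have "h \<in> ideal_quotient C K'"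
      unfolding ideal_quotient_def
    proof (intro CollectI ballI)
      fix z assume "z \<in> K'"
      then have "z * (h * ?y l) \<in> C" for l using h(2)[OF yM] unfolding link(2) ideal_quotient_def by blast
      then have "?y l * (h * z) \<in> igen x r" for l using C(1) by (simp add: ac_simps)
      then show "h * z \<in> C" unfolding C(1) by (rule grade_short_regular[OF y C(2) r])
    qed
    then show False using link(1) K(2) h(1) by blast
  qed
  have pe: "param (\<lambda>i. eta (x i))"
    using ge by (intro regular_localizes_to_param reg_mono[OF C(2)] xP) auto
  then show "param (\<lambda>i. eta (x i))" .
  obtain M where M: "ordge M \<subseteq> igen (\<lambda>i. eta (x i)) ?n" using param_primary[OF pe] unfolding pgen_def by blast
  then have yl: "ylocal (igen x ?n)" by (rule ylocal_of_eta)
  \<comment> \<open>If \<open>r\<close> were larger, \<open>h\<close> times a power of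
    \<open>x ?n\<close> would lie in the ideal of the first \<open>n\<close> elements, and
    regularity would cancel that power, putting \<open>h\<close> into \<open>ypow 1\<close>.\<close>
  show r: "r = ?n"
  proof (rule ccontr)
    assume "r \<noteq> ?n"
    then have nr: "?n < r" using ge by simp
    obtain h M where h: "h \<notin> ypow 1" "\<And>f. f \<in> ypow M \<Longrightarrow> h * f \<in> igen x ?n"
      using yl unfolding ylocal_def by blast
    have "eta (x ?n) ^ M \<in> ordge M" using xP[OF nr] by (intro ordge_power) (simp only: eta_ordge_iff)
    then have "x ?n ^ M \<in> ypow M" by (simp only: eta_ordge_iff flip: eta_power)
    then have "h * x ?n ^ M \<in> igen x ?n" by (rule h(2))
    moreover have "h * x ?n ^ j \<in> igen x ?n \<Longrightarrow> h \<in> igen x ?n" for j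
    proof (induction j)
      case (Suc j)
      have "x ?n * (h * x ?n ^ j) \<in> igen x ?n" using Suc.prems by (simp add: ac_simps)
      then show ?case using regD[OF C(2) nr] Suc.IH by blast
    qed simp
    ultimately have "h \<in> igen x ?n" by blast
    moreover have "igen x ?n \<subseteq> ypow 1"
      unfolding igen_subset_iff[OF is_ideal_ypow] using xP nr by auto
    ultimately show False using h(1) by blast
  qed
  show "ylocal C" using yl r C(1) by simp
qed

text \<open>Direct linkage is symmetric, so the equivalence is a chain of direct links. It is
  followed from \<open>K\<close> until an ideal leaves \<open>ypow 1\<close> and becomes the unit
  ideal at \<open>(Y)\<close>; what comes later in the chain plays no part in the local
  links.\<close>

theorem plicci_of_linkage:
  fixes K L :: "('n::finite option, 'k::field) mfps set"
  assumes "equivclp (\<lambda>I J. unmixed I \<and> unmixed J \<and> directly_linked I J) K L"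
    and "is_ideal K" "K \<subseteq> ypow 1" "ylocal K" and L: "\<not> L \<subseteq> ypow 1"
  shows "\<exists>s. plicci s (etaI K)"
proof -
  let ?R = "\<lambda>I J :: ('n option, 'k) mfps set. unmixed I \<and> unmixed J \<and> directly_linked I J"
  have "symp ?R" unfolding symp_def directly_linked_def by (simp add: Int_commute) blast
  then have "symclp ?R = ?R" by (rule symp_symclp_eq)
  then have "?R\<^sup>*\<^sup>* K L" using assms(1) by (simp add: equivclp_def)
  then show ?thesis using assms(2-4)
  proof (induction rule: converse_rtranclp_induct)
    case base
    then show ?case using L by blast
  next
    case (step K K')
    obtain C where C: "complete_intersection C" "C \<subseteq> K \<inter> K'" and link: "K = ideal_quotient C K'" "K' = ideal_quotient C K"
      and K': "is_ideal K'"
      using step.hyps(1) unfolding directly_linked_def proper_ideal_def by blast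
    obtain x r where x: "C = igen x r" "reg r x" using C(1) by (rule complete_intersectionE)
    have CK: "C \<subseteq> K" "C \<subseteq> K'" using C(2) by auto
    have loc: "r = CARD('n)" "param (\<lambda>i. eta (x i))" "ylocal C"
      using linked_localizes[OF step.prems x CK(1) link] by blast+
    have Ci: "is_ideal C" by (simp add: x(1))
    have q: "etaI K' = ideal_quotient (pgen (\<lambda>i. eta (x i))) (etaI K)"
      using etaI_quotient[OF Ci loc(3), of K] link(2) by (simp add: x(1) loc(1) etaI_igen pgen_def)
    have "\<exists>s. plicci s (etaI K')"
    proof (cases "K' \<subseteq> ypow 1")
      case True
      then show ?thesis using step.IH K' ylocal_mono[OF loc(3) CK(2)] by blast
    next
      case False
      then have "etaI K' = UNIV" using etaI_UNIV_of_notin by blast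
      then show ?thesis by (intro exI[of _ 0]) simp
    qed
    then obtain s where s: "plicci s (etaI K')" by blast
    have "pgen (\<lambda>i. eta (x i)) \<subseteq> etaI K"
      using etaI_mono[OF CK(1)] by (simp add: x(1) loc(1) etaI_igen pgen_def)
    then have "plicci (Suc s) (etaI K)" using loc(2) s q by auto
    then show ?case by blast
  qed
qed

section \<open>Substitution\<close>

definition vmon :: "('v::finite \<Rightarrow> 'a::comm_ring_1) \<Rightarrow> ('v \<Rightarrow> nat) \<Rightarrow> 'a"
  where "vmon v \<kappa> = (\<Prod>i\<in>UNIV. v i ^ \<kappa> i)"

lemma vmon_add: "vmon v (\<lambda>i. \<kappa> i + \<mu> i) = vmon v \<kappa> * vmon v \<mu>"
  by (simp add: vmon_def power_add prod.distrib)

lemma vmon_zero: "vmon v (\<lambda>_. 0) = 1"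
  by (simp add: vmon_def)

lemma vmon_single: "vmon v (\<lambda>w. if w = i then e else 0) = v i ^ e"
proof -
  have "vmon v (\<lambda>w. if w = i then e else 0) = (\<Prod>w\<in>UNIV. if w = i then v i ^ e else 1)"
    unfolding vmon_def by (intro prod.cong) auto
  then show ?thesis by simp
qed

lemma vmon_ordge:
  fixes v :: "'v::finite \<Rightarrow> ('w::finite, 'k::comm_ring_1) mfps"
  assumes "\<And>i. v i \<in> ordge 1"
  shows "vmon v \<kappa> \<in> ordge (tdeg \<kappa>)"
proof -
  have "(\<Prod>i\<in>A. v i ^ \<kappa> i) \<in> ordge (\<Sum>i\<in>A. \<kappa> i)" if "finite A" for A
    using that by (induction A) (auto intro: ordge_mult ordge_power assms)
  then show ?thesis by (simp add: vmon_def tdeg_def)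
qed

lemma monom_vmon: "(monom \<kappa> :: ('v::finite, 'k::comm_ring_1) mfps) = vmon mfps_var \<kappa>"
proof -
  have "(\<Prod>i\<in>A. mfps_var i ^ \<kappa> i) = (monom (\<lambda>w. if w \<in> A then \<kappa> w else 0) :: ('v, 'k) mfps)" if "finite A" for A
    using that
  proof (induction A)
    case (insert i A)
    have "(\<Prod>i\<in>insert i A. mfps_var i ^ \<kappa> i) =
        (monom (\<lambda>w. (if w = i then \<kappa> i else 0) + (if w \<in> A then \<kappa> w else 0)) :: ('v, 'k) mfps)"
      by (simp only: prod.insert[OF insert.hyps] insert.IH) (simp only: var_power monom_mult)
    also have "(\<lambda>w. (if w = i then \<kappa> i else 0) + (if w \<in> A then \<kappa> w else 0)) = (\<lambda>w. if w \<in> insert i A then \<kappa> w else 0)"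
      using insert.hyps by auto
    finally show ?case .
  qed (simp add: monom_0)
  from this[of UNIV] show ?thesis by (simp add: vmon_def)
qed

text \<open>Substitution of series without constant term: the image of a monomial has order at least
  its degree, so monomials of degree above \<open>tdeg \<mu>\<close> do not contribute at
  \<open>\<mu>\<close>.\<close>

definition subst :: "('v \<Rightarrow> ('w::finite, 'k) mfps) \<Rightarrow> ('v::finite, 'k::comm_ring_1) mfps \<Rightarrow> ('w, 'k) mfps"
  where "subst v f = Abs_mfps (\<lambda>\<mu>. \<Sum>\<kappa> | tdeg \<kappa> \<le> tdeg \<mu>. mfps_coeff f \<kappa> * mfps_coeff (vmon v \<kappa>) \<mu>)"

lemma coeff_subst:
  "mfps_coeff (subst v f) \<mu> = (\<Sum>\<kappa> | tdeg \<kappa> \<le> tdeg \<mu>. mfps_coeff f \<kappa> * mfps_coeff (vmon v \<kappa>) \<mu>)"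
  by (simp add: subst_def)

lemma subst_add: "subst v (f + g) = subst v f + subst v g"
  by (rule mfps_eqI) (simp add: coeff_subst distrib_right sum.distrib)

lemma subst_scale: "subst v (mfps_const c * f) = mfps_const c * subst v f"
  by (rule mfps_eqI) (simp add: coeff_subst sum_distrib_left mult.assoc)

lemma subst_0: "subst v 0 = 0"
  by (rule mfps_eqI) (simp add: coeff_subst)

lemma subst_sum: "subst v (sum f A) = (\<Sum>i\<in>A. subst v (f i))"
  by (induction A rule: infinite_finite_induct) (simp_all add: subst_add subst_0)

lemma subst_ordge: "f \<in> ordge N \<Longrightarrow> subst v f \<in> ordge N"
  by (auto simp: ordge_def coeff_subst intro!: sum.neutral)

lemma subst_monom:
  assumes "\<And>i. v i \<in> ordge 1"
  shows "subst v (monom \<kappa>) = vmon v \<kappa>"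
proof (rule mfps_eqI)
  fix \<mu>
  have "mfps_coeff (subst v (monom \<kappa>)) \<mu> = (\<Sum>\<nu> | tdeg \<nu> \<le> tdeg \<mu>. if \<nu> = \<kappa> then mfps_coeff (vmon v \<kappa>) \<mu> else 0)"
    unfolding coeff_subst by (intro sum.cong) (auto simp: coeff_monom)
  also have "\<dots> = mfps_coeff (vmon v \<kappa>) \<mu>"
    using vmon_ordge[of v \<kappa>, OF assms] by (auto simp: finite_tdeg_le ordge_def not_le)
  finally show "mfps_coeff (subst v (monom \<kappa>)) \<mu> = mfps_coeff (vmon v \<kappa>) \<mu>" .
qed

text \<open>Preservation of the order filtration is continuity, which makes such a homomorphism
  determined by its values at the variables.\<close>

definition local_hom :: "(('v::finite, 'k::comm_ring_1) mfps \<Rightarrow> ('w::finite, 'k) mfps) \<Rightarrow> bool"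
  where "local_hom g \<longleftrightarrow> (\<forall>x y. g (x + y) = g x + g y) \<and> (\<forall>x y. g (x * y) = g x * g y) \<and>
    (\<forall>c. g (mfps_const c) = mfps_const c) \<and> (\<forall>N. \<forall>f\<in>ordge N. g f \<in> ordge N)"

lemma local_homD:
  assumes "local_hom g"
  shows "g (x + y) = g x + g y" "g (x * y) = g x * g y" "g (mfps_const c) = mfps_const c"
    "g 0 = 0" "g 1 = 1" "f \<in> ordge N \<Longrightarrow> g f \<in> ordge N"
  using assms unfolding local_hom_def by (auto simp flip: const_0 const_1)

lemma local_hom_sum: "local_hom g \<Longrightarrow> g (sum f A) = (\<Sum>i\<in>A. g (f i))"
  by (induction A rule: infinite_finite_induct) (simp_all add: local_homD)

lemma local_hom_power: "local_hom g \<Longrightarrow> g (x ^ e) = g x ^ e"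
  by (induction e) (simp_all add: local_homD)

lemma local_hom_monom:
  assumes "local_hom g"
  shows "g (monom \<kappa>) = vmon (\<lambda>i. g (mfps_var i)) \<kappa>"
proof -
  have "g (\<Prod>i\<in>A. mfps_var i ^ \<kappa> i) = (\<Prod>i\<in>A. g (mfps_var i) ^ \<kappa> i)" for A
    by (induction A rule: infinite_finite_induct) (simp_all add: local_homD[OF assms] local_hom_power[OF assms])
  then show ?thesis by (simp add: monom_vmon) (simp add: vmon_def)
qed

text \<open>Both maps agree on truncations, and the remainders are sent into \<open>ordge N\<close>
  for every \<open>N\<close>.\<close>

lemma local_hom_unique:
  assumes g: "local_hom g" and h: "local_hom h" and eq: "\<And>i. g (mfps_var i) = h (mfps_var i)"
  shows "g = h"
proof
  fix f
  have "g f - h f \<in> ordge N" for N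
  proof -
    let ?p = "lincomb {\<kappa>. tdeg \<kappa> < N} (mfps_coeff f)"
    have "g (f - ?p) - h (f - ?p) \<in> ordge N"
      using local_homD(6)[OF g minus_truncate] local_homD(6)[OF h minus_truncate] by (rule ordge_diff)
    moreover have "g ?p = h ?p"
      unfolding lincomb_def using eq
      by (simp add: local_hom_sum[OF g] local_hom_sum[OF h] local_homD[OF g] local_homD[OF h]
          local_hom_monom[OF g] local_hom_monom[OF h])
    moreover have "g f = g (f - ?p) + g ?p" "h f = h (f - ?p) + h ?p"
      by (simp_all flip: local_homD(1)[OF g] local_homD(1)[OF h])
    ultimately show ?thesis by simp
  qed
  then have "g f - h f = 0" by (rule ordge_separated)
  then show "g f = h f" by simp
qed

lemma local_hom_comp: "local_hom g \<Longrightarrow> local_hom h \<Longrightarrow> local_hom (\<lambda>x. g (h x))"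
  by (simp add: local_hom_def)

text \<open>Multiplicativity is clear for polynomials; it passes to series by comparing truncations
  modulo every \<open>ordge N\<close>.\<close>

lemma local_hom_subst:
  assumes v: "\<And>i. v i \<in> ordge 1"
  shows "local_hom (subst v)"
  unfolding local_hom_def
proof (intro conjI allI ballI)
  show c: "subst v (mfps_const c) = mfps_const c" for c
    using subst_scale[of v c 1] subst_monom[of v "\<lambda>_. 0", OF v] by (simp add: monom_0 vmon_zero)
  fix f g
  have "subst v (f * g) - subst v f * subst v g \<in> ordge N" for N
  proof -
    let ?T = "{\<kappa> :: 'a \<Rightarrow> nat. tdeg \<kappa> < N}"
    let ?p = "lincomb ?T (mfps_coeff f)" and ?q = "lincomb ?T (mfps_coeff g)"
    have lc: "subst v (lincomb ?T c) = (\<Sum>\<kappa>\<in>?T. mfps_const (c \<kappa>) * vmon v \<kappa>)" for c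
      by (simp add: lincomb_def subst_sum subst_scale subst_monom[OF v])
    have "?p * ?q = (\<Sum>\<kappa>\<in>?T. \<Sum>\<mu>\<in>?T. mfps_const (mfps_coeff f \<kappa> * mfps_coeff g \<mu>) * monom (\<lambda>i. \<kappa> i + \<mu> i))"
      unfolding lincomb_def sum_product by (simp add: const_mult mult_ac flip: monom_mult)
    then have "subst v (?p * ?q) =
        (\<Sum>\<kappa>\<in>?T. \<Sum>\<mu>\<in>?T. mfps_const (mfps_coeff f \<kappa> * mfps_coeff g \<mu>) * (vmon v \<kappa> * vmon v \<mu>))"
      by (simp add: subst_sum subst_scale subst_monom[OF v] vmon_add)
    also have "\<dots> = subst v ?p * subst v ?q"
      unfolding lc sum_product by (simp add: const_mult mult_ac)
    finally have pq: "subst v (?p * ?q) = subst v ?p * subst v ?q" .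
    define r where "r = f - ?p"
    define s where "s = g - ?q"
    have rs: "r \<in> ordge N" "s \<in> ordge N" unfolding r_def s_def by (rule minus_truncate)+
    have fg: "f = ?p + r" "g = ?q + s" by (simp_all add: r_def s_def)
    have "f * g = ?p * ?q + (?p * s + r * g)"
      by (subst fg(1), subst (1 2) fg(2)) (simp add: algebra_simps)
    then have e1: "subst v (f * g) = subst v ?p * subst v ?q + subst v (?p * s + r * g)"
      by (simp only: subst_add pq)
    have "subst v f = subst v ?p + subst v r" "subst v g = subst v ?q + subst v s"
      by (simp_all flip: subst_add fg)
    then have e2: "subst v f * subst v g = subst v ?p * subst v ?q + (subst v ?p * subst v s + subst v r * subst v g)"
      by (simp add: algebra_simps)
    have "subst v (?p * s + r * g) \<in> ordge N"
      using rs by (intro subst_ordge ordge_add ideal_mult[OF is_ideal_ordge] ideal_mult'[OF is_ideal_ordge])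
    moreover have "subst v ?p * subst v s + subst v r * subst v g \<in> ordge N"
      using rs by (intro ordge_add ideal_mult[OF is_ideal_ordge] ideal_mult'[OF is_ideal_ordge] subst_ordge)
    ultimately show ?thesis unfolding e1 e2 by (simp add: ordge_diff)
  qed
  then have "subst v (f * g) - subst v f * subst v g = 0" by (rule ordge_separated)
  then show "subst v (f * g) = subst v f * subst v g" by simp
qed (simp_all add: subst_add subst_ordge)

lemma subst_var:
  assumes "\<And>i. v i \<in> ordge 1"
  shows "subst v (mfps_var i) = v i"
  using subst_monom[of v "\<lambda>w. if w = i then 1 else 0", OF assms] vmon_single[of v i 1] by (simp add: var_monom)

text \<open>Continuity is automatic: a bijective homomorphism sends nonunits to nonunits, hence
  \<open>ordge 1\<close> into itself, and the higher orders follow from the decomposition into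
  monomials. This makes the shifts unique among all algebra automorphisms.\<close>

lemma automorphism_local_hom:
  fixes g :: "('v::finite, 'k::field) mfps \<Rightarrow> ('v, 'k) mfps"
  assumes "mfps_algebra_automorphism g"
  shows "local_hom g"
proof -
  have g: "bij g" "\<And>x y. g (x + y) = g x + g y" "\<And>x y. g (x * y) = g x * g y" "\<And>c. g (mfps_const c) = mfps_const c"
    using assms by (auto simp: mfps_algebra_automorphism_def)
  have g1: "g 1 = 1" and g0: "g 0 = 0" using g(4)[of 1] g(4)[of 0] by simp_all
  have loc: "g f \<in> ordge 1" if f: "f \<in> ordge 1" for f
  proof (rule ccontr)
    assume "g f \<notin> ordge 1"
    then obtain u where u: "g f * u = 1" using mfps_unit[of "g f"] unfolding ordge_1_iff by blast
    obtain w where "u = g w" using g(1) by (metis bij_pointE)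
    then have "g (f * w) = g 1" using u g(3) g1 by simp
    then have "f * w = 1" using g(1) by (meson bij_is_inj injD)
    then have "1 \<in> (ordge 1 :: ('v, 'k) mfps set)" using ideal_mult'[OF is_ideal_ordge f, of w] by simp
    then show False using one_notin_ordge[of 0] by simp
  qed
  have map_coeffs: "g (monom \<kappa>) = vmon (\<lambda>i. g (mfps_var i)) \<kappa>" for \<kappa>
  proof -
    have gp: "g (x ^ e) = g x ^ e" for x e by (induction e) (simp_all add: g1 g(3))
    have "g (\<Prod>i\<in>A. mfps_var i ^ \<kappa> i) = (\<Prod>i\<in>A. g (mfps_var i) ^ \<kappa> i)" for A
      by (induction A rule: infinite_finite_induct) (simp_all add: g1 g(3) gp)
    then show ?thesis by (simp add: monom_vmon) (simp add: vmon_def)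
  qed
  have "g f \<in> ordge N" if f: "f \<in> ordge N" for f N
  proof -
    have "f \<in> ordge (N + 0)" using f by simp
    then obtain h where h: "f = (\<Sum>\<nu> | tdeg \<nu> = N. monom \<nu> * h \<nu>)" using ordge_decomp by blast
    have "g (\<Sum>\<nu>\<in>A. monom \<nu> * h \<nu>) = (\<Sum>\<nu>\<in>A. g (monom \<nu>) * g (h \<nu>))" for A
      by (induction A rule: infinite_finite_induct) (simp_all add: g g0)
    then have "g f = (\<Sum>\<nu> | tdeg \<nu> = N. vmon (\<lambda>i. g (mfps_var i)) \<nu> * g (h \<nu>))" by (simp add: h map_coeffs)
    also have "\<dots> \<in> ordge N"
      using vmon_ordge[of "\<lambda>i. g (mfps_var i)", OF loc[OF var_ordge]]
      by (intro idl.subspace_sum[OF is_ideal_ordge] ideal_mult'[OF is_ideal_ordge]) auto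
    finally show ?thesis .
  qed
  then show ?thesis using g(2-4) by (simp add: local_hom_def)
qed

section \<open>The shifts\<close>

definition shift_var :: "('n::finite \<Rightarrow> 'k::field fps) \<Rightarrow> 'n option \<Rightarrow> ('n option, 'k) mfps"
  where "shift_var a v = (case v of None \<Rightarrow> xvar | Some i \<Rightarrow> mfps_var (Some i) + mfps_of_fps (a i) * xvar)"

lemma shift_var_ordge: "shift_var a v \<in> ordge 1"
  unfolding shift_var_def
  by (cases v) (simp_all del: One_nat_def add: var_ordge ordge_add ideal_mult[OF is_ideal_ordge])

lemma local_hom_shift: "local_hom (subst (shift_var a))"
  by (rule local_hom_subst[OF shift_var_ordge])

lemma subst_shift_xvar: "subst (shift_var a) xvar = xvar"
  and subst_shift_var: "subst (shift_var a) (mfps_var (Some i)) = mfps_var (Some i) + mfps_of_fps (a i) * xvar"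
  by (simp_all add: subst_var[OF shift_var_ordge] shift_var_def)

lemma vmon_shift_var: "vmon (shift_var a) (ocons j (\<lambda>_. 0)) = xvar ^ j"
proof -
  have "ocons j (\<lambda>_ :: 'a. 0) = (\<lambda>w. if w = None then j else 0)" by (auto simp: fun_eq_iff split: option.splits)
  then show ?thesis using vmon_single[of "shift_var a" None j] by (simp add: shift_var_def)
qed

text \<open>Only pure powers of \<open>X\<close> occur in these series, and they are fixed; without
  this the composition of two shifts would not add their parameters.\<close>

lemma subst_shift_of_fps: "subst (shift_var a) (mfps_of_fps p) = mfps_of_fps p"
proof (rule mfps_eqI)
  fix \<mu> :: "'a option \<Rightarrow> nat"
  have "mfps_coeff (mfps_of_fps p) \<kappa> * mfps_coeff (vmon (shift_var a) \<kappa>) \<mu> =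
      (if \<kappa> = \<mu> then mfps_coeff (mfps_of_fps p) \<mu> else 0)" for \<kappa> :: "'a option \<Rightarrow> nat"
  proof (cases "\<forall>i. \<kappa> (Some i) = 0")
    case True
    then have "\<kappa> = ocons (\<kappa> None) (\<lambda>_. 0)" by (auto simp: fun_eq_iff split: option.splits)
    then have "vmon (shift_var a) \<kappa> = monom \<kappa>"
      using vmon_shift_var[of a "\<kappa> None"] monom_var_None_power[of "\<kappa> None"] by metis
    then show ?thesis by (auto simp: coeff_monom)
  next
    case False
    then show ?thesis by (auto simp: mfps_of_fps_def)
  qed
  then show "mfps_coeff (subst (shift_var a) (mfps_of_fps p)) \<mu> = mfps_coeff (mfps_of_fps p) \<mu>"
    by (simp add: coeff_subst finite_tdeg_le)
qed

lemma of_fps_add: "mfps_of_fps (p + q) = mfps_of_fps p + mfps_of_fps q"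
  by (rule mfps_eqI) (simp add: mfps_of_fps_def)

lemma subst_shift_add: "subst (shift_var a) (subst (shift_var b) f) = subst (shift_var (\<lambda>i. a i + b i)) f"
proof -
  have "(\<lambda>f. subst (shift_var a) (subst (shift_var b) f)) = subst (shift_var (\<lambda>i. a i + b i))"
  proof (rule local_hom_unique[OF local_hom_comp[OF local_hom_shift local_hom_shift] local_hom_shift])
    fix v
    show "subst (shift_var a) (subst (shift_var b) (mfps_var v)) = subst (shift_var (\<lambda>i. a i + b i)) (mfps_var v)"
      by (cases v) (simp_all add: subst_shift_xvar subst_shift_var local_homD[OF local_hom_shift]
          subst_shift_of_fps of_fps_add algebra_simps)
  qed
  then show ?thesis by metis
qed

lemma subst_shift_0:
  fixes f :: "('n::finite option, 'k::field) mfps"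
  shows "subst (shift_var (\<lambda>_. 0)) f = f"
proof -
  have "mfps_of_fps 0 = (0 :: ('n option, 'k) mfps)" by (rule mfps_eqI) (simp add: mfps_of_fps_def)
  then have "subst (shift_var (\<lambda>_. 0)) (mfps_var v) = (mfps_var v :: ('n option, 'k) mfps)" for v :: "'n option"
    by (cases v) (simp_all add: subst_shift_xvar subst_shift_var)
  then have "subst (shift_var (\<lambda>_. 0)) = (\<lambda>f :: ('n option, 'k) mfps. f)"
    by (intro local_hom_unique[OF local_hom_shift]) (simp_all add: local_hom_def)
  then show ?thesis by metis
qed

lemma is_shift_subst: "is_shift a (subst (shift_var a))"
  unfolding is_shift_def mfps_algebra_automorphism_def
proof (intro conjI allI)
  show "bij (subst (shift_var a))"
    by (rule o_bij[where g = "subst (shift_var (\<lambda>i. - a i))"]) (auto simp: subst_shift_add subst_shift_0)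
qed (simp_all add: subst_shift_xvar subst_shift_var local_homD[OF local_hom_shift])

lemma is_shift_unique:
  assumes "is_shift a g"
  shows "g = subst (shift_var a)"
proof (rule local_hom_unique[OF _ local_hom_shift])
  show "local_hom g" using assms automorphism_local_hom by (auto simp: is_shift_def)
  show "g (mfps_var v) = subst (shift_var a) (mfps_var v)" for v
    using assms by (cases v) (simp_all add: is_shift_def subst_shift_xvar subst_shift_var)
qed

lemma ex1_shift: "\<exists>!g. is_shift a g"
  using is_shift_subst is_shift_unique by blast

lemma shift_eq_subst: "shift a = subst (shift_var a)"
  unfolding shift_def using is_shift_subst is_shift_unique by (intro the_equality)

section \<open>Transport along ring automorphisms\<close>

definition ring_auto :: "('a::comm_ring_1 \<Rightarrow> 'a) \<Rightarrow> bool"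
  where "ring_auto \<sigma> \<longleftrightarrow> bij \<sigma> \<and> (\<forall>x y. \<sigma> (x + y) = \<sigma> x + \<sigma> y) \<and> (\<forall>x y. \<sigma> (x * y) = \<sigma> x * \<sigma> y)"

lemma ring_auto_inv:
  assumes "ring_auto \<sigma>"
  shows "ring_auto (inv_into UNIV \<sigma>)" "inv_into UNIV \<sigma> ` \<sigma> ` S = S" "\<sigma> ` inv_into UNIV \<sigma> ` S = S"
proof -
  have b: "bij \<sigma>" using assms by (simp add: ring_auto_def)
  have s: "\<sigma> (inv_into UNIV \<sigma> x) = x" for x using b by (simp add: bij_is_surj surj_f_inv_f)
  have i: "inv_into UNIV \<sigma> (\<sigma> x) = x" for x using b by (simp add: bij_is_inj inv_f_f)
  have "inv_into UNIV \<sigma> (x + y) = inv_into UNIV \<sigma> x + inv_into UNIV \<sigma> y" "inv_into UNIV \<sigma> (x * y) = inv_into UNIV \<sigma> x * inv_into UNIV \<sigma> y" for x y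
    using assms i[of "inv_into UNIV \<sigma> x + inv_into UNIV \<sigma> y"] i[of "inv_into UNIV \<sigma> x * inv_into UNIV \<sigma> y"] by (simp_all add: ring_auto_def s)
  then show "ring_auto (inv_into UNIV \<sigma>)" using b by (simp add: ring_auto_def bij_imp_bij_inv)
  show "inv_into UNIV \<sigma> ` \<sigma> ` S = S" "\<sigma> ` inv_into UNIV \<sigma> ` S = S" by (simp_all add: image_image s i)
qed

context
  fixes \<sigma> :: "'a::comm_ring_1 \<Rightarrow> 'a"
  assumes \<sigma>: "ring_auto \<sigma>"
begin

lemma ring_auto_add: "\<sigma> (x + y) = \<sigma> x + \<sigma> y"
  and ring_auto_mult: "\<sigma> (x * y) = \<sigma> x * \<sigma> y"
  using \<sigma> by (simp_all add: ring_auto_def)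

lemma ring_auto_0: "\<sigma> 0 = 0"
  using ring_auto_add[of 0 0] by simp

lemma ring_auto_mem: "\<sigma> x \<in> \<sigma> ` S \<longleftrightarrow> x \<in> S"
  using \<sigma> by (simp add: ring_auto_def bij_is_inj inj_image_mem_iff)

lemma ring_auto_eq_iff: "\<sigma> ` S = \<sigma> ` S' \<longleftrightarrow> S = S'"
  using \<sigma> by (simp add: ring_auto_def bij_is_inj inj_image_eq_iff)

lemma ring_auto_UNIV: "\<sigma> ` UNIV = UNIV"
  using \<sigma> by (simp add: ring_auto_def bij_is_surj)

lemma ring_auto_surj: obtains y where "x = \<sigma> y"
  using ring_auto_UNIV by blast

lemma ring_auto_ideal:
  assumes I: "is_ideal I"
  shows "is_ideal (\<sigma> ` I)"
proof (rule idl.subspaceI)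
  show "0 \<in> \<sigma> ` I" using idl.subspace_0[OF I] ring_auto_0 by force
  show "x + y \<in> \<sigma> ` I" if "x \<in> \<sigma> ` I" "y \<in> \<sigma> ` I" for x y
    using that idl.subspace_add[OF I] by (auto simp: image_iff simp flip: ring_auto_add)
  show "c * x \<in> \<sigma> ` I" if x: "x \<in> \<sigma> ` I" for c x
  proof -
    obtain d where "c = \<sigma> d" by (rule ring_auto_surj)
    then show ?thesis using x ideal_mult[OF I] by (auto simp flip: ring_auto_mult)
  qed
qed

lemma ring_auto_proper: "proper_ideal I \<Longrightarrow> proper_ideal (\<sigma> ` I)"
  using ring_auto_ideal ring_auto_eq_iff[of I UNIV] ring_auto_UNIV by (simp add: proper_ideal_def)

lemma ring_auto_prime:
  assumes "prime_ideal P"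
  shows "prime_ideal (\<sigma> ` P)"
  unfolding prime_ideal_def
proof (intro conjI allI impI)
  show "proper_ideal (\<sigma> ` P)" using assms ring_auto_proper by (simp add: prime_ideal_def)
  fix x y assume xy: "x * y \<in> \<sigma> ` P"
  obtain x' y' where "x = \<sigma> x'" "y = \<sigma> y'" using ring_auto_surj by metis
  then show "x \<in> \<sigma> ` P \<or> y \<in> \<sigma> ` P"
    using xy assms by (simp add: ring_auto_mem prime_ideal_def flip: ring_auto_mult)
qed

lemma ring_auto_quotient: "ideal_quotient (\<sigma> ` I) (\<sigma> ` J) = \<sigma> ` ideal_quotient I J"
proof (rule Set.set_eqI)
  fix x
  obtain x' where x: "x = \<sigma> x'" by (rule ring_auto_surj)
  show "x \<in> ideal_quotient (\<sigma> ` I) (\<sigma> ` J) \<longleftrightarrow> x \<in> \<sigma> ` ideal_quotient I J"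
    unfolding x ring_auto_mem by (simp add: ideal_quotient_def ring_auto_mem flip: ring_auto_mult)
qed

lemma ring_auto_quotient_dim_le: "quotient_dim I \<le> quotient_dim (\<sigma> ` I)"
  unfolding quotient_dim_def
proof (rule Sup_subset_mono, rule subsetI)
  fix x assume "x \<in> {enat r |r. \<exists>P. (\<forall>i\<le>r. prime_ideal (P i) \<and> I \<subseteq> P i) \<and> (\<forall>i<r. P i \<subset> P (Suc i))}"
  then obtain r P where x: "x = enat r" and P: "\<And>i. i \<le> r \<Longrightarrow> prime_ideal (P i)" "\<And>i. i \<le> r \<Longrightarrow> I \<subseteq> P i"
      "\<And>i. i < r \<Longrightarrow> P i \<subset> P (Suc i)"
    by blast
  have "inj \<sigma>" using \<sigma> by (simp add: ring_auto_def bij_is_inj)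
  then have "\<sigma> ` P i \<subset> \<sigma> ` P (Suc i)" if "i < r" for i
    using P(3)[OF that] by (intro image_strict_mono) (auto simp: inj_on_def)
  moreover have "prime_ideal (\<sigma> ` P i)" "\<sigma> ` I \<subseteq> \<sigma> ` P i" if "i \<le> r" for i
    using ring_auto_prime[OF P(1)[OF that]] P(2)[OF that] by auto
  ultimately show "x \<in> {enat r |r. \<exists>P. (\<forall>i\<le>r. prime_ideal (P i) \<and> \<sigma> ` I \<subseteq> P i) \<and> (\<forall>i<r. P i \<subset> P (Suc i))}"
    unfolding x by (intro CollectI exI[of _ r] conjI refl exI[of _ "\<lambda>i. \<sigma> ` P i"]) auto
qed

lemma ring_auto_ideal_gen_subset: "ideal_gen (\<sigma> ` S) \<subseteq> \<sigma> ` ideal_gen S"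
  by (rule idl.span_minimal) (auto intro: idl.span_base ring_auto_ideal)

end

lemma ring_auto_ideal_gen:
  assumes \<sigma>: "ring_auto \<sigma>"
  shows "ideal_gen (\<sigma> ` S) = \<sigma> ` ideal_gen S"
proof
  have "ideal_gen (inv_into UNIV \<sigma> ` \<sigma> ` S) \<subseteq> inv_into UNIV \<sigma> ` ideal_gen (\<sigma> ` S)"
    by (rule ring_auto_ideal_gen_subset[OF ring_auto_inv(1)[OF \<sigma>]])
  then have "\<sigma> ` ideal_gen S \<subseteq> \<sigma> ` inv_into UNIV \<sigma> ` ideal_gen (\<sigma> ` S)" unfolding ring_auto_inv(2)[OF \<sigma>] by (rule image_mono)
  then show "\<sigma> ` ideal_gen S \<subseteq> ideal_gen (\<sigma> ` S)" unfolding ring_auto_inv(3)[OF \<sigma>] .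
qed (rule ring_auto_ideal_gen_subset[OF \<sigma>])

lemma ring_auto_quotient_dim:
  assumes \<sigma>: "ring_auto \<sigma>"
  shows "quotient_dim (\<sigma> ` I) = quotient_dim I"
proof (rule antisym)
  show "quotient_dim (\<sigma> ` I) \<le> quotient_dim I"
    using ring_auto_quotient_dim_le[OF ring_auto_inv(1)[OF \<sigma>], of "\<sigma> ` I"] unfolding ring_auto_inv(2)[OF \<sigma>] .
qed (rule ring_auto_quotient_dim_le[OF \<sigma>])

lemma ring_auto_unmixed:
  assumes \<sigma>: "ring_auto \<sigma>" and I: "unmixed I"
  shows "unmixed (\<sigma> ` I)"
  unfolding unmixed_def
proof (intro conjI ballI)
  show "proper_ideal (\<sigma> ` I)" using I ring_auto_proper[OF \<sigma>] by (simp add: unmixed_def)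
  fix P assume "P \<in> associated_primes (\<sigma> ` I)"
  then obtain x where P: "prime_ideal P" "P = ideal_quotient (\<sigma> ` I) {x}" unfolding associated_primes_def by blast
  obtain y where "x = \<sigma> y" by (rule ring_auto_surj[OF \<sigma>])
  then have eq: "P = \<sigma> ` ideal_quotient I {y}" using P(2) ring_auto_quotient[OF \<sigma>, of I "{y}"] by simp
  have "prime_ideal (ideal_quotient I {y})"
    using ring_auto_prime[OF ring_auto_inv(1)[OF \<sigma>] P(1)] unfolding eq ring_auto_inv(2)[OF \<sigma>] .
  then have "ideal_quotient I {y} \<in> associated_primes I" by (auto simp: associated_primes_def)
  then show "quotient_dim P = quotient_dim (\<sigma> ` I)"
    using I unfolding eq by (simp add: unmixed_def ring_auto_quotient_dim[OF \<sigma>])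
qed

lemma ring_auto_regular_sequence:
  assumes \<sigma>: "ring_auto \<sigma>" and xs: "regular_sequence_mod I xs"
  shows "regular_sequence_mod (\<sigma> ` I) (map \<sigma> xs)"
proof -
  have eq: "ideal_gen (\<sigma> ` I \<union> set (take j (map \<sigma> xs))) = \<sigma> ` ideal_gen (I \<union> set (take j xs))" for j
    using ring_auto_ideal_gen[OF \<sigma>, of "I \<union> set (take j xs)"] by (simp add: image_Un take_map)
  show ?thesis
    unfolding regular_sequence_mod_def
  proof (intro conjI allI impI)
    have "ideal_gen (I \<union> set xs) \<noteq> UNIV" using xs by (simp add: regular_sequence_mod_def)
    then show "ideal_gen (\<sigma> ` I \<union> set (map \<sigma> xs)) \<noteq> UNIV"
      using eq[of "length xs"] ring_auto_eq_iff[OF \<sigma>, of _ UNIV] ring_auto_UNIV[OF \<sigma>] by simp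
    fix j y assume j: "j < length (map \<sigma> xs)" and y: "map \<sigma> xs ! j * y \<in> ideal_gen (\<sigma> ` I \<union> set (take j (map \<sigma> xs)))"
    obtain z where z: "y = \<sigma> z" by (rule ring_auto_surj[OF \<sigma>])
    have "xs ! j * z \<in> ideal_gen (I \<union> set (take j xs))"
      using y j unfolding eq z by (simp add: ring_auto_mem[OF \<sigma>] flip: ring_auto_mult[OF \<sigma>])
    then have "z \<in> ideal_gen (I \<union> set (take j xs))" using xs j by (simp add: regular_sequence_mod_def)
    then show "y \<in> ideal_gen (\<sigma> ` I \<union> set (take j (map \<sigma> xs)))" unfolding eq z ring_auto_mem[OF \<sigma>] .
  qed
qed

lemma ring_auto_one_dimensional:
  assumes \<sigma>: "ring_auto \<sigma>" and I: "one_dimensional_ideal I"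
  shows "one_dimensional_ideal (\<sigma> ` I)"
proof -
  obtain xs where xs: "regular_sequence_mod I xs" "enat (length xs) = quotient_dim I"
    using I unfolding one_dimensional_ideal_def cohen_macaulay_ideal_def by blast
  show ?thesis
    using I ring_auto_regular_sequence[OF \<sigma> xs(1)] xs(2) ring_auto_unmixed[OF \<sigma>] ring_auto_proper[OF \<sigma>]
    unfolding one_dimensional_ideal_def cohen_macaulay_ideal_def
    by (auto simp: ring_auto_quotient_dim[OF \<sigma>] intro!: exI[of _ "map \<sigma> xs"])
qed

lemma ring_auto_directly_linked:
  assumes \<sigma>: "ring_auto \<sigma>" and IJ: "directly_linked I J"
  shows "directly_linked (\<sigma> ` I) (\<sigma> ` J)"
proof -
  obtain C where C: "complete_intersection C" "C \<subseteq> I \<inter> J" "I = ideal_quotient C J" "J = ideal_quotient C I"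
    using IJ unfolding directly_linked_def by blast
  obtain xs where xs: "regular_sequence_mod {0} xs" "C = ideal_gen (set xs)" "proper_ideal C"
    using C(1) unfolding complete_intersection_def by blast
  have "complete_intersection (\<sigma> ` C)"
    unfolding complete_intersection_def
    using ring_auto_proper[OF \<sigma> xs(3)] ring_auto_regular_sequence[OF \<sigma> xs(1)] ring_auto_ideal_gen[OF \<sigma>, of "set xs"]
    by (intro conjI exI[of _ "map \<sigma> xs"]) (simp_all add: ring_auto_0[OF \<sigma>] xs(2))
  moreover have "\<sigma> ` I = ideal_quotient (\<sigma> ` C) (\<sigma> ` J)" "\<sigma> ` J = ideal_quotient (\<sigma> ` C) (\<sigma> ` I)"
    unfolding ring_auto_quotient[OF \<sigma>] using C(3,4) by simp_all
  moreover have "\<sigma> ` C \<subseteq> \<sigma> ` I \<inter> \<sigma> ` J" using C(2) by blast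
  ultimately show ?thesis
    using IJ ring_auto_proper[OF \<sigma>] unfolding directly_linked_def by blast
qed

lemma equivclp_map:
  assumes "equivclp R x y" and R: "\<And>x y. R x y \<Longrightarrow> R' (f x) (f y)"
  shows "equivclp R' (f x) (f y)"
  using assms(1)
proof (induction rule: equivclp_induct)
  case (step y z)
  then have "equivclp R' (f y) (f z)"
    using R by (auto intro: r_into_equivclp equivclp_sym)
  then show ?case using step.IH equivclp_trans by fast
qed simp

lemma ring_auto_shift: "ring_auto (shift a)"
  using is_shift_subst[of a] by (simp add: shift_eq_subst is_shift_def mfps_algebra_automorphism_def ring_auto_def)

section \<open>One-dimensional ideals\<close>

lemma prime_ypow_1: "prime_ideal (ypow 1 :: ('n::finite option, 'k::field) mfps set)"
  using one_notin_ypow[where 'n = 'n and 'k = 'k] ypow_prime[where 'n = 'n and 'k = 'k]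
  unfolding prime_ideal_def proper_ideal_def by (auto simp del: One_nat_def)

lemma ypow_1_less: "ypow 1 \<subset> (ordge 1 :: ('n::finite option, 'k::field) mfps set)"
proof
  show "ypow 1 \<subseteq> (ordge 1 :: ('n option, 'k) mfps set)"
    using prime_ypow_1[where 'n = 'n and 'k = 'k] unfolding prime_ideal_def proper_ideal_def
    by (intro ideal_le_ordge_1) auto
  show "ypow 1 \<noteq> (ordge 1 :: ('n option, 'k) mfps set)"
    using var_None_power_notin[of 1, where 'n = 'n and 'k = 'k] var_ordge[of "None :: 'n option", where 'b = 'k] by auto
qed

text \<open>Such a prime contains the variables \<open>Y\<close>, and modulo these the ring is the
  discrete valuation ring \<open>k[[X]]\<close>, with only two primes.\<close>

lemma prime_superset_ypow:
  fixes P :: "('n::finite option, 'k::field) mfps set"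
  assumes P: "prime_ideal P" and M: "ypow M \<subseteq> P"
  shows "P = ypow 1 \<or> P = ordge 1"
proof -
  have Pi: "is_ideal P" "P \<noteq> UNIV" using P by (auto simp: prime_ideal_def proper_ideal_def)
  have "mfps_var (Some i) ^ M \<in> (ypow M :: ('n option, 'k) mfps set)" for i :: 'n
    unfolding eta_ordge_iff[symmetric] eta_var_Some_power by (rule var_power_ordge)
  then have "mfps_var (Some i) ^ M \<in> P" for i using M by blast
  then have YP: "mfps_var (Some i) \<in> P" for i by (rule prime_ideal_power[OF P])
  have yP: "ypow 1 \<subseteq> P"
  proof
    fix f :: "('n option, 'k) mfps" assume "f \<in> ypow 1"
    then have "f \<in> ypow (1 + 0)" by simp
    then obtain h where h: "f = (\<Sum>\<mu> | tdeg \<mu> = 1. monom (ocons 0 \<mu>) * h \<mu>)"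
      by (rule ypow_decomp) (rule that)
    have "monom (ocons 0 \<mu>) \<in> P" if \<mu>: "tdeg \<mu> = 1" for \<mu> :: "'n \<Rightarrow> nat"
    proof -
      have "\<mu> \<noteq> (\<lambda>_. 0)" using \<mu> by auto
      then obtain i where i: "\<mu> i \<noteq> 0" by (auto simp: fun_eq_iff)
      have "(monom (ocons 0 \<mu>) :: ('n option, 'k) mfps) =
          mfps_var (Some i) * monom (ocons 0 (\<lambda>w. \<mu> w - (if w = i then 1 else 0)))"
        unfolding monom_var_Some_power[of i 1, simplified] monom_mult
        using i by (intro arg_cong[of _ _ monom]) (auto simp: fun_eq_iff split: option.splits)
      then show ?thesis using ideal_mult'[OF Pi(1) YP] by simp
    qed
    then show "f \<in> P" unfolding h by (intro idl.subspace_sum[OF Pi(1)] ideal_mult'[OF Pi(1)]) auto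
  qed
  show ?thesis
  proof (cases "P \<subseteq> ypow 1")
    case False
    then obtain f where f: "f \<in> P" "f \<notin> ypow 1" by blast
    let ?z = "\<lambda>_ :: 'n. 0 :: nat"
    have "\<exists>j. mfps_coeff f (ocons j ?z) \<noteq> 0" using f(2) by (auto simp: ypow_iff)
    then obtain j where j: "mfps_coeff f (ocons j ?z) \<noteq> 0" "\<And>i. i < j \<Longrightarrow> mfps_coeff f (ocons i ?z) = 0"
      using exists_least_iff[of "\<lambda>j. mfps_coeff f (ocons j ?z) \<noteq> 0"] by auto
    \<comment> \<open>The part of \<open>f\<close> that does not involve \<open>Y\<close>: a power
      series in \<open>X\<close> of order \<open>j\<close>, that is, \<open>X ^ j\<close> times a
      unit.\<close>
    define r where "r = (Abs_mfps (\<lambda>\<kappa>. if ypart \<kappa> = ?z then mfps_coeff f \<kappa> else 0) :: ('n option, 'k) mfps)"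
    have rc: "mfps_coeff r (ocons i \<mu>) = (if \<mu> = ?z then mfps_coeff f (ocons i \<mu>) else 0)" for i \<mu>
      by (simp add: r_def)
    have "f - r \<in> ypow 1" by (auto simp: ypow_iff rc)
    then have "f - r \<in> P" using yP by blast
    then have "f - (f - r) \<in> P" by (rule idl.subspace_diff[OF Pi(1) f(1)])
    then have rP: "r \<in> P" by simp
    obtain g where g: "r = xvar ^ j * g"
      using xvar_divides[of j r] j(2) rc by (metis (full_types))
    have "mfps_coeff g (\<lambda>_. 0) = mfps_coeff r (ocons j ?z)"
      unfolding g coeff_xvar_mult by simp
    then have "mfps_coeff g (\<lambda>_. 0) \<noteq> 0" using j(1) rc by simp
    then obtain u where "g * u = 1" by (rule mfps_unit)
    then have "xvar ^ j = r * u" by (simp add: g mult.assoc)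
    then have "xvar ^ j \<in> P" using ideal_mult'[OF Pi(1) rP] by simp
    then have "xvar \<in> P" by (rule prime_ideal_power[OF P])
    then have "mfps_var v \<in> P" for v using YP by (cases v) auto
    then have "ordge 1 \<subseteq> P" by (rule ordge_1_generated[OF Pi(1)])
    then show ?thesis using ideal_le_ordge_1[OF Pi] by blast
  qed (use yP in blast)
qed

lemma quotient_dim_ypow:
  fixes K :: "('n::finite option, 'k::field) mfps set"
  assumes K: "ypow M \<subseteq> K" "K \<subseteq> ypow 1"
  shows "quotient_dim K = enat 1"
proof (rule quotient_dim_eqI[where P = "\<lambda>i. if i = 0 then ypow 1 else ordge 1"])
  show "prime_ideal (if i = 0 then ypow 1 else ordge 1 :: ('n option, 'k) mfps set) \<and> K \<subseteq> (if i = 0 then ypow 1 else ordge 1)"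
    for i :: nat
    using prime_ypow_1[where 'n = 'n and 'k = 'k] prime_ordge_1[where 'v = "'n option" and 'k = 'k] K(2)
      ypow_1_less[where 'n = 'n and 'k = 'k] by auto
  show "(if i = 0 then ypow 1 else ordge 1 :: ('n option, 'k) mfps set) \<subset> (if Suc i = 0 then ypow 1 else ordge 1)"
    if "i < 1" for i using ypow_1_less that by simp
  fix r and P :: "nat \<Rightarrow> ('n option, 'k) mfps set"
  assume P: "\<And>i. i \<le> r \<Longrightarrow> prime_ideal (P i) \<and> K \<subseteq> P i" "\<And>i. i < r \<Longrightarrow> P i \<subset> P (Suc i)"
  have two: "P i = ypow 1 \<or> P i = ordge 1" if "i \<le> r" for i
    using P(1)[OF that] K(1) by (intro prime_superset_ypow[of _ M]) auto
  show "r \<le> 1"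
  proof (rule ccontr)
    assume "\<not> r \<le> 1"
    then have r: "0 < r" "1 < r" "0 \<le> r" "1 \<le> r" "2 \<le> r" by auto
    have "P 0 \<subset> P 1" "P 1 \<subset> P 2" using P(2)[of 0] P(2)[of 1] r by (auto simp: numeral_2_eq_2)
    then show False
      using two[OF r(3)] two[OF r(4)] two[OF r(5)] ypow_1_less[where 'n = 'n and 'k = 'k] by auto
  qed
qed

text \<open>Saturation excludes the maximal ideal as an associated prime, so only \<open>(Y)\<close>
  remains, and it makes \<open>X\<close> a regular sequence of length 1 on the quotient.\<close>

lemma one_dimensional_of_xsat:
  fixes K :: "('n::finite option, 'k::field) mfps set"
  assumes K: "is_ideal K" "ypow M \<subseteq> K" "K \<subseteq> ypow 1" "xsat K"
  shows "one_dimensional_ideal K"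
proof -
  have dim: "quotient_dim K = enat 1" by (rule quotient_dim_ypow[OF K(2,3)])
  have K1: "1 \<notin> K" using K(3) one_notin_ypow by blast
  then have proper: "proper_ideal K" using K(1) by (auto simp: proper_ideal_def)
  have "unmixed K"
    unfolding unmixed_def
  proof (intro conjI ballI proper)
    fix P assume PA: "P \<in> associated_primes K"
    then have P: "prime_ideal P" "K \<subseteq> P" using associated_prime_superset[OF K(1)] by auto
    obtain x where x: "P = ideal_quotient K {x}" using PA by (auto simp: associated_primes_def)
    have "P \<noteq> ordge 1"
    proof
      assume "P = ordge 1"
      then have "xvar * x \<in> K" using x var_ordge[of None] by (auto simp: ideal_quotient_def)
      then have "x \<in> K" using K(4) by (simp add: xsat_def)
      then have "1 \<in> P" by (simp add: x ideal_quotient_def)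
      then show False using P(1) ideal_UNIV_iff[of P] by (simp add: prime_ideal_def proper_ideal_def)
    qed
    then have "P = ypow 1" using prime_superset_ypow[OF P(1)] K(2) P(2) by blast
    then show "quotient_dim P = quotient_dim K" using quotient_dim_ypow[of 1 "ypow 1 :: ('n option, 'k) mfps set"] dim by simp
  qed
  moreover have "regular_sequence_mod K [xvar]"
    unfolding regular_sequence_mod_def
  proof (intro conjI allI impI)
    have "ideal_gen (K \<union> set [xvar]) \<subseteq> ordge 1"
      using K(3) ypow_1_less[where 'n = 'n and 'k = 'k] var_ordge[of "None :: 'n option", where 'b = 'k]
      by (intro idl.span_minimal is_ideal_ordge) auto
    moreover have "1 \<notin> (ordge 1 :: ('n option, 'k) mfps set)" using one_notin_ordge[of 0] by simp
    ultimately show "ideal_gen (K \<union> set [xvar]) \<noteq> UNIV" by blast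
    fix j y assume j: "j < length [xvar]" and y: "[xvar] ! j * y \<in> ideal_gen (K \<union> set (take j [xvar]))"
    have j0: "j = 0" using j by simp
    have eq: "ideal_gen (K \<union> set (take j [xvar])) = K" using K(1) by (simp add: j0)
    show "y \<in> ideal_gen (K \<union> set (take j [xvar]))"
      using y K(4) unfolding eq by (simp add: j0 xsat_def)
  qed
  ultimately show ?thesis
    using proper dim unfolding one_dimensional_ideal_def cohen_macaulay_ideal_def
    by (auto simp: one_enat_def intro!: exI[of _ "[xvar]"])
qed

lemma ypow_extended_ideal:
  fixes I :: "('n::finite, 'k::field) mfps set"
  assumes I: "is_ideal I" "I \<noteq> UNIV" "ordge M \<subseteq> I"
  shows "ypow M \<subseteq> extended_ideal I" "extended_ideal I \<subseteq> ypow 1"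
proof -
  have s: "f \<in> ypow N \<longleftrightarrow> (\<forall>j. slice j f \<in> ordge N)" for f :: "('n option, 'k) mfps" and N
    by (auto simp: ypow_iff ordge_def coeff_slice)
  show "ypow M \<subseteq> extended_ideal I" using I(3) unfolding subset_iff s extended_ideal_iff[OF I(1)] by blast
  show "extended_ideal I \<subseteq> ypow 1"
    using ideal_le_ordge_1[OF I(1,2)] unfolding s extended_ideal_iff[OF I(1)] subset_iff by blast
qed

text \<open>The ideal contains the \<open>M\<close>-th power of each variable in \<open>Y\<close>.
  Since \<open>(Y)\<close> is prime, containment would put the shifted variable itself into
  \<open>(Y)\<close>.\<close>

lemma shift_extended_ideal:
  fixes I :: "('n::finite, 'k::field) mfps set"
  assumes I: "ypow M \<subseteq> extended_ideal I" and c: "c \<noteq> (\<lambda>_. 0)"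
  shows "\<not> shift c ` extended_ideal I \<subseteq> ypow 1"
proof
  assume sub: "shift c ` extended_ideal I \<subseteq> ypow 1"
  obtain i where "c i \<noteq> 0" using c by (auto simp: fun_eq_iff)
  then obtain j where j: "fps_nth (c i) j \<noteq> 0" by (auto simp: fps_eq_iff)
  have "mfps_var (Some i) ^ M \<in> (ypow M :: ('n option, 'k) mfps set)"
    unfolding eta_ordge_iff[symmetric] eta_var_Some_power by (rule var_power_ordge)
  then have "shift c (mfps_var (Some i) ^ M) \<in> ypow 1" using I sub by blast
  then have "shift c (mfps_var (Some i)) ^ M \<in> ypow 1"
    unfolding shift_eq_subst local_hom_power[OF local_hom_shift] .
  then have "shift c (mfps_var (Some i)) \<in> ypow 1" by (rule prime_ideal_power[OF prime_ypow_1])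
  \<comment> \<open>The factor \<open>X\<close> moves the nonzero coefficient of \<open>c i\<close>
    from \<open>j\<close> to \<open>Suc j\<close>, at an exponent where the variable itself has no
    term.\<close>
  then have "mfps_coeff (mfps_var (Some i) + mfps_of_fps (c i) * xvar :: ('n option, 'k) mfps) (ocons (Suc j) (\<lambda>_. 0)) = 0"
    unfolding shift_eq_subst subst_shift_var ypow_iff by simp
  moreover have "mfps_coeff (mfps_of_fps (c i) * xvar :: ('n option, 'k) mfps) (ocons (Suc j) (\<lambda>_. 0)) = fps_nth (c i) j"
    using coeff_xvar_mult[of 1 "mfps_of_fps (c i) :: ('n option, 'k) mfps" "Suc j" "\<lambda>_. 0"]
    by (simp add: mult.commute mfps_of_fps_def)
  moreover have "mfps_coeff (mfps_var (Some i) :: ('n option, 'k) mfps) (ocons (Suc j) (\<lambda>_. 0)) = 0"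
    by (auto simp: mfps_var_def fun_eq_iff split: option.splits)
  ultimately show False using j by simp
qed

theorem proposition5p3:
  fixes m I :: "('n::finite, 'k::field) mfps set"
  assumes "infinite (UNIV :: 'k set)"
    and "maximal_ideal m"
    and "primary_to m I"
    and "\<not> licci I"
  shows "(\<forall>a :: 'n \<Rightarrow> 'k fps. \<exists>!g. is_shift a g) \<and>
    (\<forall>a :: 'n \<Rightarrow> 'k fps.
      one_dimensional_ideal (shift a ` extended_ideal I) \<and>
      linkage_class (shift a ` extended_ideal I) \<in> one_dimensional_linkage_classes) \<and>
    inj (\<lambda>a :: 'n \<Rightarrow> 'k fps. linkage_class (shift a ` extended_ideal I))"
proof -
  let ?T = "extended_ideal I"
  obtain M where I: "is_ideal I" "I \<noteq> UNIV" "ordge M \<subseteq> I" by (rule primary_to_maximal[OF assms(2,3)])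
  note yT = ypow_extended_ideal[OF I]
  have "one_dimensional_ideal ?T"
    by (rule one_dimensional_of_xsat[OF is_ideal_extended_ideal yT xsat_extended_ideal[OF I(1)]])
  then have one: "one_dimensional_ideal (shift a ` ?T)" for a by (rule ring_auto_one_dimensional[OF ring_auto_shift])
  then have unm: "unmixed (shift a ` ?T)" for a by (simp add: one_dimensional_ideal_def)
  have cls: "linkage_class (shift a ` ?T) \<in> one_dimensional_linkage_classes" for a
    unfolding linkage_class_def one_dimensional_linkage_classes_def using one by (intro quotientI) simp
  let ?R = "\<lambda>I J :: ('n option, 'k) mfps set. unmixed I \<and> unmixed J \<and> directly_linked I J"
  have "a = b" if eq: "linkage_class (shift a ` ?T) = linkage_class (shift b ` ?T)" for a b :: "'n \<Rightarrow> 'k fps"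
  proof (rule ccontr)
    assume ab: "a \<noteq> b"
    define c where "c = (\<lambda>i. - a i + b i)"
    have c: "c \<noteq> (\<lambda>_. 0)"
    proof
      assume "c = (\<lambda>_. 0)"
      then have "- a i + b i = 0" for i by (metis c_def)
      then show False using ab by (auto simp: fun_eq_iff)
    qed
    have "shift b ` ?T \<in> linkage_class (shift b ` ?T)"
      using unm[of b] by (simp add: linkage_class_def linkage_def)
    then have "shift b ` ?T \<in> linkage_class (shift a ` ?T)" by (simp only: eq)
    then have "equivclp ?R (shift a ` ?T) (shift b ` ?T)" by (simp add: linkage_class_def linkage_def)
    \<comment> \<open>Linkage is invariant under ring automorphisms; applying the inverse of the
      shift by \<open>a\<close> makes the first ideal unshifted.\<close>
    then have "equivclp ?R (shift (\<lambda>i. - a i) ` shift a ` ?T) (shift (\<lambda>i. - a i) ` shift b ` ?T)"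
      by (rule equivclp_map)
        (auto intro: ring_auto_unmixed[OF ring_auto_shift] ring_auto_directly_linked[OF ring_auto_shift])
    moreover have "shift (\<lambda>i. - a i) ` shift a ` ?T = ?T" "shift (\<lambda>i. - a i) ` shift b ` ?T = shift c ` ?T"
      by (simp_all add: image_image shift_eq_subst subst_shift_add subst_shift_0 c_def)
    ultimately have "equivclp ?R ?T (shift c ` ?T)" by simp
    moreover have "ylocal ?T" unfolding ylocal_def
      using yT(1) one_notin_ypow by (intro exI[of _ 1] exI[of _ M]) auto
    ultimately obtain s where s: "plicci s (map_ideal UNIV fls_const I)"
      using plicci_of_linkage[OF _ is_ideal_extended_ideal yT(2) _ shift_extended_ideal[OF yT(1) c]]
      unfolding etaI_extended_ideal by blast
    \<comment> \<open>The descent needs an algebraically closed field, so the chain over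
      \<open>k((X))\<close> is carried to the closure; the inclusion is defined everywhere, which
      meets any finite set of conditions.\<close>
    let ?e = "to_ac :: 'k fls \<Rightarrow> 'k fls alg_closure"
    have e: "subhom UNIV ?e" by (simp add: subhom_def)
    obtain A where d: "nf_defined_over UNIV I M A" using ex_nf_defined_over_UNIV[OF I(1,3)] by blast
    obtain S where "\<forall>B (g :: 'k fls \<Rightarrow> 'k fls alg_closure). subhom B g \<longrightarrow> S \<subseteq> B \<longrightarrow>
        plicci s (map_ideal B g (map_ideal UNIV fls_const I))"
      using plicci_specialize[OF is_ideal_map_ideal ordge_map_ideal[OF subhom_fls_const d] s] by blast
    then have "plicci s (map_ideal UNIV ?e (map_ideal UNIV fls_const I))" using e by simp
    then have "plicci s (map_ideal UNIV (?e \<circ> fls_const) I)"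
      using map_ideal_comp[OF subhom_fls_const e subset_UNIV I(1,3)] by simp
    moreover have "inj (?e \<circ> fls_const)" by (auto simp: inj_def dest: arg_cong[where f = "\<lambda>z. fls_nth z 0"])
    ultimately have "plicci s I"
      using plicci_descend[OF subhom_comp[OF subhom_fls_const e subset_UNIV] _ assms(1) I(1,3)] by blast
    then show False using licci_of_plicci[OF I] assms(4) by blast
  qed
  then have "inj (\<lambda>a :: 'n \<Rightarrow> 'k fps. linkage_class (shift a ` ?T))" by (rule injI)
  then show ?thesis using ex1_shift one cls by blast
qed

end
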